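(* Let $(\mathbb{A},\mathcal{A})$ and $(\mathbb{B},\mathcal{B})$ be Boolean kits. The functors $P\mapsto\overline{P}$ and $L\mapsto\mathrm{tr}_{\mathrm{lin}}(L)$ form an adjoint equivalence between the category $\mathbf{SProf}((\mathbb{A},\mathcal{A}),(\mathbb{B},\mathcal{B}))$ of stabilized profunctors and natural transformations and the category $\mathbf{Lin}((\mathbb{A},\mathcal{A}),(\mathbb{B},\mathcal{B}))$ of linear functors $\mathrm{StPSh}(\mathbb{A},\mathcal{A})\to\mathrm{StPSh}(\mathbb{B},\mathcal{B})$ and cartesian natural transformations.
   Context: A kit on a groupoid $\mathbb{A}$ is a family $\mathcal{A}(a)$ of sets of subgroups of $\mathrm{End}(a)=\mathbb{A}(a,a)$ closed under conjugation. Subgroups are orthogonal if they intersect in $\{\mathrm{id}\}$; $\mathcal{A}^\perp$ (a kit on $\mathbb{A}^{op}$) has $\mathcal{A}^\perp(a)$ all subgroups of $\mathrm{End}(a)$ orthogonal to every member of $\mathcal{A}(a)$; $\mathcal{A}$ is Boolean if $\mathcal{A}=\mathcal{A}^{\perp\perp}$; $\bigcup\mathcal{A}(a)$ is the union of members of $\mathcal{A}(a)$. A stabilized profunctor $P:(\mathbb{A},\mathcal{A})\to(\mathbb{B},\mathcal{B})$ is a functor $P:\mathbb{B}^{op}\times\mathbb{A}\to\mathbf{Set}$ such that for all $p\in P(b,a)$, $\alpha\in\mathrm{End}(a)$, $\beta\in\mathrm{End}(b)$ with $\alpha\cdot p\cdot\beta=p$ (actions induced by functoriality), $\alpha\in\bigcup\mathcal{A}(a)\Rightarrow\beta\in\bigcup\mathcal{B}(b)$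 and $\beta\in\bigcup\mathcal{B}^\perp(b)\Rightarrow\alpha\in\bigcup\mathcal{A}^\perp(a)$. $\mathrm{StPSh}(\mathbb{A},\mathcal{A})$ is the full subcategory of presheaves $X$ on $\mathbb{A}$ such that every $x\in X(a)$ has stabilizer $\{\alpha\in\mathrm{End}(a):x\cdot\alpha=x\}$ in $\mathcal{A}(a)$; for Boolean $\mathcal{A}$ the Yoneda embedding factors through it via $\mathrm{y}_{\mathcal{A}}:\mathbb{A}\to\mathrm{StPSh}(\mathbb{A},\mathcal{A})$. For a stabilized profunctor $P$, $P^\#:\mathrm{PSh}(\mathbb{A})\to\mathrm{PSh}(\mathbb{B})$ is the left Kan extension of $P$ (viewed as $\mathbb{A}\to\mathrm{PSh}(\mathbb{B})$) along the Yoneda embedding, $P^\#(X)(b)=\int^{a}P(b,a)\times X(a)$, and $\overline{P}:\mathrm{StPSh}(\mathbb{A},\mathcal{A})\to\mathrm{StPSh}(\mathbb{B},\mathcal{B})$ is its restriction (equivalently $\mathrm{Lan}_{\mathrm{y}_{\mathcal{A}}}P$); on natural transformations it acts by the induced transformation. $\mathrm{tr}_{\mathrm{lin}}(L)=L\circ\mathrm{y}_{\mathcal{A}}$, i.e. $(b,a)\mapsto L(\mathrm{y}(a))(b)$. A functor $T:\mathrm{StPSh}(\mathbb{A},\mathcal{A})\to\mathrm{StPSh}(\mathbb{B},\mathcal{B})$ is stable if it preserves filtered colimits and epimorphisms and for each $X$ the induced functor between slices $\mathrm{StPSh}(\mathbb{A},\mathcal{A})/X\to\mathrm{StPSh}(\mathbb{B},\mathcal{B})/T(X)$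 is a right adjoint; it is linear if it is stable and moreover each of these induced slice functors is a left adjoint. A natural transformation is cartesian if its naturality squares are pullbacks. *)

theory Defs
  imports "HOL-Algebra.Group" "HOL-Library.FuncSet" "HOL-Library.Equipollence"
begin

section \<open>Universes\<close>

text \<open>
  The category of sets is taken relative to a universe, given by a type \<open>'u\<close>: a set is small if it
  is a subset of \<open>'u\<close> of cardinality less than that of \<open>'u\<close>, and that cardinality is assumed to be
  a regular strong limit. Apart from \<open>\<aleph>\<^sub>0\<close> (which gives finite sets) these are the inaccessible
  cardinals, that is, the Grothendieck universes.
\<close>

definition small :: "'u set \<Rightarrow> bool" where
  "small S \<longleftrightarrow> S \<prec> (UNIV :: 'u set)"

definition set_universe :: "'u itself \<Rightarrow> bool" where
  "set_universe _ \<longleftrightarrow>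
     infinite (UNIV :: 'u set) \<and>
     (\<forall>S :: 'u set. small S \<longrightarrow> Pow S \<prec> (UNIV :: 'u set)) \<and>
     (\<forall>(S :: 'u set) (F :: 'u \<Rightarrow> 'u set).
        small S \<and> (\<forall>x\<in>S. small (F x)) \<longrightarrow> small (\<Union>x\<in>S. F x))"

lemma set_universe_nat: "set_universe TYPE(nat)"
proof -
  have small: "S \<prec> (UNIV :: nat set) \<longleftrightarrow> finite S" for S :: "'a set"
  proof
    assume S: "S \<prec> (UNIV :: nat set)"
    show "finite S"
    proof (rule ccontr)
      assume "infinite S"
      then have "(UNIV :: nat set) \<lesssim> S"
        by (simp add: infinite_le_lepoll)
      with S show False
        by (auto simp: lesspoll_def dest: lepoll_antisym)
    qed
  qed (simp add: finite_lesspoll_infinite)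
  show ?thesis
    by (auto simp: set_universe_def small_def small)
qed


section \<open>Categories, functors, natural transformations\<close>

record ('o, 'm) cat =
  Ob :: "'o set"
  Ar :: "'m set"
  Dom :: "'m \<Rightarrow> 'o"
  Cod :: "'m \<Rightarrow> 'o"
  Idt :: "'o \<Rightarrow> 'm"
  Cmp :: "'m \<Rightarrow> 'm \<Rightarrow> 'm"  \<comment> \<open>\<open>Cmp C g f\<close> is \<open>g\<close> after \<open>f\<close>\<close>

definition homs :: "('o, 'm) cat \<Rightarrow> 'o \<Rightarrow> 'o \<Rightarrow> 'm set" where
  "homs C a b = {f \<in> Ar C. Dom C f = a \<and> Cod C f = b}"

definition category :: "('o, 'm) cat \<Rightarrow> bool" where
  "category C \<longleftrightarrow>
     (\<forall>f\<in>Ar C. Dom C f \<in> Ob C \<and> Cod C f \<in> Ob C) \<and>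
     (\<forall>a\<in>Ob C. Idt C a \<in> homs C a a) \<and>
     (\<forall>f\<in>Ar C. \<forall>g\<in>Ar C. Cod C f = Dom C g \<longrightarrow> Cmp C g f \<in> homs C (Dom C f) (Cod C g)) \<and>
     (\<forall>f\<in>Ar C. Cmp C f (Idt C (Dom C f)) = f \<and> Cmp C (Idt C (Cod C f)) f = f) \<and>
     (\<forall>f\<in>Ar C. \<forall>g\<in>Ar C. \<forall>h\<in>Ar C. Cod C f = Dom C g \<and> Cod C g = Dom C h \<longrightarrow>
        Cmp C h (Cmp C g f) = Cmp C (Cmp C h g) f)"

definition small_cat :: "('u, 'u) cat \<Rightarrow> bool" where
  "small_cat C \<longleftrightarrow> category C \<and> small (Ob C) \<and> small (Ar C)"

definition inverse_arrows :: "('o, 'm) cat \<Rightarrow> 'm \<Rightarrow> 'm \<Rightarrow> bool" where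
  "inverse_arrows C f g \<longleftrightarrow>
     f \<in> Ar C \<and> g \<in> homs C (Cod C f) (Dom C f) \<and>
     Cmp C g f = Idt C (Dom C f) \<and> Cmp C f g = Idt C (Cod C f)"

definition is_iso :: "('o, 'm) cat \<Rightarrow> 'm \<Rightarrow> bool" where
  "is_iso C f \<longleftrightarrow> (\<exists>g. inverse_arrows C f g)"

definition is_epi :: "('o, 'm) cat \<Rightarrow> 'm \<Rightarrow> bool" where
  "is_epi C f \<longleftrightarrow>
     f \<in> Ar C \<and>
     (\<forall>g\<in>Ar C. \<forall>h\<in>Ar C.
        Dom C g = Cod C f \<and> Dom C h = Cod C f \<and> Cod C g = Cod C h \<and> Cmp C g f = Cmp C h f
        \<longrightarrow> g = h)"

definition small_groupoid :: "('u, 'u) cat \<Rightarrow> bool" where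
  "small_groupoid C \<longleftrightarrow> small_cat C \<and> (\<forall>f\<in>Ar C. is_iso C f)"

definition op_cat :: "('o, 'm) cat \<Rightarrow> ('o, 'm) cat" where
  "op_cat C = \<lparr>Ob = Ob C, Ar = Ar C, Dom = Cod C, Cod = Dom C, Idt = Idt C,
               Cmp = (\<lambda>g f. Cmp C f g)\<rparr>"

definition prod_cat :: "('o, 'm) cat \<Rightarrow> ('p, 'n) cat \<Rightarrow> ('o \<times> 'p, 'm \<times> 'n) cat" where
  "prod_cat C D =
     \<lparr>Ob = Ob C \<times> Ob D, Ar = Ar C \<times> Ar D,
      Dom = (\<lambda>(f, g). (Dom C f, Dom D g)), Cod = (\<lambda>(f, g). (Cod C f, Cod D g)),
      Idt = (\<lambda>(a, b). (Idt C a, Idt D b)),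
      Cmp = (\<lambda>(f', g') (f, g). (Cmp C f' f, Cmp D g' g))\<rparr>"

definition full_subcat :: "('o, 'm) cat \<Rightarrow> ('o \<Rightarrow> bool) \<Rightarrow> ('o, 'm) cat" where
  "full_subcat C P =
     \<lparr>Ob = {a \<in> Ob C. P a}, Ar = {f \<in> Ar C. P (Dom C f) \<and> P (Cod C f)},
      Dom = Dom C, Cod = Cod C, Idt = Idt C, Cmp = Cmp C\<rparr>"

record ('o, 'm, 'p, 'n) ftor =
  omap :: "'o \<Rightarrow> 'p"
  amap :: "'m \<Rightarrow> 'n"

text \<open>
  Functors are objects of the categories below, so that equality of functors has to mean equality
  on objects and arrows of the domain; hence the maps are required to be extensional.
\<close>

definition is_functor ::
  "('o, 'm) cat \<Rightarrow> ('p, 'n) cat \<Rightarrow> ('o, 'm, 'p, 'n) ftor \<Rightarrow> bool" where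
  "is_functor C D F \<longleftrightarrow>
     category C \<and> category D \<and>
     omap F \<in> Ob C \<rightarrow>\<^sub>E Ob D \<and> amap F \<in> Ar C \<rightarrow>\<^sub>E Ar D \<and>
     (\<forall>f\<in>Ar C. amap F f \<in> homs D (omap F (Dom C f)) (omap F (Cod C f))) \<and>
     (\<forall>a\<in>Ob C. amap F (Idt C a) = Idt D (omap F a)) \<and>
     (\<forall>f\<in>Ar C. \<forall>g\<in>Ar C. Cod C f = Dom C g \<longrightarrow>
        amap F (Cmp C g f) = Cmp D (amap F g) (amap F f))"

definition id_functor :: "('o, 'm) cat \<Rightarrow> ('o, 'm, 'o, 'm) ftor" where
  "id_functor C = \<lparr>omap = (\<lambda>a\<in>Ob C. a), amap = (\<lambda>f\<in>Ar C. f)\<rparr>"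

definition comp_functor ::
  "('o, 'm) cat \<Rightarrow> ('p, 'n, 'q, 'k) ftor \<Rightarrow> ('o, 'm, 'p, 'n) ftor \<Rightarrow> ('o, 'm, 'q, 'k) ftor" where
  "comp_functor C G F =
     \<lparr>omap = (\<lambda>a\<in>Ob C. omap G (omap F a)), amap = (\<lambda>f\<in>Ar C. amap G (amap F f))\<rparr>"

definition restrict_functor ::
  "('o, 'm) cat \<Rightarrow> ('o, 'm, 'p, 'n) ftor \<Rightarrow> ('o, 'm, 'p, 'n) ftor" where
  "restrict_functor C F = \<lparr>omap = restrict (omap F) (Ob C), amap = restrict (amap F) (Ar C)\<rparr>"

record ('o, 'm, 'p, 'n) ntrans =
  nsrc :: "('o, 'm, 'p, 'n) ftor"
  ntgt :: "('o, 'm, 'p, 'n) ftor"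
  ncomp :: "'o \<Rightarrow> 'n"

definition nat_trans ::
  "('o, 'm) cat \<Rightarrow> ('p, 'n) cat \<Rightarrow> ('o, 'm, 'p, 'n) ntrans \<Rightarrow> bool" where
  "nat_trans C D \<tau> \<longleftrightarrow>
     is_functor C D (nsrc \<tau>) \<and> is_functor C D (ntgt \<tau>) \<and>
     ncomp \<tau> \<in> extensional (Ob C) \<and>
     (\<forall>a\<in>Ob C. ncomp \<tau> a \<in> homs D (omap (nsrc \<tau>) a) (omap (ntgt \<tau>) a)) \<and>
     (\<forall>f\<in>Ar C. Cmp D (ncomp \<tau> (Cod C f)) (amap (nsrc \<tau>) f)
               = Cmp D (amap (ntgt \<tau>) f) (ncomp \<tau> (Dom C f)))"

definition fun_cat ::
  "('o, 'm) cat \<Rightarrow> ('p, 'n) cat \<Rightarrow> (('o, 'm, 'p, 'n) ftor, ('o, 'm, 'p, 'n) ntrans) cat" where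
  "fun_cat C D =
     \<lparr>Ob = {F. is_functor C D F}, Ar = {\<tau>. nat_trans C D \<tau>}, Dom = nsrc, Cod = ntgt,
      Idt = (\<lambda>F. \<lparr>nsrc = F, ntgt = F, ncomp = (\<lambda>a\<in>Ob C. Idt D (omap F a))\<rparr>),
      Cmp = (\<lambda>\<sigma> \<tau>. \<lparr>nsrc = nsrc \<tau>, ntgt = ntgt \<sigma>,
                    ncomp = (\<lambda>a\<in>Ob C. Cmp D (ncomp \<sigma> a) (ncomp \<tau> a))\<rparr>)\<rparr>"


section \<open>Adjunctions\<close>

definition adjunction ::
  "('o, 'm) cat \<Rightarrow> ('p, 'n) cat \<Rightarrow> ('o, 'm, 'p, 'n) ftor \<Rightarrow> ('p, 'n, 'o, 'm) ftor \<Rightarrow>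
   ('o, 'm, 'o, 'm) ntrans \<Rightarrow> ('p, 'n, 'p, 'n) ntrans \<Rightarrow> bool" where
  "adjunction C D F G \<eta> \<epsilon> \<longleftrightarrow>
     is_functor C D F \<and> is_functor D C G \<and>
     \<eta> \<in> homs (fun_cat C C) (id_functor C) (comp_functor C G F) \<and>
     \<epsilon> \<in> homs (fun_cat D D) (comp_functor D F G) (id_functor D) \<and>
     (\<forall>x\<in>Ob C. Cmp D (ncomp \<epsilon> (omap F x)) (amap F (ncomp \<eta> x)) = Idt D (omap F x)) \<and>
     (\<forall>y\<in>Ob D. Cmp C (amap G (ncomp \<epsilon> y)) (ncomp \<eta> (omap G y)) = Idt C (omap G y))"

definition is_left_adjoint ::
  "('o, 'm) cat \<Rightarrow> ('p, 'n) cat \<Rightarrow> ('o, 'm, 'p, 'n) ftor \<Rightarrow> bool" where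
  "is_left_adjoint C D F \<longleftrightarrow> (\<exists>G \<eta> \<epsilon>. adjunction C D F G \<eta> \<epsilon>)"

definition is_right_adjoint ::
  "('o, 'm) cat \<Rightarrow> ('p, 'n) cat \<Rightarrow> ('o, 'm, 'p, 'n) ftor \<Rightarrow> bool" where
  "is_right_adjoint C D G \<longleftrightarrow> (\<exists>F \<eta> \<epsilon>. adjunction D C F G \<eta> \<epsilon>)"

definition adjoint_equivalence ::
  "('o, 'm) cat \<Rightarrow> ('p, 'n) cat \<Rightarrow> ('o, 'm, 'p, 'n) ftor \<Rightarrow> ('p, 'n, 'o, 'm) ftor \<Rightarrow>
   ('o, 'm, 'o, 'm) ntrans \<Rightarrow> ('p, 'n, 'p, 'n) ntrans \<Rightarrow> bool" where
  "adjoint_equivalence C D F G \<eta> \<epsilon> \<longleftrightarrow>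
     adjunction C D F G \<eta> \<epsilon> \<and>
     (\<forall>x\<in>Ob C. is_iso C (ncomp \<eta> x)) \<and> (\<forall>y\<in>Ob D. is_iso D (ncomp \<epsilon> y))"


section \<open>Slices, pullbacks, filtered colimits\<close>

text \<open>An arrow \<open>(f, g, h)\<close> of the slice is the arrow \<open>h\<close> from \<open>f\<close> to \<open>g\<close>.\<close>

definition slice_cat :: "('o, 'm) cat \<Rightarrow> 'o \<Rightarrow> ('m, 'm \<times> 'm \<times> 'm) cat" where
  "slice_cat C x =
     \<lparr>Ob = {f \<in> Ar C. Cod C f = x},
      Ar = {(f, g, h). f \<in> Ar C \<and> Cod C f = x \<and> g \<in> Ar C \<and> Cod C g = x \<and>
                       h \<in> homs C (Dom C f) (Dom C g) \<and> Cmp C g h = f},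
      Dom = (\<lambda>(f, g, h). f), Cod = (\<lambda>(f, g, h). g),
      Idt = (\<lambda>f. (f, f, Idt C (Dom C f))),
      Cmp = (\<lambda>(g, k, h') (f, _, h). (f, k, Cmp C h' h))\<rparr>"

definition slice_functor ::
  "('o, 'm) cat \<Rightarrow> ('o, 'm, 'p, 'n) ftor \<Rightarrow> 'o \<Rightarrow>
   ('m, 'm \<times> 'm \<times> 'm, 'n, 'n \<times> 'n \<times> 'n) ftor" where
  "slice_functor C T x =
     \<lparr>omap = (\<lambda>f\<in>Ob (slice_cat C x). amap T f),
      amap = (\<lambda>t\<in>Ar (slice_cat C x). case t of (f, g, h) \<Rightarrow> (amap T f, amap T g, amap T h))\<rparr>"

definition is_pullback :: "('o, 'm) cat \<Rightarrow> 'm \<Rightarrow> 'm \<Rightarrow> 'm \<Rightarrow> 'm \<Rightarrow> bool" where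
  "is_pullback C p q f g \<longleftrightarrow>
     p \<in> Ar C \<and> q \<in> Ar C \<and> f \<in> Ar C \<and> g \<in> Ar C \<and>
     Dom C p = Dom C q \<and> Cod C p = Dom C f \<and> Cod C q = Dom C g \<and> Cod C f = Cod C g \<and>
     Cmp C f p = Cmp C g q \<and>
     (\<forall>p'\<in>Ar C. \<forall>q'\<in>Ar C.
        Dom C p' = Dom C q' \<and> Cod C p' = Dom C f \<and> Cod C q' = Dom C g \<and> Cmp C f p' = Cmp C g q'
        \<longrightarrow> (\<exists>!u. u \<in> homs C (Dom C p') (Dom C p) \<and> Cmp C p u = p' \<and> Cmp C q u = q'))"

definition cartesian ::
  "('o, 'm) cat \<Rightarrow> ('p, 'n) cat \<Rightarrow> ('o, 'm, 'p, 'n) ntrans \<Rightarrow> bool" where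
  "cartesian C D \<tau> \<longleftrightarrow>
     (\<forall>h\<in>Ar C. is_pullback D (ncomp \<tau> (Dom C h)) (amap (nsrc \<tau>) h)
                             (amap (ntgt \<tau>) h) (ncomp \<tau> (Cod C h)))"

definition filtered :: "('o, 'm) cat \<Rightarrow> bool" where
  "filtered J \<longleftrightarrow>
     category J \<and> Ob J \<noteq> {} \<and>
     (\<forall>i\<in>Ob J. \<forall>j\<in>Ob J. \<exists>k\<in>Ob J. homs J i k \<noteq> {} \<and> homs J j k \<noteq> {}) \<and>
     (\<forall>f\<in>Ar J. \<forall>g\<in>Ar J. Dom J f = Dom J g \<and> Cod J f = Cod J g \<longrightarrow>
        (\<exists>h\<in>Ar J. Dom J h = Cod J f \<and> Cmp J h f = Cmp J h g))"

definition is_cocone ::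
  "('o, 'm) cat \<Rightarrow> ('p, 'n) cat \<Rightarrow> ('o, 'm, 'p, 'n) ftor \<Rightarrow> 'p \<Rightarrow> ('o \<Rightarrow> 'n) \<Rightarrow> bool" where
  "is_cocone J C D c l \<longleftrightarrow>
     is_functor J C D \<and> c \<in> Ob C \<and>
     (\<forall>i\<in>Ob J. l i \<in> homs C (omap D i) c) \<and>
     (\<forall>f\<in>Ar J. Cmp C (l (Cod J f)) (amap D f) = l (Dom J f))"

definition is_colimit ::
  "('o, 'm) cat \<Rightarrow> ('p, 'n) cat \<Rightarrow> ('o, 'm, 'p, 'n) ftor \<Rightarrow> 'p \<Rightarrow> ('o \<Rightarrow> 'n) \<Rightarrow> bool" where
  "is_colimit J C D c l \<longleftrightarrow>
     is_cocone J C D c l \<and>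
     (\<forall>c' l'. is_cocone J C D c' l' \<longrightarrow>
        (\<exists>!u. u \<in> homs C c c' \<and> (\<forall>i\<in>Ob J. Cmp C u (l i) = l' i)))"

definition preserves_colimits_of_shape ::
  "('j, 'k) cat \<Rightarrow> ('o, 'm) cat \<Rightarrow> ('p, 'n) cat \<Rightarrow> ('o, 'm, 'p, 'n) ftor \<Rightarrow> bool" where
  "preserves_colimits_of_shape J C D T \<longleftrightarrow>
     (\<forall>E c l. is_colimit J C E c l \<longrightarrow>
        is_colimit J D (comp_functor J T E) (omap T c) (\<lambda>i. amap T (l i)))"

definition preserves_epis ::
  "('o, 'm) cat \<Rightarrow> ('p, 'n) cat \<Rightarrow> ('o, 'm, 'p, 'n) ftor \<Rightarrow> bool" where
  "preserves_epis C D T \<longleftrightarrow> (\<forall>f. is_epi C f \<longrightarrow> is_epi D (amap T f))"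


section \<open>Kits\<close>

definition End_group :: "('o, 'm) cat \<Rightarrow> 'o \<Rightarrow> 'm monoid" where
  "End_group C a = \<lparr>carrier = homs C a a, monoid.mult = Cmp C, one = Idt C a\<rparr>"

definition kit :: "('o, 'm) cat \<Rightarrow> ('o \<Rightarrow> 'm set set) \<Rightarrow> bool" where
  "kit C K \<longleftrightarrow>
     (\<forall>a\<in>Ob C. \<forall>H\<in>K a. subgroup H (End_group C a)) \<and>
     (\<forall>f g. inverse_arrows C f g \<longrightarrow>
        (\<forall>H\<in>K (Dom C f). (\<lambda>h. Cmp C f (Cmp C h g)) ` H \<in> K (Cod C f)))"

text \<open>If \<open>K\<close> is a kit on \<open>C\<close>, then \<open>kit_perp C K\<close> is a kit on \<open>op_cat C\<close>.\<close>

definition kit_perp :: "('o, 'm) cat \<Rightarrow> ('o \<Rightarrow> 'm set set) \<Rightarrow> 'o \<Rightarrow> 'm set set" where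
  "kit_perp C K a =
     {H. subgroup H (End_group (op_cat C) a) \<and> (\<forall>G\<in>K a. G \<inter> H = {Idt C a})}"

definition boolean_kit :: "('o, 'm) cat \<Rightarrow> ('o \<Rightarrow> 'm set set) \<Rightarrow> bool" where
  "boolean_kit C K \<longleftrightarrow>
     kit C K \<and> (\<forall>a\<in>Ob C. K a = kit_perp (op_cat C) (kit_perp C K) a)"


section \<open>Presheaves and stabilized presheaves\<close>

record 'u smap =
  sdom :: "'u set"
  scod :: "'u set"
  sfun :: "'u \<Rightarrow> 'u"

definition set_cat :: "('u set, 'u smap) cat" where
  "set_cat =
     \<lparr>Ob = {S. small S},
      Ar = {f. small (sdom f) \<and> small (scod f) \<and> sfun f \<in> sdom f \<rightarrow>\<^sub>E scod f},
      Dom = sdom, Cod = scod,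
      Idt = (\<lambda>S. \<lparr>sdom = S, scod = S, sfun = (\<lambda>x\<in>S. x)\<rparr>),
      Cmp = (\<lambda>g f. \<lparr>sdom = sdom f, scod = scod g, sfun = (\<lambda>x\<in>sdom f. sfun g (sfun f x))\<rparr>)\<rparr>"

type_synonym 'u psh = "('u, 'u, 'u set, 'u smap) ftor"
type_synonym 'u psh_map = "('u, 'u, 'u set, 'u smap) ntrans"
type_synonym 'u prof = "('u \<times> 'u, 'u \<times> 'u, 'u set, 'u smap) ftor"
type_synonym 'u prof_map = "('u \<times> 'u, 'u \<times> 'u, 'u set, 'u smap) ntrans"
type_synonym 'u psh_ftor = "('u psh, 'u psh_map, 'u psh, 'u psh_map) ftor"
type_synonym 'u psh_ftor_map = "('u psh, 'u psh_map, 'u psh, 'u psh_map) ntrans"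
type_synonym 'u kit = "'u \<Rightarrow> 'u set set"

definition PSh :: "('u, 'u) cat \<Rightarrow> ('u psh, 'u psh_map) cat" where
  "PSh A = fun_cat (op_cat A) set_cat"

definition psh_stabilizer :: "('u, 'u) cat \<Rightarrow> 'u psh \<Rightarrow> 'u \<Rightarrow> 'u \<Rightarrow> 'u set" where
  "psh_stabilizer A X a x = {\<alpha> \<in> homs A a a. sfun (amap X \<alpha>) x = x}"

definition StPSh :: "('u, 'u) cat \<Rightarrow> 'u kit \<Rightarrow> ('u psh, 'u psh_map) cat" where
  "StPSh A \<A> =
     full_subcat (PSh A) (\<lambda>X. \<forall>a\<in>Ob A. \<forall>x\<in>omap X a. psh_stabilizer A X a x \<in> \<A> a)"

definition yoneda_ob :: "('u, 'u) cat \<Rightarrow> 'u \<Rightarrow> 'u psh" where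
  "yoneda_ob A a =
     \<lparr>omap = (\<lambda>c\<in>Ob A. homs A c a),
      amap = (\<lambda>f\<in>Ar A. \<lparr>sdom = homs A (Cod A f) a, scod = homs A (Dom A f) a,
                        sfun = (\<lambda>h\<in>homs A (Cod A f) a. Cmp A h f)\<rparr>)\<rparr>"

definition yoneda :: "('u, 'u) cat \<Rightarrow> ('u, 'u, 'u psh, 'u psh_map) ftor" where
  "yoneda A =
     \<lparr>omap = (\<lambda>a\<in>Ob A. yoneda_ob A a),
      amap = (\<lambda>f\<in>Ar A.
        \<lparr>nsrc = yoneda_ob A (Dom A f), ntgt = yoneda_ob A (Cod A f),
         ncomp = (\<lambda>c\<in>Ob A. \<lparr>sdom = homs A c (Dom A f), scod = homs A c (Cod A f),
                            sfun = (\<lambda>h\<in>homs A c (Dom A f). Cmp A f h)\<rparr>)\<rparr>)\<rparr>"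


section \<open>Stabilized profunctors\<close>

definition Prof :: "('u, 'u) cat \<Rightarrow> ('u, 'u) cat \<Rightarrow> ('u prof, 'u prof_map) cat" where
  "Prof A B = fun_cat (prod_cat (op_cat B) A) set_cat"

text \<open>\<open>\<alpha> \<cdot> p \<cdot> \<beta>\<close> is \<open>P(\<beta>, \<alpha>)(p)\<close>.\<close>

definition stabilized ::
  "('u, 'u) cat \<Rightarrow> 'u kit \<Rightarrow> ('u, 'u) cat \<Rightarrow> 'u kit \<Rightarrow> 'u prof \<Rightarrow> bool" where
  "stabilized A \<A> B \<B> P \<longleftrightarrow>
     (\<forall>a\<in>Ob A. \<forall>b\<in>Ob B. \<forall>p\<in>omap P (b, a). \<forall>\<alpha>\<in>homs A a a. \<forall>\<beta>\<in>homs B b b.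
        sfun (amap P (\<beta>, \<alpha>)) p = p \<longrightarrow>
          (\<alpha> \<in> \<Union>(\<A> a) \<longrightarrow> \<beta> \<in> \<Union>(\<B> b)) \<and>
          (\<beta> \<in> \<Union>(kit_perp B \<B> b) \<longrightarrow> \<alpha> \<in> \<Union>(kit_perp A \<A> a)))"

definition SProf ::
  "('u, 'u) cat \<Rightarrow> 'u kit \<Rightarrow> ('u, 'u) cat \<Rightarrow> 'u kit \<Rightarrow> ('u prof, 'u prof_map) cat" where
  "SProf A \<A> B \<B> = full_subcat (Prof A B) (stabilized A \<A> B \<B>)"


section \<open>Linear functors\<close>

definition stable ::
  "('u, 'u) cat \<Rightarrow> 'u kit \<Rightarrow> ('u, 'u) cat \<Rightarrow> 'u kit \<Rightarrow> 'u psh_ftor \<Rightarrow> bool" where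
  "stable A \<A> B \<B> T \<longleftrightarrow>
     is_functor (StPSh A \<A>) (StPSh B \<B>) T \<and>
     (\<forall>J :: ('u, 'u) cat. small_cat J \<and> filtered J \<longrightarrow>
        preserves_colimits_of_shape J (StPSh A \<A>) (StPSh B \<B>) T) \<and>
     preserves_epis (StPSh A \<A>) (StPSh B \<B>) T \<and>
     (\<forall>X\<in>Ob (StPSh A \<A>).
        is_right_adjoint (slice_cat (StPSh A \<A>) X) (slice_cat (StPSh B \<B>) (omap T X))
          (slice_functor (StPSh A \<A>) T X))"

definition linear ::
  "('u, 'u) cat \<Rightarrow> 'u kit \<Rightarrow> ('u, 'u) cat \<Rightarrow> 'u kit \<Rightarrow> 'u psh_ftor \<Rightarrow> bool" where
  "linear A \<A> B \<B> T \<longleftrightarrow>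
     stable A \<A> B \<B> T \<and>
     (\<forall>X\<in>Ob (StPSh A \<A>).
        is_left_adjoint (slice_cat (StPSh A \<A>) X) (slice_cat (StPSh B \<B>) (omap T X))
          (slice_functor (StPSh A \<A>) T X))"

definition Lin ::
  "('u, 'u) cat \<Rightarrow> 'u kit \<Rightarrow> ('u, 'u) cat \<Rightarrow> 'u kit \<Rightarrow> ('u psh_ftor, 'u psh_ftor_map) cat" where
  "Lin A \<A> B \<B> =
     (let F = fun_cat (StPSh A \<A>) (StPSh B \<B>) in
      \<lparr>Ob = {L \<in> Ob F. linear A \<A> B \<B> L},
       Ar = {\<tau> \<in> Ar F. linear A \<A> B \<B> (nsrc \<tau>) \<and> linear A \<A> B \<B> (ntgt \<tau>) \<and>
                      cartesian (StPSh A \<A>) (StPSh B \<B>) \<tau>},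
       Dom = Dom F, Cod = Cod F, Idt = Idt F, Cmp = Cmp F\<rparr>)"


section \<open>The extension of a profunctor along the Yoneda embedding\<close>

text \<open>
  The coend \<open>\<integral>\<^sup>a P(b,a) \<times> X(a)\<close> is the set of triples \<open>(a, p, x)\<close> modulo the equivalence relation
  generated by \<open>(a', f \<cdot> p, x) ~ (a, p, x \<cdot> f)\<close> for \<open>f : a \<rightarrow> a'\<close>. To obtain a subset of \<open>'u\<close>, an
  equivalence class is encoded by applying an injection \<open>triple_code\<close> to a chosen representative;
  such an injection exists because \<open>'u\<close> is infinite. \<open>coend_in\<close> maps a triple to (the code of) its
  class, and \<open>inv_into UNIV triple_code\<close> maps a code to a representative.
\<close>

definition triple_code :: "'u \<times> 'u \<times> 'u \<Rightarrow> 'u" where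
  "triple_code = (SOME e. inj e)"

definition coend_triples ::
  "('u, 'u) cat \<Rightarrow> 'u prof \<Rightarrow> 'u psh \<Rightarrow> 'u \<Rightarrow> ('u \<times> 'u \<times> 'u) set" where
  "coend_triples A P X b = {(a, p, x). a \<in> Ob A \<and> p \<in> omap P (b, a) \<and> x \<in> omap X a}"

definition coend_step ::
  "('u, 'u) cat \<Rightarrow> ('u, 'u) cat \<Rightarrow> 'u prof \<Rightarrow> 'u psh \<Rightarrow> 'u \<Rightarrow> ('u \<times> 'u \<times> 'u) rel" where
  "coend_step A B P X b =
     {((Cod A f, sfun (amap P (Idt B b, f)) p, x), (Dom A f, p, sfun (amap X f) x)) | f p x.
        f \<in> Ar A \<and> p \<in> omap P (b, Dom A f) \<and> x \<in> omap X (Cod A f)}"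

definition coend_in ::
  "('u, 'u) cat \<Rightarrow> ('u, 'u) cat \<Rightarrow> 'u prof \<Rightarrow> 'u psh \<Rightarrow> 'u \<Rightarrow> 'u \<times> 'u \<times> 'u \<Rightarrow> 'u" where
  "coend_in A B P X b t =
     triple_code (SOME t'. (t, t') \<in> (coend_step A B P X b \<union> (coend_step A B P X b)\<inverse>)\<^sup>*)"

definition coend ::
  "('u, 'u) cat \<Rightarrow> ('u, 'u) cat \<Rightarrow> 'u prof \<Rightarrow> 'u psh \<Rightarrow> 'u \<Rightarrow> 'u set" where
  "coend A B P X b = coend_in A B P X b ` coend_triples A P X b"

definition coend_map ::
  "('u, 'u) cat \<Rightarrow> ('u, 'u) cat \<Rightarrow> 'u prof \<times> 'u psh \<times> 'u \<Rightarrow> 'u prof \<times> 'u psh \<times> 'u \<Rightarrow>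
   ('u \<times> 'u \<times> 'u \<Rightarrow> 'u \<times> 'u \<times> 'u) \<Rightarrow> 'u smap" where
  "coend_map A B = (\<lambda>(P, X, b) (Q, Y, c) \<phi>.
     \<lparr>sdom = coend A B P X b, scod = coend A B Q Y c,
      sfun = (\<lambda>k\<in>coend A B P X b. coend_in A B Q Y c (\<phi> (inv_into UNIV triple_code k)))\<rparr>)"

definition psh_ext_ob ::
  "('u, 'u) cat \<Rightarrow> ('u, 'u) cat \<Rightarrow> 'u prof \<Rightarrow> 'u psh \<Rightarrow> 'u psh" where
  "psh_ext_ob A B P X =
     \<lparr>omap = (\<lambda>b\<in>Ob B. coend A B P X b),
      amap = (\<lambda>g\<in>Ar B. coend_map A B (P, X, Cod B g) (P, X, Dom B g)
                          (\<lambda>(a, p, x). (a, sfun (amap P (g, Idt A a)) p, x)))\<rparr>"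

definition psh_ext :: "('u, 'u) cat \<Rightarrow> ('u, 'u) cat \<Rightarrow> 'u prof \<Rightarrow> 'u psh_ftor" where
  "psh_ext A B P =
     \<lparr>omap = (\<lambda>X\<in>Ob (PSh A). psh_ext_ob A B P X),
      amap = (\<lambda>\<tau>\<in>Ar (PSh A).
        \<lparr>nsrc = psh_ext_ob A B P (nsrc \<tau>), ntgt = psh_ext_ob A B P (ntgt \<tau>),
         ncomp = (\<lambda>b\<in>Ob B. coend_map A B (P, nsrc \<tau>, b) (P, ntgt \<tau>, b)
                             (\<lambda>(a, p, x). (a, p, sfun (ncomp \<tau> a) x)))\<rparr>)\<rparr>"

definition st_ext :: "('u, 'u) cat \<Rightarrow> 'u kit \<Rightarrow> ('u, 'u) cat \<Rightarrow> 'u prof \<Rightarrow> 'u psh_ftor" where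
  "st_ext A \<A> B P = restrict_functor (StPSh A \<A>) (psh_ext A B P)"

definition st_ext_map ::
  "('u, 'u) cat \<Rightarrow> 'u kit \<Rightarrow> ('u, 'u) cat \<Rightarrow> 'u prof_map \<Rightarrow> 'u psh_ftor_map" where
  "st_ext_map A \<A> B \<theta> =
     \<lparr>nsrc = st_ext A \<A> B (nsrc \<theta>), ntgt = st_ext A \<A> B (ntgt \<theta>),
      ncomp = (\<lambda>X\<in>Ob (StPSh A \<A>).
        \<lparr>nsrc = psh_ext_ob A B (nsrc \<theta>) X, ntgt = psh_ext_ob A B (ntgt \<theta>) X,
         ncomp = (\<lambda>b\<in>Ob B. coend_map A B (nsrc \<theta>, X, b) (ntgt \<theta>, X, b)
                             (\<lambda>(a, p, x). (a, sfun (ncomp \<theta> (b, a)) p, x)))\<rparr>)\<rparr>"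

definition st_ext_functor ::
  "('u, 'u) cat \<Rightarrow> 'u kit \<Rightarrow> ('u, 'u) cat \<Rightarrow> 'u kit \<Rightarrow>
   ('u prof, 'u prof_map, 'u psh_ftor, 'u psh_ftor_map) ftor" where
  "st_ext_functor A \<A> B \<B> =
     \<lparr>omap = (\<lambda>P\<in>Ob (SProf A \<A> B \<B>). st_ext A \<A> B P),
      amap = (\<lambda>\<theta>\<in>Ar (SProf A \<A> B \<B>). st_ext_map A \<A> B \<theta>)\<rparr>"


section \<open>The linear trace\<close>

text \<open>
  The functor \<open>L \<circ> y\<close> from \<open>A\<close> to presheaves on \<open>B\<close>, transposed to a functor on \<open>B\<^sup>o\<^sup>p \<times> A\<close>.
\<close>

definition tr_lin_ob :: "('u, 'u) cat \<Rightarrow> ('u, 'u) cat \<Rightarrow> 'u psh_ftor \<Rightarrow> 'u prof" where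
  "tr_lin_ob A B L =
     (let Ly = comp_functor A L (yoneda A) in
      \<lparr>omap = (\<lambda>(b, a)\<in>Ob B \<times> Ob A. omap (omap Ly a) b),
       amap = (\<lambda>(g, f)\<in>Ar B \<times> Ar A.
         Cmp set_cat (ncomp (amap Ly f) (Dom B g)) (amap (omap Ly (Dom A f)) g))\<rparr>)"

definition tr_lin_map :: "('u, 'u) cat \<Rightarrow> ('u, 'u) cat \<Rightarrow> 'u psh_ftor_map \<Rightarrow> 'u prof_map" where
  "tr_lin_map A B \<tau> =
     \<lparr>nsrc = tr_lin_ob A B (nsrc \<tau>), ntgt = tr_lin_ob A B (ntgt \<tau>),
      ncomp = (\<lambda>(b, a)\<in>Ob B \<times> Ob A. ncomp (ncomp \<tau> (omap (yoneda A) a)) b)\<rparr>"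

definition tr_lin_functor ::
  "('u, 'u) cat \<Rightarrow> 'u kit \<Rightarrow> ('u, 'u) cat \<Rightarrow> 'u kit \<Rightarrow>
   ('u psh_ftor, 'u psh_ftor_map, 'u prof, 'u prof_map) ftor" where
  "tr_lin_functor A \<A> B \<B> =
     \<lparr>omap = (\<lambda>L\<in>Ob (Lin A \<A> B \<B>). tr_lin_ob A B L),
      amap = (\<lambda>\<tau>\<in>Ar (Lin A \<A> B \<B>). tr_lin_map A B \<tau>)\<rparr>"

end

theory Submission
  imports Defs
begin

text \<open>
  For a Boolean kit, a subgroup belongs to \<open>\<A> a\<close> if and only if it is contained in \<open>\<Union>(\<A> a)\<close>. Hence every presheaf that
  maps to a stabilized presheaf is stabilized, so that slices of the category of stabilized presheaves are slices of the
  category of presheaves.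

  Let \<open>P\<close> be a stabilized profunctor. If \<open>\<alpha> \<in> \<Union>(\<A> a)\<close> and \<open>\<alpha> \<cdot> p = p\<close>, then \<open>\<alpha>\<close> is the identity, because it also lies in
  \<open>\<Union>(\<A>\<^sup>\<bottom> a)\<close>. Therefore the extension of \<open>P\<close> identifies the fibre of \<open>V \<rightarrow> X\<close> over \<open>x\<close> with the fibre over the class of
  \<open>(a, p, x)\<close>; the slice functors are restrictions along functors between categories of elements and have both
  adjoints, and the extensions of transformations of profunctors are cartesian.

  Conversely, let \<open>L\<close> be linear. In the slice over itself, \<open>X\<close> is the colimit of its elements \<open>y a \<rightarrow> X\<close>; the left adjoint
  slice functor of \<open>L\<close> preserves this colimit, which makes the comparison map from \<open>\<integral>\<^sup>a L(y a) \<times> X(a)\<close> to \<open>L X\<close> bijective.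
  The trace of \<open>L\<close> is stabilized: for \<open>\<alpha>\<close> in \<open>H \<in> \<A> a\<close>, apply \<open>L\<close> to the quotient of \<open>y a\<close> by \<open>H\<close>, and use that the right
  adjoint slice functors preserve the empty equalizer of \<open>\<alpha>\<close> and the identity if \<open>\<alpha>\<close> is not the identity.
\<close>

section \<open>Smallness\<close>

text \<open>Slices are unavoidable here. For a nontrivial group whose kit holds only the trivial
  subgroup, stabilized presheaves are the free actions: these have no terminal object, and no map
  out of a representable identifies a point with a different translate of it. A linear functor can
  therefore be an adjoint only locally.

  The adjoints on slices are produced one object at a time, by exhibiting universal arrows. Each of
  them needs a presheaf of tuples, of families or of equivalence classes, which has to be coded into
  the fixed type \<open>'u\<close> of elements. Invertibility of arrows keeps the coends tractable:
  equality of two classes is witnessed by a single arrow instead of a zigzag.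

  The two conditions on a stabilized profunctor enter separately: the first makes its extension land
  in stabilized presheaves, the second makes elements of the kit act freely on it. For the trace of
  a linear functor the first condition and the freeness are obtained independently; the second
  condition then follows by looking at all \<alpha> whose effect on \<open>p\<close> is compensated
  by some element of a given orthogonal subgroup.\<close>

lemma lesspoll_image: "S \<prec> T \<Longrightarrow> f ` S \<prec> T"
  by (meson image_lepoll lesspoll_trans1)

lemma lesspoll_subset: "S \<prec> T \<Longrightarrow> R \<subseteq> S \<Longrightarrow> R \<prec> T"
  by (meson lesspoll_trans1 subset_imp_lepoll)

lemma set_universe_infinite: "set_universe TYPE('u) \<Longrightarrow> infinite (UNIV :: 'u set)"
  by (simp add: set_universe_def)

lemma set_universe_Pow: "set_universe TYPE('u) \<Longrightarrow> small (S :: 'u set) \<Longrightarrow> Pow S \<prec> (UNIV :: 'u set)"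
  by (simp add: set_universe_def)

lemma set_universe_UNION:
  fixes S :: "'u set" and F :: "'u \<Rightarrow> 'u set"
  assumes "set_universe TYPE('u)" "small S" "\<And>x. x \<in> S \<Longrightarrow> small (F x)"
  shows "small (\<Union>x\<in>S. F x)"
proof -
  have "\<forall>(S :: 'u set) (F :: 'u \<Rightarrow> 'u set).
        small S \<and> (\<forall>x\<in>S. small (F x)) \<longrightarrow> small (\<Union>x\<in>S. F x)"
    using assms(1) unfolding set_universe_def by (elim conjE)
  then show ?thesis
    using assms(2,3) by blast
qed

lemma ex_inj_pair:
  assumes "set_universe TYPE('u)"
  shows "\<exists>e :: 'u \<times> 'u \<Rightarrow> 'u. inj e"
proof -
  obtain f :: "'u \<times> 'u \<Rightarrow> 'u" where "bij_betw f (UNIV \<times> UNIV) UNIV"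
    using card_of_Times_same_infinite[OF set_universe_infinite[OF assms]] card_of_ordIso by blast
  then show ?thesis
    by (auto simp: bij_betw_def)
qed

lemma inj_triple_code:
  assumes "set_universe TYPE('u)"
  shows "inj (triple_code :: 'u \<times> 'u \<times> 'u \<Rightarrow> 'u)"
proof -
  obtain e :: "'u \<times> 'u \<Rightarrow> 'u" where e: "inj e"
    using ex_inj_pair[OF assms] by blast
  have "inj (\<lambda>(a, b, c). e (a, e (b, c)))"
    by (rule injI) (auto dest!: injD[OF e])
  then show ?thesis
    unfolding triple_code_def by (rule someI[where P = inj])
qed

text \<open>The bridge from sets over an arbitrary type to small sets in \<open>'u\<close>; every
  presheaf built from tuples, families or classes passes through it.\<close>

lemma lesspoll_encode:
  assumes "S \<prec> (UNIV :: 'u set)"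
  obtains e :: "'x \<Rightarrow> 'u" where "inj_on e S" "small (e ` S)"
proof -
  obtain e :: "'x \<Rightarrow> 'u" where "inj_on e S"
    using assms by (auto simp: lesspoll_def lepoll_def)
  moreover have "small (e ` S)"
    unfolding small_def by (rule lesspoll_image[OF assms])
  ultimately show thesis by (rule that)
qed

text \<open>The axiom on unions speaks of index sets inside \<open>'u\<close>. Coding the index set
  transports it to any index type.\<close>

lemma lesspoll_UNION:
  fixes F :: "'x \<Rightarrow> 'u set"
  assumes U: "set_universe TYPE('u)" and S: "S \<prec> (UNIV :: 'u set)"
    and F: "\<And>x. x \<in> S \<Longrightarrow> small (F x)"
  shows "small (\<Union>x\<in>S. F x)"
proof -
  obtain e :: "'x \<Rightarrow> 'u" where e: "inj_on e S" "small (e ` S)"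
    using lesspoll_encode[OF S] .
  have "(\<Union>x\<in>S. F x) = (\<Union>k\<in>e ` S. F (inv_into S e k))"
    using e(1) by auto
  moreover have "\<forall>k\<in>e ` S. small (F (inv_into S e k))"
    using e(1) F by auto
  ultimately show ?thesis
    using set_universe_UNION[OF U e(2), of "\<lambda>k. F (inv_into S e k)"] by (metis (no_types, lifting))
qed

lemma lesspoll_Sigma:
  fixes F :: "'a \<Rightarrow> 'b set"
  assumes U: "set_universe TYPE('u)" and S: "S \<prec> (UNIV :: 'u set)"
    and F: "\<And>x. x \<in> S \<Longrightarrow> F x \<prec> (UNIV :: 'u set)"
  shows "Sigma S F \<prec> (UNIV :: 'u set)"
proof -
  obtain c :: "'u \<times> 'u \<Rightarrow> 'u" where c: "inj c"
    using ex_inj_pair[OF U] by blast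
  obtain e where e: "inj_on e S" "small (e ` S :: 'u set)"
    using lesspoll_encode[OF S] .
  have "\<forall>x\<in>S. \<exists>d :: 'b \<Rightarrow> 'u. inj_on d (F x)"
    using F by (auto simp: lesspoll_def lepoll_def)
  then obtain d where d: "\<And>x. x \<in> S \<Longrightarrow> inj_on (d x :: 'b \<Rightarrow> 'u) (F x)"
    by metis
  \<comment> \<open>The index is coded by \<open>e\<close>, the element by an injection
    \<open>d x\<close> of its own fibre; the pairing \<open>c\<close> keeps different fibres
    apart.\<close>
  define h where "h = (\<lambda>(x, y). c (e x, d x y))"
  have "inj_on h (Sigma S F)"
  proof (rule inj_onI)
    fix s t assume st: "s \<in> Sigma S F" "t \<in> Sigma S F" "h s = h t"
    then have "(e (fst s), d (fst s) (snd s)) = (e (fst t), d (fst t) (snd t))"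
      using injD[OF c] by (auto simp: h_def split_beta)
    moreover from this have "fst s = fst t"
      using st inj_onD[OF e(1)] by auto
    ultimately show "s = t"
      using st inj_onD[OF d[of "fst t"]] by (auto simp: prod_eq_iff)
  qed
  moreover have "h ` Sigma S F \<subseteq> (\<Union>x\<in>S. (\<lambda>y. c (e x, d x y)) ` F x)"
    unfolding h_def by auto
  moreover have "small (\<Union>x\<in>S. (\<lambda>y. c (e x, d x y)) ` F x)"
    using U S F by (intro lesspoll_UNION) (simp_all add: small_def lesspoll_image)
  ultimately have "Sigma S F \<lesssim> (\<Union>x\<in>S. (\<lambda>y. c (e x, d x y)) ` F x)"
    and "(\<Union>x\<in>S. (\<lambda>y. c (e x, d x y)) ` F x) \<prec> (UNIV :: 'u set)"
    unfolding small_def lepoll_def by blast+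
  then show ?thesis
    by (rule lesspoll_trans1)
qed

lemma lesspoll_Pow:
  assumes U: "set_universe TYPE('u)" and S: "S \<prec> (UNIV :: 'u set)"
  shows "Pow S \<prec> (UNIV :: 'u set)"
proof -
  obtain e where e: "inj_on e S" "small (e ` S :: 'u set)"
    using lesspoll_encode[OF S] .
  have "Pow (e ` S) \<prec> (UNIV :: 'u set)"
    by (rule set_universe_Pow[OF U e(2)])
  moreover have "Pow S \<lesssim> Pow (e ` S)"
    unfolding lepoll_def using inj_on_image_Pow[OF e(1)] by (intro exI[of _ "image e"]) auto
  ultimately show ?thesis
    by (rule lesspoll_trans1[rotated])
qed

text \<open>An extensional family is determined by its graph, a subset of \<open>Sigma S F\<close>,
  so closure under dependent sums and power sets suffices. This bounds the presheaf of families that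
  gives the right adjoint on slices.\<close>

lemma lesspoll_PiE:
  assumes U: "set_universe TYPE('u)" and S: "S \<prec> (UNIV :: 'u set)"
    and F: "\<And>x. x \<in> S \<Longrightarrow> F x \<prec> (UNIV :: 'u set)"
  shows "PiE S F \<prec> (UNIV :: 'u set)"
proof -
  have "PiE S F \<lesssim> Pow (Sigma S F)"
    unfolding lepoll_def
  proof (intro exI[of _ "\<lambda>f. (\<lambda>x. (x, f x)) ` S"] conjI)
    show "inj_on (\<lambda>f. (\<lambda>x. (x, f x)) ` S) (PiE S F)"
    proof (rule inj_onI)
      fix f g assume f: "f \<in> PiE S F" and g: "g \<in> PiE S F"
        and eq: "(\<lambda>x. (x, f x)) ` S = (\<lambda>x. (x, g x)) ` S"
      have "f x = g x" if "x \<in> S" for x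
        using eq that by auto
      then show "f = g"
        using f g by (intro PiE_ext) auto
    qed
  qed auto
  moreover have "Pow (Sigma S F) \<prec> (UNIV :: 'u set)"
    using F by (intro lesspoll_Pow[OF U] lesspoll_Sigma[OF U S])
  ultimately show ?thesis
    by (rule lesspoll_trans1)
qed


section \<open>Categories and functors\<close>

lemma homsI: "f \<in> Ar C \<Longrightarrow> Dom C f = a \<Longrightarrow> Cod C f = b \<Longrightarrow> f \<in> homs C a b"
  by (simp add: homs_def)

lemma homsD:
  assumes "f \<in> homs C a b"
  shows "f \<in> Ar C" "Dom C f = a" "Cod C f = b"
  using assms by (simp_all add: homs_def)

lemma ar_hom: "f \<in> Ar C \<Longrightarrow> f \<in> homs C (Dom C f) (Cod C f)"
  by (simp add: homs_def)

lemma cat_hom_ob: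
  assumes "category C" "f \<in> homs C a b"
  shows "a \<in> Ob C" "b \<in> Ob C"
  using assms by (auto simp: category_def homs_def)

lemma cat_id: "category C \<Longrightarrow> a \<in> Ob C \<Longrightarrow> Idt C a \<in> homs C a a"
  by (simp add: category_def)

lemma cat_comp: "category C \<Longrightarrow> f \<in> homs C a b \<Longrightarrow> g \<in> homs C b c \<Longrightarrow> Cmp C g f \<in> homs C a c"
  by (auto simp: category_def homs_def)

lemma cat_id_right: "category C \<Longrightarrow> f \<in> homs C a b \<Longrightarrow> Cmp C f (Idt C a) = f"
  by (auto simp: category_def homs_def)

lemma cat_id_left: "category C \<Longrightarrow> f \<in> homs C a b \<Longrightarrow> Cmp C (Idt C b) f = f"
  by (auto simp: category_def homs_def)

lemma cat_assoc:
  "category C \<Longrightarrow> f \<in> homs C a b \<Longrightarrow> g \<in> homs C b c \<Longrightarrow> h \<in> homs C c d \<Longrightarrow>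
   Cmp C h (Cmp C g f) = Cmp C (Cmp C h g) f"
  by (auto simp: category_def homs_def)

lemma categoryI:
  assumes "\<And>f. f \<in> Ar C \<Longrightarrow> Dom C f \<in> Ob C" "\<And>f. f \<in> Ar C \<Longrightarrow> Cod C f \<in> Ob C"
    and "\<And>a. a \<in> Ob C \<Longrightarrow> Idt C a \<in> homs C a a"
    and "\<And>f g a b c. f \<in> homs C a b \<Longrightarrow> g \<in> homs C b c \<Longrightarrow> Cmp C g f \<in> homs C a c"
    and "\<And>f a b. f \<in> homs C a b \<Longrightarrow> Cmp C f (Idt C a) = f"
    and "\<And>f a b. f \<in> homs C a b \<Longrightarrow> Cmp C (Idt C b) f = f"
    and "\<And>f g h a b c d. f \<in> homs C a b \<Longrightarrow> g \<in> homs C b c \<Longrightarrow> h \<in> homs C c d \<Longrightarrow>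
           Cmp C h (Cmp C g f) = Cmp C (Cmp C h g) f"
  shows "category C"
  unfolding category_def using assms by (simp add: homs_def)

lemma functor_cat:
  assumes "is_functor C D F"
  shows "category C" "category D"
  using assms by (auto simp: is_functor_def)

lemma functor_ob: "is_functor C D F \<Longrightarrow> a \<in> Ob C \<Longrightarrow> omap F a \<in> Ob D"
  by (auto simp: is_functor_def)

lemma functor_hom:
  "is_functor C D F \<Longrightarrow> f \<in> homs C a b \<Longrightarrow> amap F f \<in> homs D (omap F a) (omap F b)"
  by (auto simp: is_functor_def homs_def)

lemma functor_id: "is_functor C D F \<Longrightarrow> a \<in> Ob C \<Longrightarrow> amap F (Idt C a) = Idt D (omap F a)"
  by (auto simp: is_functor_def)

lemma functor_comp:
  "is_functor C D F \<Longrightarrow> f \<in> homs C a b \<Longrightarrow> g \<in> homs C b c \<Longrightarrow>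
   amap F (Cmp C g f) = Cmp D (amap F g) (amap F f)"
  by (auto simp: is_functor_def homs_def)

lemma functor_ext_ob: "is_functor C D F \<Longrightarrow> omap F \<in> extensional (Ob C)"
  by (auto simp: is_functor_def PiE_def)

lemma functor_ext_ar: "is_functor C D F \<Longrightarrow> amap F \<in> extensional (Ar C)"
  by (auto simp: is_functor_def PiE_def)

lemma functorI:
  assumes "category C" "category D"
    and "omap F \<in> extensional (Ob C)" "amap F \<in> extensional (Ar C)"
    and "\<And>a. a \<in> Ob C \<Longrightarrow> omap F a \<in> Ob D"
    and "\<And>f a b. f \<in> homs C a b \<Longrightarrow> amap F f \<in> homs D (omap F a) (omap F b)"
    and "\<And>a. a \<in> Ob C \<Longrightarrow> amap F (Idt C a) = Idt D (omap F a)"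
    and "\<And>f g a b c. f \<in> homs C a b \<Longrightarrow> g \<in> homs C b c \<Longrightarrow>
          amap F (Cmp C g f) = Cmp D (amap F g) (amap F f)"
  shows "is_functor C D F"
  unfolding is_functor_def using assms by (auto simp: homs_def PiE_def)

lemma id_functor_simps:
  "a \<in> Ob C \<Longrightarrow> omap (id_functor C) a = a" "f \<in> Ar C \<Longrightarrow> amap (id_functor C) f = f"
  by (auto simp: id_functor_def homs_def)

lemma comp_functor_simps:
  "a \<in> Ob C \<Longrightarrow> omap (comp_functor C G F) a = omap G (omap F a)"
  "f \<in> Ar C \<Longrightarrow> amap (comp_functor C G F) f = amap G (amap F f)"
  by (auto simp: comp_functor_def homs_def)

lemma functor_id_functor: "category C \<Longrightarrow> is_functor C C (id_functor C)"
  by (rule functorI) (auto simp: id_functor_def homs_def category_def)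

lemma functor_comp_functor:
  assumes F: "is_functor C D F" and G: "is_functor D E G"
  shows "is_functor C E (comp_functor C G F)"
proof (rule functorI)
  note cats = functor_cat[OF F] functor_cat[OF G]
  show "category C" "category E" by (fact cats)+
  show "omap (comp_functor C G F) \<in> extensional (Ob C)" "amap (comp_functor C G F) \<in> extensional (Ar C)"
    by (simp_all add: comp_functor_def)
  show "omap (comp_functor C G F) a \<in> Ob E" if "a \<in> Ob C" for a
    using that functor_ob[OF F] functor_ob[OF G] by (simp add: comp_functor_simps)
  show "amap (comp_functor C G F) f \<in> homs E (omap (comp_functor C G F) a) (omap (comp_functor C G F) b)"
    if "f \<in> homs C a b" for f a b
    using that functor_hom[OF G functor_hom[OF F that]] cat_hom_ob[OF cats(1) that]
    by (simp add: comp_functor_simps homsD(1)[OF that])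
  show "amap (comp_functor C G F) (Idt C a) = Idt E (omap (comp_functor C G F) a)" if "a \<in> Ob C" for a
    using that functor_id[OF F] functor_id[OF G] functor_ob[OF F]
    by (simp add: comp_functor_simps homsD(1)[OF cat_id[OF cats(1)]])
  show "amap (comp_functor C G F) (Cmp C g f) =
        Cmp E (amap (comp_functor C G F) g) (amap (comp_functor C G F) f)"
    if "f \<in> homs C a b" "g \<in> homs C b c" for f g a b c
    using that functor_comp[OF F that] functor_comp[OF G functor_hom[OF F that(1)] functor_hom[OF F that(2)]]
    by (simp add: comp_functor_simps homsD(1)[OF cat_comp[OF cats(1) that]] homsD(1)[OF that(1)] homsD(1)[OF that(2)])
qed

lemma nat_transD:
  assumes "nat_trans C D \<tau>"
  shows "is_functor C D (nsrc \<tau>)" "is_functor C D (ntgt \<tau>)" "ncomp \<tau> \<in> extensional (Ob C)"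
    "\<And>a. a \<in> Ob C \<Longrightarrow> ncomp \<tau> a \<in> homs D (omap (nsrc \<tau>) a) (omap (ntgt \<tau>) a)"
    "\<And>f a b. f \<in> homs C a b \<Longrightarrow>
       Cmp D (ncomp \<tau> b) (amap (nsrc \<tau>) f) = Cmp D (amap (ntgt \<tau>) f) (ncomp \<tau> a)"
  using assms by (auto simp: nat_trans_def homs_def)

lemma fun_cat_simps [simp]:
  "Ob (fun_cat C D) = {F. is_functor C D F}" "Ar (fun_cat C D) = {\<tau>. nat_trans C D \<tau>}"
  "Dom (fun_cat C D) = nsrc" "Cod (fun_cat C D) = ntgt"
  "nsrc (Idt (fun_cat C D) F) = F" "ntgt (Idt (fun_cat C D) F) = F"
  "nsrc (Cmp (fun_cat C D) \<sigma> \<tau>) = nsrc \<tau>" "ntgt (Cmp (fun_cat C D) \<sigma> \<tau>) = ntgt \<sigma>"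
  "a \<in> Ob C \<Longrightarrow> ncomp (Idt (fun_cat C D) F) a = Idt D (omap F a)"
  "a \<in> Ob C \<Longrightarrow> ncomp (Cmp (fun_cat C D) \<sigma> \<tau>) a = Cmp D (ncomp \<sigma> a) (ncomp \<tau> a)"
  "ncomp (Idt (fun_cat C D) F) \<in> extensional (Ob C)"
  "ncomp (Cmp (fun_cat C D) \<sigma> \<tau>) \<in> extensional (Ob C)"
  by (simp_all add: fun_cat_def)

lemma nt_homD:
  assumes "\<tau> \<in> homs (fun_cat C D) F G"
  shows "is_functor C D F" "is_functor C D G" "ncomp \<tau> \<in> extensional (Ob C)"
    "\<And>a. a \<in> Ob C \<Longrightarrow> ncomp \<tau> a \<in> homs D (omap F a) (omap G a)"
    "\<And>f a b. f \<in> homs C a b \<Longrightarrow> Cmp D (ncomp \<tau> b) (amap F f) = Cmp D (amap G f) (ncomp \<tau> a)"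
    "nsrc \<tau> = F" "ntgt \<tau> = G"
  using assms nat_transD[of C D \<tau>] by (auto simp: homs_def)

lemma nt_homI:
  assumes "is_functor C D F" "is_functor C D G" "ncomp \<tau> \<in> extensional (Ob C)" "nsrc \<tau> = F" "ntgt \<tau> = G"
    "\<And>a. a \<in> Ob C \<Longrightarrow> ncomp \<tau> a \<in> homs D (omap F a) (omap G a)"
    "\<And>f a b. f \<in> homs C a b \<Longrightarrow> Cmp D (ncomp \<tau> b) (amap F f) = Cmp D (amap G f) (ncomp \<tau> a)"
  shows "\<tau> \<in> homs (fun_cat C D) F G"
  using assms by (auto simp: homs_def nat_trans_def)

lemma nt_hom_eqI:
  assumes "\<tau> \<in> homs (fun_cat C D) F G" "\<sigma> \<in> homs (fun_cat C D) F G"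
    and "\<And>a. a \<in> Ob C \<Longrightarrow> ncomp \<tau> a = ncomp \<sigma> a"
  shows "\<tau> = \<sigma>"
proof -
  have "ncomp \<tau> = ncomp \<sigma>"
    using nt_homD(3)[OF assms(1)] nt_homD(3)[OF assms(2)] assms(3) by (rule extensionalityI)
  then show ?thesis
    using nt_homD(6,7)[OF assms(1)] nt_homD(6,7)[OF assms(2)] by (cases \<tau>, cases \<sigma>) simp
qed

lemma category_fun_cat:
  assumes C: "category C" and D: "category D"
  shows "category (fun_cat C D)"
proof -
  let ?F = "fun_cat C D"
  have id: "Idt ?F F \<in> homs ?F F F" if F: "is_functor C D F" for F
    using functor_ob[OF F] functor_hom[OF F] cat_hom_ob[OF C]
    by (intro nt_homI[OF F F]) (auto simp: cat_id[OF D] cat_id_left[OF D functor_hom[OF F]]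
      cat_id_right[OF D functor_hom[OF F]])
  have cmp: "Cmp ?F \<sigma> \<tau> \<in> homs ?F F H"
    if t: "\<tau> \<in> homs ?F F G" and s: "\<sigma> \<in> homs ?F G H" for \<sigma> \<tau> F G H
  proof -
    note t' = nt_homD[OF t] and s' = nt_homD[OF s]
    show ?thesis
    proof (rule nt_homI[OF t'(1) s'(2)])
      show "ncomp (Cmp ?F \<sigma> \<tau>) a \<in> homs D (omap F a) (omap H a)" if "a \<in> Ob C" for a
        using that cat_comp[OF D t'(4) s'(4)] by simp
      show "Cmp D (ncomp (Cmp ?F \<sigma> \<tau>) b) (amap F f) = Cmp D (amap H f) (ncomp (Cmp ?F \<sigma> \<tau>) a)"
        if f: "f \<in> homs C a b" for f a b
      proof -
        note ob = cat_hom_ob[OF C f]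
        note Ff = functor_hom[OF t'(1) f] and Gf = functor_hom[OF t'(2) f] and Hf = functor_hom[OF s'(2) f]
        have "Cmp D (Cmp D (ncomp \<sigma> b) (ncomp \<tau> b)) (amap F f)
            = Cmp D (ncomp \<sigma> b) (Cmp D (amap G f) (ncomp \<tau> a))"
          using cat_assoc[OF D Ff t'(4)[OF ob(2)] s'(4)[OF ob(2)]] t'(5)[OF f] by simp
        also have "\<dots> = Cmp D (amap H f) (Cmp D (ncomp \<sigma> a) (ncomp \<tau> a))"
          using cat_assoc[OF D t'(4)[OF ob(1)] Gf s'(4)[OF ob(2)]] s'(5)[OF f]
            cat_assoc[OF D t'(4)[OF ob(1)] s'(4)[OF ob(1)] Hf] by simp
        finally show ?thesis using ob by simp
      qed
    qed (use t' s' in auto)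
  qed
  show ?thesis
  proof (rule categoryI)
    show "Cmp ?F \<tau> (Idt ?F F) = \<tau>" if t: "\<tau> \<in> homs ?F F G" for \<tau> F G
      by (intro nt_hom_eqI[OF cmp[OF id[OF nt_homD(1)[OF t]] t] t]) (simp add: cat_id_right[OF D nt_homD(4)[OF t]])
    show "Cmp ?F (Idt ?F G) \<tau> = \<tau>" if t: "\<tau> \<in> homs ?F F G" for \<tau> F G
      by (intro nt_hom_eqI[OF cmp[OF t id[OF nt_homD(2)[OF t]]] t]) (simp add: cat_id_left[OF D nt_homD(4)[OF t]])
    show "Cmp ?F \<rho> (Cmp ?F \<sigma> \<tau>) = Cmp ?F (Cmp ?F \<rho> \<sigma>) \<tau>"
      if t: "\<tau> \<in> homs ?F F G" and s: "\<sigma> \<in> homs ?F G H" and r: "\<rho> \<in> homs ?F H K" for \<rho> \<sigma> \<tau> F G H K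
      using cat_assoc[OF D nt_homD(4)[OF t] nt_homD(4)[OF s] nt_homD(4)[OF r]]
      by (intro nt_hom_eqI[OF cmp[OF cmp[OF t s] r] cmp[OF t cmp[OF s r]]]) simp
  qed (auto simp: id cmp dest: nat_transD)
qed

section \<open>Opposite categories, product categories and full subcategories\<close>

lemma op_cat_simps [simp]:
  "Ob (op_cat C) = Ob C" "Ar (op_cat C) = Ar C" "Dom (op_cat C) = Cod C" "Cod (op_cat C) = Dom C"
  "Idt (op_cat C) = Idt C" "Cmp (op_cat C) g f = Cmp C f g" "homs (op_cat C) a b = homs C b a"
  "op_cat (op_cat C) = C"
  by (auto simp: op_cat_def homs_def)

lemma category_op_cat: "category C \<Longrightarrow> category (op_cat C)"
  by (rule categoryI) (auto intro: cat_id cat_comp simp: cat_id_left cat_id_right cat_assoc dest: ar_hom cat_hom_ob)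

lemma functor_op_cat:
  assumes "is_functor C D F"
  shows "is_functor (op_cat C) (op_cat D) F"
  using functor_cat[OF assms] functor_ext_ob[OF assms] functor_ext_ar[OF assms]
  by (intro functorI) (auto intro: category_op_cat functor_ob[OF assms] functor_hom[OF assms]
    functor_id[OF assms] functor_comp[OF assms])

lemma prod_cat_simps [simp]:
  "Ob (prod_cat C D) = Ob C \<times> Ob D" "Ar (prod_cat C D) = Ar C \<times> Ar D"
  "Dom (prod_cat C D) (f, g) = (Dom C f, Dom D g)" "Cod (prod_cat C D) (f, g) = (Cod C f, Cod D g)"
  "Idt (prod_cat C D) (a, b) = (Idt C a, Idt D b)"
  "Cmp (prod_cat C D) (f', g') (f, g) = (Cmp C f' f, Cmp D g' g)"
  "homs (prod_cat C D) (a, b) (a', b') = homs C a a' \<times> homs D b b'"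
  by (auto simp: prod_cat_def homs_def)

lemma category_prod_cat:
  assumes C: "category C" and D: "category D"
  shows "category (prod_cat C D)"
proof (rule categoryI)
  let ?P = "prod_cat C D"
  show "Dom ?P f \<in> Ob ?P" "Cod ?P f \<in> Ob ?P" if "f \<in> Ar ?P" for f
    using that C D by (auto simp: category_def)
  show "Idt ?P a \<in> homs ?P a a" if "a \<in> Ob ?P" for a
    using that cat_id[OF C] cat_id[OF D] by (cases a) auto
  show "Cmp ?P g f \<in> homs ?P a c" if "f \<in> homs ?P a b" "g \<in> homs ?P b c" for f g a b c
    using that cat_comp[OF C] cat_comp[OF D] by (cases f, cases g, cases a, cases b, cases c) auto
  show "Cmp ?P f (Idt ?P a) = f" "Cmp ?P (Idt ?P b) f = f" if "f \<in> homs ?P a b" for f a b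
    using that cat_id_left[OF C] cat_id_left[OF D] cat_id_right[OF C] cat_id_right[OF D]
    by (cases f, cases a, cases b, auto)+
  show "Cmp ?P h (Cmp ?P g f) = Cmp ?P (Cmp ?P h g) f"
    if "f \<in> homs ?P a b" "g \<in> homs ?P b c" "h \<in> homs ?P c d" for f g h a b c d
    using that cat_assoc[OF C] cat_assoc[OF D]
    by (cases f, cases g, cases h, cases a, cases b, cases c, cases d) auto
qed

lemma full_subcat_simps [simp]:
  "Ob (full_subcat C P) = {a \<in> Ob C. P a}" "Dom (full_subcat C P) = Dom C" "Cod (full_subcat C P) = Cod C"
  "Idt (full_subcat C P) = Idt C" "Cmp (full_subcat C P) = Cmp C"
  "Ar (full_subcat C P) = {f \<in> Ar C. P (Dom C f) \<and> P (Cod C f)}"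
  "f \<in> homs (full_subcat C P) a b \<longleftrightarrow> f \<in> homs C a b \<and> P a \<and> P b"
  by (auto simp: full_subcat_def homs_def)

lemma category_full_subcat: "category C \<Longrightarrow> category (full_subcat C P)"
  unfolding category_def by (simp add: homs_def)

section \<open>Adjunctions from universal arrows\<close>

lemma cat_simps:
  assumes "category C"
  shows "f \<in> Ar C \<Longrightarrow> Dom C f \<in> Ob C" "f \<in> Ar C \<Longrightarrow> Cod C f \<in> Ob C"
    "a \<in> Ob C \<Longrightarrow> Idt C a \<in> Ar C" "a \<in> Ob C \<Longrightarrow> Dom C (Idt C a) = a" "a \<in> Ob C \<Longrightarrow> Cod C (Idt C a) = a"
    "f \<in> Ar C \<Longrightarrow> g \<in> Ar C \<Longrightarrow> Cod C f = Dom C g \<Longrightarrow> Cmp C g f \<in> Ar C"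
    "f \<in> Ar C \<Longrightarrow> g \<in> Ar C \<Longrightarrow> Cod C f = Dom C g \<Longrightarrow> Dom C (Cmp C g f) = Dom C f"
    "f \<in> Ar C \<Longrightarrow> g \<in> Ar C \<Longrightarrow> Cod C f = Dom C g \<Longrightarrow> Cod C (Cmp C g f) = Cod C g"
    "f \<in> Ar C \<Longrightarrow> Dom C f = a \<Longrightarrow> Cmp C f (Idt C a) = f"
    "f \<in> Ar C \<Longrightarrow> Cod C f = a \<Longrightarrow> Cmp C (Idt C a) f = f"
    "f \<in> Ar C \<Longrightarrow> g \<in> Ar C \<Longrightarrow> h \<in> Ar C \<Longrightarrow> Cod C f = Dom C g \<Longrightarrow> Cod C g = Dom C h \<Longrightarrow>
     Cmp C (Cmp C h g) f = Cmp C h (Cmp C g f)"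
  using assms by (auto simp: category_def homs_def)

lemma functor_simps:
  assumes "is_functor C D F"
  shows "a \<in> Ob C \<Longrightarrow> omap F a \<in> Ob D" "f \<in> Ar C \<Longrightarrow> amap F f \<in> Ar D"
    "f \<in> Ar C \<Longrightarrow> Dom D (amap F f) = omap F (Dom C f)"
    "f \<in> Ar C \<Longrightarrow> Cod D (amap F f) = omap F (Cod C f)"
    "a \<in> Ob C \<Longrightarrow> amap F (Idt C a) = Idt D (omap F a)"
    "f \<in> Ar C \<Longrightarrow> g \<in> Ar C \<Longrightarrow> Cod C f = Dom C g \<Longrightarrow> amap F (Cmp C g f) = Cmp D (amap F g) (amap F f)"
  using assms by (auto simp: is_functor_def homs_def)

definition op_nt :: "('o, 'm, 'p, 'n) ntrans \<Rightarrow> ('o, 'm, 'p, 'n) ntrans" where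
  "op_nt \<tau> = \<lparr>nsrc = ntgt \<tau>, ntgt = nsrc \<tau>, ncomp = ncomp \<tau>\<rparr>"

lemma op_nt_hom:
  assumes "\<tau> \<in> homs (fun_cat C D) F G"
  shows "op_nt \<tau> \<in> homs (fun_cat (op_cat C) (op_cat D)) G F"
  using nt_homD[OF assms] by (intro nt_homI functor_op_cat) (auto simp: op_nt_def)

text \<open>Reversing arrows exchanges the two functors as well as unit and counit. Thus statements
  about right adjoints need no proof of their own.\<close>

lemma adjunction_op:
  assumes "adjunction C D F G \<eta> \<epsilon>"
  shows "adjunction (op_cat D) (op_cat C) G F (op_nt \<epsilon>) (op_nt \<eta>)"
proof -
  \<comment> \<open>Composite and identity functors depend on the category only through its sets of
    objects and arrows, which the opposite category keeps.\<close>
  have "comp_functor (op_cat X) H K = comp_functor X H K" "id_functor (op_cat X) = id_functor X"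
    for X :: "('x, 'y) cat" and H :: "('p', 'q', 'r', 's') ftor" and K
    by (simp_all add: comp_functor_def id_functor_def)
  note * = this
  show ?thesis
    using assms op_nt_hom[of \<eta>] op_nt_hom[of \<epsilon>] unfolding adjunction_def
    by (simp add: *) (simp add: op_nt_def functor_op_cat)
qed

lemma is_left_adjoint_op: "is_left_adjoint (op_cat C) (op_cat D) G \<longleftrightarrow> is_right_adjoint C D G"
  unfolding is_left_adjoint_def is_right_adjoint_def
  using adjunction_op[of D C _ G] adjunction_op[of "op_cat C" "op_cat D" G] by fastforce

text \<open>A terminal object of the comma category of \<open>F\<close> over
  \<open>d\<close>.\<close>

definition couniversal ::
  "('o, 'm) cat \<Rightarrow> ('p, 'n) cat \<Rightarrow> ('o, 'm, 'p, 'n) ftor \<Rightarrow> 'p \<Rightarrow> 'o \<Rightarrow> 'n \<Rightarrow> bool" where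
  "couniversal C D F d c e \<longleftrightarrow> c \<in> Ob C \<and> e \<in> homs D (omap F c) d \<and>
     (\<forall>c'\<in>Ob C. \<forall>u\<in>homs D (omap F c') d. \<exists>!t. t \<in> homs C c' c \<and> Cmp D e (amap F t) = u)"

text \<open>A choice of couniversal arrows is the object part of a right adjoint. Uniqueness of
  lifts forces its action on arrows, and gives functoriality, naturality of the unit and the second
  triangle identity; the first one is the definition of the unit.\<close>

lemma left_adjoint_of_couniversal:
  assumes F: "is_functor C D F" and cu: "\<And>d. d \<in> Ob D \<Longrightarrow> \<exists>c e. couniversal C D F d c e"
  shows "is_left_adjoint C D F"
proof -
  note C = functor_cat(1)[OF F] and D = functor_cat(2)[OF F]
  obtain g e where ge: "\<And>d. d \<in> Ob D \<Longrightarrow> couniversal C D F d (g d) (e d)"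
    using cu by metis
  have g: "g d \<in> Ob C" and e: "e d \<in> homs D (omap F (g d)) d" if "d \<in> Ob D" for d
    using ge[OF that] by (auto simp: couniversal_def)
  define lift where "lift d c u = (THE t. t \<in> homs C c (g d) \<and> Cmp D (e d) (amap F t) = u)" for d c u
  have ex1: "\<exists>!t. t \<in> homs C c (g d) \<and> Cmp D (e d) (amap F t) = u"
    if "d \<in> Ob D" "c \<in> Ob C" "u \<in> homs D (omap F c) d" for d c u
    using ge[OF that(1)] that(2,3) by (auto simp: couniversal_def)
  have lift: "lift d c u \<in> homs C c (g d)" "Cmp D (e d) (amap F (lift d c u)) = u"
    if "d \<in> Ob D" "c \<in> Ob C" "u \<in> homs D (omap F c) d" for d c u
    using theI'[OF ex1[OF that]] by (auto simp: lift_def)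
  \<comment> \<open>Every equation between arrows into \<open>g d\<close> is checked below by
    applying \<open>F\<close> and composing with \<open>e d\<close>.\<close>
  have uniq: "t = t'" if "d \<in> Ob D" "t \<in> homs C c (g d)" "t' \<in> homs C c (g d)"
    "Cmp D (e d) (amap F t) = Cmp D (e d) (amap F t')" for d c t t'
  proof -
    have "c \<in> Ob C" using cat_hom_ob[OF C that(2)] by simp
    moreover have "Cmp D (e d) (amap F t) \<in> homs D (omap F c) d"
      using cat_comp[OF D functor_hom[OF F that(2)] e[OF that(1)]] .
    ultimately show ?thesis
      using ex1[OF that(1)] that(2-4) by metis
  qed
  define G where "G = \<lparr>omap = (\<lambda>d\<in>Ob D. g d),
    amap = (\<lambda>h\<in>Ar D. lift (Cod D h) (g (Dom D h)) (Cmp D h (e (Dom D h))))\<rparr>"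
  have G_ob: "omap G d = g d" if "d \<in> Ob D" for d
    using that by (simp add: G_def)
  have G_hom: "amap G h \<in> homs C (g d) (g d')" and G_eq: "Cmp D (e d') (amap F (amap G h)) = Cmp D h (e d)"
    if h: "h \<in> homs D d d'" for h d d'
    using lift[OF cat_hom_ob(2)[OF D h] g[OF cat_hom_ob(1)[OF D h]] cat_comp[OF D e[OF cat_hom_ob(1)[OF D h]] h]]
      homsD[OF h] by (simp_all add: G_def)
  have G: "is_functor D C G"
  proof (rule functorI[OF D C])
    show "omap G \<in> extensional (Ob D)" "amap G \<in> extensional (Ar D)"
      by (simp_all add: G_def)
    show "omap G d \<in> Ob C" if "d \<in> Ob D" for d
      using that g by (simp add: G_ob)
    show "amap G h \<in> homs C (omap G d) (omap G d')" if "h \<in> homs D d d'" for h d d'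
      using G_hom[OF that] cat_hom_ob[OF D that] by (simp add: G_ob)
    show "amap G (Idt D d) = Idt C (omap G d)" if d: "d \<in> Ob D" for d
    proof (rule uniq[OF d])
      note i = cat_id[OF D d]
      show "amap G (Idt D d) \<in> homs C (g d) (g d)" by (rule G_hom[OF i])
      show "Idt C (omap G d) \<in> homs C (g d) (g d)"
        using cat_id[OF C g[OF d]] by (simp add: G_ob d)
      show "Cmp D (e d) (amap F (amap G (Idt D d))) = Cmp D (e d) (amap F (Idt C (omap G d)))"
        unfolding G_eq[OF i] G_ob[OF d] functor_id[OF F g[OF d]]
        using cat_id_left[OF D e[OF d]] cat_id_right[OF D e[OF d]] by simp
    qed
    show "amap G (Cmp D h' h) = Cmp C (amap G h') (amap G h)"
      if h: "h \<in> homs D d d'" and h': "h' \<in> homs D d' d''" for h h' d d' d''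
    proof (rule uniq)
      note hh = cat_comp[OF D h h']
      show d'': "d'' \<in> Ob D" using cat_hom_ob[OF D h'] by simp
      show "amap G (Cmp D h' h) \<in> homs C (g d) (g d'')" by (rule G_hom[OF hh])
      show "Cmp C (amap G h') (amap G h) \<in> homs C (g d) (g d'')"
        by (rule cat_comp[OF C G_hom[OF h] G_hom[OF h']])
      have "Cmp D (e d'') (Cmp D (amap F (amap G h')) (amap F (amap G h)))
          = Cmp D (Cmp D h' (e d')) (amap F (amap G h))"
        using cat_assoc[OF D functor_hom[OF F G_hom[OF h]] functor_hom[OF F G_hom[OF h']] e[OF d'']]
          G_eq[OF h'] by simp
      also have "\<dots> = Cmp D h' (Cmp D h (e d))"
        using cat_assoc[OF D functor_hom[OF F G_hom[OF h]] e[OF cat_hom_ob(1)[OF D h']] h']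
          G_eq[OF h] by simp
      finally show "Cmp D (e d'') (amap F (amap G (Cmp D h' h)))
          = Cmp D (e d'') (amap F (Cmp C (amap G h') (amap G h)))"
        unfolding G_eq[OF hh] functor_comp[OF F G_hom[OF h] G_hom[OF h']]
        using cat_assoc[OF D e[OF cat_hom_ob(1)[OF D h]] h h'] by simp
    qed
  qed
  define \<eta> where "\<eta> = \<lparr>nsrc = id_functor C, ntgt = comp_functor C G F,
    ncomp = (\<lambda>c\<in>Ob C. lift (omap F c) c (Idt D (omap F c)))\<rparr>"
  define \<epsilon> where "\<epsilon> = \<lparr>nsrc = comp_functor D F G, ntgt = id_functor D, ncomp = (\<lambda>d\<in>Ob D. e d)\<rparr>"
  have \<eta>: "ncomp \<eta> c \<in> homs C c (g (omap F c))"
    and \<eta>_eq: "Cmp D (e (omap F c)) (amap F (ncomp \<eta> c)) = Idt D (omap F c)" if c: "c \<in> Ob C" for c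
    using lift[OF functor_ob[OF F c] c cat_id[OF D functor_ob[OF F c]]] c by (simp_all add: \<eta>_def)
  have "\<eta> \<in> homs (fun_cat C C) (id_functor C) (comp_functor C G F)"
  proof (rule nt_homI[OF functor_id_functor[OF C] functor_comp_functor[OF F G]])
    show "ncomp \<eta> c \<in> homs C (omap (id_functor C) c) (omap (comp_functor C G F) c)" if "c \<in> Ob C" for c
      using \<eta>[OF that] that functor_ob[OF F that] by (simp add: id_functor_simps comp_functor_simps G_ob)
    show "Cmp C (ncomp \<eta> b) (amap (id_functor C) f) = Cmp C (amap (comp_functor C G F) f) (ncomp \<eta> a)"
      if f: "f \<in> homs C a b" for f a b
    proof -
      note ob = cat_hom_ob[OF C f] and Ff = functor_hom[OF F f]
      note Fob = functor_ob[OF F ob(1)] functor_ob[OF F ob(2)]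
      note GFf = G_hom[OF Ff]
      have "Cmp C (ncomp \<eta> b) f = Cmp C (amap G (amap F f)) (ncomp \<eta> a)"
      proof (rule uniq[OF Fob(2)])
        show "Cmp C (ncomp \<eta> b) f \<in> homs C a (g (omap F b))" by (rule cat_comp[OF C f \<eta>[OF ob(2)]])
        show "Cmp C (amap G (amap F f)) (ncomp \<eta> a) \<in> homs C a (g (omap F b))"
          by (rule cat_comp[OF C \<eta>[OF ob(1)] GFf])
        have "Cmp D (e (omap F b)) (Cmp D (amap F (ncomp \<eta> b)) (amap F f)) = amap F f"
          using cat_assoc[OF D Ff functor_hom[OF F \<eta>[OF ob(2)]] e[OF Fob(2)]] \<eta>_eq[OF ob(2)]
            cat_id_left[OF D Ff] by simp
        moreover have "Cmp D (e (omap F b)) (Cmp D (amap F (amap G (amap F f))) (amap F (ncomp \<eta> a))) = amap F f"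
          using cat_assoc[OF D functor_hom[OF F \<eta>[OF ob(1)]] functor_hom[OF F GFf] e[OF Fob(2)]]
            cat_assoc[OF D functor_hom[OF F \<eta>[OF ob(1)]] e[OF Fob(1)] Ff]
            G_eq[OF Ff] \<eta>_eq[OF ob(1)] cat_id_right[OF D Ff] by simp
        ultimately show "Cmp D (e (omap F b)) (amap F (Cmp C (ncomp \<eta> b) f))
            = Cmp D (e (omap F b)) (amap F (Cmp C (amap G (amap F f)) (ncomp \<eta> a)))"
          using functor_comp[OF F f \<eta>[OF ob(2)]] functor_comp[OF F \<eta>[OF ob(1)] GFf] by simp
      qed
      then show ?thesis
        using homsD(1)[OF f] by (simp add: id_functor_simps comp_functor_simps)
    qed
  qed (simp_all add: \<eta>_def)
  moreover have "\<epsilon> \<in> homs (fun_cat D D) (comp_functor D F G) (id_functor D)"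
  proof (rule nt_homI[OF functor_comp_functor[OF G F] functor_id_functor[OF D]])
    show "ncomp \<epsilon> d \<in> homs D (omap (comp_functor D F G) d) (omap (id_functor D) d)" if "d \<in> Ob D" for d
      using e[OF that] that by (simp add: id_functor_simps comp_functor_simps G_ob \<epsilon>_def)
    show "Cmp D (ncomp \<epsilon> b) (amap (comp_functor D F G) f) = Cmp D (amap (id_functor D) f) (ncomp \<epsilon> a)"
      if "f \<in> homs D a b" for f a b
      using G_eq[OF that] homsD(1)[OF that] cat_hom_ob[OF D that]
      by (simp add: id_functor_simps comp_functor_simps \<epsilon>_def)
  qed (simp_all add: \<epsilon>_def)
  moreover have "Cmp D (ncomp \<epsilon> (omap F x)) (amap F (ncomp \<eta> x)) = Idt D (omap F x)" if "x \<in> Ob C" for x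
    using \<eta>_eq[OF that] functor_ob[OF F that] by (simp add: \<epsilon>_def)
  moreover have "Cmp C (amap G (ncomp \<epsilon> y)) (ncomp \<eta> (omap G y)) = Idt C (omap G y)" if y: "y \<in> Ob D" for y
  proof -
    note gy = g[OF y] and ey = e[OF y]
    note Fgy = functor_ob[OF F gy] and Gey = G_hom[OF e[OF y]]
    have "Cmp C (amap G (e y)) (ncomp \<eta> (g y)) = Idt C (g y)"
    proof (rule uniq[OF y])
      show "Cmp C (amap G (e y)) (ncomp \<eta> (g y)) \<in> homs C (g y) (g y)"
        by (rule cat_comp[OF C \<eta>[OF gy] Gey])
      show "Idt C (g y) \<in> homs C (g y) (g y)" by (rule cat_id[OF C gy])
      show "Cmp D (e y) (amap F (Cmp C (amap G (e y)) (ncomp \<eta> (g y)))) = Cmp D (e y) (amap F (Idt C (g y)))"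
        using functor_comp[OF F \<eta>[OF gy] Gey] functor_id[OF F gy] G_eq[OF ey] \<eta>_eq[OF gy]
          cat_assoc[OF D functor_hom[OF F \<eta>[OF gy]] functor_hom[OF F Gey] ey]
          cat_assoc[OF D functor_hom[OF F \<eta>[OF gy]] e[OF Fgy] ey] by simp
    qed
    then show ?thesis
      using y by (simp add: \<epsilon>_def G_ob)
  qed
  ultimately show ?thesis
    unfolding is_left_adjoint_def adjunction_def using F G by blast
qed

text \<open>The components of the counit are couniversal: \<open>u\<close> lifts to
  \<open>G u\<close> after the unit. One triangle identity shows that this is a lift, the other that
  it is the only one.\<close>

lemma couniversal_of_left_adjoint:
  assumes "is_left_adjoint C D F" and d: "d \<in> Ob D"
  shows "\<exists>c e. couniversal C D F d c e"
proof -
  obtain G \<eta> \<epsilon> where adj: "adjunction C D F G \<eta> \<epsilon>"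
    using assms(1) by (auto simp: is_left_adjoint_def)
  then have F: "is_functor C D F" and G: "is_functor D C G"
    and \<eta>: "\<eta> \<in> homs (fun_cat C C) (id_functor C) (comp_functor C G F)"
    and \<epsilon>: "\<epsilon> \<in> homs (fun_cat D D) (comp_functor D F G) (id_functor D)"
    and tri1: "\<And>x. x \<in> Ob C \<Longrightarrow> Cmp D (ncomp \<epsilon> (omap F x)) (amap F (ncomp \<eta> x)) = Idt D (omap F x)"
    and tri2: "\<And>y. y \<in> Ob D \<Longrightarrow> Cmp C (amap G (ncomp \<epsilon> y)) (ncomp \<eta> (omap G y)) = Idt C (omap G y)"
    by (auto simp: adjunction_def)
  note C = functor_cat(1)[OF F] and D = functor_cat(2)[OF F]
  have \<eta>h: "ncomp \<eta> c \<in> homs C c (omap G (omap F c))" if "c \<in> Ob C" for c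
    using nt_homD(4)[OF \<eta> that] that by (simp add: id_functor_simps comp_functor_simps)
  have \<epsilon>h: "ncomp \<epsilon> c \<in> homs D (omap F (omap G c)) c" if "c \<in> Ob D" for c
    using nt_homD(4)[OF \<epsilon> that] that by (simp add: id_functor_simps comp_functor_simps)
  have \<eta>n: "Cmp C (ncomp \<eta> b) f = Cmp C (amap G (amap F f)) (ncomp \<eta> a)" if "f \<in> homs C a b" for f a b
    using nt_homD(5)[OF \<eta> that] homsD(1)[OF that] by (simp add: id_functor_simps comp_functor_simps)
  have \<epsilon>n: "Cmp D (ncomp \<epsilon> b) (amap F (amap G f)) = Cmp D f (ncomp \<epsilon> a)" if "f \<in> homs D a b" for f a b
    using nt_homD(5)[OF \<epsilon> that] homsD(1)[OF that] by (simp add: id_functor_simps comp_functor_simps)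
  have Gd: "omap G d \<in> Ob C" by (rule functor_ob[OF G d])
  have "\<exists>!t. t \<in> homs C c (omap G d) \<and> Cmp D (ncomp \<epsilon> d) (amap F t) = u"
    if c: "c \<in> Ob C" and u: "u \<in> homs D (omap F c) d" for c u
  proof (intro ex1I[of _ "Cmp C (amap G u) (ncomp \<eta> c)"] conjI)
    note Gu = functor_hom[OF G u]
    show "Cmp C (amap G u) (ncomp \<eta> c) \<in> homs C c (omap G d)"
      by (rule cat_comp[OF C \<eta>h[OF c] Gu])
    show "Cmp D (ncomp \<epsilon> d) (amap F (Cmp C (amap G u) (ncomp \<eta> c))) = u"
      using functor_comp[OF F \<eta>h[OF c] Gu] \<epsilon>n[OF u] tri1[OF c] cat_id_right[OF D u]
        cat_assoc[OF D functor_hom[OF F \<eta>h[OF c]] functor_hom[OF F Gu] \<epsilon>h[OF d]]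
        cat_assoc[OF D functor_hom[OF F \<eta>h[OF c]] \<epsilon>h[OF functor_ob[OF F c]] u] by simp
    show "t = Cmp C (amap G u) (ncomp \<eta> c)"
      if t: "t \<in> homs C c (omap G d) \<and> Cmp D (ncomp \<epsilon> d) (amap F t) = u" for t
    proof -
      have th: "t \<in> homs C c (omap G d)" using t by simp
      have "amap G u = Cmp C (amap G (ncomp \<epsilon> d)) (amap G (amap F t))"
        using t functor_comp[OF G functor_hom[OF F th] \<epsilon>h[OF d]] by simp
      then show ?thesis
        using cat_assoc[OF C \<eta>h[OF c] functor_hom[OF G functor_hom[OF F th]] functor_hom[OF G \<epsilon>h[OF d]]]
          \<eta>n[OF th] cat_assoc[OF C th \<eta>h[OF Gd] functor_hom[OF G \<epsilon>h[OF d]]] tri2[OF d]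
          cat_id_left[OF C th] by simp
    qed
  qed
  then have "couniversal C D F d (omap G d) (ncomp \<epsilon> d)"
    using Gd \<epsilon>h[OF d] by (auto simp: couniversal_def)
  then show ?thesis by blast
qed


section \<open>Slices\<close>

lemma slice_cat_simps [simp]:
  "Ob (slice_cat C x) = {f \<in> Ar C. Cod C f = x}"
  "Dom (slice_cat C x) (f, g, h) = f" "Cod (slice_cat C x) (f, g, h) = g"
  "Idt (slice_cat C x) f = (f, f, Idt C (Dom C f))"
  "Cmp (slice_cat C x) (g, k, h') (f, g', h) = (f, k, Cmp C h' h)"
  by (simp_all add: slice_cat_def)

lemma slice_ar_iff [simp]:
  "(f, g, h) \<in> Ar (slice_cat C x) \<longleftrightarrow> f \<in> Ar C \<and> Cod C f = x \<and> g \<in> Ar C \<and> Cod C g = x \<and>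
     h \<in> homs C (Dom C f) (Dom C g) \<and> Cmp C g h = f"
  by (simp add: slice_cat_def)

lemma slice_hom_iff:
  "t \<in> homs (slice_cat C x) f g \<longleftrightarrow>
   (\<exists>h. t = (f, g, h) \<and> f \<in> Ar C \<and> Cod C f = x \<and> g \<in> Ar C \<and> Cod C g = x \<and>
      h \<in> homs C (Dom C f) (Dom C g) \<and> Cmp C g h = f)"
  by (auto simp: homs_def slice_cat_def)

lemma slice_hom_triple:
  "(f', g', h) \<in> homs (slice_cat C x) f g \<longleftrightarrow>
   f' = f \<and> g' = g \<and> f \<in> homs C (Dom C f) x \<and> g \<in> homs C (Dom C g) x \<and>
      h \<in> homs C (Dom C f) (Dom C g) \<and> Cmp C g h = f"
  by (auto simp: slice_hom_iff homs_def)

lemma category_slice_cat: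
  assumes C: "category C"
  shows "category (slice_cat C x)"
proof (rule categoryI)
  let ?S = "slice_cat C x"
  show "Dom ?S f \<in> Ob ?S" "Cod ?S f \<in> Ob ?S" if "f \<in> Ar ?S" for f
    using that by (auto simp: slice_cat_def)
  show "Idt ?S a \<in> homs ?S a a" if "a \<in> Ob ?S" for a
    using that by (auto simp: slice_hom_iff homs_def cat_simps[OF C])
  show "Cmp ?S g f \<in> homs ?S a c" if fg: "f \<in> homs ?S a b" "g \<in> homs ?S b c" for f g a b c
  proof -
    obtain h k where hk: "f = (a, b, h)" "g = (b, c, k)" "a \<in> homs C (Dom C a) x" "c \<in> homs C (Dom C c) x"
      "h \<in> homs C (Dom C a) (Dom C b)" "k \<in> homs C (Dom C b) (Dom C c)" "Cmp C b h = a" "Cmp C c k = b"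
      using fg unfolding slice_hom_iff by (auto simp: homs_def)
    have "Cmp C c (Cmp C k h) = a"
      using cat_assoc[OF C hk(5,6,4)] hk(7,8) by simp
    then show ?thesis
      using cat_comp[OF C hk(5,6)] hk(3,4) by (simp add: hk(1,2) slice_hom_triple)
  qed
  show "Cmp ?S f (Idt ?S a) = f" "Cmp ?S (Idt ?S b) f = f" if fh: "f \<in> homs ?S a b" for f a b
  proof -
    obtain h where h: "f = (a, b, h)" "h \<in> homs C (Dom C a) (Dom C b)"
      using fh unfolding slice_hom_iff by blast
    show "Cmp ?S f (Idt ?S a) = f" "Cmp ?S (Idt ?S b) f = f"
      using cat_id_left[OF C h(2)] cat_id_right[OF C h(2)] by (simp_all add: h(1))
  qed
  show "Cmp ?S h (Cmp ?S g f) = Cmp ?S (Cmp ?S h g) f"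
    if fgh: "f \<in> homs ?S a b" "g \<in> homs ?S b c" "h \<in> homs ?S c d" for f g h a b c d
  proof -
    obtain f' g' h' where "f = (a, b, f')" "f' \<in> homs C (Dom C a) (Dom C b)"
      "g = (b, c, g')" "g' \<in> homs C (Dom C b) (Dom C c)" "h = (c, d, h')" "h' \<in> homs C (Dom C c) (Dom C d)"
      using fgh unfolding slice_hom_iff by blast
    then show ?thesis
      using cat_assoc[OF C] by simp
  qed
qed

lemma slice_functor_simps:
  "f \<in> homs C a x \<Longrightarrow> omap (slice_functor C T x) f = amap T f"
  "(f, g, h) \<in> Ar (slice_cat C x) \<Longrightarrow> amap (slice_functor C T x) (f, g, h) = (amap T f, amap T g, amap T h)"
  by (auto simp: slice_functor_def homs_def)

lemma functor_slice_functor: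
  assumes T: "is_functor C D T"
  shows "is_functor (slice_cat C x) (slice_cat D (omap T x)) (slice_functor C T x)"
proof (rule functorI)
  note C = functor_cat(1)[OF T] and D = functor_cat(2)[OF T]
  let ?S = "slice_cat C x" and ?R = "slice_cat D (omap T x)" and ?F = "slice_functor C T x"
  show "category ?S" "category ?R"
    by (simp_all add: category_slice_cat C D)
  show "omap ?F \<in> extensional (Ob ?S)" "amap ?F \<in> extensional (Ar ?S)"
    by (simp_all add: slice_functor_def)
  show "omap ?F a \<in> Ob ?R" if "a \<in> Ob ?S" for a
    using that by (auto simp: slice_functor_def functor_simps[OF T])
  show "amap ?F f \<in> homs ?R (omap ?F a) (omap ?F b)" if fh: "f \<in> homs ?S a b" for f a b
  proof -
    obtain h where f: "f = (a, b, h)" using fh by (auto simp: slice_hom_iff)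
    show ?thesis
      using fh homsD(1)[OF fh] unfolding f
      by (auto simp: slice_functor_simps slice_hom_triple functor_simps[OF T] functor_hom[OF T]
          simp flip: functor_comp[OF T])
  qed
  show "amap ?F (Idt ?S a) = Idt ?R (omap ?F a)" if "a \<in> Ob ?S" for a
    using that by (auto simp: slice_functor_def functor_simps[OF T] cat_simps[OF C] slice_cat_def homs_def)
  show "amap ?F (Cmp ?S g f) = Cmp ?R (amap ?F g) (amap ?F f)"
    if fg: "f \<in> homs ?S a b" "g \<in> homs ?S b c" for f g a b c
  proof -
    obtain h k where f: "f = (a, b, h)" and g: "g = (b, c, k)" using fg by (auto simp: slice_hom_iff)
    have "Cmp ?S g f \<in> Ar ?S"
      using homsD(1)[OF cat_comp[OF category_slice_cat[OF C] fg]] .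
    then show ?thesis
      using homsD(1)[OF fg(1)] homsD(1)[OF fg(2)] fg unfolding f g
      by (auto simp: slice_functor_simps slice_hom_triple functor_comp[OF T])
  qed
qed

text \<open>Existence of couniversal arrows for the slice functor at \<open>x\<close>, with each
  triple of the slice replaced by its underlying arrow and a commuting triangle. All later work on
  slices uses this form and never touches triples.\<close>

definition slice_couniversal ::
  "('o, 'm) cat \<Rightarrow> ('p, 'n) cat \<Rightarrow> ('o, 'm, 'p, 'n) ftor \<Rightarrow> 'o \<Rightarrow> bool" where
  "slice_couniversal C D T x \<longleftrightarrow>
    (\<forall>K. \<forall>k\<in>homs D K (omap T x). \<exists>W. \<exists>w\<in>homs C W x. \<exists>e\<in>homs D (omap T W) K. Cmp D k e = amap T w \<and>
      (\<forall>V. \<forall>v\<in>homs C V x. \<forall>u\<in>homs D (omap T V) K. Cmp D k u = amap T v \<longrightarrow>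
        (\<exists>!t. t \<in> homs C V W \<and> Cmp C w t = v \<and> Cmp D e (amap T t) = u)))"

text \<open>The dual of \<open>slice_couniversal\<close>: universal arrows from \<open>k\<close> to
  the slice functor, that is, the data of a left adjoint of it.\<close>

definition slice_universal ::
  "('o, 'm) cat \<Rightarrow> ('p, 'n) cat \<Rightarrow> ('o, 'm, 'p, 'n) ftor \<Rightarrow> 'o \<Rightarrow> bool" where
  "slice_universal C D T x \<longleftrightarrow>
    (\<forall>K. \<forall>k\<in>homs D K (omap T x). \<exists>W. \<exists>w\<in>homs C W x. \<exists>e\<in>homs D K (omap T W). Cmp D (amap T w) e = k \<and>
      (\<forall>V. \<forall>v\<in>homs C V x. \<forall>u\<in>homs D K (omap T V). Cmp D (amap T v) u = k \<longrightarrow>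
        (\<exists>!t. t \<in> homs C W V \<and> Cmp C v t = w \<and> Cmp D (amap T t) e = u)))"

text \<open>An arrow of the slice between given objects is determined by its underlying arrow, so
  quantifying over triples and over arrows that commute with the projections is the same.\<close>

lemma slice_left_adjoint_iff:
  assumes T: "is_functor C D T"
  shows "is_left_adjoint (slice_cat C x) (slice_cat D (omap T x)) (slice_functor C T x)
    \<longleftrightarrow> slice_couniversal C D T x"
proof -
  note C = functor_cat(1)[OF T] and D = functor_cat(2)[OF T]
  let ?S = "slice_cat C x" and ?R = "slice_cat D (omap T x)" and ?F = "slice_functor C T x"
  have ar: "(v, w, t) \<in> homs ?S v w \<longleftrightarrow> t \<in> homs C V W \<and> Cmp C w t = v"
    if "v \<in> homs C V x" "w \<in> homs C W x" for v w t V W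
    using that by (auto simp: slice_hom_triple homs_def)
  have ar': "(v, w, t) \<in> homs ?R v w \<longleftrightarrow> t \<in> homs D V W \<and> Cmp D w t = v"
    if "v \<in> homs D V (omap T x)" "w \<in> homs D W (omap T x)" for v w t V W
    using that by (auto simp: slice_hom_triple homs_def)
  have cmp: "Cmp ?R (amap T w, k, e) (amap ?F (v, w, t)) = (amap T v, k, Cmp D e (amap T t))"
    if "v \<in> homs C V x" "w \<in> homs C W x" "t \<in> homs C V W" "Cmp C w t = v" for v w k e t V W
    using homsD(1)[of "(v, w, t)" ?S v w] ar[OF that(1,2), of t] that by (simp add: slice_functor_simps)
  \<comment> \<open>The translation for one candidate \<open>w\<close> with structure arrow
    \<open>e\<close>; the quantifiers over candidates are handled afterwards.\<close>
  have main: "couniversal ?S ?R ?F k w (amap T w, k, e) \<longleftrightarrow> Cmp D k e = amap T w \<and>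
      (\<forall>V. \<forall>v\<in>homs C V x. \<forall>u\<in>homs D (omap T V) K. Cmp D k u = amap T v \<longrightarrow>
        (\<exists>!t. t \<in> homs C V W \<and> Cmp C w t = v \<and> Cmp D e (amap T t) = u))" (is "_ \<longleftrightarrow> _ \<and> ?U")
    if k: "k \<in> homs D K (omap T x)" and w: "w \<in> homs C W x" and e: "e \<in> homs D (omap T W) K"
    for k K w W e
  proof -
    have Fw: "omap ?F w = amap T w" using w by (rule slice_functor_simps)
    note Tw = functor_hom[OF T w]
    have "(\<exists>!t. t \<in> homs ?S v w \<and> Cmp ?R (amap T w, k, e) (amap ?F t) = (amap T v, k, u))
        \<longleftrightarrow> (\<exists>!t. t \<in> homs C V W \<and> Cmp C w t = v \<and> Cmp D e (amap T t) = u)"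
      if v: "v \<in> homs C V x" for v u V
    proof -
      have *: "t \<in> homs ?S v w \<and> Cmp ?R (amap T w, k, e) (amap ?F t) = (amap T v, k, u) \<longleftrightarrow>
          (\<exists>h. t = (v, w, h) \<and> h \<in> homs C V W \<and> Cmp C w h = v \<and> Cmp D e (amap T h) = u)" for t
        using ar[OF v w] cmp[OF v w] by (cases t) (auto simp: slice_hom_iff)
      show ?thesis unfolding * by blast
    qed
    note ex = this
    have "(\<forall>v\<in>Ob ?S. \<forall>u\<in>homs ?R (omap ?F v) k. \<exists>!t. t \<in> homs ?S v w \<and> Cmp ?R (amap T w, k, e) (amap ?F t) = u) \<longleftrightarrow> ?U"
    proof (intro iffI ballI allI impI)
      fix V v u
      assume all: "\<forall>v\<in>Ob ?S. \<forall>u\<in>homs ?R (omap ?F v) k. \<exists>!t. t \<in> homs ?S v w \<and> Cmp ?R (amap T w, k, e) (amap ?F t) = u"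
        and v: "v \<in> homs C V x" and u: "u \<in> homs D (omap T V) K" "Cmp D k u = amap T v"
      have "(amap T v, k, u) \<in> homs ?R (omap ?F v) k"
        using ar'[OF functor_hom[OF T v] k, of u] u v by (simp add: slice_functor_simps)
      moreover have "v \<in> Ob ?S"
        using v by (simp add: homs_def)
      ultimately have "\<exists>!t. t \<in> homs ?S v w \<and> Cmp ?R (amap T w, k, e) (amap ?F t) = (amap T v, k, u)"
        using all by blast
      then show "\<exists>!t. t \<in> homs C V W \<and> Cmp C w t = v \<and> Cmp D e (amap T t) = u"
        by (simp only: ex[OF v])
    next
      fix v u
      assume U: ?U and v: "v \<in> Ob ?S" and u: "u \<in> homs ?R (omap ?F v) k"
      have vh: "v \<in> homs C (Dom C v) x" using v by (auto simp: homs_def)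
      obtain u' where u': "u = (amap T v, k, u')" using u slice_functor_simps(1)[OF vh] by (auto simp: slice_hom_iff)
      have "u' \<in> homs D (omap T (Dom C v)) K" "Cmp D k u' = amap T v"
        using u ar'[OF functor_hom[OF T vh] k, of u'] slice_functor_simps(1)[OF vh, of T] by (simp_all add: u')
      then show "\<exists>!t. t \<in> homs ?S v w \<and> Cmp ?R (amap T w, k, e) (amap ?F t) = u"
        unfolding u' ex[OF vh] using U vh by blast
    qed
    note lift = this
    have wS: "w \<in> Ob ?S" using w by (simp add: homs_def)
    have Eh: "(amap T w, k, e) \<in> homs ?R (omap ?F w) k \<longleftrightarrow> Cmp D k e = amap T w"
      unfolding Fw using ar'[OF Tw k, of e] e by simp
    show ?thesis
    proof
      assume "couniversal ?S ?R ?F k w (amap T w, k, e)"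
      note c = this[unfolded couniversal_def]
      show "Cmp D k e = amap T w \<and> ?U"
        by (intro conjI iffD1[OF Eh] iffD1[OF lift] conjunct1[OF conjunct2[OF c]] conjunct2[OF conjunct2[OF c]])
    next
      assume c: "Cmp D k e = amap T w \<and> ?U"
      show "couniversal ?S ?R ?F k w (amap T w, k, e)"
        unfolding couniversal_def
        by (intro conjI iffD2[OF Eh] iffD2[OF lift] conjunct1[OF c] conjunct2[OF c] wS)
    qed
  qed
  have "is_left_adjoint ?S ?R ?F \<longleftrightarrow> (\<forall>k\<in>Ob ?R. \<exists>w E. couniversal ?S ?R ?F k w E)"
    by (intro iffI ballI left_adjoint_of_couniversal[OF functor_slice_functor[OF T]])
       (erule couniversal_of_left_adjoint, assumption, erule bspec, assumption)
  also have "\<dots> \<longleftrightarrow> slice_couniversal C D T x"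
    unfolding slice_couniversal_def
  proof (intro iffI allI ballI)
    fix K k assume all: "\<forall>k\<in>Ob ?R. \<exists>w E. couniversal ?S ?R ?F k w E" and k: "k \<in> homs D K (omap T x)"
    have "k \<in> Ob ?R" using k by (auto simp: homs_def)
    then obtain w E where wE: "couniversal ?S ?R ?F k w E" using all by blast
    then have w: "w \<in> homs C (Dom C w) x" by (auto simp: couniversal_def homs_def)
    obtain e where E: "E = (amap T w, k, e)"
      using wE slice_functor_simps(1)[OF w, of T] by (auto simp: couniversal_def slice_hom_iff)
    have e: "e \<in> homs D (omap T (Dom C w)) K"
      using wE ar'[OF functor_hom[OF T w] k, of e] slice_functor_simps(1)[OF w, of T]
      by (simp add: E couniversal_def)
    show "\<exists>W. \<exists>w\<in>homs C W x. \<exists>e\<in>homs D (omap T W) K. Cmp D k e = amap T w \<and>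
      (\<forall>V. \<forall>v\<in>homs C V x. \<forall>u\<in>homs D (omap T V) K. Cmp D k u = amap T v \<longrightarrow>
        (\<exists>!t. t \<in> homs C V W \<and> Cmp C w t = v \<and> Cmp D e (amap T t) = u))"
      by (rule exI, rule bexI[OF _ w], rule bexI[OF _ e], rule main[OF k w e, THEN iffD1]) (use wE E in simp)
  next
    fix k assume all: "\<forall>K. \<forall>k\<in>homs D K (omap T x). \<exists>W. \<exists>w\<in>homs C W x. \<exists>e\<in>homs D (omap T W) K. Cmp D k e = amap T w \<and>
      (\<forall>V. \<forall>v\<in>homs C V x. \<forall>u\<in>homs D (omap T V) K. Cmp D k u = amap T v \<longrightarrow>
        (\<exists>!t. t \<in> homs C V W \<and> Cmp C w t = v \<and> Cmp D e (amap T t) = u))"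
      and "k \<in> Ob ?R"
    then have k: "k \<in> homs D (Dom D k) (omap T x)" by (auto simp: homs_def)
    obtain W w e where w: "w \<in> homs C W x" and e: "e \<in> homs D (omap T W) (Dom D k)"
      and c: "Cmp D k e = amap T w \<and>
      (\<forall>V. \<forall>v\<in>homs C V x. \<forall>u\<in>homs D (omap T V) (Dom D k). Cmp D k u = amap T v \<longrightarrow>
        (\<exists>!t. t \<in> homs C V W \<and> Cmp C w t = v \<and> Cmp D e (amap T t) = u))"
      using all[THEN spec, THEN bspec, OF k] by (elim exE bexE) (rule that)
    have "couniversal ?S ?R ?F k w (amap T w, k, e)"
      by (rule main[OF k w e, THEN iffD2, OF c])
    then show "\<exists>w E. couniversal ?S ?R ?F k w E" by blast
  qed
  finally show ?thesis .
qed

text \<open>The argument for left adjoints, carried out in the opposite categories: a left adjoint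
  of the slice functor amounts to couniversal arrows for the functor between the opposites.\<close>

lemma slice_right_adjoint_iff:
  assumes T: "is_functor C D T"
  shows "is_right_adjoint (slice_cat C x) (slice_cat D (omap T x)) (slice_functor C T x)
    \<longleftrightarrow> slice_universal C D T x"
proof -
  note C = functor_cat(1)[OF T] and D = functor_cat(2)[OF T]
  let ?S = "slice_cat C x" and ?R = "slice_cat D (omap T x)" and ?F = "slice_functor C T x"
  have ar: "(v, w, t) \<in> homs ?S v w \<longleftrightarrow> t \<in> homs C V W \<and> Cmp C w t = v"
    if "v \<in> homs C V x" "w \<in> homs C W x" for v w t V W
    using that by (auto simp: slice_hom_triple homs_def)
  have ar': "(v, w, t) \<in> homs ?R v w \<longleftrightarrow> t \<in> homs D V W \<and> Cmp D w t = v"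
    if "v \<in> homs D V (omap T x)" "w \<in> homs D W (omap T x)" for v w t V W
    using that by (auto simp: slice_hom_triple homs_def)
  have cmp: "Cmp ?R (amap ?F (w, v, t)) (k, amap T w, e) = (k, amap T v, Cmp D (amap T t) e)"
    if "v \<in> homs C V x" "w \<in> homs C W x" "t \<in> homs C W V" "Cmp C v t = w" for v w k e t V W
    using homsD(1)[of "(w, v, t)" ?S w v] ar[OF that(2,1), of t] that by (simp add: slice_functor_simps)
  have main: "couniversal (op_cat ?S) (op_cat ?R) ?F k w (k, amap T w, e) \<longleftrightarrow> Cmp D (amap T w) e = k \<and>
      (\<forall>V. \<forall>v\<in>homs C V x. \<forall>u\<in>homs D K (omap T V). Cmp D (amap T v) u = k \<longrightarrow>
        (\<exists>!t. t \<in> homs C W V \<and> Cmp C v t = w \<and> Cmp D (amap T t) e = u))" (is "_ \<longleftrightarrow> _ \<and> ?U")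
    if k: "k \<in> homs D K (omap T x)" and w: "w \<in> homs C W x" and e: "e \<in> homs D K (omap T W)"
    for k K w W e
  proof -
    have Fw: "omap ?F w = amap T w" using w by (rule slice_functor_simps)
    note Tw = functor_hom[OF T w]
    have "(\<exists>!t. t \<in> homs ?S w v \<and> Cmp ?R (amap ?F t) (k, amap T w, e) = (k, amap T v, u))
        \<longleftrightarrow> (\<exists>!t. t \<in> homs C W V \<and> Cmp C v t = w \<and> Cmp D (amap T t) e = u)"
      if v: "v \<in> homs C V x" for v u V
    proof -
      have *: "t \<in> homs ?S w v \<and> Cmp ?R (amap ?F t) (k, amap T w, e) = (k, amap T v, u) \<longleftrightarrow>
          (\<exists>h. t = (w, v, h) \<and> h \<in> homs C W V \<and> Cmp C v h = w \<and> Cmp D (amap T h) e = u)" for t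
        using ar[OF w v] cmp[OF v w] by (cases t) (auto simp: slice_hom_iff)
      show ?thesis unfolding * by blast
    qed
    note ex = this
    have "(\<forall>v\<in>Ob ?S. \<forall>u\<in>homs ?R k (omap ?F v). \<exists>!t. t \<in> homs ?S w v \<and> Cmp ?R (amap ?F t) (k, amap T w, e) = u) \<longleftrightarrow> ?U"
    proof (intro iffI ballI allI impI)
      fix V v u
      assume all: "\<forall>v\<in>Ob ?S. \<forall>u\<in>homs ?R k (omap ?F v). \<exists>!t. t \<in> homs ?S w v \<and> Cmp ?R (amap ?F t) (k, amap T w, e) = u"
        and v: "v \<in> homs C V x" and u: "u \<in> homs D K (omap T V)" "Cmp D (amap T v) u = k"
      have "(k, amap T v, u) \<in> homs ?R k (omap ?F v)"
        using ar'[OF k functor_hom[OF T v], of u] u v by (simp add: slice_functor_simps)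
      moreover have "v \<in> Ob ?S"
        using v by (simp add: homs_def)
      ultimately have "\<exists>!t. t \<in> homs ?S w v \<and> Cmp ?R (amap ?F t) (k, amap T w, e) = (k, amap T v, u)"
        using all by blast
      then show "\<exists>!t. t \<in> homs C W V \<and> Cmp C v t = w \<and> Cmp D (amap T t) e = u"
        by (simp only: ex[OF v])
    next
      fix v u
      assume U: ?U and v: "v \<in> Ob ?S" and u: "u \<in> homs ?R k (omap ?F v)"
      have vh: "v \<in> homs C (Dom C v) x" using v by (auto simp: homs_def)
      obtain u' where u': "u = (k, amap T v, u')" using u slice_functor_simps(1)[OF vh] by (auto simp: slice_hom_iff)
      have "u' \<in> homs D K (omap T (Dom C v))" "Cmp D (amap T v) u' = k"
        using u ar'[OF k functor_hom[OF T vh], of u'] slice_functor_simps(1)[OF vh, of T] by (simp_all add: u')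
      then show "\<exists>!t. t \<in> homs ?S w v \<and> Cmp ?R (amap ?F t) (k, amap T w, e) = u"
        unfolding u' ex[OF vh] using U vh by blast
    qed
    note lift = this
    have wS: "w \<in> Ob ?S" using w by (simp add: homs_def)
    have Eh: "(k, amap T w, e) \<in> homs ?R k (omap ?F w) \<longleftrightarrow> Cmp D (amap T w) e = k"
      unfolding Fw using ar'[OF k Tw, of e] e by simp
    show ?thesis
    proof
      assume "couniversal (op_cat ?S) (op_cat ?R) ?F k w (k, amap T w, e)"
      note c = this[unfolded couniversal_def op_cat_simps]
      show "Cmp D (amap T w) e = k \<and> ?U"
        by (intro conjI iffD1[OF Eh] iffD1[OF lift] conjunct1[OF conjunct2[OF c]] conjunct2[OF conjunct2[OF c]])
    next
      assume c: "Cmp D (amap T w) e = k \<and> ?U"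
      show "couniversal (op_cat ?S) (op_cat ?R) ?F k w (k, amap T w, e)"
        unfolding couniversal_def op_cat_simps
        by (intro conjI iffD2[OF Eh] iffD2[OF lift] conjunct1[OF c] conjunct2[OF c] wS)
    qed
  qed
  have "is_right_adjoint ?S ?R ?F \<longleftrightarrow> (\<forall>k\<in>Ob ?R. \<exists>w E. couniversal (op_cat ?S) (op_cat ?R) ?F k w E)"
    unfolding is_left_adjoint_op[symmetric]
    by (intro iffI ballI left_adjoint_of_couniversal[OF functor_op_cat[OF functor_slice_functor[OF T]]])
       (erule couniversal_of_left_adjoint, simp, erule bspec, simp)
  also have "\<dots> \<longleftrightarrow> slice_universal C D T x"
    unfolding slice_universal_def
  proof (intro iffI allI ballI)
    fix K k assume all: "\<forall>k\<in>Ob ?R. \<exists>w E. couniversal (op_cat ?S) (op_cat ?R) ?F k w E" and k: "k \<in> homs D K (omap T x)"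
    have "k \<in> Ob ?R" using k by (auto simp: homs_def)
    then obtain w E where wE: "couniversal (op_cat ?S) (op_cat ?R) ?F k w E" using all by blast
    then have w: "w \<in> homs C (Dom C w) x" by (auto simp: couniversal_def homs_def)
    obtain e where E: "E = (k, amap T w, e)"
      using wE slice_functor_simps(1)[OF w, of T] by (auto simp: couniversal_def slice_hom_iff)
    have e: "e \<in> homs D K (omap T (Dom C w))"
      using wE ar'[OF k functor_hom[OF T w], of e] slice_functor_simps(1)[OF w, of T]
      by (simp add: E couniversal_def)
    show "\<exists>W. \<exists>w\<in>homs C W x. \<exists>e\<in>homs D K (omap T W). Cmp D (amap T w) e = k \<and>
      (\<forall>V. \<forall>v\<in>homs C V x. \<forall>u\<in>homs D K (omap T V). Cmp D (amap T v) u = k \<longrightarrow>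
        (\<exists>!t. t \<in> homs C W V \<and> Cmp C v t = w \<and> Cmp D (amap T t) e = u))"
      by (rule exI, rule bexI[OF _ w], rule bexI[OF _ e], rule main[OF k w e, THEN iffD1]) (use wE E in simp)
  next
    fix k assume all: "\<forall>K. \<forall>k\<in>homs D K (omap T x). \<exists>W. \<exists>w\<in>homs C W x. \<exists>e\<in>homs D K (omap T W). Cmp D (amap T w) e = k \<and>
      (\<forall>V. \<forall>v\<in>homs C V x. \<forall>u\<in>homs D K (omap T V). Cmp D (amap T v) u = k \<longrightarrow>
        (\<exists>!t. t \<in> homs C W V \<and> Cmp C v t = w \<and> Cmp D (amap T t) e = u))"
      and "k \<in> Ob ?R"
    then have k: "k \<in> homs D (Dom D k) (omap T x)" by (auto simp: homs_def)
    obtain W w e where w: "w \<in> homs C W x" and e: "e \<in> homs D (Dom D k) (omap T W)"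
      and c: "Cmp D (amap T w) e = k \<and>
      (\<forall>V. \<forall>v\<in>homs C V x. \<forall>u\<in>homs D (Dom D k) (omap T V). Cmp D (amap T v) u = k \<longrightarrow>
        (\<exists>!t. t \<in> homs C W V \<and> Cmp C v t = w \<and> Cmp D (amap T t) e = u))"
      using all[THEN spec, THEN bspec, OF k] by (elim exE bexE) (rule that)
    have "couniversal (op_cat ?S) (op_cat ?R) ?F k w (k, amap T w, e)"
      by (rule main[OF k w e, THEN iffD2, OF c])
    then show "\<exists>w E. couniversal (op_cat ?S) (op_cat ?R) ?F k w E" by blast
  qed
  finally show ?thesis .
qed

section \<open>Colimits, pullbacks and isomorphisms\<close>

lemma ex1_eq: "\<exists>!x. Q x \<Longrightarrow> Q a \<Longrightarrow> Q b \<Longrightarrow> a = b"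
  by blast

definition has_products :: "('o, 'm) cat \<Rightarrow> bool" where
  "has_products D \<longleftrightarrow> (\<forall>y\<in>Ob D. \<forall>z\<in>Ob D. \<exists>p. \<exists>q\<in>homs D p y. \<exists>r\<in>homs D p z.
     \<forall>w. \<forall>f\<in>homs D w y. \<forall>g\<in>homs D w z. \<exists>!h. h \<in> homs D w p \<and> Cmp D q h = f \<and> Cmp D r h = g)"

lemma has_productsD:
  assumes "has_products D" "y \<in> Ob D" "z \<in> Ob D"
  obtains p q r where "q \<in> homs D p y" "r \<in> homs D p z"
    "\<And>w f g. f \<in> homs D w y \<Longrightarrow> g \<in> homs D w z \<Longrightarrow>
       \<exists>!h. h \<in> homs D w p \<and> Cmp D q h = f \<and> Cmp D r h = g"
proof -
  have "\<exists>p. \<exists>q\<in>homs D p y. \<exists>r\<in>homs D p z.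
     \<forall>w. \<forall>f\<in>homs D w y. \<forall>g\<in>homs D w z. \<exists>!h. h \<in> homs D w p \<and> Cmp D q h = f \<and> Cmp D r h = g"
    using assms unfolding has_products_def by simp
  then show thesis by (elim exE bexE) (rule that, assumption+, simp)
qed

lemma slice_couniversalD:
  assumes "slice_couniversal C D T x" "k \<in> homs D K (omap T x)"
  obtains W w e where "w \<in> homs C W x" "e \<in> homs D (omap T W) K" "Cmp D k e = amap T w"
    "\<And>V v u. v \<in> homs C V x \<Longrightarrow> u \<in> homs D (omap T V) K \<Longrightarrow> Cmp D k u = amap T v \<Longrightarrow>
       \<exists>!t. t \<in> homs C V W \<and> Cmp C w t = v \<and> Cmp D e (amap T t) = u"
proof -
  have "\<exists>W. \<exists>w\<in>homs C W x. \<exists>e\<in>homs D (omap T W) K. Cmp D k e = amap T w \<and>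
      (\<forall>V. \<forall>v\<in>homs C V x. \<forall>u\<in>homs D (omap T V) K. Cmp D k u = amap T v \<longrightarrow>
        (\<exists>!t. t \<in> homs C V W \<and> Cmp C w t = v \<and> Cmp D e (amap T t) = u))"
    using assms unfolding slice_couniversal_def by simp
  then show thesis by (elim exE bexE conjE) (rule that, assumption+, simp)
qed

lemma slice_universalD:
  assumes "slice_universal C D T x" "k \<in> homs D K (omap T x)"
  obtains W w e where "w \<in> homs C W x" "e \<in> homs D K (omap T W)" "Cmp D (amap T w) e = k"
    "\<And>V v u. v \<in> homs C V x \<Longrightarrow> u \<in> homs D K (omap T V) \<Longrightarrow> Cmp D (amap T v) u = k \<Longrightarrow>
       \<exists>!t. t \<in> homs C W V \<and> Cmp C v t = w \<and> Cmp D (amap T t) e = u"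
proof -
  have "\<exists>W. \<exists>w\<in>homs C W x. \<exists>e\<in>homs D K (omap T W). Cmp D (amap T w) e = k \<and>
      (\<forall>V. \<forall>v\<in>homs C V x. \<forall>u\<in>homs D K (omap T V). Cmp D (amap T v) u = k \<longrightarrow>
        (\<exists>!t. t \<in> homs C W V \<and> Cmp C v t = w \<and> Cmp D (amap T t) e = u))"
    using assms unfolding slice_universal_def by simp
  then show thesis by (elim exE bexE conjE) (rule that, assumption+, simp)
qed

text \<open>
  The forgetful functor of a slice over \<open>y\<close> has the right adjoint \<open>z \<mapsto> z \<times> y\<close>, so that colimits in the
  slice over \<open>T c\<close> are colimits.
\<close>

lemma slice_couniversal_preserves_colimit:
  assumes T: "is_functor C D T" and prods: "has_products D"
    and cu: "slice_couniversal C D T c" and colim: "is_colimit J C E c l"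
  shows "is_colimit J D (comp_functor J T E) (omap T c) (\<lambda>i. amap T (l i))"
proof -
  note C = functor_cat(1)[OF T] and D = functor_cat(2)[OF T]
  have E: "is_functor J C E" and c: "c \<in> Ob C" and l: "\<And>i. i \<in> Ob J \<Longrightarrow> l i \<in> homs C (omap E i) c"
    and l_nat: "\<And>i j f. f \<in> homs J i j \<Longrightarrow> Cmp C (l j) (amap E f) = l i"
    using colim by (auto simp: is_colimit_def is_cocone_def homs_def)
  have univ: "\<exists>!u. u \<in> homs C c c' \<and> (\<forall>i\<in>Ob J. Cmp C u (l i) = l' i)" if "is_cocone J C E c' l'" for c' l'
    using colim that by (simp add: is_colimit_def)
  note J = functor_cat(1)[OF E]
  note TE = functor_comp_functor[OF E T]
  have coneI: "is_cocone J C E c' l'" if "c' \<in> Ob C" "\<And>i. i \<in> Ob J \<Longrightarrow> l' i \<in> homs C (omap E i) c'"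
      "\<And>i j f. f \<in> homs J i j \<Longrightarrow> Cmp C (l' j) (amap E f) = l' i" for c' l'
    using that E by (auto simp: is_cocone_def homs_def)
  have Tl: "amap T (l i) \<in> homs D (omap T (omap E i)) (omap T c)" if "i \<in> Ob J" for i
    by (rule functor_hom[OF T l[OF that]])
  have Tl_nat: "Cmp D (amap T (l j)) (amap T (amap E f)) = amap T (l i)" if f: "f \<in> homs J i j" for i j f
    using functor_comp[OF T functor_hom[OF E f] l[OF cat_hom_ob(2)[OF J f]]] l_nat[OF f] by simp
  have "is_cocone J D (comp_functor J T E) (omap T c) (\<lambda>i. amap T (l i))"
    unfolding is_cocone_def using TE functor_ob[OF T c] Tl Tl_nat
    by (auto simp: comp_functor_simps dest: ar_hom)
  moreover have "\<exists>!m. m \<in> homs D (omap T c) c' \<and> (\<forall>i\<in>Ob J. Cmp D m (amap T (l i)) = l' i)"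
    if cone: "is_cocone J D (comp_functor J T E) c' l'" for c' l'
  proof -
    have c': "c' \<in> Ob D" and l': "\<And>i. i \<in> Ob J \<Longrightarrow> l' i \<in> homs D (omap T (omap E i)) c'"
      using cone by (auto simp: is_cocone_def comp_functor_simps)
    have l'_nat: "Cmp D (l' j) (amap T (amap E f)) = l' i" if "f \<in> homs J i j" for f i j
      using cone that by (auto simp: is_cocone_def homs_def comp_functor_simps)
    obtain p q r where q: "q \<in> homs D p c'" and r: "r \<in> homs D p (omap T c)"
      and prod: "\<And>w f g. f \<in> homs D w c' \<Longrightarrow> g \<in> homs D w (omap T c) \<Longrightarrow>
         \<exists>!h. h \<in> homs D w p \<and> Cmp D q h = f \<and> Cmp D r h = g"
      by (rule has_productsD[OF prods c' functor_ob[OF T c]]) (rule that)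
    have prod_eq: "h = h'" if hs: "h \<in> homs D w p" "h' \<in> homs D w p" "Cmp D q h = Cmp D q h'" "Cmp D r h = Cmp D r h'"
      for w h h'
      using prod[OF cat_comp[OF D hs(1) q] cat_comp[OF D hs(1) r]] hs by auto
    obtain W w e where w: "w \<in> homs C W c" and e: "e \<in> homs D (omap T W) p" and re: "Cmp D r e = amap T w"
      and lift: "\<And>V v u. v \<in> homs C V c \<Longrightarrow> u \<in> homs D (omap T V) p \<Longrightarrow> Cmp D r u = amap T v \<Longrightarrow>
         \<exists>!t. t \<in> homs C V W \<and> Cmp C w t = v \<and> Cmp D e (amap T t) = u"
      by (rule slice_couniversalD[OF cu r]) (rule that)
    have lift_eq: "t = t'" if ts: "t \<in> homs C V W" "t' \<in> homs C V W" "Cmp C w t = Cmp C w t'"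
        "Cmp D e (amap T t) = Cmp D e (amap T t')" for V t t'
    proof -
      note Tt = functor_hom[OF T ts(1)]
      have "Cmp D r (Cmp D e (amap T t)) = amap T (Cmp C w t)"
        using cat_assoc[OF D Tt e r] re functor_comp[OF T ts(1) w] by simp
      from lift[OF cat_comp[OF C ts(1) w] cat_comp[OF D Tt e] this] show ?thesis
        using ts by auto
    qed
    \<comment> \<open>The cocone \<open>l'\<close> has no map to \<open>T c\<close>. Pairing it with
      \<open>T (l i)\<close> gives a cocone \<open>h\<close> with vertex the product, which does lie
      over \<open>T c\<close> and can be transposed along \<open>e\<close>.\<close>
    have "\<forall>i\<in>Ob J. \<exists>h. h \<in> homs D (omap T (omap E i)) p \<and> Cmp D q h = l' i \<and> Cmp D r h = amap T (l i)"
      using prod[OF l' Tl] by blast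
    then obtain h where h: "\<And>i. i \<in> Ob J \<Longrightarrow> h i \<in> homs D (omap T (omap E i)) p"
      and qh: "\<And>i. i \<in> Ob J \<Longrightarrow> Cmp D q (h i) = l' i" and rh: "\<And>i. i \<in> Ob J \<Longrightarrow> Cmp D r (h i) = amap T (l i)"
      by metis
    have "\<forall>i\<in>Ob J. \<exists>t. t \<in> homs C (omap E i) W \<and> Cmp C w t = l i \<and> Cmp D e (amap T t) = h i"
      using lift[OF l h rh] by blast
    then obtain t where t: "\<And>i. i \<in> Ob J \<Longrightarrow> t i \<in> homs C (omap E i) W"
      and wt: "\<And>i. i \<in> Ob J \<Longrightarrow> Cmp C w (t i) = l i" and et: "\<And>i. i \<in> Ob J \<Longrightarrow> Cmp D e (amap T (t i)) = h i"
      by metis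
    have t_nat: "Cmp C (t j) (amap E f) = t i" if f: "f \<in> homs J i j" for f i j
    proof (rule lift_eq)
      note ob = cat_hom_ob[OF J f] and Ef = functor_hom[OF E f]
      note TEf = functor_hom[OF T Ef]
      show "Cmp C (t j) (amap E f) \<in> homs C (omap E i) W" by (rule cat_comp[OF C Ef t[OF ob(2)]])
      show "t i \<in> homs C (omap E i) W" by (rule t[OF ob(1)])
      show "Cmp C w (Cmp C (t j) (amap E f)) = Cmp C w (t i)"
        using cat_assoc[OF C Ef t[OF ob(2)] w] wt[OF ob(1)] wt[OF ob(2)] l_nat[OF f] by simp
      have "Cmp D (h j) (amap T (amap E f)) = h i"
      proof (rule prod_eq)
        show "Cmp D (h j) (amap T (amap E f)) \<in> homs D (omap T (omap E i)) p"
          by (rule cat_comp[OF D TEf h[OF ob(2)]])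
        show "h i \<in> homs D (omap T (omap E i)) p" by (rule h[OF ob(1)])
        show "Cmp D q (Cmp D (h j) (amap T (amap E f))) = Cmp D q (h i)"
          using cat_assoc[OF D TEf h[OF ob(2)] q] qh[OF ob(1)] qh[OF ob(2)] l'_nat[OF f] by simp
        show "Cmp D r (Cmp D (h j) (amap T (amap E f))) = Cmp D r (h i)"
          using cat_assoc[OF D TEf h[OF ob(2)] r] rh[OF ob(1)] rh[OF ob(2)] Tl_nat[OF f] by simp
      qed
      then show "Cmp D e (amap T (Cmp C (t j) (amap E f))) = Cmp D e (amap T (t i))"
        using functor_comp[OF T Ef t[OF ob(2)]] cat_assoc[OF D TEf functor_hom[OF T t[OF ob(2)]] e]
          et[OF ob(1)] et[OF ob(2)] by simp
    qed
    have "is_cocone J C E W t"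
      using coneI[OF cat_hom_ob(1)[OF C w] t t_nat] .
    from univ[OF this] obtain u where u: "u \<in> homs C c W" and ul: "\<And>i. i \<in> Ob J \<Longrightarrow> Cmp C u (l i) = t i"
      and u_uniq: "\<And>u'. u' \<in> homs C c W \<Longrightarrow> (\<And>i. i \<in> Ob J \<Longrightarrow> Cmp C u' (l i) = t i) \<Longrightarrow> u' = u"
      by (elim ex1E conjE) (rule that, assumption, blast, blast)
    note Tu = functor_hom[OF T u]
    show ?thesis
    proof (intro ex1I[of _ "Cmp D q (Cmp D e (amap T u))"] conjI ballI)
      show "Cmp D q (Cmp D e (amap T u)) \<in> homs D (omap T c) c'"
        by (rule cat_comp[OF D cat_comp[OF D Tu e] q])
      show "Cmp D (Cmp D q (Cmp D e (amap T u))) (amap T (l i)) = l' i" if i: "i \<in> Ob J" for i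
      proof -
        have "Cmp D (Cmp D q (Cmp D e (amap T u))) (amap T (l i))
            = Cmp D q (Cmp D (Cmp D e (amap T u)) (amap T (l i)))"
          using cat_assoc[OF D Tl[OF i] cat_comp[OF D Tu e] q] by simp
        also have "Cmp D (Cmp D e (amap T u)) (amap T (l i)) = h i"
          using cat_assoc[OF D Tl[OF i] Tu e] functor_comp[OF T l[OF i] u] ul[OF i] et[OF i] by simp
        finally show ?thesis using qh[OF i] by simp
      qed
      show "m = Cmp D q (Cmp D e (amap T u))"
        if m: "m \<in> homs D (omap T c) c' \<and> (\<forall>i\<in>Ob J. Cmp D m (amap T (l i)) = l' i)" for m
      proof -
        have mh: "m \<in> homs D (omap T c) c'" using m by simp
        note id = cat_id[OF D functor_ob[OF T c]]
        \<comment> \<open>A competitor \<open>m\<close> is paired with the identity of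
          \<open>T c\<close>. The pair lies over \<open>T c\<close> through \<open>T\<close> of an
          identity, so it transposes to a section \<open>t'\<close> of \<open>w\<close>, and the
          colimit in \<open>C\<close> identifies \<open>t'\<close> with \<open>u\<close>.\<close>
        obtain h' where h': "h' \<in> homs D (omap T c) p" "Cmp D q h' = m" "Cmp D r h' = Idt D (omap T c)"
          using prod[OF mh id] by blast
        have "Cmp D r h' = amap T (Idt C c)" using h'(3) functor_id[OF T c] by simp
        from lift[OF cat_id[OF C c] h'(1) this] obtain t' where t': "t' \<in> homs C c W"
          "Cmp C w t' = Idt C c" "Cmp D e (amap T t') = h'" by blast
        have "t' = u"
        proof (rule u_uniq[OF t'(1)])
          fix i assume i: "i \<in> Ob J"
          show "Cmp C t' (l i) = t i"
          proof (rule lift_eq)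
            show "Cmp C t' (l i) \<in> homs C (omap E i) W" by (rule cat_comp[OF C l[OF i] t'(1)])
            show "t i \<in> homs C (omap E i) W" by (rule t[OF i])
            show "Cmp C w (Cmp C t' (l i)) = Cmp C w (t i)"
              using cat_assoc[OF C l[OF i] t'(1) w] t'(2) cat_id_left[OF C l[OF i]] wt[OF i] by simp
            have "Cmp D h' (amap T (l i)) = h i"
            proof (rule prod_eq)
              show "Cmp D h' (amap T (l i)) \<in> homs D (omap T (omap E i)) p" by (rule cat_comp[OF D Tl[OF i] h'(1)])
              show "h i \<in> homs D (omap T (omap E i)) p" by (rule h[OF i])
              show "Cmp D q (Cmp D h' (amap T (l i))) = Cmp D q (h i)"
                using cat_assoc[OF D Tl[OF i] h'(1) q] h'(2) m i qh[OF i] by simp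
              show "Cmp D r (Cmp D h' (amap T (l i))) = Cmp D r (h i)"
                using cat_assoc[OF D Tl[OF i] h'(1) r] h'(3) cat_id_left[OF D Tl[OF i]] rh[OF i] by simp
            qed
            then show "Cmp D e (amap T (Cmp C t' (l i))) = Cmp D e (amap T (t i))"
              using functor_comp[OF T l[OF i] t'(1)] cat_assoc[OF D Tl[OF i] functor_hom[OF T t'(1)] e]
                t'(3) et[OF i] by simp
          qed
        qed
        then show ?thesis using t'(3) h'(2) by simp
      qed
    qed
  qed
  ultimately show ?thesis
    unfolding is_colimit_def by blast
qed

text \<open>Let \<open>g\<close> and \<open>h\<close> agree after \<open>T f\<close>. Paired with
  the identity of \<open>T b\<close>, they become arrows over \<open>T b\<close> and transpose to
  sections \<open>t\<close> and \<open>s\<close> of \<open>w\<close>. These agree after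
  \<open>f\<close>, because both composites are the transpose of the same arrow; as \<open>f\<close>
  is epi they are equal, and so are \<open>g\<close> and \<open>h\<close>.\<close>

lemma slice_couniversal_preserves_epi:
  assumes T: "is_functor C D T" and prods: "has_products D"
    and cu: "\<And>x. x \<in> Ob C \<Longrightarrow> slice_couniversal C D T x"
  shows "preserves_epis C D T"
  unfolding preserves_epis_def
proof (intro allI impI)
  note C = functor_cat(1)[OF T] and D = functor_cat(2)[OF T]
  fix f assume epi: "is_epi C f"
  define a b where "a = Dom C f" and "b = Cod C f"
  have f: "f \<in> homs C a b" using epi by (auto simp: is_epi_def a_def b_def homs_def)
  have cancel: "g = h" if "g \<in> homs C b z" "h \<in> homs C b z" "Cmp C g f = Cmp C h f" for g h z
    using epi that by (auto simp: is_epi_def b_def homs_def)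
  note b = cat_hom_ob(2)[OF C f] and Tf = functor_hom[OF T f]
  show "is_epi D (amap T f)"
    unfolding is_epi_def
  proof (intro conjI ballI impI)
    show "amap T f \<in> Ar D" using homsD(1)[OF Tf] .
    fix g h assume "g \<in> Ar D" "h \<in> Ar D"
      and gh: "Dom D g = Cod D (amap T f) \<and> Dom D h = Cod D (amap T f) \<and> Cod D g = Cod D h \<and>
        Cmp D g (amap T f) = Cmp D h (amap T f)"
    define z where "z = Cod D g"
    have g: "g \<in> homs D (omap T b) z" and h: "h \<in> homs D (omap T b) z"
      using gh \<open>g \<in> Ar D\<close> \<open>h \<in> Ar D\<close> homsD(3)[OF Tf] by (auto simp: homs_def z_def)
    obtain p q r where q: "q \<in> homs D p z" and r: "r \<in> homs D p (omap T b)"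
      and prod: "\<And>w f g. f \<in> homs D w z \<Longrightarrow> g \<in> homs D w (omap T b) \<Longrightarrow>
         \<exists>!h. h \<in> homs D w p \<and> Cmp D q h = f \<and> Cmp D r h = g"
      by (rule has_productsD[OF prods cat_hom_ob(2)[OF D g] functor_ob[OF T b]]) (rule that)
    obtain W w e where w: "w \<in> homs C W b" and e: "e \<in> homs D (omap T W) p" and "Cmp D r e = amap T w"
      and lift: "\<And>V v u. v \<in> homs C V b \<Longrightarrow> u \<in> homs D (omap T V) p \<Longrightarrow> Cmp D r u = amap T v \<Longrightarrow>
         \<exists>!t. t \<in> homs C V W \<and> Cmp C w t = v \<and> Cmp D e (amap T t) = u"
      by (rule slice_couniversalD[OF cu[OF b] r]) (rule that)
    note id = cat_id[OF D functor_ob[OF T b]]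
    have *: "\<exists>h t. h \<in> homs D (omap T b) p \<and> Cmp D q h = g \<and> Cmp D r h = Idt D (omap T b) \<and>
        t \<in> homs C b W \<and> Cmp C w t = Idt C b \<and> Cmp D e (amap T t) = h" if g: "g \<in> homs D (omap T b) z" for g
    proof -
      obtain h where h: "h \<in> homs D (omap T b) p" "Cmp D q h = g" "Cmp D r h = Idt D (omap T b)"
        using prod[OF g id] by blast
      then show ?thesis
        using lift[OF cat_id[OF C b] h(1)] functor_id[OF T b] by auto
    qed
    obtain g' t where g': "g' \<in> homs D (omap T b) p" "Cmp D q g' = g" "Cmp D r g' = Idt D (omap T b)"
      and t: "t \<in> homs C b W" "Cmp C w t = Idt C b" "Cmp D e (amap T t) = g'" using *[OF g] by blast
    obtain h' s where h': "h' \<in> homs D (omap T b) p" "Cmp D q h' = h" "Cmp D r h' = Idt D (omap T b)"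
      and s: "s \<in> homs C b W" "Cmp C w s = Idt C b" "Cmp D e (amap T s) = h'" using *[OF h] by blast
    have eq: "Cmp D g' (amap T f) = Cmp D h' (amap T f)"
    proof -
      have "Cmp D q (Cmp D g' (amap T f)) = Cmp D q (Cmp D h' (amap T f))"
        using cat_assoc[OF D Tf g'(1) q] cat_assoc[OF D Tf h'(1) q] g'(2) h'(2) gh by simp
      moreover have "Cmp D r (Cmp D g' (amap T f)) = Cmp D r (Cmp D h' (amap T f))"
        using cat_assoc[OF D Tf g'(1) r] cat_assoc[OF D Tf h'(1) r] g'(3) h'(3) by simp
      ultimately show ?thesis
        using prod[OF cat_comp[OF D cat_comp[OF D Tf g'(1)] q] cat_comp[OF D cat_comp[OF D Tf g'(1)] r]]
          cat_comp[OF D Tf g'(1)] cat_comp[OF D Tf h'(1)] by auto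
    qed
    have "Cmp C t f = Cmp C s f"
    proof -
      have tf: "Cmp C w (Cmp C t f) = f" and sf: "Cmp C w (Cmp C s f) = f"
        using cat_assoc[OF C f t(1) w] cat_assoc[OF C f s(1) w] t(2) s(2) cat_id_left[OF C f] by auto
      have etf: "Cmp D e (amap T (Cmp C t f)) = Cmp D g' (amap T f)"
        using functor_comp[OF T f t(1)] cat_assoc[OF D Tf functor_hom[OF T t(1)] e] t(3) by simp
      have esf: "Cmp D e (amap T (Cmp C s f)) = Cmp D g' (amap T f)"
        using functor_comp[OF T f s(1)] cat_assoc[OF D Tf functor_hom[OF T s(1)] e] s(3) eq by simp
      have "Cmp D r (Cmp D g' (amap T f)) = amap T f"
        using cat_assoc[OF D Tf g'(1) r] g'(3) cat_id_left[OF D Tf] by simp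
      from lift[OF f cat_comp[OF D Tf g'(1)] this] show ?thesis
        using tf sf etf esf cat_comp[OF C f t(1)] cat_comp[OF C f s(1)] by auto
    qed
    then have "t = s" by (rule cancel[OF t(1) s(1)])
    then show "g = h" using t(3) s(3) g'(2) h'(2) by simp
  qed
qed

section \<open>Pullback squares, cartesian transformations and inverses\<close>

lemma pullbackI:
  assumes "p \<in> homs D w x" "q \<in> homs D w y" "f \<in> homs D x z" "g \<in> homs D y z" "Cmp D f p = Cmp D g q"
    and "\<And>v p' q'. p' \<in> homs D v x \<Longrightarrow> q' \<in> homs D v y \<Longrightarrow> Cmp D f p' = Cmp D g q' \<Longrightarrow>
      \<exists>!u. u \<in> homs D v w \<and> Cmp D p u = p' \<and> Cmp D q u = q'"
  shows "is_pullback D p q f g"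
  unfolding is_pullback_def
proof (intro conjI ballI impI)
  fix p' q' assume *: "p' \<in> Ar D" "q' \<in> Ar D"
    "Dom D p' = Dom D q' \<and> Cod D p' = Dom D f \<and> Cod D q' = Dom D g \<and> Cmp D f p' = Cmp D g q'"
  have "p' \<in> homs D (Dom D p') x" "q' \<in> homs D (Dom D p') y"
    using * homsD(2)[OF assms(3)] homsD(2)[OF assms(4)] by (auto intro: homsI)
  from assms(6)[OF this] show "\<exists>!u. u \<in> homs D (Dom D p') (Dom D p) \<and> Cmp D p u = p' \<and> Cmp D q u = q'"
    using * unfolding homsD(2)[OF assms(1)] by blast
qed (use assms(1-5) in \<open>simp_all add: homs_def\<close>)

lemma pullbackD:
  assumes "is_pullback D p q f g" "p \<in> homs D w x" "q \<in> homs D w y"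
    and "p' \<in> homs D v x" "q' \<in> homs D v y" "Cmp D f p' = Cmp D g q'"
  shows "\<exists>!u. u \<in> homs D v w \<and> Cmp D p u = p' \<and> Cmp D q u = q'"
proof -
  have "\<forall>p'\<in>Ar D. \<forall>q'\<in>Ar D.
        Dom D p' = Dom D q' \<and> Cod D p' = Dom D f \<and> Cod D q' = Dom D g \<and> Cmp D f p' = Cmp D g q'
        \<longrightarrow> (\<exists>!u. u \<in> homs D (Dom D p') (Dom D p) \<and> Cmp D p u = p' \<and> Cmp D q u = q')"
    and cod: "Cod D p = Dom D f" "Cod D q = Dom D g"
    using assms(1) unfolding is_pullback_def by blast+
  from this(1) have "\<exists>!u. u \<in> homs D (Dom D p') (Dom D p) \<and> Cmp D p u = p' \<and> Cmp D q u = q'"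
    by (elim ballE[where x = p'] ballE[where x = q'] impE)
       (use cod assms(6) homsD[OF assms(2)] homsD[OF assms(3)] homsD[OF assms(4)] homsD[OF assms(5)] in simp_all)
  then show ?thesis
    unfolding homsD(2)[OF assms(2)] homsD(2)[OF assms(4)] .
qed

text \<open>Pasting of pullbacks: a matching pair is lifted first through the square of \<sigma>,
  then the result through the square of \<tau>.\<close>

lemma cartesian_comp:
  assumes \<tau>: "\<tau> \<in> homs (fun_cat C D) F G" and \<sigma>: "\<sigma> \<in> homs (fun_cat C D) G H"
    and c\<tau>: "cartesian C D \<tau>" and c\<sigma>: "cartesian C D \<sigma>"
  shows "cartesian C D (Cmp (fun_cat C D) \<sigma> \<tau>)"
  unfolding cartesian_def
proof
  note t = nt_homD[OF \<tau>] and s = nt_homD[OF \<sigma>]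
  note C = functor_cat(1)[OF t(1)] and D = functor_cat(2)[OF t(1)]
  fix h assume "h \<in> Ar C"
  define a b where "a = Dom C h" and "b = Cod C h"
  have h: "h \<in> homs C a b" using \<open>h \<in> Ar C\<close> by (simp add: homs_def a_def b_def)
  note ob = cat_hom_ob[OF C h]
  note Fh = functor_hom[OF t(1) h] and Gh = functor_hom[OF t(2) h] and Hh = functor_hom[OF s(2) h]
  note ta = t(4)[OF ob(1)] and tb = t(4)[OF ob(2)] and sa = s(4)[OF ob(1)] and sb = s(4)[OF ob(2)]
  have pt: "is_pullback D (ncomp \<tau> a) (amap F h) (amap G h) (ncomp \<tau> b)"
    and ps: "is_pullback D (ncomp \<sigma> a) (amap G h) (amap H h) (ncomp \<sigma> b)"
    using c\<tau> c\<sigma> \<open>h \<in> Ar C\<close> t(6,7) s(6,7) by (auto simp: cartesian_def a_def b_def)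
  have "is_pullback D (Cmp D (ncomp \<sigma> a) (ncomp \<tau> a)) (amap F h) (amap H h) (Cmp D (ncomp \<sigma> b) (ncomp \<tau> b))"
  proof (rule pullbackI[OF cat_comp[OF D ta sa] Fh Hh cat_comp[OF D tb sb]])
    show "Cmp D (amap H h) (Cmp D (ncomp \<sigma> a) (ncomp \<tau> a)) = Cmp D (Cmp D (ncomp \<sigma> b) (ncomp \<tau> b)) (amap F h)"
      using nt_homD(5)[OF cat_comp[OF category_fun_cat[OF C D] \<tau> \<sigma>] h] ob by simp
    fix v p' q' assume p': "p' \<in> homs D v (omap H a)" and q': "q' \<in> homs D v (omap F b)"
      and eq: "Cmp D (amap H h) p' = Cmp D (Cmp D (ncomp \<sigma> b) (ncomp \<tau> b)) q'"
    have "Cmp D (amap H h) p' = Cmp D (ncomp \<sigma> b) (Cmp D (ncomp \<tau> b) q')"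
      using eq cat_assoc[OF D q' tb sb] by simp
    from pullbackD[OF ps sa Gh p' cat_comp[OF D q' tb] this] obtain r where
      r: "r \<in> homs D v (omap G a)" "Cmp D (ncomp \<sigma> a) r = p'" "Cmp D (amap G h) r = Cmp D (ncomp \<tau> b) q'"
      and r_uniq: "\<And>r'. r' \<in> homs D v (omap G a) \<Longrightarrow> Cmp D (ncomp \<sigma> a) r' = p' \<Longrightarrow>
        Cmp D (amap G h) r' = Cmp D (ncomp \<tau> b) q' \<Longrightarrow> r' = r" by (elim ex1E conjE) (rule that, assumption+, blast)
    from pullbackD[OF pt ta Fh r(1) q' r(3)] obtain u where
      u: "u \<in> homs D v (omap F a)" "Cmp D (ncomp \<tau> a) u = r" "Cmp D (amap F h) u = q'"
      and u_uniq: "\<And>u'. u' \<in> homs D v (omap F a) \<Longrightarrow> Cmp D (ncomp \<tau> a) u' = r \<Longrightarrow>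
        Cmp D (amap F h) u' = q' \<Longrightarrow> u' = u" by (elim ex1E conjE) (rule that, assumption+, blast)
    show "\<exists>!u. u \<in> homs D v (omap F a) \<and> Cmp D (Cmp D (ncomp \<sigma> a) (ncomp \<tau> a)) u = p' \<and> Cmp D (amap F h) u = q'"
    proof (intro ex1I[of _ u] conjI)
      show "Cmp D (Cmp D (ncomp \<sigma> a) (ncomp \<tau> a)) u = p'"
        using cat_assoc[OF D u(1) ta sa] u(2) r(2) by simp
      show "u' = u" if u': "u' \<in> homs D v (omap F a) \<and> Cmp D (Cmp D (ncomp \<sigma> a) (ncomp \<tau> a)) u' = p' \<and> Cmp D (amap F h) u' = q'" for u'
      proof -
        have u'h: "u' \<in> homs D v (omap F a)" using u' by simp
        have "Cmp D (ncomp \<tau> a) u' = r"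
          using u' cat_assoc[OF D u'h ta sa] cat_assoc[OF D u'h ta Gh] cat_assoc[OF D u'h Fh tb] t(5)[OF h]
          by (intro r_uniq cat_comp[OF D u'h ta]) simp_all
        then show ?thesis using u_uniq u' by blast
      qed
    qed (use u in simp_all)
  qed
  then show "is_pullback D (ncomp (Cmp (fun_cat C D) \<sigma> \<tau>) (Dom C h)) (amap (nsrc (Cmp (fun_cat C D) \<sigma> \<tau>)) h)
        (amap (ntgt (Cmp (fun_cat C D) \<sigma> \<tau>)) h) (ncomp (Cmp (fun_cat C D) \<sigma> \<tau>) (Cod C h))"
    using ob t(6) s(7) by (simp add: a_def b_def)
qed

lemma inverse_arrowsI:
  "f \<in> homs C a b \<Longrightarrow> g \<in> homs C b a \<Longrightarrow> Cmp C g f = Idt C a \<Longrightarrow> Cmp C f g = Idt C b \<Longrightarrow> inverse_arrows C f g"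
  by (simp add: inverse_arrows_def homs_def)

lemma inverse_arrowsD:
  assumes "inverse_arrows C f g" "f \<in> homs C a b"
  shows "g \<in> homs C b a" "Cmp C g f = Idt C a" "Cmp C f g = Idt C b"
  using assms by (auto simp: inverse_arrows_def homs_def)

lemma is_iso_id: "category C \<Longrightarrow> a \<in> Ob C \<Longrightarrow> is_iso C (Idt C a)"
  unfolding is_iso_def
  by (intro exI[of _ "Idt C a"] inverse_arrowsI[where a = a and b = a]) (auto simp: cat_id cat_id_left[OF _ cat_id])

text \<open>A commuting square with two opposite sides invertible is a pullback: the lift is forced
  to be the inverse of one side after \<open>p\<close>.\<close>

lemma cartesian_iso:
  assumes \<tau>: "\<tau> \<in> homs (fun_cat C D) F G" and iso: "\<And>a. a \<in> Ob C \<Longrightarrow> is_iso D (ncomp \<tau> a)"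
  shows "cartesian C D \<tau>"
  unfolding cartesian_def
proof
  note t = nt_homD[OF \<tau>]
  note C = functor_cat(1)[OF t(1)] and D = functor_cat(2)[OF t(1)]
  fix h assume "h \<in> Ar C"
  define a b where "a = Dom C h" and "b = Cod C h"
  have h: "h \<in> homs C a b" using \<open>h \<in> Ar C\<close> by (simp add: homs_def a_def b_def)
  note ob = cat_hom_ob[OF C h]
  note Fh = functor_hom[OF t(1) h] and Gh = functor_hom[OF t(2) h]
  note ta = t(4)[OF ob(1)] and tb = t(4)[OF ob(2)]
  obtain r where "inverse_arrows D (ncomp \<tau> a) r" using iso[OF ob(1)] by (auto simp: is_iso_def)
  note r = inverse_arrowsD[OF this ta]
  obtain s where "inverse_arrows D (ncomp \<tau> b) s" using iso[OF ob(2)] by (auto simp: is_iso_def)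
  note s = inverse_arrowsD[OF this tb]
  have "is_pullback D (ncomp \<tau> a) (amap F h) (amap G h) (ncomp \<tau> b)"
  proof (rule pullbackI[OF ta Fh Gh tb])
    show "Cmp D (amap G h) (ncomp \<tau> a) = Cmp D (ncomp \<tau> b) (amap F h)" using t(5)[OF h] by simp
    fix v p q assume p: "p \<in> homs D v (omap G a)" and q: "q \<in> homs D v (omap F b)"
      and eq: "Cmp D (amap G h) p = Cmp D (ncomp \<tau> b) q"
    have rp: "Cmp D r p \<in> homs D v (omap F a)" by (rule cat_comp[OF D p r(1)])
    have trp: "Cmp D (ncomp \<tau> a) (Cmp D r p) = p"
      using cat_assoc[OF D p r(1) ta] r(3) cat_id_left[OF D p] by simp
    have "Cmp D (ncomp \<tau> b) (Cmp D (amap F h) (Cmp D r p)) = Cmp D (ncomp \<tau> b) q"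
      using cat_assoc[OF D rp Fh tb] t(5)[OF h] cat_assoc[OF D rp ta Gh] trp eq by simp
    then have "Cmp D s (Cmp D (ncomp \<tau> b) (Cmp D (amap F h) (Cmp D r p))) = Cmp D s (Cmp D (ncomp \<tau> b) q)"
      by simp
    then have Frp: "Cmp D (amap F h) (Cmp D r p) = q"
      using cat_assoc[OF D cat_comp[OF D rp Fh] tb s(1)] cat_assoc[OF D q tb s(1)] s(2)
        cat_id_left[OF D q] cat_id_left[OF D cat_comp[OF D rp Fh]] by simp
    show "\<exists>!u. u \<in> homs D v (omap F a) \<and> Cmp D (ncomp \<tau> a) u = p \<and> Cmp D (amap F h) u = q"
    proof (intro ex1I[of _ "Cmp D r p"] conjI rp trp Frp)
      show "u = Cmp D r p" if "u \<in> homs D v (omap F a) \<and> Cmp D (ncomp \<tau> a) u = p \<and> Cmp D (amap F h) u = q" for u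
        using that cat_assoc[OF D _ ta r(1), of u v] r(2) cat_id_left[OF D, of u v] by auto
    qed
  qed
  then show "is_pullback D (ncomp \<tau> (Dom C h)) (amap (nsrc \<tau>) h) (amap (ntgt \<tau>) h) (ncomp \<tau> (Cod C h))"
    using t(6,7) by (simp add: a_def b_def)
qed

text \<open>The invertibility of the components of the inverse is kept in the conclusion, because
  \<open>cartesian_iso\<close> will be applied to the inverse too: an isomorphism of linear functors
  needs a cartesian inverse.\<close>

lemma nt_inverse:
  assumes \<tau>: "\<tau> \<in> homs (fun_cat C D) F G" and iso: "\<And>a. a \<in> Ob C \<Longrightarrow> is_iso D (ncomp \<tau> a)"
  obtains \<sigma> where "\<sigma> \<in> homs (fun_cat C D) G F" "inverse_arrows (fun_cat C D) \<tau> \<sigma>"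
    "\<And>a. a \<in> Ob C \<Longrightarrow> is_iso D (ncomp \<sigma> a)"
proof -
  note t = nt_homD[OF \<tau>]
  note C = functor_cat(1)[OF t(1)] and D = functor_cat(2)[OF t(1)]
  obtain s where s: "\<And>a. a \<in> Ob C \<Longrightarrow> inverse_arrows D (ncomp \<tau> a) (s a)"
    using iso unfolding is_iso_def by metis
  note inv = inverse_arrowsD[OF s t(4)]
  define \<sigma> where "\<sigma> = \<lparr>nsrc = G, ntgt = F, ncomp = (\<lambda>a\<in>Ob C. s a)\<rparr>"
  have \<sigma>: "\<sigma> \<in> homs (fun_cat C D) G F"
  proof (rule nt_homI[OF t(2,1)])
    show "Cmp D (ncomp \<sigma> b) (amap G f) = Cmp D (amap F f) (ncomp \<sigma> a)" if f: "f \<in> homs C a b" for f a b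
    proof -
      note ob = cat_hom_ob[OF C f] and Ff = functor_hom[OF t(1) f] and Gf = functor_hom[OF t(2) f]
      note sa = inv(1)[OF ob(1) ob(1)] and sb = inv(1)[OF ob(2) ob(2)]
      have "Cmp D (s b) (amap G f) = Cmp D (s b) (Cmp D (amap G f) (Cmp D (ncomp \<tau> a) (s a)))"
        using inv(3)[OF ob(1) ob(1)] cat_id_right[OF D Gf] by simp
      also have "\<dots> = Cmp D (s b) (Cmp D (ncomp \<tau> b) (Cmp D (amap F f) (s a)))"
        using cat_assoc[OF D sa t(4)[OF ob(1)] Gf] t(5)[OF f] cat_assoc[OF D sa Ff t(4)[OF ob(2)]] by simp
      also have "\<dots> = Cmp D (amap F f) (s a)"
        using cat_assoc[OF D cat_comp[OF D sa Ff] t(4)[OF ob(2)] sb] inv(2)[OF ob(2) ob(2)]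
          cat_id_left[OF D cat_comp[OF D sa Ff]] by simp
      finally show ?thesis using ob by (simp add: \<sigma>_def)
    qed
    show "ncomp \<sigma> a \<in> homs D (omap G a) (omap F a)" if "a \<in> Ob C" for a
      using inv(1)[OF that that] that by (simp add: \<sigma>_def)
  qed (simp_all add: \<sigma>_def)
  note F = category_fun_cat[OF C D]
  have "inverse_arrows (fun_cat C D) \<tau> \<sigma>"
    by (rule inverse_arrowsI[OF \<tau> \<sigma>]; rule nt_hom_eqI[OF cat_comp[OF F \<tau> \<sigma>] cat_id[OF F]] nt_hom_eqI[OF cat_comp[OF F \<sigma> \<tau>] cat_id[OF F]])
      (use t(1,2) inv in \<open>simp_all add: \<sigma>_def\<close>)
  moreover have "is_iso D (ncomp \<sigma> a)" if "a \<in> Ob C" for a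
    unfolding is_iso_def using inv[OF that that] t(4)[OF that] that
    by (intro exI[of _ "ncomp \<tau> a"] inverse_arrowsI) (auto simp: \<sigma>_def)
  ultimately show thesis using that \<sigma> by blast
qed

section \<open>Set-valued functors\<close>

lemma set_cat_simps [simp]:
  "Ob set_cat = {S. small S}" "Dom set_cat = sdom" "Cod set_cat = scod"
  "sdom (Idt set_cat S) = S" "scod (Idt set_cat S) = S"
  "sdom (Cmp set_cat g f) = sdom f" "scod (Cmp set_cat g f) = scod g"
  "x \<in> S \<Longrightarrow> sfun (Idt set_cat S) x = x"
  "x \<in> sdom f \<Longrightarrow> sfun (Cmp set_cat g f) x = sfun g (sfun f x)"
  by (simp_all add: set_cat_def)

lemma set_hom_iff:
  "f \<in> homs set_cat S T \<longleftrightarrow> small S \<and> small T \<and> sdom f = S \<and> scod f = T \<and> sfun f \<in> S \<rightarrow>\<^sub>E T"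
  by (auto simp: homs_def set_cat_def)

lemma set_hom_eqI:
  assumes "f \<in> homs set_cat S T" "g \<in> homs set_cat S T" "\<And>x. x \<in> S \<Longrightarrow> sfun f x = sfun g x"
  shows "f = g"
proof -
  have "sfun f = sfun g"
    using assms by (auto simp: set_hom_iff intro: PiE_ext)
  then show ?thesis
    using assms(1,2) by (cases f, cases g) (auto simp: set_hom_iff)
qed

lemma category_set_cat: "category set_cat"
proof -
  have cmp: "Cmp set_cat g f \<in> homs set_cat R T" if "f \<in> homs set_cat R S" "g \<in> homs set_cat S T"
    for f g :: "'u smap" and R S T
    using that by (auto simp: set_hom_iff) (auto simp: set_cat_def)
  have id: "Idt set_cat S \<in> homs set_cat S S" if "small S" for S :: "'u set"
    using that by (auto simp: set_hom_iff) (auto simp: set_cat_def)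
  have fs: "small S" "small T" "sdom f = S" "\<And>x. x \<in> S \<Longrightarrow> sfun f x \<in> T"
    if "f \<in> homs set_cat S T" for f :: "'u smap" and S T
    using that by (auto simp: set_hom_iff)
  show ?thesis
  proof (rule categoryI)
    fix f :: "'u smap" assume "f \<in> Ar set_cat"
    then show "Dom set_cat f \<in> Ob set_cat" "Cod set_cat f \<in> Ob set_cat"
      by (simp_all add: set_cat_def)
  next
    fix f :: "'u smap" and S T assume f: "f \<in> homs set_cat S T"
    show "Cmp set_cat f (Idt set_cat S) = f"
      by (rule set_hom_eqI[OF cmp[OF id f] f]) (use fs[OF f] in auto)
    show "Cmp set_cat (Idt set_cat T) f = f"
      by (rule set_hom_eqI[OF cmp[OF f id] f]) (use fs[OF f] in auto)
  next
    fix f g h :: "'u smap" and R S T V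
    assume f: "f \<in> homs set_cat R S" and g: "g \<in> homs set_cat S T" and h: "h \<in> homs set_cat T V"
    show "Cmp set_cat h (Cmp set_cat g f) = Cmp set_cat (Cmp set_cat h g) f"
      by (rule set_hom_eqI[OF cmp[OF cmp[OF f g] h] cmp[OF f cmp[OF g h]]])
         (use fs[OF f] fs[OF g] in auto)
  qed (use cmp id in auto)
qed

abbreviation act :: "('o, 'm, 'u set, 'u smap) ftor \<Rightarrow> 'm \<Rightarrow> 'u \<Rightarrow> 'u" where
  "act F f x \<equiv> sfun (amap F f) x"

abbreviation app :: "('o, 'm, 'u set, 'u smap) ntrans \<Rightarrow> 'o \<Rightarrow> 'u \<Rightarrow> 'u" where
  "app \<tau> a x \<equiv> sfun (ncomp \<tau> a) x"

lemma sf_small: "is_functor C set_cat F \<Longrightarrow> a \<in> Ob C \<Longrightarrow> small (omap F a)"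
  using functor_ob by fastforce

lemma sf_hom: "is_functor C set_cat F \<Longrightarrow> f \<in> homs C a b \<Longrightarrow> sdom (amap F f) = omap F a"
  using functor_hom[of C set_cat F f a b] by (simp add: set_hom_iff)

lemma sf_act: "is_functor C set_cat F \<Longrightarrow> f \<in> homs C a b \<Longrightarrow> x \<in> omap F a \<Longrightarrow> act F f x \<in> omap F b"
  using functor_hom[of C set_cat F f a b] by (auto simp: set_hom_iff)

lemma sf_id: "is_functor C set_cat F \<Longrightarrow> a \<in> Ob C \<Longrightarrow> x \<in> omap F a \<Longrightarrow> act F (Idt C a) x = x"
  by (simp add: functor_id)

lemma sf_comp:
  "is_functor C set_cat F \<Longrightarrow> f \<in> homs C a b \<Longrightarrow> g \<in> homs C b c \<Longrightarrow> x \<in> omap F a \<Longrightarrow>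
   act F (Cmp C g f) x = act F g (act F f x)"
  by (simp add: functor_comp sf_hom)

definition set_functor :: "('o, 'm) cat \<Rightarrow> ('o \<Rightarrow> 'u set) \<Rightarrow> ('m \<Rightarrow> 'u \<Rightarrow> 'u) \<Rightarrow> ('o, 'm, 'u set, 'u smap) ftor" where
  "set_functor C S \<phi> = \<lparr>omap = (\<lambda>a\<in>Ob C. S a),
     amap = (\<lambda>f\<in>Ar C. \<lparr>sdom = S (Dom C f), scod = S (Cod C f), sfun = (\<lambda>x\<in>S (Dom C f). \<phi> f x)\<rparr>)\<rparr>"

lemma set_functor_simps:
  "a \<in> Ob C \<Longrightarrow> omap (set_functor C S \<phi>) a = S a"
  "f \<in> homs C a b \<Longrightarrow> x \<in> S a \<Longrightarrow> act (set_functor C S \<phi>) f x = \<phi> f x"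
  by (auto simp: set_functor_def homs_def)

lemma functor_set_functor:
  assumes C: "category C" and S: "\<And>a. a \<in> Ob C \<Longrightarrow> small (S a)"
    and \<phi>: "\<And>f a b x. f \<in> homs C a b \<Longrightarrow> x \<in> S a \<Longrightarrow> \<phi> f x \<in> S b"
    and id: "\<And>a x. a \<in> Ob C \<Longrightarrow> x \<in> S a \<Longrightarrow> \<phi> (Idt C a) x = x"
    and comp: "\<And>f g a b c x. f \<in> homs C a b \<Longrightarrow> g \<in> homs C b c \<Longrightarrow> x \<in> S a \<Longrightarrow> \<phi> (Cmp C g f) x = \<phi> g (\<phi> f x)"
  shows "is_functor C set_cat (set_functor C S \<phi>)"
proof (rule functorI[OF C category_set_cat])
  let ?F = "set_functor C S \<phi>"
  show "omap ?F \<in> extensional (Ob C)" "amap ?F \<in> extensional (Ar C)"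
    by (simp_all add: set_functor_def)
  show "omap ?F a \<in> Ob set_cat" if "a \<in> Ob C" for a
    using that S by (simp add: set_functor_simps)
  show hom: "amap ?F f \<in> homs set_cat (omap ?F a) (omap ?F b)" if f: "f \<in> homs C a b" for f a b
    using S cat_hom_ob[OF C f] \<phi>[OF f] homsD[OF f] by (auto simp: set_hom_iff set_functor_def)
  show "amap ?F (Idt C a) = Idt set_cat (omap ?F a)" if a: "a \<in> Ob C" for a
  proof (rule set_hom_eqI[OF hom[OF cat_id[OF C a]] cat_id[OF category_set_cat]])
    show "act ?F (Idt C a) x = sfun (Idt set_cat (omap ?F a)) x" if "x \<in> omap ?F a" for x
      using that a id cat_id[OF C a] by (simp add: set_functor_simps)
  qed (use S a in \<open>simp add: set_functor_simps\<close>)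
  show "amap ?F (Cmp C g f) = Cmp set_cat (amap ?F g) (amap ?F f)"
    if f: "f \<in> homs C a b" and g: "g \<in> homs C b c" for f g a b c
  proof (rule set_hom_eqI[OF hom[OF cat_comp[OF C f g]] cat_comp[OF category_set_cat hom[OF f] hom[OF g]]])
    fix x assume x: "x \<in> omap ?F a"
    then have "x \<in> S a" using cat_hom_ob[OF C f] by (simp add: set_functor_simps)
    then show "act ?F (Cmp C g f) x = sfun (Cmp set_cat (amap ?F g) (amap ?F f)) x"
      using x hom[OF f] \<phi>[OF f] comp[OF f g]
      by (simp add: set_functor_simps(2)[OF f] set_functor_simps(2)[OF g] set_functor_simps(2)[OF cat_comp[OF C f g]] set_hom_iff)
  qed
qed

text \<open>The elements of \<open>S\<close> may have any type. They are carried into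
  \<open>'u\<close> by an injection \<open>e a\<close> for each object, and later constructions
  compute with \<open>S\<close> and \<open>e\<close> only, never with the codes.\<close>

lemma ex_set_functor:
  fixes S :: "'o \<Rightarrow> 'x set"
  assumes C: "category C" and S: "\<And>a. a \<in> Ob C \<Longrightarrow> S a \<prec> (UNIV :: 'u set)"
    and \<phi>: "\<And>f a b x. f \<in> homs C a b \<Longrightarrow> x \<in> S a \<Longrightarrow> \<phi> f x \<in> S b"
    and id: "\<And>a x. a \<in> Ob C \<Longrightarrow> x \<in> S a \<Longrightarrow> \<phi> (Idt C a) x = x"
    and comp: "\<And>f g a b c x. f \<in> homs C a b \<Longrightarrow> g \<in> homs C b c \<Longrightarrow> x \<in> S a \<Longrightarrow> \<phi> (Cmp C g f) x = \<phi> g (\<phi> f x)"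
  shows "\<exists>(F :: ('o, 'm, 'u set, 'u smap) ftor) (e :: 'o \<Rightarrow> 'x \<Rightarrow> 'u). is_functor C set_cat F \<and>
    (\<forall>a\<in>Ob C. bij_betw (e a) (S a) (omap F a)) \<and>
    (\<forall>a b. \<forall>f\<in>homs C a b. \<forall>x\<in>S a. act F f (e a x) = e b (\<phi> f x))"
proof -
  have "\<forall>a\<in>Ob C. \<exists>e :: 'x \<Rightarrow> 'u. inj_on e (S a) \<and> small (e ` S a)"
    using S lesspoll_encode by metis
  then obtain e :: "'o \<Rightarrow> 'x \<Rightarrow> 'u" where e: "\<And>a. a \<in> Ob C \<Longrightarrow> inj_on (e a) (S a)"
    "\<And>a. a \<in> Ob C \<Longrightarrow> small (e a ` S a)"
    by metis
  define \<psi> where "\<psi> f k = e (Cod C f) (\<phi> f (inv_into (S (Dom C f)) (e (Dom C f)) k))" for f k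
  have \<psi>: "\<psi> f (e a x) = e b (\<phi> f x)" if "f \<in> homs C a b" "x \<in> S a" for f a b x
    using that e(1)[OF cat_hom_ob(1)[OF C that(1)]] by (simp add: \<psi>_def homs_def)
  let ?F = "set_functor C (\<lambda>a. e a ` S a) \<psi>"
  have "is_functor C set_cat ?F"
  proof (rule functor_set_functor[OF C e(2)])
    show "\<psi> f k \<in> e b ` S b" if "f \<in> homs C a b" "k \<in> e a ` S a" for f a b k
      using that \<psi>[OF that(1)] \<phi>[OF that(1)] by auto
    show "\<psi> (Idt C a) k = k" if "a \<in> Ob C" "k \<in> e a ` S a" for a k
      using that \<psi>[OF cat_id[OF C that(1)]] id[OF that(1)] by auto
    show "\<psi> (Cmp C g f) k = \<psi> g (\<psi> f k)" if f: "f \<in> homs C a b" and g: "g \<in> homs C b c" and k: "k \<in> e a ` S a"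
      for f g a b c k
    proof -
      obtain x where x: "x \<in> S a" "k = e a x" using k by auto
      show ?thesis
        using \<psi>[OF cat_comp[OF C f g] x(1)] \<psi>[OF f x(1)] \<psi>[OF g \<phi>[OF f x(1)]] comp[OF f g x(1)] x(2) by simp
    qed
  qed
  moreover have "bij_betw (e a) (S a) (omap ?F a)" if "a \<in> Ob C" for a
    using e(1)[OF that] that by (simp add: bij_betw_def set_functor_simps)
  moreover have "act ?F f (e a x) = e b (\<phi> f x)" if "f \<in> homs C a b" "x \<in> S a" for f a b x
    using \<psi>[OF that] that set_functor_simps(2)[OF that(1), of "e a x" "\<lambda>a. e a ` S a"] by simp
  ultimately show ?thesis by blast
qed

section \<open>Transformations of set-valued functors, elementwise\<close>

lemma snt_fun:
  assumes "\<tau> \<in> homs (fun_cat C set_cat) F G" "a \<in> Ob C"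
  shows "sdom (ncomp \<tau> a) = omap F a" "scod (ncomp \<tau> a) = omap G a" "sfun (ncomp \<tau> a) \<in> omap F a \<rightarrow>\<^sub>E omap G a"
  using nt_homD(4)[OF assms] by (simp_all add: set_hom_iff)

lemma snt_in:
  "\<tau> \<in> homs (fun_cat C set_cat) F G \<Longrightarrow> a \<in> Ob C \<Longrightarrow> x \<in> omap F a \<Longrightarrow> app \<tau> a x \<in> omap G a"
  by (rule PiE_mem[OF snt_fun(3)])

lemma snt_nat:
  assumes \<tau>: "\<tau> \<in> homs (fun_cat C set_cat) F G" and f: "f \<in> homs C a b" and x: "x \<in> omap F a"
  shows "app \<tau> b (act F f x) = act G f (app \<tau> a x)"
proof -
  note t = nt_homD[OF \<tau>]
  have "a \<in> Ob C" using cat_hom_ob[OF functor_cat(1)[OF t(1)] f] by simp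
  then have "sfun (Cmp set_cat (ncomp \<tau> b) (amap F f)) x = app \<tau> b (act F f x)"
    "sfun (Cmp set_cat (amap G f) (ncomp \<tau> a)) x = act G f (app \<tau> a x)"
    using x snt_fun(1)[OF \<tau>] sf_hom[OF t(1) f] by simp_all
  then show ?thesis using t(5)[OF f] by simp
qed

lemma snt_eqI:
  assumes "\<tau> \<in> homs (fun_cat C set_cat) F G" "\<sigma> \<in> homs (fun_cat C set_cat) F G"
    and "\<And>a x. a \<in> Ob C \<Longrightarrow> x \<in> omap F a \<Longrightarrow> app \<tau> a x = app \<sigma> a x"
  shows "\<tau> = \<sigma>"
  using assms by (intro nt_hom_eqI[OF assms(1,2)] set_hom_eqI[OF nt_homD(4)[OF assms(1)] nt_homD(4)[OF assms(2)]])

lemma snt_comp: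
  assumes "\<tau> \<in> homs (fun_cat C set_cat) F G" "a \<in> Ob C" "x \<in> omap F a"
  shows "app (Cmp (fun_cat C set_cat) \<sigma> \<tau>) a x = app \<sigma> a (app \<tau> a x)"
  using assms snt_fun(1)[OF assms(1,2)] by simp

lemma snt_id: "a \<in> Ob C \<Longrightarrow> x \<in> omap F a \<Longrightarrow> app (Idt (fun_cat C set_cat) F) a x = x"
  by simp

definition set_nt ::
  "('o, 'm) cat \<Rightarrow> ('o, 'm, 'u set, 'u smap) ftor \<Rightarrow> ('o, 'm, 'u set, 'u smap) ftor \<Rightarrow> ('o \<Rightarrow> 'u \<Rightarrow> 'u) \<Rightarrow>
   ('o, 'm, 'u set, 'u smap) ntrans" where
  "set_nt C F G \<psi> = \<lparr>nsrc = F, ntgt = G,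
     ncomp = (\<lambda>a\<in>Ob C. \<lparr>sdom = omap F a, scod = omap G a, sfun = (\<lambda>x\<in>omap F a. \<psi> a x)\<rparr>)\<rparr>"

lemma set_nt_app: "a \<in> Ob C \<Longrightarrow> x \<in> omap F a \<Longrightarrow> app (set_nt C F G \<psi>) a x = \<psi> a x"
  by (simp add: set_nt_def)

lemma snt_homI:
  assumes F: "is_functor C set_cat F" and G: "is_functor C set_cat G"
    and src: "nsrc \<tau> = F" "ntgt \<tau> = G" "ncomp \<tau> \<in> extensional (Ob C)"
    and dom: "\<And>a. a \<in> Ob C \<Longrightarrow> sdom (ncomp \<tau> a) = omap F a" "\<And>a. a \<in> Ob C \<Longrightarrow> scod (ncomp \<tau> a) = omap G a"
    and ext: "\<And>a. a \<in> Ob C \<Longrightarrow> sfun (ncomp \<tau> a) \<in> extensional (omap F a)"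
    and app: "\<And>a x. a \<in> Ob C \<Longrightarrow> x \<in> omap F a \<Longrightarrow> app \<tau> a x \<in> omap G a"
    and nat: "\<And>f a b x. f \<in> homs C a b \<Longrightarrow> x \<in> omap F a \<Longrightarrow> app \<tau> b (act F f x) = act G f (app \<tau> a x)"
  shows "\<tau> \<in> homs (fun_cat C set_cat) F G"
proof (rule nt_homI[OF F G src(3) src(1,2)])
  note C = functor_cat(1)[OF F]
  show h: "ncomp \<tau> a \<in> homs set_cat (omap F a) (omap G a)" if "a \<in> Ob C" for a
    using that dom ext app sf_small[OF F] sf_small[OF G] by (auto simp: set_hom_iff PiE_def)
  show "Cmp set_cat (ncomp \<tau> b) (amap F f) = Cmp set_cat (amap G f) (ncomp \<tau> a)" if f: "f \<in> homs C a b" for f a b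
  proof (rule set_hom_eqI)
    note ob = cat_hom_ob[OF C f]
    show "Cmp set_cat (ncomp \<tau> b) (amap F f) \<in> homs set_cat (omap F a) (omap G b)"
      by (rule cat_comp[OF category_set_cat functor_hom[OF F f] h[OF ob(2)]])
    show "Cmp set_cat (amap G f) (ncomp \<tau> a) \<in> homs set_cat (omap F a) (omap G b)"
      by (rule cat_comp[OF category_set_cat h[OF ob(1)] functor_hom[OF G f]])
    show "sfun (Cmp set_cat (ncomp \<tau> b) (amap F f)) x = sfun (Cmp set_cat (amap G f) (ncomp \<tau> a)) x"
      if "x \<in> omap F a" for x
      using that nat[OF f that] ob dom sf_hom[OF F f] by simp
  qed
qed

lemma set_nt_hom:
  assumes "is_functor C set_cat F" "is_functor C set_cat G"
    and "\<And>a x. a \<in> Ob C \<Longrightarrow> x \<in> omap F a \<Longrightarrow> \<psi> a x \<in> omap G a"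
    and "\<And>f a b x. f \<in> homs C a b \<Longrightarrow> x \<in> omap F a \<Longrightarrow> \<psi> b (act F f x) = act G f (\<psi> a x)"
  shows "set_nt C F G \<psi> \<in> homs (fun_cat C set_cat) F G"
proof (rule snt_homI[OF assms(1,2)])
  show "app (set_nt C F G \<psi>) b (act F f x) = act G f (app (set_nt C F G \<psi>) a x)"
    if "f \<in> homs C a b" "x \<in> omap F a" for f a b x
    using that assms(4)[OF that] cat_hom_ob[OF functor_cat(1)[OF assms(1)] that(1)] sf_act[OF assms(1) that]
    by (simp add: set_nt_app)
qed (use assms(3) in \<open>auto simp: set_nt_app\<close>, auto simp: set_nt_def)

lemma snt_iso:
  assumes \<tau>: "\<tau> \<in> homs (fun_cat C set_cat) F G" and bij: "\<And>a. a \<in> Ob C \<Longrightarrow> bij_betw (sfun (ncomp \<tau> a)) (omap F a) (omap G a)"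
  obtains \<sigma> where "\<sigma> \<in> homs (fun_cat C set_cat) G F" "inverse_arrows (fun_cat C set_cat) \<tau> \<sigma>"
proof -
  note t = nt_homD[OF \<tau>]
  note C = functor_cat(1)[OF t(1)]
  define \<psi> where "\<psi> a = inv_into (omap F a) (sfun (ncomp \<tau> a))" for a
  have \<psi>: "\<psi> a y \<in> omap F a" "app \<tau> a (\<psi> a y) = y" if "a \<in> Ob C" "y \<in> omap G a" for a y
    using bij_betwE[OF bij_betw_inv_into[OF bij[OF that(1)]]] bij_betw_inv_into_right[OF bij[OF that(1)]] that(2)
    by (auto simp: \<psi>_def)
  have \<psi>': "\<psi> a (app \<tau> a x) = x" if "a \<in> Ob C" "x \<in> omap F a" for a x
    using bij_betw_inv_into_left[OF bij[OF that(1)] that(2)] by (simp add: \<psi>_def)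
  let ?s = "set_nt C G F \<psi>"
  have s: "?s \<in> homs (fun_cat C set_cat) G F"
  proof (rule set_nt_hom[OF t(2,1) \<psi>(1)])
    fix f a b y assume f: "f \<in> homs C a b" and y: "y \<in> omap G a"
    note ob = cat_hom_ob[OF C f]
    have "\<psi> b (act G f y) = \<psi> b (act G f (app \<tau> a (\<psi> a y)))"
      using \<psi>(2)[OF ob(1) y] by simp
    also have "\<dots> = \<psi> b (app \<tau> b (act F f (\<psi> a y)))"
      using snt_nat[OF \<tau> f \<psi>(1)[OF ob(1) y]] by simp
    also have "\<dots> = act F f (\<psi> a y)"
      by (rule \<psi>'[OF ob(2) sf_act[OF t(1) f \<psi>(1)[OF ob(1) y]]])
    finally show "\<psi> b (act G f y) = act F f (\<psi> a y)" .
  qed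
  note FC = category_fun_cat[OF C category_set_cat]
  have "inverse_arrows (fun_cat C set_cat) \<tau> ?s"
  proof (rule inverse_arrowsI[OF \<tau> s])
    show "Cmp (fun_cat C set_cat) ?s \<tau> = Idt (fun_cat C set_cat) F"
      using \<psi>' snt_in[OF \<tau>] t(1)
      by (intro snt_eqI[OF cat_comp[OF FC \<tau> s] cat_id[OF FC]]) (auto simp: snt_comp[OF \<tau>] set_nt_app simp del: fun_cat_simps(10))
    show "Cmp (fun_cat C set_cat) \<tau> ?s = Idt (fun_cat C set_cat) G"
      using \<psi> t(2)
      by (intro snt_eqI[OF cat_comp[OF FC s \<tau>] cat_id[OF FC]]) (auto simp: snt_comp[OF s] set_nt_app simp del: fun_cat_simps(10))
  qed
  with s show thesis by (rule that)
qed


section \<open>Presheaves\<close>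

abbreviation psh :: "('u, 'u) cat \<Rightarrow> 'u psh \<Rightarrow> bool" where
  "psh A X \<equiv> is_functor (op_cat A) set_cat X"

lemma PSh_ob [simp]: "X \<in> Ob (PSh A) \<longleftrightarrow> psh A X"
  by (simp add: PSh_def)

lemma category_PSh: "category A \<Longrightarrow> category (PSh A)"
  unfolding PSh_def by (intro category_fun_cat category_op_cat category_set_cat)

lemma psh_small: "psh A X \<Longrightarrow> a \<in> Ob A \<Longrightarrow> small (omap X a)"
  using sf_small[of "op_cat A" X a] by simp

lemma psh_act: "psh A X \<Longrightarrow> f \<in> homs A a b \<Longrightarrow> x \<in> omap X b \<Longrightarrow> act X f x \<in> omap X a"
  using sf_act[of "op_cat A" X f b a x] by simp

lemma psh_id: "psh A X \<Longrightarrow> a \<in> Ob A \<Longrightarrow> x \<in> omap X a \<Longrightarrow> act X (Idt A a) x = x"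
  using sf_id[of "op_cat A" X a x] by simp

lemma psh_comp:
  "psh A X \<Longrightarrow> f \<in> homs A a b \<Longrightarrow> g \<in> homs A b c \<Longrightarrow> x \<in> omap X c \<Longrightarrow>
   act X (Cmp A g f) x = act X f (act X g x)"
  using sf_comp[of "op_cat A" X g c b f a x] by simp

lemma psh_in: "\<tau> \<in> homs (PSh A) X Y \<Longrightarrow> a \<in> Ob A \<Longrightarrow> x \<in> omap X a \<Longrightarrow> app \<tau> a x \<in> omap Y a"
  using snt_in[of \<tau> "op_cat A" X Y a x] by (simp add: PSh_def)

lemma psh_nat:
  "\<tau> \<in> homs (PSh A) X Y \<Longrightarrow> f \<in> homs A a b \<Longrightarrow> x \<in> omap X b \<Longrightarrow> app \<tau> a (act X f x) = act Y f (app \<tau> b x)"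
  using snt_nat[of \<tau> "op_cat A" X Y f b a x] by (simp add: PSh_def)

lemma psh_eqI:
  assumes "\<tau> \<in> homs (PSh A) X Y" "\<sigma> \<in> homs (PSh A) X Y"
    and "\<And>a x. a \<in> Ob A \<Longrightarrow> x \<in> omap X a \<Longrightarrow> app \<tau> a x = app \<sigma> a x"
  shows "\<tau> = \<sigma>"
  using assms snt_eqI[of \<tau> "op_cat A" X Y \<sigma>] by (simp add: PSh_def)

lemma psh_cmp:
  "\<tau> \<in> homs (PSh A) X Y \<Longrightarrow> a \<in> Ob A \<Longrightarrow> x \<in> omap X a \<Longrightarrow>
   app (Cmp (PSh A) \<sigma> \<tau>) a x = app \<sigma> a (app \<tau> a x)"
  using snt_comp[of \<tau> "op_cat A" X Y a x \<sigma>] by (simp add: PSh_def)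

lemma psh_idt: "a \<in> Ob A \<Longrightarrow> x \<in> omap X a \<Longrightarrow> app (Idt (PSh A) X) a x = x"
  using snt_id[of a "op_cat A" x X] by (simp add: PSh_def)

lemma psh_hom_ob:
  assumes "\<tau> \<in> homs (PSh A) X Y"
  shows "psh A X" "psh A Y"
  using assms nt_homD(1,2)[of \<tau> "op_cat A" set_cat X Y] by (simp_all add: PSh_def)

definition psh_nt :: "('u, 'u) cat \<Rightarrow> 'u psh \<Rightarrow> 'u psh \<Rightarrow> ('u \<Rightarrow> 'u \<Rightarrow> 'u) \<Rightarrow> 'u psh_map" where
  "psh_nt A = set_nt (op_cat A)"

lemma psh_nt_app: "a \<in> Ob A \<Longrightarrow> x \<in> omap X a \<Longrightarrow> app (psh_nt A X Y \<psi>) a x = \<psi> a x"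
  by (simp add: psh_nt_def set_nt_app)

lemma psh_nt_hom:
  assumes "psh A X" "psh A Y"
    and "\<And>a x. a \<in> Ob A \<Longrightarrow> x \<in> omap X a \<Longrightarrow> \<psi> a x \<in> omap Y a"
    and "\<And>f a b x. f \<in> homs A a b \<Longrightarrow> x \<in> omap X b \<Longrightarrow> \<psi> a (act X f x) = act Y f (\<psi> b x)"
  shows "psh_nt A X Y \<psi> \<in> homs (PSh A) X Y"
  unfolding PSh_def psh_nt_def by (rule set_nt_hom) (use assms in auto)

lemma ex_psh:
  fixes S :: "'u \<Rightarrow> 'x set" and A :: "('u, 'u) cat"
  assumes A: "category A" and S: "\<And>a. a \<in> Ob A \<Longrightarrow> S a \<prec> (UNIV :: 'u set)"
    and \<phi>: "\<And>f a b x. f \<in> homs A a b \<Longrightarrow> x \<in> S b \<Longrightarrow> \<phi> f x \<in> S a"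
    and id: "\<And>a x. a \<in> Ob A \<Longrightarrow> x \<in> S a \<Longrightarrow> \<phi> (Idt A a) x = x"
    and comp: "\<And>f g a b c x. f \<in> homs A a b \<Longrightarrow> g \<in> homs A b c \<Longrightarrow> x \<in> S c \<Longrightarrow> \<phi> (Cmp A g f) x = \<phi> f (\<phi> g x)"
  shows "\<exists>(X :: 'u psh) (e :: 'u \<Rightarrow> 'x \<Rightarrow> 'u). psh A X \<and>
    (\<forall>a\<in>Ob A. bij_betw (e a) (S a) (omap X a)) \<and>
    (\<forall>b a. \<forall>f\<in>homs A a b. \<forall>x\<in>S b. act X f (e b x) = e a (\<phi> f x))"
proof -
  have "\<exists>(X :: 'u psh) (e :: 'u \<Rightarrow> 'x \<Rightarrow> 'u). psh A X \<and>
    (\<forall>a\<in>Ob (op_cat A). bij_betw (e a) (S a) (omap X a)) \<and>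
    (\<forall>b a. \<forall>f\<in>homs (op_cat A) b a. \<forall>x\<in>S b. act X f (e b x) = e a (\<phi> f x))"
  proof (rule ex_set_functor[OF category_op_cat[OF A]])
    show "\<phi> (Cmp (op_cat A) g f) x = \<phi> g (\<phi> f x)"
      if "f \<in> homs (op_cat A) a b" "g \<in> homs (op_cat A) b c" "x \<in> S a" for f g a b c x
      using that by (simp add: comp[of g c b f a x])
  qed (use S \<phi> id in auto)
  then show ?thesis by simp
qed

lemma psh_iso:
  assumes \<tau>: "\<tau> \<in> homs (PSh A) X Y" and bij: "\<And>a. a \<in> Ob A \<Longrightarrow> bij_betw (sfun (ncomp \<tau> a)) (omap X a) (omap Y a)"
  obtains \<sigma> where "\<sigma> \<in> homs (PSh A) Y X" "inverse_arrows (PSh A) \<tau> \<sigma>"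
  using snt_iso[of \<tau> "op_cat A" X Y thesis] assms that by (simp add: PSh_def)

text \<open>Recognizing this shape lets \<open>functor_set_functor\<close> prove that representables
  are presheaves.\<close>

lemma yoneda_ob_set_functor:
  "yoneda_ob A a = set_functor (op_cat A) (\<lambda>c. homs A c a) (\<lambda>f h. Cmp A h f)"
  by (simp add: yoneda_ob_def set_functor_def)

section \<open>Boolean kits and stabilized presheaves\<close>

text \<open>The inverse operation of the monoid record is replaced by two-sided inverses in
  \<open>C\<close>. This description is symmetric under reversing composition, which makes the
  subgroups of \<open>A\<close> and of its opposite comparable.\<close>

lemma subgroup_End_iff:
  assumes C: "category C" and iso: "\<And>f. f \<in> Ar C \<Longrightarrow> is_iso C f" and a: "a \<in> Ob C"
  shows "subgroup H (End_group C a) \<longleftrightarrow> H \<subseteq> homs C a a \<and> Idt C a \<in> H \<and>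
    (\<forall>f\<in>H. \<forall>g\<in>H. Cmp C g f \<in> H) \<and> (\<forall>f\<in>H. \<exists>g\<in>H. Cmp C g f = Idt C a \<and> Cmp C f g = Idt C a)"
    (is "_ \<longleftrightarrow> ?R")
proof -
  let ?G = "End_group C a"
  have simps [simp]: "carrier ?G = homs C a a" "x \<otimes>\<^bsub>?G\<^esub> y = Cmp C x y" "\<one>\<^bsub>?G\<^esub> = Idt C a" for x y
    by (simp_all add: End_group_def)
  interpret group ?G
  proof (rule groupI)
    show "x \<otimes>\<^bsub>?G\<^esub> y \<otimes>\<^bsub>?G\<^esub> z = x \<otimes>\<^bsub>?G\<^esub> (y \<otimes>\<^bsub>?G\<^esub> z)"
      if "x \<in> carrier ?G" "y \<in> carrier ?G" "z \<in> carrier ?G" for x y z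
      using that cat_assoc[OF C, of z a a y a x a] by simp
    show "\<exists>y\<in>carrier ?G. y \<otimes>\<^bsub>?G\<^esub> x = \<one>\<^bsub>?G\<^esub>" if x: "x \<in> carrier ?G" for x
      using iso[of x] x inverse_arrowsD[of C x _ a a] by (auto simp: is_iso_def dest: homsD)
  qed (use cat_comp[OF C] cat_id[OF C a] cat_id_left[OF C] in auto)
  show ?thesis
  proof
    assume "subgroup H ?G"
    then interpret subgroup H ?G .
    have "\<exists>g\<in>H. Cmp C g f = Idt C a \<and> Cmp C f g = Idt C a" if f: "f \<in> H" for f
      using l_inv[of f] r_inv[of f] mem_carrier[OF f] m_inv_closed[OF f] by auto
    then show ?R
      using subset one_closed m_closed by simp
  next
    assume R: ?R
    show "subgroup H ?G"
    proof (rule subgroupI)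
      show "inv\<^bsub>?G\<^esub> f \<in> H" if f: "f \<in> H" for f
      proof -
        obtain g where g: "g \<in> H" "Cmp C g f = Idt C a" using R f by blast
        then have "inv\<^bsub>?G\<^esub> f = g" using R f by (intro inv_equality) auto
        with g show ?thesis by simp
      qed
    qed (use R in auto)
  qed
qed

locale kit_groupoid =
  fixes A :: "('u, 'u) cat" and \<A> :: "'u kit"
  assumes U: "set_universe TYPE('u)" and A: "small_groupoid A" and K: "boolean_kit A \<A>"
begin

lemma cat: "category A" and small_Ob: "small (Ob A)" and small_Ar: "small (Ar A)"
  and iso: "f \<in> Ar A \<Longrightarrow> is_iso A f"
  using A by (auto simp: small_groupoid_def small_cat_def)

abbreviation StP where "StP \<equiv> StPSh A \<A>"

definition ginv :: "'u \<Rightarrow> 'u" where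
  "ginv f = (SOME g. inverse_arrows A f g)"

lemma ginv:
  assumes "f \<in> homs A a b"
  shows "ginv f \<in> homs A b a" "Cmp A (ginv f) f = Idt A a" "Cmp A f (ginv f) = Idt A b"
proof -
  have "inverse_arrows A f (ginv f)"
    using iso[OF homsD(1)[OF assms]] unfolding is_iso_def ginv_def by (rule someI_ex)
  from inverse_arrowsD[OF this assms] show "ginv f \<in> homs A b a" "Cmp A (ginv f) f = Idt A a" "Cmp A f (ginv f) = Idt A b" .
qed

lemma End_iff:
  "a \<in> Ob A \<Longrightarrow> subgroup H (End_group A a) \<longleftrightarrow> H \<subseteq> homs A a a \<and> Idt A a \<in> H \<and>
    (\<forall>f\<in>H. \<forall>g\<in>H. Cmp A g f \<in> H) \<and> (\<forall>f\<in>H. \<exists>g\<in>H. Cmp A g f = Idt A a \<and> Cmp A f g = Idt A a)"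
  using subgroup_End_iff[OF cat iso] .

text \<open>None of the closure conditions changes when the order of composition is
  reversed.\<close>

lemma op_End_iff: "a \<in> Ob A \<Longrightarrow> subgroup H (End_group (op_cat A) a) \<longleftrightarrow> subgroup H (End_group A a)"
proof -
  assume a: "a \<in> Ob A"
  have "is_iso (op_cat A) f" if "f \<in> Ar (op_cat A)" for f
    using iso[of f] that by (auto simp: is_iso_def inverse_arrows_def)
  from subgroup_End_iff[OF category_op_cat[OF cat] this, of a] show ?thesis
    using a by (auto simp: End_iff)
qed

section \<open>Orthogonality in a Boolean kit\<close>

lemma kit_subgroup: "a \<in> Ob A \<Longrightarrow> H \<in> \<A> a \<Longrightarrow> subgroup H (End_group A a)"
  using K by (auto simp: boolean_kit_def kit_def)

lemma perp_iff:
  "a \<in> Ob A \<Longrightarrow> H \<in> kit_perp A \<A> a \<longleftrightarrow> subgroup H (End_group A a) \<and> (\<forall>G\<in>\<A> a. G \<inter> H = {Idt A a})"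
  by (simp add: kit_perp_def op_End_iff)

lemma kit_iff:
  "a \<in> Ob A \<Longrightarrow> H \<in> \<A> a \<longleftrightarrow> subgroup H (End_group A a) \<and> (\<forall>G\<in>kit_perp A \<A> a. G \<inter> H = {Idt A a})"
proof -
  assume "a \<in> Ob A"
  then have "\<A> a = kit_perp (op_cat A) (kit_perp A \<A>) a"
    using K unfolding boolean_kit_def by blast
  then have "H \<in> \<A> a \<longleftrightarrow> H \<in> kit_perp (op_cat A) (kit_perp A \<A>) a" by (rule arg_cong)
  also have "\<dots> \<longleftrightarrow> subgroup H (End_group A a) \<and> (\<forall>G\<in>kit_perp A \<A> a. G \<inter> H = {Idt A a})"
    unfolding kit_perp_def[of "op_cat A"] by simp
  finally show ?thesis .
qed

lemma perp_disjoint: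
  assumes "a \<in> Ob A" "\<alpha> \<in> \<Union>(\<A> a)" "\<alpha> \<in> \<Union>(kit_perp A \<A> a)"
  shows "\<alpha> = Idt A a"
proof -
  obtain G H where "G \<in> \<A> a" "H \<in> kit_perp A \<A> a" and \<alpha>: "\<alpha> \<in> G" "\<alpha> \<in> H"
    using assms by blast
  then have "G \<inter> H = {Idt A a}"
    using perp_iff[OF assms(1)] by blast
  with \<alpha> show ?thesis by blast
qed

text \<open>An element shared by \<open>H\<close> and an orthogonal subgroup lies both in a member
  of the kit and in a member of the orthogonal kit, so it is the identity. Hence \<open>H\<close>
  belongs to the double orthogonal, which is the kit.\<close>

lemma kitI:
  assumes a: "a \<in> Ob A" and H: "subgroup H (End_group A a)" and sub: "H \<subseteq> \<Union>(\<A> a)"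
  shows "H \<in> \<A> a"
proof -
  have "G \<inter> H = {Idt A a}" if G: "G \<in> kit_perp A \<A> a" for G
  proof -
    have "Idt A a \<in> G" "Idt A a \<in> H"
      using G H End_iff[OF a] perp_iff[OF a] by blast+
    moreover have "\<alpha> = Idt A a" if "\<alpha> \<in> G" "\<alpha> \<in> H" for \<alpha>
      using that sub G by (intro perp_disjoint[OF a]) auto
    ultimately show ?thesis by blast
  qed
  with H show ?thesis by (simp add: kit_iff[OF a])
qed

lemma trivial_subgroup: "a \<in> Ob A \<Longrightarrow> subgroup {Idt A a} (End_group A a)"
  using cat_id[OF cat] cat_id_left[OF cat cat_id[OF cat]] by (simp add: End_iff)

text \<open>The trivial subgroup is orthogonal to every subgroup. This apparently idle fact is what
  lets the second stabilization condition be applied with \<beta> an identity.\<close>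

lemma id_perp: "a \<in> Ob A \<Longrightarrow> Idt A a \<in> \<Union>(kit_perp A \<A> a)"
proof -
  assume a: "a \<in> Ob A"
  have "{Idt A a} \<in> kit_perp A \<A> a"
    unfolding perp_iff[OF a] using trivial_subgroup[OF a] kit_subgroup[OF a] End_iff[OF a] by blast
  then show ?thesis by blast
qed

lemma id_kit: "a \<in> Ob A \<Longrightarrow> Idt A a \<in> \<Union>(\<A> a)"
proof -
  assume a: "a \<in> Ob A"
  have "{Idt A a} \<in> \<A> a"
    unfolding kit_iff[OF a] using trivial_subgroup[OF a] perp_iff[OF a] End_iff[OF a] by blast
  then show ?thesis by blast
qed

text \<open>Stabilizers of points in a quotient of a representable are conjugates of elements of the
  subgroup; this keeps them in the kit.\<close>

lemma kit_conj:
  assumes f: "f \<in> homs A a b" and h: "h \<in> \<Union>(\<A> b)"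
  shows "Cmp A (ginv f) (Cmp A h f) \<in> \<Union>(\<A> a)"
proof -
  obtain H where H: "H \<in> \<A> b" "h \<in> H" using h by blast
  note fi = ginv[OF f]
  have "inverse_arrows A (ginv f) f"
    by (rule inverse_arrowsI[OF fi(1) f fi(3,2)])
  moreover have "\<forall>f g. inverse_arrows A f g \<longrightarrow> (\<forall>H\<in>\<A> (Dom A f). (\<lambda>h. Cmp A f (Cmp A h g)) ` H \<in> \<A> (Cod A f))"
    using K unfolding boolean_kit_def kit_def by blast
  ultimately have "(\<lambda>h. Cmp A (ginv f) (Cmp A h f)) ` H \<in> \<A> a"
    using H(1) homsD[OF fi(1)] by auto
  with H(2) show ?thesis by blast
qed

section \<open>Stabilizers and stabilized presheaves\<close>

lemma stabilizer_subgroup: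
  assumes X: "psh A X" and a: "a \<in> Ob A" and x: "x \<in> omap X a"
  shows "subgroup (psh_stabilizer A X a x) (End_group A a)"
  unfolding End_iff[OF a] psh_stabilizer_def
proof (intro conjI ballI)
  show "Idt A a \<in> {\<alpha> \<in> homs A a a. act X \<alpha> x = x}"
    using cat_id[OF cat a] psh_id[OF X a x] by simp
  fix f assume f: "f \<in> {\<alpha> \<in> homs A a a. act X \<alpha> x = x}"
  then have fh: "f \<in> homs A a a" by simp
  show "Cmp A g f \<in> {\<alpha> \<in> homs A a a. act X \<alpha> x = x}" if "g \<in> {\<alpha> \<in> homs A a a. act X \<alpha> x = x}" for g
    using that f cat_comp[OF cat fh] psh_comp[OF X fh, of g a x] x by auto
  have "act X (ginv f) x = act X (ginv f) (act X f x)" using f by simp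
  also have "\<dots> = x"
    using psh_comp[OF X ginv(1)[OF fh] fh x] ginv(3)[OF fh] psh_id[OF X a x] by simp
  finally show "\<exists>g\<in>{\<alpha> \<in> homs A a a. act X \<alpha> x = x}. Cmp A g f = Idt A a \<and> Cmp A f g = Idt A a"
    using ginv[OF fh] by blast
qed auto

text \<open>The stabilizer only has to be covered by members of the kit, each element by a member of
  its own. By \<open>kitI\<close> this already makes the whole stabilizer a member, and the
  elementwise form is the one that passes along maps.\<close>

definition st :: "'u psh \<Rightarrow> bool" where
  "st X \<longleftrightarrow> psh A X \<and>
     (\<forall>a\<in>Ob A. \<forall>x\<in>omap X a. \<forall>\<alpha>\<in>homs A a a. act X \<alpha> x = x \<longrightarrow> \<alpha> \<in> \<Union>(\<A> a))"

lemma StPSh_ob [simp]: "X \<in> Ob StP \<longleftrightarrow> st X"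
proof -
  have "psh_stabilizer A X a x \<in> \<A> a \<longleftrightarrow> (\<forall>\<alpha>\<in>homs A a a. act X \<alpha> x = x \<longrightarrow> \<alpha> \<in> \<Union>(\<A> a))"
    if "psh A X" "a \<in> Ob A" "x \<in> omap X a" for a x
    using kitI[OF that(2) stabilizer_subgroup[OF that]] unfolding psh_stabilizer_def by blast
  then show ?thesis
    by (auto simp: StPSh_def st_def)
qed

lemma st_psh: "st X \<Longrightarrow> psh A X"
  by (simp add: st_def)

lemma st_stab: "st X \<Longrightarrow> a \<in> Ob A \<Longrightarrow> x \<in> omap X a \<Longrightarrow> \<alpha> \<in> homs A a a \<Longrightarrow> act X \<alpha> x = x \<Longrightarrow> \<alpha> \<in> \<Union>(\<A> a)"
  unfolding st_def by blast

lemma StPSh_hom: "\<tau> \<in> homs StP X Y \<longleftrightarrow> \<tau> \<in> homs (PSh A) X Y \<and> st X \<and> st Y"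
  using StPSh_ob[of X] StPSh_ob[of Y] psh_hom_ob[of \<tau> A X Y] by (auto simp: StPSh_def)

lemma StPSh_simps [simp]: "Idt StP = Idt (PSh A)" "Cmp StP = Cmp (PSh A)"
  "Dom StP = nsrc" "Cod StP = ntgt"
  by (simp_all add: StPSh_def) (simp_all add: PSh_def)

lemma category_StPSh: "category StP"
  unfolding StPSh_def by (intro category_full_subcat category_PSh cat)

text \<open>Maps can only enlarge stabilizers: whatever fixes \<open>y\<close> also fixes its image,
  and the stabilizer of the image is covered by the kit.\<close>

lemma st_over:
  assumes \<tau>: "\<tau> \<in> homs (PSh A) Y X" and X: "st X"
  shows "st Y"
  unfolding st_def
proof (intro conjI ballI impI)
  show "psh A Y" by (rule psh_hom_ob(1)[OF \<tau>])
  fix a y \<alpha> assume "a \<in> Ob A" "y \<in> omap Y a" "\<alpha> \<in> homs A a a" "act Y \<alpha> y = y"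
  then show "\<alpha> \<in> \<Union>(\<A> a)"
    using psh_nat[OF \<tau>, of \<alpha> a a y] psh_in[OF \<tau>, of a y] by (intro st_stab[OF X, of a "app \<tau> a y"]) auto
qed

lemma StPSh_over: "\<tau> \<in> homs (PSh A) Y X \<Longrightarrow> st X \<Longrightarrow> \<tau> \<in> homs StP Y X"
  using st_over by (simp add: StPSh_hom)

text \<open>The product of presheaves projects to \<open>Y\<close>, so \<open>st_over\<close> makes
  it stabilized, and in a full subcategory it remains a product. Pairs are coded into
  \<open>'u\<close> by \<open>e\<close> and decoded by \<open>d\<close>.\<close>

lemma has_products_StPSh: "has_products StP"
  unfolding has_products_def
proof (intro ballI)
  fix Y Z assume "Y \<in> Ob StP" "Z \<in> Ob StP"
  then have Y: "st Y" and Z: "st Z" by simp_all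
  note Y' = st_psh[OF Y] and Z' = st_psh[OF Z]
  have "\<exists>(P :: 'u psh) (e :: 'u \<Rightarrow> 'u \<times> 'u \<Rightarrow> 'u). psh A P \<and>
    (\<forall>a\<in>Ob A. bij_betw (e a) (omap Y a \<times> omap Z a) (omap P a)) \<and>
    (\<forall>b a. \<forall>f\<in>homs A a b. \<forall>t\<in>omap Y b \<times> omap Z b. act P f (e b t) = e a (map_prod (act Y f) (act Z f) t))"
  proof (rule ex_psh[OF cat])
    show "omap Y a \<times> omap Z a \<prec> (UNIV :: 'u set)" if "a \<in> Ob A" for a
      using psh_small[OF Y' that] psh_small[OF Z' that] by (intro lesspoll_Sigma[OF U]) (simp_all add: small_def)
    show "map_prod (act Y f) (act Z f) x \<in> omap Y a \<times> omap Z a"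
      if "f \<in> homs A a b" "x \<in> omap Y b \<times> omap Z b" for f a b x
      using that psh_act[OF Y'] psh_act[OF Z'] by auto
    show "map_prod (act Y (Idt A a)) (act Z (Idt A a)) x = x" if "a \<in> Ob A" "x \<in> omap Y a \<times> omap Z a" for a x
      using that psh_id[OF Y'] psh_id[OF Z'] by auto
    show "map_prod (act Y (Cmp A g f)) (act Z (Cmp A g f)) x = map_prod (act Y f) (act Z f) (map_prod (act Y g) (act Z g) x)"
      if "f \<in> homs A a b" "g \<in> homs A b c" "x \<in> omap Y c \<times> omap Z c" for f g a b c x
      using that psh_comp[OF Y'] psh_comp[OF Z'] by auto
  qed
  then obtain P :: "'u psh" and e :: "'u \<Rightarrow> 'u \<times> 'u \<Rightarrow> 'u" where Pe: "psh A P \<and>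
    (\<forall>a\<in>Ob A. bij_betw (e a) (omap Y a \<times> omap Z a) (omap P a)) \<and>
    (\<forall>b a. \<forall>f\<in>homs A a b. \<forall>t\<in>omap Y b \<times> omap Z b. act P f (e b t) = e a (map_prod (act Y f) (act Z f) t))"
    by (elim exE) (rule that)
  then have P: "psh A P" by (rule conjunct1)
  have e: "bij_betw (e a) (omap Y a \<times> omap Z a) (omap P a)" if "a \<in> Ob A" for a
    using Pe that by blast
  have eact: "act P f (e b t) = e a (map_prod (act Y f) (act Z f) t)"
    if "f \<in> homs A a b" "t \<in> omap Y b \<times> omap Z b" for f a b t
    using Pe that by blast
  define d where "d a = inv_into (omap Y a \<times> omap Z a) (e a)" for a
  have d: "d a k \<in> omap Y a \<times> omap Z a" "e a (d a k) = k" if "a \<in> Ob A" "k \<in> omap P a" for a k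
    using bij_betwE[OF bij_betw_inv_into[OF e[OF that(1)]]] bij_betw_inv_into_right[OF e[OF that(1)]] that(2)
    by (auto simp: d_def)
  have de: "d a (e a t) = t" if "a \<in> Ob A" "t \<in> omap Y a \<times> omap Z a" for a t
    using bij_betw_inv_into_left[OF e[OF that(1)] that(2)] by (simp add: d_def)
  have ein: "e a t \<in> omap P a" if "a \<in> Ob A" "t \<in> omap Y a \<times> omap Z a" for a t
    using bij_betwE[OF e[OF that(1)]] that(2) by blast
  have dact: "d a (act P f k) = map_prod (act Y f) (act Z f) (d b k)" if f: "f \<in> homs A a b" and k: "k \<in> omap P b" for f a b k
  proof -
    note ob = cat_hom_ob[OF cat f]
    have "map_prod (act Y f) (act Z f) (d b k) \<in> omap Y a \<times> omap Z a"
      using d(1)[OF ob(2) k] psh_act[OF Y' f] psh_act[OF Z' f] by auto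
    then show ?thesis
      using eact[OF f d(1)[OF ob(2) k]] d(2)[OF ob(2) k] de[OF ob(1)] by simp
  qed
  define q r where "q = psh_nt A P Y (\<lambda>a k. fst (d a k))" and "r = psh_nt A P Z (\<lambda>a k. snd (d a k))"
  have qP: "q \<in> homs (PSh A) P Y"
    unfolding q_def by (rule psh_nt_hom[OF P Y']) (use d dact in \<open>auto simp: mem_Times_iff\<close>)
  have rP: "r \<in> homs (PSh A) P Z"
    unfolding r_def by (rule psh_nt_hom[OF P Z']) (use d dact in \<open>auto simp: mem_Times_iff\<close>)
  have q: "q \<in> homs StP P Y" and r: "r \<in> homs StP P Z"
    using StPSh_over qP rP Y Z by blast+
  have qapp: "app q a k = fst (d a k)" and rapp: "app r a k = snd (d a k)" if "a \<in> Ob A" "k \<in> omap P a" for a k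
    using that by (simp_all add: q_def r_def psh_nt_app)
  have "\<exists>!h. h \<in> homs StP W P \<and> Cmp StP q h = f \<and> Cmp StP r h = g"
    if "f \<in> homs StP W Y" "g \<in> homs StP W Z" for W f g
  proof -
    have f: "f \<in> homs (PSh A) W Y" and g: "g \<in> homs (PSh A) W Z" and W: "st W"
      using that by (simp_all add: StPSh_hom)
    note W' = st_psh[OF W]
    let ?h = "psh_nt A W P (\<lambda>a w. e a (app f a w, app g a w))"
    have h: "?h \<in> homs (PSh A) W P"
    proof (rule psh_nt_hom[OF W' P])
      show "e a (app f a (act W j x), app g a (act W j x)) = act P j (e b (app f b x, app g b x))"
        if j: "j \<in> homs A a b" and x: "x \<in> omap W b" for j a b x
      proof -
        have "b \<in> Ob A" using cat_hom_ob[OF cat j] by simp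
        then show ?thesis
          using eact[OF j, of "(app f b x, app g b x)"] psh_in[OF f _ x] psh_in[OF g _ x] psh_nat[OF f j x] psh_nat[OF g j x]
          by simp
      qed
    qed (use ein psh_in[OF f] psh_in[OF g] in auto)
    have happ: "app ?h a w = e a (app f a w, app g a w)" if "a \<in> Ob A" "w \<in> omap W a" for a w
      using that by (simp add: psh_nt_app)
    have "?h \<in> homs StP W P \<and> Cmp StP q ?h = f \<and> Cmp StP r ?h = g"
    proof (intro conjI)
      show "?h \<in> homs StP W P" using h W st_over[OF qP Y] by (simp add: StPSh_hom)
      have "Cmp (PSh A) q ?h = f"
        by (rule psh_eqI[OF cat_comp[OF category_PSh[OF cat] h qP] f])
           (use psh_in[OF f] psh_in[OF g] in \<open>simp add: psh_cmp[OF h] happ qapp ein de\<close>)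
      then show "Cmp StP q ?h = f" by simp
      have "Cmp (PSh A) r ?h = g"
        by (rule psh_eqI[OF cat_comp[OF category_PSh[OF cat] h rP] g])
           (use psh_in[OF f] psh_in[OF g] in \<open>simp add: psh_cmp[OF h] happ rapp ein de\<close>)
      then show "Cmp StP r ?h = g" by simp
    qed
    moreover have "h' = ?h" if h': "h' \<in> homs StP W P \<and> Cmp StP q h' = f \<and> Cmp StP r h' = g" for h'
    proof -
      have h'': "h' \<in> homs (PSh A) W P" using h' by (simp add: StPSh_hom)
      show ?thesis
      proof (rule psh_eqI[OF h'' h])
        fix a w assume a: "a \<in> Ob A" and w: "w \<in> omap W a"
        note k = psh_in[OF h'' a w]
        have "app f a w = fst (d a (app h' a w))" "app g a w = snd (d a (app h' a w))"
          using h' psh_cmp[OF h'' a w] qapp[OF a k] rapp[OF a k] by auto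
        then show "app h' a w = app ?h a w"
          using d(2)[OF a k] happ[OF a w] by simp
      qed
    qed
    ultimately show ?thesis by (rule ex1I)
  qed
  then show "\<exists>p. \<exists>q\<in>homs StP p Y. \<exists>r\<in>homs StP p Z. \<forall>w. \<forall>f\<in>homs StP w Y.
     \<forall>g\<in>homs StP w Z. \<exists>!h. h \<in> homs StP w p \<and> Cmp StP q h = f \<and> Cmp StP r h = g"
    using q r by (intro exI[of _ P] bexI[of _ q] bexI[of _ r] allI ballI)
qed

lemma StPSh_iso:
  assumes \<tau>: "\<tau> \<in> homs StP X Y"
    and bij: "\<And>a. a \<in> Ob A \<Longrightarrow> bij_betw (sfun (ncomp \<tau> a)) (omap X a) (omap Y a)"
  shows "is_iso StP \<tau>"
proof -
  have \<tau>': "\<tau> \<in> homs (PSh A) X Y" and st: "st X" "st Y" using \<tau> by (simp_all add: StPSh_hom)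
  obtain \<sigma> where \<sigma>: "\<sigma> \<in> homs (PSh A) Y X" "inverse_arrows (PSh A) \<tau> \<sigma>"
    using psh_iso[OF \<tau>' bij] .
  have "inverse_arrows StP \<tau> \<sigma>"
    using inverse_arrowsD[OF \<sigma>(2) \<tau>'] st \<sigma>(1) by (intro inverse_arrowsI[OF \<tau>]) (auto simp: StPSh_hom)
  then show ?thesis by (auto simp: is_iso_def)
qed

text \<open>Lifts are chosen element by element using \<open>ex\<close>; \<open>uniq\<close> makes
  the choice natural and the induced map unique.\<close>

lemma StPSh_pullback:
  assumes p: "p \<in> homs StP W X" and q: "q \<in> homs StP W Y"
    and f: "f \<in> homs StP X Z" and g: "g \<in> homs StP Y Z"
    and comm: "Cmp StP f p = Cmp StP g q"
    and ex: "\<And>a x y. a \<in> Ob A \<Longrightarrow> x \<in> omap X a \<Longrightarrow> y \<in> omap Y a \<Longrightarrow> app f a x = app g a y \<Longrightarrow>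
      \<exists>w\<in>omap W a. app p a w = x \<and> app q a w = y"
    and uniq: "\<And>a w w'. a \<in> Ob A \<Longrightarrow> w \<in> omap W a \<Longrightarrow> w' \<in> omap W a \<Longrightarrow> app p a w = app p a w' \<Longrightarrow>
      app q a w = app q a w' \<Longrightarrow> w = w'"
  shows "is_pullback StP p q f g"
proof (rule pullbackI[OF p q f g comm])
  have p': "p \<in> homs (PSh A) W X" and q': "q \<in> homs (PSh A) W Y" and W: "st W"
    using p q by (simp_all add: StPSh_hom)
  fix V i j assume i: "i \<in> homs StP V X" and j: "j \<in> homs StP V Y"
    and eq: "Cmp StP f i = Cmp StP g j"
  have i': "i \<in> homs (PSh A) V X" and j': "j \<in> homs (PSh A) V Y" and V: "st V"
    using i j by (simp_all add: StPSh_hom)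
  have "\<exists>w\<in>omap W a. app p a w = app i a v \<and> app q a w = app j a v" if "a \<in> Ob A" "v \<in> omap V a" for a v
    using that eq psh_cmp[OF i' that, of f] psh_cmp[OF j' that, of g] psh_in[OF i' that] psh_in[OF j' that]
    by (intro ex) auto
  then obtain u where u: "\<And>a v. a \<in> Ob A \<Longrightarrow> v \<in> omap V a \<Longrightarrow> u a v \<in> omap W a"
    "\<And>a v. a \<in> Ob A \<Longrightarrow> v \<in> omap V a \<Longrightarrow> app p a (u a v) = app i a v"
    "\<And>a v. a \<in> Ob A \<Longrightarrow> v \<in> omap V a \<Longrightarrow> app q a (u a v) = app j a v"
    by metis
  let ?u = "psh_nt A V W u"
  have uh: "?u \<in> homs (PSh A) V W"
  proof (rule psh_nt_hom[OF st_psh[OF V] st_psh[OF W] u(1)])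
    fix h a b v assume h: "h \<in> homs A a b" and v: "v \<in> omap V b"
    note ob = cat_hom_ob[OF cat h] and hv = psh_act[OF st_psh[OF V] h v] and huv = psh_act[OF st_psh[OF W] h u(1)[OF cat_hom_ob(2)[OF cat h] v]]
    show "u a (act V h v) = act W h (u b v)"
      by (rule uniq[OF ob(1) u(1)[OF ob(1) hv] huv])
         (use u(2,3)[OF ob(1) hv] u[OF ob(2) v] psh_nat[OF i' h v] psh_nat[OF j' h v]
           psh_nat[OF p' h] psh_nat[OF q' h] in simp_all)
  qed
  have uapp: "app ?u a v = u a v" if "a \<in> Ob A" "v \<in> omap V a" for a v
    using that by (simp add: psh_nt_app)
  note PC = category_PSh[OF cat]
  show "\<exists>!u. u \<in> homs StP V W \<and> Cmp StP p u = i \<and> Cmp StP q u = j"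
  proof (intro ex1I[of _ ?u] conjI)
    show "?u \<in> homs StP V W" using uh V W by (simp add: StPSh_hom)
    have "Cmp (PSh A) p ?u = i" "Cmp (PSh A) q ?u = j"
      by (rule psh_eqI[OF cat_comp[OF PC uh p'] i'] psh_eqI[OF cat_comp[OF PC uh q'] j']; simp add: psh_cmp[OF uh] uapp u)+
    then show "Cmp StP p ?u = i" "Cmp StP q ?u = j" by simp_all
    fix t assume t: "t \<in> homs StP V W \<and> Cmp StP p t = i \<and> Cmp StP q t = j"
    then have t': "t \<in> homs (PSh A) V W" by (simp add: StPSh_hom)
    show "t = ?u"
    proof (rule psh_eqI[OF t' uh])
      fix a v assume a: "a \<in> Ob A" and v: "v \<in> omap V a"
      have "app p a (app t a v) = app i a v" "app q a (app t a v) = app j a v"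
        using t psh_cmp[OF t' a v] by auto
      then show "app t a v = app ?u a v"
        using uniq[OF a psh_in[OF t' a v] u(1)[OF a v]] u(2,3)[OF a v] uapp[OF a v] by simp
    qed
  qed
qed

section \<open>Representable presheaves and their quotients\<close>

lemma yoneda_functor: "a \<in> Ob A \<Longrightarrow> psh A (yoneda_ob A a)"
  unfolding yoneda_ob_set_functor
proof (rule functor_set_functor[OF category_op_cat[OF cat]])
  show "small (homs A c a)" for c
    using small_Ar unfolding small_def by (rule lesspoll_subset) (auto simp: homs_def)
qed (auto simp: cat_id_right[OF cat] cat_assoc[OF cat] intro: cat_comp[OF cat])

lemma yoneda_omap [simp]: "c \<in> Ob A \<Longrightarrow> omap (yoneda_ob A a) c = homs A c a"
  by (simp add: yoneda_ob_def)

lemma yoneda_act: "f \<in> homs A c d \<Longrightarrow> h \<in> homs A d a \<Longrightarrow> act (yoneda_ob A a) f h = Cmp A h f"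
  by (auto simp: yoneda_ob_def homs_def)

text \<open>Since \<open>h\<close> is invertible, only the identity fixes it by precomposition, and
  identities are covered by the kit.\<close>

lemma yoneda_st: "a \<in> Ob A \<Longrightarrow> st (yoneda_ob A a)"
  unfolding st_def
proof (intro conjI ballI impI)
  fix c h \<alpha> assume "c \<in> Ob A" "h \<in> omap (yoneda_ob A a) c" and \<alpha>: "\<alpha> \<in> homs A c c"
    and fixed: "act (yoneda_ob A a) \<alpha> h = h"
  then have h: "h \<in> homs A c a" by simp
  have "Cmp A (ginv h) (Cmp A h \<alpha>) = Cmp A (ginv h) h" using fixed yoneda_act[OF \<alpha> h] by simp
  then have "\<alpha> = Idt A c"
    using cat_assoc[OF cat \<alpha> h ginv(1)[OF h]] ginv(2)[OF h] cat_id_left[OF cat \<alpha>] by simp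
  then show "\<alpha> \<in> \<Union>(\<A> c)" using id_kit[OF \<open>c \<in> Ob A\<close>] by simp
qed (rule yoneda_functor)

text \<open>The map from the representable of \<open>a\<close> to \<open>X\<close> that names the
  element \<open>x\<close> in the Yoneda lemma.\<close>

definition yon :: "'u psh \<Rightarrow> 'u \<Rightarrow> 'u \<Rightarrow> 'u psh_map" where
  "yon X a x = psh_nt A (yoneda_ob A a) X (\<lambda>c h. act X h x)"

lemma yon_hom:
  assumes X: "psh A X" and a: "a \<in> Ob A" and x: "x \<in> omap X a"
  shows "yon X a x \<in> homs (PSh A) (yoneda_ob A a) X"
  unfolding yon_def
proof (rule psh_nt_hom[OF yoneda_functor[OF a] X])
  show "act X h x \<in> omap X c" if "c \<in> Ob A" "h \<in> omap (yoneda_ob A a) c" for c h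
    using that psh_act[OF X _ x] by auto
  show "act X (act (yoneda_ob A a) f h) x = act X f (act X h x)"
    if f: "f \<in> homs A c d" and "h \<in> omap (yoneda_ob A a) d" for f c d h
  proof -
    have "h \<in> homs A d a" using that cat_hom_ob[OF cat f] by simp
    then show ?thesis using psh_comp[OF X f _ x] yoneda_act[OF f] by simp
  qed
qed

lemma yon_hom_st: "st X \<Longrightarrow> a \<in> Ob A \<Longrightarrow> x \<in> omap X a \<Longrightarrow> yon X a x \<in> homs StP (yoneda_ob A a) X"
  using yon_hom[OF st_psh] yoneda_st by (simp add: StPSh_hom)

lemma yon_app: "h \<in> homs A c a \<Longrightarrow> app (yon X a x) c h = act X h x"
  using cat_hom_ob[OF cat, of h c a] by (simp add: yon_def psh_nt_app)

lemma yon_eqI: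
  assumes "\<tau> \<in> homs (PSh A) (yoneda_ob A a) X" "\<sigma> \<in> homs (PSh A) (yoneda_ob A a) X" "a \<in> Ob A"
    "app \<tau> a (Idt A a) = app \<sigma> a (Idt A a)"
  shows "\<tau> = \<sigma>"
proof (rule psh_eqI[OF assms(1,2)])
  fix c h assume c: "c \<in> Ob A" and "h \<in> omap (yoneda_ob A a) c"
  then have h: "h \<in> homs A c a" by simp
  have "app \<tau> c h = act X h (app \<tau> a (Idt A a))" if "\<tau> \<in> homs (PSh A) (yoneda_ob A a) X" for \<tau>
    using psh_nat[OF that h, of "Idt A a"] yoneda_act[OF h cat_id[OF cat assms(3)]] cat_id_left[OF cat h]
      assms(3) cat_id[OF cat assms(3)] by simp
  then show "app \<tau> c h = app \<sigma> c h" using assms by simp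
qed

definition ymap :: "'u \<Rightarrow> 'u psh_map" where
  "ymap f = amap (yoneda A) f"

lemma ymap_eq: "f \<in> homs A a b \<Longrightarrow> ymap f = yon (yoneda_ob A b) a f"
proof -
  assume f: "f \<in> homs A a b"
  have "\<lparr>sdom = homs A c a, scod = homs A c b, sfun = \<lambda>h\<in>homs A c a. Cmp A f h\<rparr> =
     \<lparr>sdom = homs A c a, scod = homs A c b, sfun = \<lambda>h\<in>homs A c a. act (yoneda_ob A b) h f\<rparr>" for c
    using yoneda_act[OF _ f] by (auto intro!: restrict_ext)
  then show ?thesis
    using homsD[OF f] by (auto simp: ymap_def yoneda_def yon_def psh_nt_def set_nt_def intro!: restrict_ext)
qed

lemma ymap_hom: "f \<in> homs A a b \<Longrightarrow> ymap f \<in> homs (PSh A) (yoneda_ob A a) (yoneda_ob A b)"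
  using cat_hom_ob[OF cat, of f a b] by (simp add: ymap_eq yon_hom yoneda_functor)

lemma ymap_hom_st: "f \<in> homs A a b \<Longrightarrow> ymap f \<in> homs StP (yoneda_ob A a) (yoneda_ob A b)"
  using ymap_hom cat_hom_ob[OF cat, of f a b] yoneda_st by (simp add: StPSh_hom)

lemma ymap_app: "f \<in> homs A a b \<Longrightarrow> h \<in> homs A c a \<Longrightarrow> app (ymap f) c h = Cmp A f h"
  by (simp add: ymap_eq yon_app yoneda_act)

lemma ymap_id: "a \<in> Ob A \<Longrightarrow> ymap (Idt A a) = Idt (PSh A) (yoneda_ob A a)"
  by (rule yon_eqI[OF ymap_hom[OF cat_id[OF cat]] cat_id[OF category_PSh[OF cat]]])
     (auto simp: yoneda_functor ymap_app[OF cat_id[OF cat] cat_id[OF cat]] cat_id_left[OF cat cat_id[OF cat]]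
       psh_idt cat_id[OF cat])

lemma ymap_comp:
  assumes f: "f \<in> homs A a b" and g: "g \<in> homs A b c"
  shows "ymap (Cmp A g f) = Cmp (PSh A) (ymap g) (ymap f)"
proof (rule yon_eqI[OF ymap_hom[OF cat_comp[OF cat f g]] cat_comp[OF category_PSh[OF cat] ymap_hom[OF f] ymap_hom[OF g]]])
  show a: "a \<in> Ob A" using cat_hom_ob[OF cat f] by simp
  note id = cat_id[OF cat a]
  show "app (ymap (Cmp A g f)) a (Idt A a) = app (Cmp (PSh A) (ymap g) (ymap f)) a (Idt A a)"
    using ymap_app[OF cat_comp[OF cat f g] id] ymap_app[OF f id] ymap_app[OF g f] cat_id_right[OF cat f]
      cat_id_right[OF cat cat_comp[OF cat f g]] psh_cmp[OF ymap_hom[OF f] a, of "Idt A a" "ymap g"] a id by simp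
qed

text \<open>Together with \<open>map_yon\<close>, the naturality of the Yoneda correspondence in the
  object and in the presheaf.\<close>

lemma yon_ymap:
  assumes X: "psh A X" and f: "f \<in> homs A a b" and x: "x \<in> omap X b"
  shows "Cmp (PSh A) (yon X b x) (ymap f) = yon X a (act X f x)"
proof (rule yon_eqI)
  note ob = cat_hom_ob[OF cat f]
  note id = cat_id[OF cat ob(1)] and fx = psh_act[OF X f x]
  show "Cmp (PSh A) (yon X b x) (ymap f) \<in> homs (PSh A) (yoneda_ob A a) X"
    by (rule cat_comp[OF category_PSh[OF cat] ymap_hom[OF f] yon_hom[OF X ob(2) x]])
  show "yon X a (act X f x) \<in> homs (PSh A) (yoneda_ob A a) X" by (rule yon_hom[OF X ob(1) fx])
  show "a \<in> Ob A" by (rule ob(1))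
  show "app (Cmp (PSh A) (yon X b x) (ymap f)) a (Idt A a) = app (yon X a (act X f x)) a (Idt A a)"
    using psh_cmp[OF ymap_hom[OF f] ob(1), of "Idt A a" "yon X b x"] ob id ymap_app[OF f id] cat_id_right[OF cat f]
      yon_app[OF f] yon_app[OF id] psh_id[OF X ob(1) fx] by simp
qed

lemma map_yon:
  assumes \<tau>: "\<tau> \<in> homs (PSh A) X Y" and a: "a \<in> Ob A" and x: "x \<in> omap X a"
  shows "Cmp (PSh A) \<tau> (yon X a x) = yon Y a (app \<tau> a x)"
proof (rule yon_eqI[OF _ _ a])
  note XY = psh_hom_ob[OF \<tau>]
  note y = yon_hom[OF XY(1) a x] and id = cat_id[OF cat a]
  show "Cmp (PSh A) \<tau> (yon X a x) \<in> homs (PSh A) (yoneda_ob A a) Y"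
    by (rule cat_comp[OF category_PSh[OF cat] y \<tau>])
  show "yon Y a (app \<tau> a x) \<in> homs (PSh A) (yoneda_ob A a) Y"
    by (rule yon_hom[OF XY(2) a psh_in[OF \<tau> a x]])
  show "app (Cmp (PSh A) \<tau> (yon X a x)) a (Idt A a) = app (yon Y a (app \<tau> a x)) a (Idt A a)"
    using psh_cmp[OF y a, of "Idt A a" \<tau>] a id yon_app[OF id] psh_id[OF XY(1) a x]
      psh_id[OF XY(2) a psh_in[OF \<tau> a x]] by simp
qed

lemma yon_id: "a \<in> Ob A \<Longrightarrow> yon (yoneda_ob A a) a (Idt A a) = Idt (PSh A) (yoneda_ob A a)"
  using ymap_eq[OF cat_id[OF cat]] ymap_id by simp

text \<open>\<open>X c\<close> consists of the cosets \<open>H h\<close> of arrows \<open>h\<close>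
  from \<open>c\<close> to \<open>a\<close>. If \<gamma> fixes the coset of \<open>h\<close>, then
  \<open>h \<gamma> = k h\<close> for some \<open>k\<close> in \<open>H\<close>, so \<gamma> is a
  conjugate of \<open>k\<close> and is covered by the kit. This is the one place where members of
  the kit have to be realized inside a stabilized presheaf.\<close>

lemma ex_quotient:
  assumes a: "a \<in> Ob A" and H: "H \<in> \<A> a"
  shows "\<exists>X q. st X \<and> q \<in> homs (PSh A) (yoneda_ob A a) X \<and> (\<forall>\<alpha>\<in>H. Cmp (PSh A) q (ymap \<alpha>) = q)"
proof -
  note HG = kit_subgroup[OF a H, unfolded End_iff[OF a]]
  have Hh: "H \<subseteq> homs A a a" and H_id: "Idt A a \<in> H" and H_cmp: "\<And>f g. f \<in> H \<Longrightarrow> g \<in> H \<Longrightarrow> Cmp A g f \<in> H"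
    and H_inv: "\<And>f. f \<in> H \<Longrightarrow> \<exists>g\<in>H. Cmp A g f = Idt A a \<and> Cmp A f g = Idt A a"
    using HG by blast+
  \<comment> \<open>The coset of \<open>h\<close> as a set of arrows; precomposition acts on it
    elementwise, so no representatives have to be chosen.\<close>
  define co where "co h = (\<lambda>k. Cmp A k h) ` H" for h
  define S where "S c = co ` homs A c a" for c
  define \<phi> where "\<phi> f D = (\<lambda>h. Cmp A h f) ` D" for f and D :: "'u set"
  have \<phi>_co: "\<phi> f (co h) = co (Cmp A h f)" if f: "f \<in> homs A c d" and h: "h \<in> homs A d a" for f c d h
    unfolding \<phi>_def co_def image_image using cat_assoc[OF cat f h] Hh by (intro image_cong) auto
  have co_mult: "co (Cmp A \<alpha> h) = co h" if \<alpha>: "\<alpha> \<in> H" and h: "h \<in> homs A c a" for \<alpha> h c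
  proof -
    have \<alpha>h: "\<alpha> \<in> homs A a a" using Hh \<alpha> by blast
    have "Cmp A k (Cmp A \<alpha> h) \<in> co h" if k: "k \<in> H" for k
      using cat_assoc[OF cat h \<alpha>h, of k a] k Hh H_cmp[OF \<alpha> k] by (auto simp: co_def)
    moreover have "Cmp A k h \<in> co (Cmp A \<alpha> h)" if k: "k \<in> H" for k
    proof -
      obtain g where g: "g \<in> H" "Cmp A g \<alpha> = Idt A a" using H_inv[OF \<alpha>] by blast
      have kh: "k \<in> homs A a a" and gh: "g \<in> homs A a a" using k g Hh by auto
      have "Cmp A (Cmp A k g) (Cmp A \<alpha> h) = Cmp A k (Cmp A g (Cmp A \<alpha> h))"
        using cat_assoc[OF cat cat_comp[OF cat h \<alpha>h] gh kh] by simp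
      also have "\<dots> = Cmp A k h"
        using cat_assoc[OF cat h \<alpha>h gh] g(2) cat_id_left[OF cat h] by simp
      finally show ?thesis using H_cmp[OF g(1) k] by (auto simp: co_def intro!: image_eqI[of _ _ "Cmp A k g"])
    qed
    ultimately show ?thesis by (auto simp: co_def)
  qed
  have "\<exists>(X :: 'u psh) (e :: 'u \<Rightarrow> 'u set \<Rightarrow> 'u). psh A X \<and>
    (\<forall>c\<in>Ob A. bij_betw (e c) (S c) (omap X c)) \<and>
    (\<forall>d c. \<forall>f\<in>homs A c d. \<forall>t\<in>S d. act X f (e d t) = e c (\<phi> f t))"
  proof (rule ex_psh[OF cat])
    show "S c \<prec> (UNIV :: 'u set)" for c
      unfolding S_def using small_Ar unfolding small_def
      by (intro lesspoll_image) (erule lesspoll_subset, auto simp: homs_def)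
    show "\<phi> f D \<in> S c" if "f \<in> homs A c d" "D \<in> S d" for f c d D
      using that \<phi>_co[OF that(1)] cat_comp[OF cat that(1)] by (auto simp: S_def)
    show "\<phi> (Idt A c) D = D" if c: "c \<in> Ob A" and D: "D \<in> S c" for c D
      using D \<phi>_co[OF cat_id[OF cat c]] cat_id_right[OF cat] by (auto simp: S_def)
    show "\<phi> (Cmp A g f) D = \<phi> f (\<phi> g D)" if f: "f \<in> homs A b c" and g: "g \<in> homs A c d" and D: "D \<in> S d" for f g b c d D
    proof -
      obtain h where h: "h \<in> homs A d a" "D = co h" using D by (auto simp: S_def)
      show ?thesis
        unfolding h(2) \<phi>_co[OF g h(1)] \<phi>_co[OF cat_comp[OF cat f g] h(1)] \<phi>_co[OF f cat_comp[OF cat g h(1)]]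
        using cat_assoc[OF cat f g h(1)] by simp
    qed
  qed
  then obtain X :: "'u psh" and e :: "'u \<Rightarrow> 'u set \<Rightarrow> 'u" where Xe: "psh A X \<and>
    (\<forall>c\<in>Ob A. bij_betw (e c) (S c) (omap X c)) \<and>
    (\<forall>d c. \<forall>f\<in>homs A c d. \<forall>t\<in>S d. act X f (e d t) = e c (\<phi> f t))"
    by (elim exE) (rule that)
  then have X: "psh A X" by (rule conjunct1)
  have e: "bij_betw (e c) (S c) (omap X c)" if "c \<in> Ob A" for c
    using Xe that by blast
  have eact: "act X f (e d t) = e c (\<phi> f t)" if "f \<in> homs A c d" "t \<in> S d" for f c d t
    using Xe that by blast
  have co_S: "co h \<in> S c" if "h \<in> homs A c a" for h c
    using that by (auto simp: S_def)
  have "st X"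
    unfolding st_def
  proof (intro conjI X ballI impI)
    fix c x \<gamma> assume c: "c \<in> Ob A" and x: "x \<in> omap X c" and \<gamma>: "\<gamma> \<in> homs A c c" and fixed: "act X \<gamma> x = x"
    obtain h where h: "h \<in> homs A c a" "x = e c (co h)"
      using x bij_betw_imp_surj_on[OF e[OF c]] by (auto simp: S_def)
    note h\<gamma> = cat_comp[OF cat \<gamma> h(1)]
    have "e c (co (Cmp A h \<gamma>)) = e c (co h)"
      using fixed eact[OF \<gamma> co_S[OF h(1)]] \<phi>_co[OF \<gamma> h(1)] h(2) by simp
    then have "co (Cmp A h \<gamma>) = co h"
      using inj_onD[OF bij_betw_imp_inj_on[OF e[OF c]]] co_S[OF h(1)] co_S[OF h\<gamma>] by blast
    moreover have "Cmp A h \<gamma> \<in> co (Cmp A h \<gamma>)"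
      using H_id cat_id_left[OF cat h\<gamma>] by (auto simp: co_def intro!: image_eqI[of _ _ "Idt A a"])
    ultimately obtain k where k: "k \<in> H" "Cmp A h \<gamma> = Cmp A k h" by (auto simp: co_def)
    have "Cmp A (ginv h) (Cmp A k h) \<in> \<Union>(\<A> c)"
      by (rule kit_conj[OF h(1)]) (use k(1) H in blast)
    moreover have "Cmp A (ginv h) (Cmp A h \<gamma>) = \<gamma>"
      using cat_assoc[OF cat \<gamma> h(1) ginv(1)[OF h(1)]] ginv(2)[OF h(1)] cat_id_left[OF cat \<gamma>] by simp
    ultimately show "\<gamma> \<in> \<Union>(\<A> c)" using k(2) by simp
  qed
  moreover define q where "q = psh_nt A (yoneda_ob A a) X (\<lambda>c h. e c (co h))"
  have q: "q \<in> homs (PSh A) (yoneda_ob A a) X"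
    unfolding q_def
  proof (rule psh_nt_hom[OF yoneda_functor[OF a] X])
    show "e c (co h) \<in> omap X c" if "c \<in> Ob A" "h \<in> omap (yoneda_ob A a) c" for c h
      using that bij_betwE[OF e[OF that(1)]] co_S[of h c] by simp
    show "e c (co (act (yoneda_ob A a) f h)) = act X f (e d (co h))"
      if f: "f \<in> homs A c d" and "h \<in> omap (yoneda_ob A a) d" for f c d h
    proof -
      have h: "h \<in> homs A d a" using that cat_hom_ob[OF cat f] by simp
      show ?thesis using eact[OF f co_S[OF h]] \<phi>_co[OF f h] yoneda_act[OF f h] by simp
    qed
  qed
  moreover have "Cmp (PSh A) q (ymap \<alpha>) = q" if \<alpha>: "\<alpha> \<in> H" for \<alpha>
  proof (rule yon_eqI[OF cat_comp[OF category_PSh[OF cat] _ q] q a])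
    have \<alpha>h: "\<alpha> \<in> homs A a a" using \<alpha> Hh by blast
    show y: "ymap \<alpha> \<in> homs (PSh A) (yoneda_ob A a) (yoneda_ob A a)" by (rule ymap_hom[OF \<alpha>h])
    note id = cat_id[OF cat a]
    show "app (Cmp (PSh A) q (ymap \<alpha>)) a (Idt A a) = app q a (Idt A a)"
      using psh_cmp[OF y a, of "Idt A a" q] a id ymap_app[OF \<alpha>h id] co_mult[OF \<alpha> id] cat_comp[OF cat id \<alpha>h]
      by (simp add: q_def psh_nt_app)
  qed
  ultimately show ?thesis by blast
qed

end

section \<open>Profunctors and coends\<close>

locale two_kits = A: kit_groupoid A \<A> + B: kit_groupoid B \<B>
  for A :: "('u, 'u) cat" and \<A> :: "'u kit" and B :: "('u, 'u) cat" and \<B> :: "'u kit"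
begin

abbreviation SA where "SA \<equiv> StPSh A \<A>"
abbreviation SB where "SB \<equiv> StPSh B \<B>"
abbreviation ext_ob where "ext_ob P X \<equiv> psh_ext_ob A B P X"
abbreviation ext where "ext P \<equiv> st_ext A \<A> B P"
abbreviation lin where "lin L \<equiv> linear A \<A> B \<B> L"

definition prof :: "'u prof \<Rightarrow> bool" where
  "prof P \<longleftrightarrow> is_functor (prod_cat (op_cat B) A) set_cat P"

text \<open>The action of a pair of arrows splits into a covariant action of \<open>A\<close> and a
  contravariant action of \<open>B\<close> that commute with each other. The coend identifies along
  the first, and its presheaf structure comes from the second.\<close>

definition lact :: "'u prof \<Rightarrow> 'u \<Rightarrow> 'u \<Rightarrow> 'u \<Rightarrow> 'u" where
  "lact P b f p = act P (Idt B b, f) p"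

definition ract :: "'u prof \<Rightarrow> 'u \<Rightarrow> 'u \<Rightarrow> 'u \<Rightarrow> 'u" where
  "ract P a g p = act P (g, Idt A a) p"

lemma prof_small: "prof P \<Longrightarrow> b \<in> Ob B \<Longrightarrow> a \<in> Ob A \<Longrightarrow> small (omap P (b, a))"
  unfolding prof_def using sf_small[of "prod_cat (op_cat B) A" P "(b, a)"] by simp

lemma prof_act:
  "prof P \<Longrightarrow> g \<in> homs B b b' \<Longrightarrow> f \<in> homs A a a' \<Longrightarrow> p \<in> omap P (b', a) \<Longrightarrow> act P (g, f) p \<in> omap P (b, a')"
  unfolding prof_def using sf_act[of "prod_cat (op_cat B) A" P "(g, f)" "(b', a)" "(b, a')" p] by simp

lemma prof_comp:
  "prof P \<Longrightarrow> g \<in> homs B b b' \<Longrightarrow> g' \<in> homs B b' b'' \<Longrightarrow> f \<in> homs A a a' \<Longrightarrow> f' \<in> homs A a' a'' \<Longrightarrow>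
   p \<in> omap P (b'', a) \<Longrightarrow> act P (Cmp B g' g, Cmp A f' f) p = act P (g, f') (act P (g', f) p)"
  unfolding prof_def
  using sf_comp[of "prod_cat (op_cat B) A" P "(g', f)" "(b'', a)" "(b', a')" "(g, f')" "(b, a'')" p] by simp

lemma prof_id: "prof P \<Longrightarrow> b \<in> Ob B \<Longrightarrow> a \<in> Ob A \<Longrightarrow> p \<in> omap P (b, a) \<Longrightarrow> act P (Idt B b, Idt A a) p = p"
  unfolding prof_def using sf_id[of "prod_cat (op_cat B) A" P "(b, a)" p] by simp

lemma lact_in: "prof P \<Longrightarrow> b \<in> Ob B \<Longrightarrow> f \<in> homs A a a' \<Longrightarrow> p \<in> omap P (b, a) \<Longrightarrow> lact P b f p \<in> omap P (b, a')"
  unfolding lact_def by (rule prof_act[OF _ cat_id[OF B.cat]])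

lemma ract_in: "prof P \<Longrightarrow> g \<in> homs B b b' \<Longrightarrow> a \<in> Ob A \<Longrightarrow> p \<in> omap P (b', a) \<Longrightarrow> ract P a g p \<in> omap P (b, a)"
  unfolding ract_def by (rule prof_act[OF _ _ cat_id[OF A.cat]])

lemma lact_id: "prof P \<Longrightarrow> b \<in> Ob B \<Longrightarrow> a \<in> Ob A \<Longrightarrow> p \<in> omap P (b, a) \<Longrightarrow> lact P b (Idt A a) p = p"
  by (simp add: lact_def prof_id)

lemma ract_id: "prof P \<Longrightarrow> b \<in> Ob B \<Longrightarrow> a \<in> Ob A \<Longrightarrow> p \<in> omap P (b, a) \<Longrightarrow> ract P a (Idt B b) p = p"
  by (simp add: ract_def prof_id)

lemma lact_comp:
  assumes "prof P" "b \<in> Ob B" "f \<in> homs A a a'" "f' \<in> homs A a' a''" "p \<in> omap P (b, a)"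
  shows "lact P b (Cmp A f' f) p = lact P b f' (lact P b f p)"
  using prof_comp[OF assms(1) cat_id[OF B.cat assms(2)] cat_id[OF B.cat assms(2)] assms(3-5)]
    cat_id_left[OF B.cat cat_id[OF B.cat assms(2)]] by (simp add: lact_def)

lemma ract_comp:
  assumes "prof P" "g \<in> homs B b b'" "g' \<in> homs B b' b''" "a \<in> Ob A" "p \<in> omap P (b'', a)"
  shows "ract P a (Cmp B g' g) p = ract P a g (ract P a g' p)"
  using prof_comp[OF assms(1-3) cat_id[OF A.cat assms(4)] cat_id[OF A.cat assms(4)] assms(5)]
    cat_id_left[OF A.cat cat_id[OF A.cat assms(4)]] by (simp add: ract_def)

lemma act_split:
  assumes "prof P" "g \<in> homs B b b'" "f \<in> homs A a a'" "p \<in> omap P (b', a)"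
  shows "act P (g, f) p = lact P b f (ract P a g p)" "act P (g, f) p = ract P a' g (lact P b' f p)"
proof -
  note ob = cat_hom_ob[OF B.cat assms(2)] cat_hom_ob[OF A.cat assms(3)]
  show "act P (g, f) p = lact P b f (ract P a g p)"
    using prof_comp[OF assms(1) cat_id[OF B.cat ob(1)] assms(2) cat_id[OF A.cat ob(3)] assms(3,4)]
      cat_id_right[OF B.cat assms(2)] cat_id_right[OF A.cat assms(3)] by (simp add: lact_def ract_def)
  show "act P (g, f) p = ract P a' g (lact P b' f p)"
    using prof_comp[OF assms(1,2) cat_id[OF B.cat ob(2)] assms(3) cat_id[OF A.cat ob(4)] assms(4)]
      cat_id_left[OF B.cat assms(2)] cat_id_left[OF A.cat assms(3)] by (simp add: lact_def ract_def)
qed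

lemma lact_ract:
  assumes "prof P" "g \<in> homs B b b'" "f \<in> homs A a a'" "p \<in> omap P (b', a)"
  shows "lact P b f (ract P a g p) = ract P a' g (lact P b' f p)"
  using act_split[OF assms] by simp

lemma lact_ginv:
  assumes "prof P" "b \<in> Ob B" "f \<in> homs A a a'" "p \<in> omap P (b, a)"
  shows "lact P b (A.ginv f) (lact P b f p) = p"
  using lact_comp[OF assms(1-3) A.ginv(1)[OF assms(3)] assms(4)] A.ginv(2)[OF assms(3)]
    lact_id[OF assms(1,2) cat_hom_ob(1)[OF A.cat assms(3)] assms(4)] by simp

lemma lact_ginv':
  assumes "prof P" "b \<in> Ob B" "f \<in> homs A a a'" "p \<in> omap P (b, a')"
  shows "lact P b f (lact P b (A.ginv f) p) = p"
  using lact_comp[OF assms(1,2) A.ginv(1)[OF assms(3)] assms(3,4)] A.ginv(3)[OF assms(3)]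
    lact_id[OF assms(1,2) cat_hom_ob(2)[OF A.cat assms(3)] assms(4)] by simp

lemma psh_ginv:
  assumes "psh A X" "f \<in> homs A a a'" "x \<in> omap X a'"
  shows "act X (A.ginv f) (act X f x) = x"
  using psh_comp[OF assms(1) A.ginv(1)[OF assms(2)] assms(2,3)] A.ginv(3)[OF assms(2)]
    psh_id[OF assms(1) cat_hom_ob(2)[OF A.cat assms(2)] assms(3)] by simp

section \<open>The coend as a set of classes\<close>

definition crel :: "'u prof \<Rightarrow> 'u psh \<Rightarrow> 'u \<Rightarrow> 'u \<times> 'u \<times> 'u \<Rightarrow> 'u \<times> 'u \<times> 'u \<Rightarrow> bool" where
  "crel P X b t t' \<longleftrightarrow> t \<in> coend_triples A P X b \<and> t' \<in> coend_triples A P X b \<and>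
    (\<exists>f\<in>homs A (fst t) (fst t'). fst (snd t') = lact P b f (fst (snd t)) \<and> snd (snd t) = act X f (snd (snd t')))"

lemma triples_iff: "(a, p, x) \<in> coend_triples A P X b \<longleftrightarrow> a \<in> Ob A \<and> p \<in> omap P (b, a) \<and> x \<in> omap X a"
  by (simp add: coend_triples_def)

lemma crel_refl:
  assumes P: "prof P" and X: "psh A X" and b: "b \<in> Ob B"
    and t: "t \<in> coend_triples A P X b"
  shows "crel P X b t t"
proof -
  obtain a p x where [simp]: "t = (a, p, x)" by (cases t)
  have "a \<in> Ob A" "p \<in> omap P (b, a)" "x \<in> omap X a"
    using t by (simp_all add: triples_iff)
  then have "Idt A a \<in> homs A a a" "lact P b (Idt A a) p = p" "act X (Idt A a) x = x"
    using cat_id[OF A.cat] lact_id[OF P b] psh_id[OF X] by simp_all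
  then show ?thesis
    using t by (auto simp: crel_def intro!: bexI[of _ "Idt A a"])
qed

lemma crel_sym:
  assumes P: "prof P" and X: "psh A X" and b: "b \<in> Ob B"
    and t: "crel P X b t t'"
  shows "crel P X b t' t"
proof -
  obtain a p x a' p' x' f where t: "t = (a, p, x)" "t' = (a', p', x')" "p \<in> omap P (b, a)" "x' \<in> omap X a'"
    and f: "f \<in> homs A a a'" "p' = lact P b f p" "x = act X f x'"
    using t by (cases t, cases t') (auto simp: crel_def triples_iff)
  then have "p = lact P b (A.ginv f) p'" "x' = act X (A.ginv f) x"
    using lact_ginv[OF P b f(1)] psh_ginv[OF X f(1)] by auto
  then show ?thesis
    using assms(4) A.ginv(1)[OF f(1)] by (auto simp: crel_def t(1,2))
qed

lemma crel_trans:
  assumes P: "prof P" and X: "psh A X" and b: "b \<in> Ob B"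
    and t: "crel P X b t t'" and t': "crel P X b t' t''"
  shows "crel P X b t t''"
proof -
  obtain f g where f: "f \<in> homs A (fst t) (fst t')" "fst (snd t') = lact P b f (fst (snd t))" "snd (snd t) = act X f (snd (snd t'))"
    and g: "g \<in> homs A (fst t') (fst t'')" "fst (snd t'') = lact P b g (fst (snd t'))" "snd (snd t') = act X g (snd (snd t''))"
    using t t' by (auto simp: crel_def)
  have "fst (snd t) \<in> omap P (b, fst t)" "snd (snd t'') \<in> omap X (fst t'')"
    using t t' by (auto simp: crel_def coend_triples_def)
  then have "fst (snd t'') = lact P b (Cmp A g f) (fst (snd t))" "snd (snd t) = act X (Cmp A g f) (snd (snd t''))"
    using lact_comp[OF P b f(1) g(1)] psh_comp[OF X f(1) g(1)] f g by auto
  then show ?thesis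
    using t t' cat_comp[OF A.cat f(1) g(1)] by (auto simp: crel_def)
qed

lemma coend_step_crel:
  assumes P: "prof P" and X: "psh A X" and b: "b \<in> Ob B"
  shows "(t, t') \<in> coend_step A B P X b \<longleftrightarrow> crel P X b t' t"
proof
  assume "(t, t') \<in> coend_step A B P X b"
  then obtain f p x where *: "t = (Cod A f, lact P b f p, x)" "t' = (Dom A f, p, act X f x)"
    "f \<in> Ar A" "p \<in> omap P (b, Dom A f)" "x \<in> omap X (Cod A f)"
    by (auto simp: coend_step_def lact_def)
  then have f: "f \<in> homs A (Dom A f) (Cod A f)" by (simp add: ar_hom)
  show "crel P X b t' t"
    using * f lact_in[OF P b f] psh_act[OF X f] cat_hom_ob[OF A.cat f] by (auto simp: crel_def triples_iff)
next
  assume "crel P X b t' t"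
  then obtain f where "f \<in> homs A (fst t') (fst t)" "fst (snd t) = lact P b f (fst (snd t'))"
    "snd (snd t') = act X f (snd (snd t))" and tr: "t \<in> coend_triples A P X b" "t' \<in> coend_triples A P X b"
    by (auto simp: crel_def)
  then show "(t, t') \<in> coend_step A B P X b"
    unfolding coend_step_def by (cases t, cases t') (auto simp: lact_def triples_iff homs_def)
qed

text \<open>Over a groupoid a generating step along \<open>f\<close> is undone by the step along the
  inverse of \<open>f\<close>, and consecutive steps compose. The generated equivalence relation is
  therefore a single step.\<close>

lemma rtrancl_crel:
  assumes P: "prof P" and X: "psh A X" and b: "b \<in> Ob B"
    and t: "t \<in> coend_triples A P X b"
  shows "(t, t') \<in> (coend_step A B P X b \<union> (coend_step A B P X b)\<inverse>)\<^sup>* \<longleftrightarrow> crel P X b t t'"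
proof
  assume "(t, t') \<in> (coend_step A B P X b \<union> (coend_step A B P X b)\<inverse>)\<^sup>*"
  then show "crel P X b t t'"
  proof induction
    case base show ?case by (rule crel_refl[OF P X b t])
  next
    case (step y z)
    from step.hyps(2) have "(y, z) \<in> coend_step A B P X b \<or> (z, y) \<in> coend_step A B P X b" by simp
    then have "crel P X b y z"
      unfolding coend_step_crel[OF P X b] using crel_sym[OF P X b] by blast
    with step.IH show ?case by (rule crel_trans[OF P X b])
  qed
next
  assume "crel P X b t t'"
  then show "(t, t') \<in> (coend_step A B P X b \<union> (coend_step A B P X b)\<inverse>)\<^sup>*"
    using coend_step_crel[OF P X b] by (intro r_into_rtrancl) auto
qed

text \<open>The code of \<open>t\<close> is the code of some chosen triple of its class; as
  \<open>triple_code\<close> is injective, decoding returns exactly that triple.\<close>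

lemma coend_in_rep:
  assumes P: "prof P" and X: "psh A X" and b: "b \<in> Ob B"
    and t: "t \<in> coend_triples A P X b"
  shows "crel P X b t (inv_into UNIV triple_code (coend_in A B P X b t))"
proof -
  have "crel P X b t (SOME t'. crel P X b t t')"
    using crel_refl[OF P X b t] by (rule someI)
  then show ?thesis
    unfolding coend_in_def rtrancl_crel[OF P X b t] using inj_triple_code[OF A.U] by simp
qed

text \<open>Related triples satisfy the same predicate \<open>crel P X b t\<close>, so the same
  representative is chosen for both. Conversely, a common representative links the two.\<close>

lemma coend_in_eq:
  assumes P: "prof P" and X: "psh A X" and b: "b \<in> Ob B"
    and t: "t \<in> coend_triples A P X b" "t' \<in> coend_triples A P X b"
  shows "coend_in A B P X b t = coend_in A B P X b t' \<longleftrightarrow> crel P X b t t'"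
proof
  assume "coend_in A B P X b t = coend_in A B P X b t'"
  then show "crel P X b t t'"
    using coend_in_rep[OF P X b t(1)] coend_in_rep[OF P X b t(2)] crel_sym[OF P X b] crel_trans[OF P X b] by metis
next
  assume "crel P X b t t'"
  then have "crel P X b t = crel P X b t'"
    using crel_sym[OF P X b] crel_trans[OF P X b] by blast
  then show "coend_in A B P X b t = coend_in A B P X b t'"
    unfolding coend_in_def rtrancl_crel[OF P X b t(1)] rtrancl_crel[OF P X b t(2)] by simp
qed

definition cl :: "'u prof \<Rightarrow> 'u psh \<Rightarrow> 'u \<Rightarrow> 'u \<Rightarrow> 'u \<Rightarrow> 'u \<Rightarrow> 'u" where
  "cl P X b a p x = coend_in A B P X b (a, p, x)"

lemma cl_eq_iff:
  assumes "prof P" "psh A X" "b \<in> Ob B"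
    "a \<in> Ob A" "p \<in> omap P (b, a)" "x \<in> omap X a" "a' \<in> Ob A" "p' \<in> omap P (b, a')" "x' \<in> omap X a'"
  shows "cl P X b a p x = cl P X b a' p' x' \<longleftrightarrow> (\<exists>f\<in>homs A a a'. p' = lact P b f p \<and> x = act X f x')"
  using assms unfolding cl_def by (subst coend_in_eq[OF assms(1-3)]) (auto simp: triples_iff crel_def)

lemma cl_slide:
  assumes "prof P" "psh A X" "b \<in> Ob B"
    "f \<in> homs A a a'" "p \<in> omap P (b, a)" "x \<in> omap X a'"
  shows "cl P X b a' (lact P b f p) x = cl P X b a p (act X f x)"
  using cat_hom_ob[OF A.cat assms(4)] lact_in[OF assms(1,3-5)] psh_act[OF assms(2,4,6)] assms
  by (subst eq_commute, subst cl_eq_iff) auto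

lemma cl_in: "a \<in> Ob A \<Longrightarrow> p \<in> omap P (b, a) \<Longrightarrow> x \<in> omap X a \<Longrightarrow> cl P X b a p x \<in> coend A B P X b"
  by (auto simp: coend_def cl_def triples_iff)

lemma coendE:
  assumes "k \<in> coend A B P X b"
  obtains a p x where "a \<in> Ob A" "p \<in> omap P (b, a)" "x \<in> omap X a" "k = cl P X b a p x"
  using assms by (auto simp: coend_def cl_def triples_iff)

text \<open>A map of coends evaluates \<phi> at the decoded representative, which need not be the
  given triple. Invariance of \<phi> along one generating step is enough to replace one by the
  other.\<close>

lemma coend_map_fun:
  assumes P: "prof P" and X: "psh A X" and b: "b \<in> Ob B"
    and resp: "\<And>a a' p x f. f \<in> homs A a a' \<Longrightarrow> p \<in> omap P (b, a) \<Longrightarrow> x \<in> omap X a' \<Longrightarrow>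
       coend_in A B Q Y c (\<phi> (a', lact P b f p, x)) = coend_in A B Q Y c (\<phi> (a, p, act X f x))"
    and t: "a \<in> Ob A" "p \<in> omap P (b, a)" "x \<in> omap X a"
  shows "coend_in A B Q Y c (\<phi> (inv_into UNIV triple_code (cl P X b a p x))) = coend_in A B Q Y c (\<phi> (a, p, x))"
proof -
  have "(a, p, x) \<in> coend_triples A P X b" using t by (simp add: triples_iff)
  note r = coend_in_rep[OF P X b this]
  obtain a' p' x' where t': "inv_into UNIV triple_code (cl P X b a p x) = (a', p', x')"
    by (cases "inv_into UNIV triple_code (cl P X b a p x)") auto
  then obtain f where "f \<in> homs A a a'" "p' = lact P b f p" "x = act X f x'" "x' \<in> omap X a'"
    using r by (auto simp: crel_def triples_iff cl_def)
  with resp[of f a a' p x'] t show ?thesis unfolding t' by simp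
qed

lemma coend_small:
  assumes P: "prof P" and X: "psh A X" and b: "b \<in> Ob B"
  shows "small (coend A B P X b)"
proof -
  have "coend_triples A P X b = (SIGMA a:Ob A. omap P (b, a) \<times> omap X a)"
    by (auto simp: coend_triples_def)
  moreover have "(SIGMA a:Ob A. omap P (b, a) \<times> omap X a) \<prec> (UNIV :: 'u set)"
    using A.small_Ob prof_small[OF P b] psh_small[OF X]
    by (intro lesspoll_Sigma[OF A.U]) (simp_all add: small_def)
  ultimately show ?thesis
    unfolding coend_def small_def by (simp add: lesspoll_image)
qed

section \<open>The extension on presheaves and on their maps\<close>

lemma ext_ob_set_functor:
  "ext_ob P X = set_functor (op_cat B) (coend A B P X)
     (\<lambda>g k. coend_in A B P X (Dom B g)
       ((\<lambda>(a, p, x). (a, act P (g, Idt A a) p, x)) (inv_into UNIV triple_code k)))"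
  by (simp add: psh_ext_ob_def set_functor_def coend_map_def)

lemma ext_omap [simp]: "b \<in> Ob B \<Longrightarrow> omap (ext_ob P X) b = coend A B P X b"
  by (simp add: psh_ext_ob_def)

lemma ext_act_aux:
  assumes P: "prof P" and X: "psh A X" and g: "g \<in> homs B b b'"
    and t: "a \<in> Ob A" "p \<in> omap P (b', a)" "x \<in> omap X a"
  shows "coend_in A B P X (Dom B g) ((\<lambda>(a, p, x). (a, act P (g, Idt A a) p, x)) (inv_into UNIV triple_code (cl P X b' a p x)))
    = cl P X b a (ract P a g p) x"
proof -
  note ob = cat_hom_ob[OF B.cat g]
  have "coend_in A B P X b ((\<lambda>(a, p, x). (a, act P (g, Idt A a) p, x)) (inv_into UNIV triple_code (cl P X b' a p x)))
     = coend_in A B P X b ((\<lambda>(a, p, x). (a, act P (g, Idt A a) p, x)) (a, p, x))"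
  proof (rule coend_map_fun[OF P X ob(2) _ t])
    fix a a' p x f assume f: "f \<in> homs A a a'" and p: "p \<in> omap P (b', a)" and x: "x \<in> omap X a'"
    note oba = cat_hom_ob[OF A.cat f]
    have "cl P X b a' (ract P a' g (lact P b' f p)) x = cl P X b a' (lact P b f (ract P a g p)) x"
      using lact_ract[OF P g f p] by simp
    also have "\<dots> = cl P X b a (ract P a g p) (act X f x)"
      by (rule cl_slide[OF P X ob(1) f ract_in[OF P g oba(1) p] x])
    finally show "coend_in A B P X b (case (a', lact P b' f p, x) of (a, p, x) \<Rightarrow> (a, act P (g, Idt A a) p, x)) =
        coend_in A B P X b (case (a, p, act X f x) of (a, p, x) \<Rightarrow> (a, act P (g, Idt A a) p, x))"
      by (simp add: cl_def ract_def)
  qed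
  then show ?thesis
    using homsD(2)[OF g] by (simp add: cl_def ract_def)
qed

lemma ext_ob_functor:
  assumes P: "prof P" and X: "psh A X"
  shows "psh B (ext_ob P X)"
  unfolding ext_ob_set_functor
proof (rule functor_set_functor[OF category_op_cat[OF B.cat]])
  let ?\<phi> = "\<lambda>g k. coend_in A B P X (Dom B g) ((\<lambda>(a, p, x). (a, act P (g, Idt A a) p, x)) (inv_into UNIV triple_code k))"
  show "small (coend A B P X b)" if "b \<in> Ob (op_cat B)" for b
    using that coend_small[OF P X] by simp
  show "?\<phi> g k \<in> coend A B P X b'" if "g \<in> homs (op_cat B) b b'" and k: "k \<in> coend A B P X b" for g b b' k
  proof -
    have g: "g \<in> homs B b' b" using that by simp
    obtain a p x where t: "a \<in> Ob A" "p \<in> omap P (b, a)" "x \<in> omap X a" "k = cl P X b a p x" using coendE[OF k] .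
    show ?thesis
      unfolding t(4) ext_act_aux[OF P X g t(1-3)] by (rule cl_in[OF t(1) ract_in[OF P g t(1,2)] t(3)])
  qed
  show "?\<phi> (Idt (op_cat B) b) k = k" if "b \<in> Ob (op_cat B)" and k: "k \<in> coend A B P X b" for b k
  proof -
    have b: "b \<in> Ob B" using that by simp
    obtain a p x where t: "a \<in> Ob A" "p \<in> omap P (b, a)" "x \<in> omap X a" "k = cl P X b a p x" using coendE[OF k] .
    show ?thesis
      using ext_act_aux[OF P X cat_id[OF B.cat b] t(1-3)] ract_id[OF P b t(1,2)] by (simp add: t(4))
  qed
  show "?\<phi> (Cmp (op_cat B) g' g) k = ?\<phi> g' (?\<phi> g k)"
    if "g \<in> homs (op_cat B) b b'" "g' \<in> homs (op_cat B) b' b''" and k: "k \<in> coend A B P X b" for g g' b b' b'' k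
  proof -
    have g: "g \<in> homs B b' b" "g' \<in> homs B b'' b'" using that by simp_all
    obtain a p x where t: "a \<in> Ob A" "p \<in> omap P (b, a)" "x \<in> omap X a" "k = cl P X b a p x" using coendE[OF k] .
    show ?thesis
      unfolding t(4) ext_act_aux[OF P X g(1) t(1-3)] ext_act_aux[OF P X g(2) t(1) ract_in[OF P g(1) t(1,2)] t(3)]
      using ext_act_aux[OF P X cat_comp[OF B.cat g(2,1)] t(1-3)] ract_comp[OF P g(2,1) t(1,2)] by simp
  qed
qed

lemma ext_act:
  assumes P: "prof P" and X: "psh A X" and g: "g \<in> homs B b b'"
    and t: "a \<in> Ob A" "p \<in> omap P (b', a)" "x \<in> omap X a"
  shows "act (ext_ob P X) g (cl P X b' a p x) = cl P X b a (ract P a g p) x"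
proof -
  have "g \<in> homs (op_cat B) b' b" using g by simp
  then show ?thesis
    unfolding ext_ob_set_functor using ext_act_aux[OF P X g t] cl_in[where x = x and X = X, OF t]
    by (subst set_functor_simps(2)[where a = b' and b = b]) auto
qed

definition ext_map :: "'u prof \<Rightarrow> 'u psh_map \<Rightarrow> 'u psh_map" where
  "ext_map P \<tau> = \<lparr>nsrc = ext_ob P (nsrc \<tau>), ntgt = ext_ob P (ntgt \<tau>),
         ncomp = (\<lambda>b\<in>Ob B. coend_map A B (P, nsrc \<tau>, b) (P, ntgt \<tau>, b)
                             (\<lambda>(a, p, x). (a, p, app \<tau> a x)))\<rparr>"

lemma ext_map_app:
  assumes P: "prof P" and \<tau>: "\<tau> \<in> homs (PSh A) X Y" and b: "b \<in> Ob B"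
    and t: "a \<in> Ob A" "p \<in> omap P (b, a)" "x \<in> omap X a"
  shows "app (ext_map P \<tau>) b (cl P X b a p x) = cl P Y b a p (app \<tau> a x)"
proof -
  note XY = psh_hom_ob[OF \<tau>]
  have src: "nsrc \<tau> = X" "ntgt \<tau> = Y" using \<tau> by (auto simp: PSh_def homs_def)
  have "coend_in A B P Y b ((\<lambda>(a, p, x). (a, p, app \<tau> a x)) (inv_into UNIV triple_code (cl P X b a p x)))
     = coend_in A B P Y b ((\<lambda>(a, p, x). (a, p, app \<tau> a x)) (a, p, x))"
  proof (rule coend_map_fun[OF P XY(1) b _ t])
    fix a a' p x f assume f: "f \<in> homs A a a'" and p: "p \<in> omap P (b, a)" and x: "x \<in> omap X a'"
    note oba = cat_hom_ob[OF A.cat f]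
    show "coend_in A B P Y b (case (a', lact P b f p, x) of (a, p, x) \<Rightarrow> (a, p, app \<tau> a x)) =
        coend_in A B P Y b (case (a, p, act X f x) of (a, p, x) \<Rightarrow> (a, p, app \<tau> a x))"
      using cl_slide[OF P XY(2) b f p psh_in[OF \<tau> oba(2) x]] psh_nat[OF \<tau> f x] by (simp add: cl_def)
  qed
  then show ?thesis
    using b cl_in[where x = x and X = X, OF t] by (simp add: ext_map_def coend_map_def src cl_def)
qed

lemma ext_map_hom:
  assumes P: "prof P" and \<tau>: "\<tau> \<in> homs (PSh A) X Y"
  shows "ext_map P \<tau> \<in> homs (PSh B) (ext_ob P X) (ext_ob P Y)"
proof -
  note XY = psh_hom_ob[OF \<tau>]
  have src: "nsrc \<tau> = X" "ntgt \<tau> = Y" using \<tau> by (auto simp: PSh_def homs_def)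
  show ?thesis
    unfolding PSh_def
  proof (rule snt_homI[OF ext_ob_functor[OF P XY(1)] ext_ob_functor[OF P XY(2)]])
    show "app (ext_map P \<tau>) b k \<in> omap (ext_ob P Y) b"
      if b: "b \<in> Ob (op_cat B)" and k: "k \<in> omap (ext_ob P X) b" for b k
    proof -
      have "k \<in> coend A B P X b" using b k by simp
      then obtain a p x where t: "a \<in> Ob A" "p \<in> omap P (b, a)" "x \<in> omap X a" "k = cl P X b a p x" by (rule coendE)
      show ?thesis
        using b ext_map_app[OF P \<tau> _ t(1-3)] cl_in[where x = "app \<tau> a x", OF t(1,2) psh_in[OF \<tau> t(1,3)]] by (simp add: t(4))
    qed
    show "app (ext_map P \<tau>) b' (act (ext_ob P X) g k) = act (ext_ob P Y) g (app (ext_map P \<tau>) b k)"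
      if "g \<in> homs (op_cat B) b b'" and k: "k \<in> omap (ext_ob P X) b" for g b b' k
    proof -
      have g: "g \<in> homs B b' b" using that by simp
      note ob = cat_hom_ob[OF B.cat g]
      have "k \<in> coend A B P X b" using ob k by simp
      then obtain a p x where t: "a \<in> Ob A" "p \<in> omap P (b, a)" "x \<in> omap X a" "k = cl P X b a p x" by (rule coendE)
      show ?thesis
        unfolding t(4) ext_act[OF P XY(1) g t(1-3)] ext_map_app[OF P \<tau> ob(2) t(1-3)]
          ext_map_app[OF P \<tau> ob(1) t(1) ract_in[OF P g t(1,2)] t(3)] ext_act[OF P XY(2) g t(1,2) psh_in[OF \<tau> t(1,3)]] ..
    qed
  qed (auto simp: ext_map_def coend_map_def src)
qed

lemma psh_ext_simps:
  "X \<in> Ob (PSh A) \<Longrightarrow> omap (psh_ext A B P) X = ext_ob P X"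
  "\<tau> \<in> Ar (PSh A) \<Longrightarrow> amap (psh_ext A B P) \<tau> = ext_map P \<tau>"
  by (simp_all add: psh_ext_def ext_map_def)

lemma ext_map_id:
  assumes P: "prof P" and X: "psh A X"
  shows "ext_map P (Idt (PSh A) X) = Idt (PSh B) (ext_ob P X)"
proof (rule psh_eqI)
  have id: "Idt (PSh A) X \<in> homs (PSh A) X X" using cat_id[OF category_PSh[OF A.cat]] X by simp
  show "ext_map P (Idt (PSh A) X) \<in> homs (PSh B) (ext_ob P X) (ext_ob P X)"
    by (rule ext_map_hom[OF P id])
  show "Idt (PSh B) (ext_ob P X) \<in> homs (PSh B) (ext_ob P X) (ext_ob P X)"
    using cat_id[OF category_PSh[OF B.cat]] ext_ob_functor[OF P X] by simp
  fix b k assume b: "b \<in> Ob B" and k: "k \<in> omap (ext_ob P X) b"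
  then have "k \<in> coend A B P X b" by simp
  then obtain a p x where t: "a \<in> Ob A" "p \<in> omap P (b, a)" "x \<in> omap X a" "k = cl P X b a p x" by (rule coendE)
  show "app (ext_map P (Idt (PSh A) X)) b k = app (Idt (PSh B) (ext_ob P X)) b k"
    unfolding psh_idt[OF b k] unfolding t(4) ext_map_app[OF P id b t(1-3)] psh_idt[where X = X, OF t(1,3)] ..
qed

lemma ext_map_comp:
  assumes P: "prof P" and \<tau>: "\<tau> \<in> homs (PSh A) X Y" and \<sigma>: "\<sigma> \<in> homs (PSh A) Y Z"
  shows "ext_map P (Cmp (PSh A) \<sigma> \<tau>) = Cmp (PSh B) (ext_map P \<sigma>) (ext_map P \<tau>)"
proof (rule psh_eqI)
  note st = cat_comp[OF category_PSh[OF A.cat] \<tau> \<sigma>]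
  show "ext_map P (Cmp (PSh A) \<sigma> \<tau>) \<in> homs (PSh B) (ext_ob P X) (ext_ob P Z)"
    by (rule ext_map_hom[OF P st])
  show "Cmp (PSh B) (ext_map P \<sigma>) (ext_map P \<tau>) \<in> homs (PSh B) (ext_ob P X) (ext_ob P Z)"
    by (rule cat_comp[OF category_PSh[OF B.cat] ext_map_hom[OF P \<tau>] ext_map_hom[OF P \<sigma>]])
  fix b k assume b: "b \<in> Ob B" and k: "k \<in> omap (ext_ob P X) b"
  then have "k \<in> coend A B P X b" by simp
  then obtain a p x where t: "a \<in> Ob A" "p \<in> omap P (b, a)" "x \<in> omap X a" "k = cl P X b a p x" by (rule coendE)
  show "app (ext_map P (Cmp (PSh A) \<sigma> \<tau>)) b k = app (Cmp (PSh B) (ext_map P \<sigma>) (ext_map P \<tau>)) b k"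
    unfolding psh_cmp[OF ext_map_hom[OF P \<tau>] b k]
    unfolding t(4) ext_map_app[OF P st b t(1-3)] ext_map_app[OF P \<tau> b t(1-3)] psh_cmp[OF \<tau> t(1,3)]
      ext_map_app[OF P \<sigma> b t(1,2) psh_in[OF \<tau> t(1,3)]] ..
qed

section \<open>The extension of a stabilized profunctor is linear\<close>

lemma ext_eqI:
  assumes \<tau>: "\<tau> \<in> homs (PSh B) (ext_ob P X) Z" and \<sigma>: "\<sigma> \<in> homs (PSh B) (ext_ob P X) Z"
    and eq: "\<And>b a p x. b \<in> Ob B \<Longrightarrow> a \<in> Ob A \<Longrightarrow> p \<in> omap P (b, a) \<Longrightarrow> x \<in> omap X a \<Longrightarrow>
      app \<tau> b (cl P X b a p x) = app \<sigma> b (cl P X b a p x)"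
  shows "\<tau> = \<sigma>"
proof (rule psh_eqI[OF \<tau> \<sigma>])
  fix b k assume b: "b \<in> Ob B" and "k \<in> omap (ext_ob P X) b"
  then have "k \<in> coend A B P X b" by simp
  then show "app \<tau> b k = app \<sigma> b k" by (rule coendE) (use eq b in simp)
qed

text \<open>The universal property of the coend, with naturality in \<open>b\<close> included: a
  family that is dinatural in \<open>a\<close> and natural in \<open>b\<close> induces a map of
  presheaves.\<close>

lemma ex_ext_map:
  assumes P: "prof P" and X: "psh A X" and Z: "psh B Z"
    and u: "\<And>b a p x. b \<in> Ob B \<Longrightarrow> a \<in> Ob A \<Longrightarrow> p \<in> omap P (b, a) \<Longrightarrow> x \<in> omap X a \<Longrightarrow> u b a p x \<in> omap Z b"
    and slide: "\<And>b f a a' p x. b \<in> Ob B \<Longrightarrow> f \<in> homs A a a' \<Longrightarrow> p \<in> omap P (b, a) \<Longrightarrow> x \<in> omap X a' \<Longrightarrow>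
      u b a' (lact P b f p) x = u b a p (act X f x)"
    and nat: "\<And>b b' g a p x. g \<in> homs B b b' \<Longrightarrow> a \<in> Ob A \<Longrightarrow> p \<in> omap P (b', a) \<Longrightarrow> x \<in> omap X a \<Longrightarrow>
      u b a (ract P a g p) x = act Z g (u b' a p x)"
  obtains \<tau> where "\<tau> \<in> homs (PSh B) (ext_ob P X) Z"
    "\<And>b a p x. b \<in> Ob B \<Longrightarrow> a \<in> Ob A \<Longrightarrow> p \<in> omap P (b, a) \<Longrightarrow> x \<in> omap X a \<Longrightarrow> app \<tau> b (cl P X b a p x) = u b a p x"
proof -
  have wd: "u b a p x = u b a' p' x'"
    if wd: "b \<in> Ob B" "a \<in> Ob A" "p \<in> omap P (b, a)" "x \<in> omap X a" "a' \<in> Ob A" "p' \<in> omap P (b, a')" "x' \<in> omap X a'"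
      "cl P X b a p x = cl P X b a' p' x'" for b a p x a' p' x'
  proof -
    obtain f where "f \<in> homs A a a'" "p' = lact P b f p" "x = act X f x'"
      using wd(8) cl_eq_iff[OF P X wd(1-7)] by blast
    then show ?thesis using slide[OF wd(1) _ wd(3,7)] by simp
  qed
  \<comment> \<open>The value is read off from any triple that presents \<open>k\<close>; by
    \<open>wd\<close> it does not depend on the triple.\<close>
  define \<psi> where "\<psi> b k = (SOME y. \<exists>a p x. a \<in> Ob A \<and> p \<in> omap P (b, a) \<and> x \<in> omap X a \<and> k = cl P X b a p x \<and> y = u b a p x)" for b k
  have \<psi>: "\<psi> b (cl P X b a p x) = u b a p x"
    if t: "b \<in> Ob B" "a \<in> Ob A" "p \<in> omap P (b, a)" "x \<in> omap X a" for b a p x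
    unfolding \<psi>_def
  proof (rule some_equality)
    show "\<exists>a' p' x'. a' \<in> Ob A \<and> p' \<in> omap P (b, a') \<and> x' \<in> omap X a' \<and> cl P X b a p x = cl P X b a' p' x' \<and> u b a p x = u b a' p' x'"
      using t by blast
    fix y assume "\<exists>a' p' x'. a' \<in> Ob A \<and> p' \<in> omap P (b, a') \<and> x' \<in> omap X a' \<and> cl P X b a p x = cl P X b a' p' x' \<and> y = u b a' p' x'"
    then show "y = u b a p x" using wd[OF t] by metis
  qed
  let ?\<tau> = "psh_nt B (ext_ob P X) Z \<psi>"
  have "?\<tau> \<in> homs (PSh B) (ext_ob P X) Z"
  proof (rule psh_nt_hom[OF ext_ob_functor[OF P X] Z])
    fix b k assume b: "b \<in> Ob B" and "k \<in> omap (ext_ob P X) b"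
    then have "k \<in> coend A B P X b" by simp
    then show "\<psi> b k \<in> omap Z b" by (rule coendE) (use \<psi> u b in simp)
  next
    fix g b b' k assume g: "g \<in> homs B b b'" and k: "k \<in> omap (ext_ob P X) b'"
    note ob = cat_hom_ob[OF B.cat g]
    have "k \<in> coend A B P X b'" using k ob by simp
    then obtain a p x where t: "a \<in> Ob A" "p \<in> omap P (b', a)" "x \<in> omap X a" "k = cl P X b' a p x" by (rule coendE)
    show "\<psi> b (act (ext_ob P X) g k) = act Z g (\<psi> b' k)"
      unfolding t(4) ext_act[OF P X g t(1-3)] \<psi>[OF ob(2) t(1-3)] \<psi>[OF ob(1) t(1) ract_in[OF P g t(1,2)] t(3)]
      by (rule nat[OF g t(1-3)])
  qed
  moreover have "app ?\<tau> b (cl P X b a p x) = u b a p x"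
    if "b \<in> Ob B" "a \<in> Ob A" "p \<in> omap P (b, a)" "x \<in> omap X a" for b a p x
    using \<psi>[OF that] that cl_in[where X = X and x = x, OF that(2-4)] by (simp add: psh_nt_app)
  ultimately show thesis by (rule that)
qed

definition sprof :: "'u prof \<Rightarrow> bool" where
  "sprof P \<longleftrightarrow> prof P \<and> stabilized A \<A> B \<B> P"

lemma SProf_ob [simp]: "P \<in> Ob (SProf A \<A> B \<B>) \<longleftrightarrow> sprof P"
  by (simp add: SProf_def Prof_def sprof_def prof_def)

lemma SProf_hom:
  "\<theta> \<in> homs (SProf A \<A> B \<B>) P Q \<longleftrightarrow> \<theta> \<in> homs (fun_cat (prod_cat (op_cat B) A) set_cat) P Q \<and> sprof P \<and> sprof Q"
  using nt_homD(1,2)[of \<theta> "prod_cat (op_cat B) A" set_cat P Q]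
  by (auto simp: SProf_def Prof_def sprof_def prof_def)

lemma sprof_prof: "sprof P \<Longrightarrow> prof P"
  by (simp add: sprof_def)

lemma sprof_stab:
  "sprof P \<Longrightarrow> a \<in> Ob A \<Longrightarrow> b \<in> Ob B \<Longrightarrow> p \<in> omap P (b, a) \<Longrightarrow> \<alpha> \<in> homs A a a \<Longrightarrow> \<beta> \<in> homs B b b \<Longrightarrow>
   act P (\<beta>, \<alpha>) p = p \<Longrightarrow> \<alpha> \<in> \<Union>(\<A> a) \<Longrightarrow> \<beta> \<in> \<Union>(\<B> b)"
  unfolding sprof_def stabilized_def by blast

text \<open>The identity of \<open>b\<close> lies in the orthogonal kit, so the second stabilization
  condition with \<beta> an identity puts \<alpha> into the orthogonal kit of \<open>A\<close> as
  well.\<close>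

lemma sprof_free:
  assumes P: "sprof P" and a: "a \<in> Ob A" and b: "b \<in> Ob B" and p: "p \<in> omap P (b, a)"
    and \<alpha>: "\<alpha> \<in> homs A a a" "\<alpha> \<in> \<Union>(\<A> a)" and fixed: "lact P b \<alpha> p = p"
  shows "\<alpha> = Idt A a"
proof -
  have "\<alpha> \<in> \<Union>(kit_perp A \<A> a)"
    using P a b p \<alpha>(1) cat_id[OF B.cat b] fixed B.id_perp[OF b] unfolding sprof_def stabilized_def lact_def by blast
  then show ?thesis by (rule A.perp_disjoint[OF a \<alpha>(2)])
qed

text \<open>If \<beta> fixes the class of \<open>(a, p, x)\<close>, the witnessing arrow
  \<open>f\<close> fixes \<open>x\<close> and together with \<beta> fixes \<open>p\<close>. As
  \<open>X\<close> is stabilized, \<open>f\<close> is covered by the kit, and the first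
  stabilization condition transfers this to \<beta>.\<close>

lemma ext_st:
  assumes P: "sprof P" and X: "A.st X"
  shows "B.st (ext_ob P X)"
  unfolding B.st_def
proof (intro conjI ballI impI)
  note P' = sprof_prof[OF P] and X' = A.st_psh[OF X]
  show "psh B (ext_ob P X)" by (rule ext_ob_functor[OF P' X'])
  fix b k \<beta> assume b: "b \<in> Ob B" and k: "k \<in> omap (ext_ob P X) b" and \<beta>: "\<beta> \<in> homs B b b"
    and fixed: "act (ext_ob P X) \<beta> k = k"
  have "k \<in> coend A B P X b" using b k by simp
  then obtain a p x where t: "a \<in> Ob A" "p \<in> omap P (b, a)" "x \<in> omap X a" "k = cl P X b a p x" by (rule coendE)
  have "cl P X b a (ract P a \<beta> p) x = cl P X b a p x"
    using fixed ext_act[OF P' X' \<beta> t(1-3)] by (simp add: t(4))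
  then obtain f where f: "f \<in> homs A a a" "p = lact P b f (ract P a \<beta> p)" "x = act X f x"
    using cl_eq_iff[OF P' X' b t(1) ract_in[OF P' \<beta> t(1,2)] t(3) t(1-3)] by blast
  have "f \<in> \<Union>(\<A> a)" using A.st_stab[OF X t(1,3) f(1)] f(3) by simp
  moreover have "act P (\<beta>, f) p = p" using act_split(1)[OF P' \<beta> f(1) t(2)] f(2) by simp
  ultimately show "\<beta> \<in> \<Union>(\<B> b)" using sprof_stab[OF P t(1) b t(2) f(1) \<beta>] by blast
qed

text \<open>The arrow that identifies the two classes fixes \<open>p\<close> and the common image in
  \<open>X\<close>. The latter puts it into the kit, and by \<open>sprof_free\<close> it is then the
  identity.\<close>

lemma cl_cancel:
  assumes P: "sprof P" and \<tau>: "\<tau> \<in> homs (PSh A) Y X" and X: "A.st X" and b: "b \<in> Ob B"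
    and a: "a \<in> Ob A" and p: "p \<in> omap P (b, a)" and y: "y \<in> omap Y a" and y': "y' \<in> omap Y a"
    and over: "app \<tau> a y = app \<tau> a y'" and eq: "cl P Y b a p y = cl P Y b a p y'"
  shows "y = y'"
proof -
  note P' = sprof_prof[OF P] and YX = psh_hom_ob[OF \<tau>]
  obtain f where f: "f \<in> homs A a a" "p = lact P b f p" "y = act Y f y'"
    using eq cl_eq_iff[OF P' YX(1) b a p y a p y'] by blast
  have "act X f (app \<tau> a y') = app \<tau> a y'"
    using psh_nat[OF \<tau> f(1) y'] f(3) over by simp
  then have "f \<in> \<Union>(\<A> a)" by (rule A.st_stab[OF X a psh_in[OF \<tau> a y'] f(1)])
  then have "f = Idt A a" using sprof_free[OF P a b p f(1)] f(2) by simp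
  then show ?thesis using f(3) psh_id[OF YX(1) a y'] by simp
qed

lemma st_ext_ob: "A.st X \<Longrightarrow> omap (ext P) X = ext_ob P X"
  using A.StPSh_ob[of X] A.st_psh[of X] by (simp add: st_ext_def restrict_functor_def psh_ext_def)

lemma st_ext_ar: "\<tau> \<in> homs SA X Y \<Longrightarrow> amap (ext P) \<tau> = ext_map P \<tau>"
  using homsD(1)[of \<tau> "SA" X Y] homsD(1)[of \<tau> "PSh A" X Y]
  by (auto simp: st_ext_def restrict_functor_def psh_ext_simps A.StPSh_hom)

lemma functor_st_ext:
  assumes P: "sprof P"
  shows "is_functor SA SB (ext P)"
proof (rule functorI[OF A.category_StPSh B.category_StPSh])
  let ?T = "ext P"
  note P' = sprof_prof[OF P]
  show "omap ?T \<in> extensional (Ob SA)" "amap ?T \<in> extensional (Ar SA)"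
    by (simp_all add: st_ext_def restrict_functor_def)
  show "omap ?T X \<in> Ob SB" if "X \<in> Ob SA" for X
    using that ext_st[OF P] by (simp add: st_ext_ob)
  show "amap ?T f \<in> homs SB (omap ?T X) (omap ?T Y)" if f: "f \<in> homs SA X Y" for f X Y
    using f ext_st[OF P] ext_map_hom[OF P'] by (auto simp: A.StPSh_hom B.StPSh_hom st_ext_ob st_ext_ar[OF f])
  show "amap ?T (Idt SA X) = Idt SB (omap ?T X)" if X: "X \<in> Ob SA" for X
    using X ext_map_id[OF P' A.st_psh] st_ext_ar[OF cat_id[OF A.category_StPSh X]] by (simp add: st_ext_ob)
  show "amap ?T (Cmp SA g f) = Cmp SB (amap ?T g) (amap ?T f)"
    if f: "f \<in> homs SA X Y" and g: "g \<in> homs SA Y Z" for f g X Y Z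
    using f g ext_map_comp[OF P'] st_ext_ar[OF cat_comp[OF A.category_StPSh f g]] st_ext_ar[OF f] st_ext_ar[OF g]
    by (auto simp: A.StPSh_hom)
qed

text \<open>
  The right adjoint sends \<open>k\<close> to the presheaf of pairs of an element \<open>x \<in> X a\<close> and a natural family of elements of
  \<open>K\<close> lying over the classes of \<open>(a, p, x)\<close>.
\<close>

lemma st_ext_couniversal:
  assumes P: "sprof P" and X: "A.st X"
  shows "slice_couniversal SA SB (ext P) X"
  unfolding slice_couniversal_def
proof (intro allI ballI)
  note P' = sprof_prof[OF P] and X' = A.st_psh[OF X]
  fix K k assume k: "k \<in> homs SB K (omap (ext P) X)"
  then have k': "k \<in> homs (PSh B) K (ext_ob P X)" and K: "B.st K"
    using X by (simp_all add: B.StPSh_hom st_ext_ob)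
  note K' = B.st_psh[OF K]
  define D where "D a = (SIGMA b:Ob B. omap P (b, a))" for a
  \<comment> \<open>The last two conditions say that the family lies over the classes of
    \<open>(a, p, x)\<close> and is natural in \<open>b\<close>; extensionality off
    \<open>D a\<close> makes a family determined by its values.\<close>
  define S where "S a = {(x, s). x \<in> omap X a \<and> s \<in> (\<Pi>\<^sub>E (b, p)\<in>D a. omap K b) \<and>
    (\<forall>b\<in>Ob B. \<forall>p\<in>omap P (b, a). app k b (s (b, p)) = cl P X b a p x) \<and>
    (\<forall>b b'. \<forall>g\<in>homs B b b'. \<forall>p\<in>omap P (b', a). s (b, ract P a g p) = act K g (s (b', p)))}" for a
  define \<phi> where "\<phi> f t = (act X f (fst t), \<lambda>(b, p)\<in>D (Dom A f). snd t (b, lact P b f p))" for f and t :: "'u \<times> ('u \<times> 'u \<Rightarrow> 'u)"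
  have SI: "(x, s) \<in> S a" if "x \<in> omap X a" "s \<in> extensional (D a)"
      "\<And>b p. b \<in> Ob B \<Longrightarrow> p \<in> omap P (b, a) \<Longrightarrow> s (b, p) \<in> omap K b"
      "\<And>b p. b \<in> Ob B \<Longrightarrow> p \<in> omap P (b, a) \<Longrightarrow> app k b (s (b, p)) = cl P X b a p x"
      "\<And>b b' g p. g \<in> homs B b b' \<Longrightarrow> p \<in> omap P (b', a) \<Longrightarrow> s (b, ract P a g p) = act K g (s (b', p))" for a x s
    using that by (auto simp: S_def D_def PiE_def)
  have SD: "fst t \<in> omap X a" "snd t \<in> extensional (D a)"
      "\<And>b p. b \<in> Ob B \<Longrightarrow> p \<in> omap P (b, a) \<Longrightarrow> snd t (b, p) \<in> omap K b"
      "\<And>b p. b \<in> Ob B \<Longrightarrow> p \<in> omap P (b, a) \<Longrightarrow> app k b (snd t (b, p)) = cl P X b a p (fst t)"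
      "\<And>b b' g p. g \<in> homs B b b' \<Longrightarrow> p \<in> omap P (b', a) \<Longrightarrow> snd t (b, ract P a g p) = act K g (snd t (b', p))"
    if "t \<in> S a" for t a
    using that by (auto simp: S_def D_def PiE_def Pi_def)
  have S_eqI: "t = t'" if t: "t \<in> S a" "t' \<in> S a" "fst t = fst t'"
    "\<And>b p. b \<in> Ob B \<Longrightarrow> p \<in> omap P (b, a) \<Longrightarrow> snd t (b, p) = snd t' (b, p)" for a t t'
  proof -
    have "snd t = snd t'"
      by (rule extensionalityI[OF SD(2)[OF t(1)] SD(2)[OF t(2)]]) (use t(4) in \<open>auto simp: D_def\<close>)
    with t(3) show ?thesis by (simp add: prod_eq_iff)
  qed
  have \<phi>_simps: "fst (\<phi> f t) = act X f (fst t)" for f t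
    by (simp add: \<phi>_def)
  have \<phi>_snd: "snd (\<phi> f t) (b, p) = snd t (b, lact P b f p)" if "f \<in> homs A a a'" "b \<in> Ob B" "p \<in> omap P (b, a)" for f t b p a a'
    using that by (simp add: \<phi>_def D_def homsD)
  have \<phi>_in: "\<phi> f t \<in> S a" if f: "f \<in> homs A a a'" and t: "t \<in> S a'" for f a a' t
  proof -
    note ob = cat_hom_ob[OF A.cat f]
    have "(fst (\<phi> f t), snd (\<phi> f t)) \<in> S a"
    proof (rule SI)
      show "fst (\<phi> f t) \<in> omap X a" using psh_act[OF X' f SD(1)[OF t]] by (simp add: \<phi>_simps)
      show "snd (\<phi> f t) \<in> extensional (D a)" using homsD(2)[OF f] by (auto simp: \<phi>_def)
      show "snd (\<phi> f t) (b, p) \<in> omap K b" if "b \<in> Ob B" "p \<in> omap P (b, a)" for b p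
        using SD(3)[OF t that(1) lact_in[OF P' that(1) f that(2)]] \<phi>_snd[OF f that] by simp
      show "app k b (snd (\<phi> f t) (b, p)) = cl P X b a p (fst (\<phi> f t))" if "b \<in> Ob B" "p \<in> omap P (b, a)" for b p
        using SD(4)[OF t that(1) lact_in[OF P' that(1) f that(2)]] \<phi>_snd[OF f that] cl_slide[OF P' X' that(1) f that(2) SD(1)[OF t]]
        by (simp add: \<phi>_simps)
      show "snd (\<phi> f t) (b, ract P a g p) = act K g (snd (\<phi> f t) (b', p))"
        if g: "g \<in> homs B b b'" and p: "p \<in> omap P (b', a)" for b b' g p
      proof -
        note obb = cat_hom_ob[OF B.cat g]
        show ?thesis
          using \<phi>_snd[OF f obb(1) ract_in[OF P' g ob(1) p], of t] \<phi>_snd[OF f obb(2) p, of t] lact_ract[OF P' g f p]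
            SD(5)[OF t g lact_in[OF P' obb(2) f p]] by simp
      qed
    qed
    then show ?thesis by simp
  qed
  have "\<exists>(W :: 'u psh) (e :: 'u \<Rightarrow> 'u \<times> ('u \<times> 'u \<Rightarrow> 'u) \<Rightarrow> 'u). psh A W \<and>
    (\<forall>a\<in>Ob A. bij_betw (e a) (S a) (omap W a)) \<and>
    (\<forall>b a. \<forall>f\<in>homs A a b. \<forall>t\<in>S b. act W f (e b t) = e a (\<phi> f t))"
  proof (rule ex_psh[OF A.cat])
    show "S a \<prec> (UNIV :: 'u set)" if a: "a \<in> Ob A" for a
    proof (rule lesspoll_subset)
      have Da: "D a \<prec> (UNIV :: 'u set)"
        using B.small_Ob prof_small[OF P' _ a] by (auto simp: D_def small_def intro!: lesspoll_Sigma[OF A.U])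
      have "(\<Pi>\<^sub>E (b, p)\<in>D a. omap K b) \<prec> (UNIV :: 'u set)"
        using psh_small[OF K'] by (intro lesspoll_PiE[OF A.U Da]) (auto simp: D_def small_def)
      then show "omap X a \<times> (\<Pi>\<^sub>E (b, p)\<in>D a. omap K b) \<prec> (UNIV :: 'u set)"
        using psh_small[OF X' a] by (intro lesspoll_Sigma[OF A.U]) (simp_all add: small_def)
      show "S a \<subseteq> omap X a \<times> (\<Pi>\<^sub>E (b, p)\<in>D a. omap K b)" by (auto simp: S_def)
    qed
    show "\<phi> f t \<in> S a" if "f \<in> homs A a b" "t \<in> S b" for f a b t by (rule \<phi>_in[OF that])
    show "\<phi> (Idt A a) t = t" if a: "a \<in> Ob A" and t: "t \<in> S a" for a t
      by (rule S_eqI[OF \<phi>_in[OF cat_id[OF A.cat a] t] t])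
         (use psh_id[OF X' a SD(1)[OF t]] \<phi>_snd[OF cat_id[OF A.cat a]] lact_id[OF P' _ a] in \<open>auto simp: \<phi>_simps\<close>)
    show "\<phi> (Cmp A g f) t = \<phi> f (\<phi> g t)" if f: "f \<in> homs A a b" and g: "g \<in> homs A b c" and t: "t \<in> S c" for f g a b c t
      by (rule S_eqI[OF \<phi>_in[OF cat_comp[OF A.cat f g] t] \<phi>_in[OF f \<phi>_in[OF g t]]])
         (use psh_comp[OF X' f g SD(1)[OF t]] \<phi>_snd[OF cat_comp[OF A.cat f g]] \<phi>_snd[OF f] \<phi>_snd[OF g]
           lact_comp[OF P' _ f g] lact_in[OF P' _ f] in \<open>auto simp: \<phi>_simps\<close>)
  qed
  then obtain W :: "'u psh" and e :: "'u \<Rightarrow> 'u \<times> ('u \<times> 'u \<Rightarrow> 'u) \<Rightarrow> 'u" where We: "psh A W \<and>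
    (\<forall>a\<in>Ob A. bij_betw (e a) (S a) (omap W a)) \<and>
    (\<forall>b a. \<forall>f\<in>homs A a b. \<forall>t\<in>S b. act W f (e b t) = e a (\<phi> f t))"
    by (elim exE) (rule that)
  then have W': "psh A W" by (rule conjunct1)
  have e: "bij_betw (e a) (S a) (omap W a)" if "a \<in> Ob A" for a
    using We that by blast
  have eact: "act W f (e b t) = e a (\<phi> f t)" if "f \<in> homs A a b" "t \<in> S b" for f a b t
    using We that by blast
  define d where "d a = inv_into (S a) (e a)" for a
  have d: "d a z \<in> S a" "e a (d a z) = z" if "a \<in> Ob A" "z \<in> omap W a" for a z
    using bij_betwE[OF bij_betw_inv_into[OF e[OF that(1)]]] bij_betw_inv_into_right[OF e[OF that(1)]] that(2)
    by (auto simp: d_def)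
  have de: "d a (e a t) = t" if "a \<in> Ob A" "t \<in> S a" for a t
    using bij_betw_inv_into_left[OF e[OF that(1)] that(2)] by (simp add: d_def)
  have ein: "e a t \<in> omap W a" if "a \<in> Ob A" "t \<in> S a" for a t
    using bij_betwE[OF e[OF that(1)]] that(2) by blast
  have dact: "d a (act W f z) = \<phi> f (d b z)" if f: "f \<in> homs A a b" and z: "z \<in> omap W b" for f a b z
    using eact[OF f d(1)[OF cat_hom_ob(2)[OF A.cat f] z]] d(2)[OF cat_hom_ob(2)[OF A.cat f] z]
      de[OF cat_hom_ob(1)[OF A.cat f] \<phi>_in[OF f d(1)[OF cat_hom_ob(2)[OF A.cat f] z]]] by simp
  define w where "w = psh_nt A W X (\<lambda>a z. fst (d a z))"
  have w': "w \<in> homs (PSh A) W X"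
    unfolding w_def by (rule psh_nt_hom[OF W' X']) (use SD(1) d dact in \<open>auto simp: \<phi>_simps\<close>)
  have wapp: "app w a z = fst (d a z)" if "a \<in> Ob A" "z \<in> omap W a" for a z
    using that by (simp add: w_def psh_nt_app)
  have w: "w \<in> homs SA W X" and W: "A.st W"
    using A.StPSh_over[OF w' X] A.st_over[OF w' X] by auto
  \<comment> \<open>The couniversal arrow is evaluation: the class of \<open>(a, p, z)\<close> goes
    to the value at \<open>(b, p)\<close> of the family coded by \<open>z\<close>.\<close>
  obtain c where c': "c \<in> homs (PSh B) (ext_ob P W) K"
    and capp: "\<And>b a p z. b \<in> Ob B \<Longrightarrow> a \<in> Ob A \<Longrightarrow> p \<in> omap P (b, a) \<Longrightarrow> z \<in> omap W a \<Longrightarrow>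
      app c b (cl P W b a p z) = snd (d a z) (b, p)"
  proof (rule ex_ext_map[OF P' W' K'])
    show "snd (d a z) (b, p) \<in> omap K b" if "b \<in> Ob B" "a \<in> Ob A" "p \<in> omap P (b, a)" "z \<in> omap W a" for b a p z
      using SD(3)[OF d(1)[OF that(2,4)] that(1,3)] .
    show "snd (d a' z) (b, lact P b f p) = snd (d a (act W f z)) (b, p)"
      if "b \<in> Ob B" "f \<in> homs A a a'" "p \<in> omap P (b, a)" "z \<in> omap W a'" for b f a a' p z
      using dact[OF that(2,4)] \<phi>_snd[OF that(2,1,3)] by simp
    show "snd (d a z) (b, ract P a g p) = act K g (snd (d a z) (b', p))"
      if "g \<in> homs B b b'" "a \<in> Ob A" "p \<in> omap P (b', a)" "z \<in> omap W a" for b b' g a p z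
      using SD(5)[OF d(1)[OF that(2,4)] that(1,3)] .
  qed (rule that)
  have c: "c \<in> homs SB (omap (ext P) W) K"
    using B.StPSh_over[OF c' K] W by (simp add: st_ext_ob)
  have kc: "Cmp (PSh B) k c = ext_map P w"
    by (rule ext_eqI[OF cat_comp[OF category_PSh[OF B.cat] c' k'] ext_map_hom[OF P' w']])
       (use SD(4) d in \<open>simp add: psh_cmp[OF c'] cl_in capp ext_map_app[OF P' w'] wapp\<close>)
  have univ: "\<exists>!t. t \<in> homs SA V W \<and> Cmp SA w t = v \<and> Cmp SB c (amap (ext P) t) = u"
    if v: "v \<in> homs SA V X" and u: "u \<in> homs SB (omap (ext P) V) K"
      and ku: "Cmp SB k u = amap (ext P) v" for V v u
  proof -
    have v': "v \<in> homs (PSh A) V X" and V: "A.st V" using v by (simp_all add: A.StPSh_hom)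
    have u': "u \<in> homs (PSh B) (ext_ob P V) K" using u V by (simp add: B.StPSh_hom st_ext_ob)
    note V' = A.st_psh[OF V]
    have ku': "app k b (app u b (cl P V b a p y)) = cl P X b a p (app v a y)"
      if "b \<in> Ob B" "a \<in> Ob A" "p \<in> omap P (b, a)" "y \<in> omap V a" for b a p y
      using ku psh_cmp[OF u' that(1), of "cl P V b a p y" k] cl_in[where X = V and x = y, OF that(2-4)] ext_map_app[OF P' v' that] st_ext_ar[OF v] that(1)
      by simp
    \<comment> \<open>The transpose of \<open>u\<close>: an element \<open>y\<close> yields the
      family of values of \<open>u\<close> at the classes of \<open>(a, p, y)\<close>. Evaluating it
      returns \<open>u\<close>, which leaves no other possibility.\<close>
    define s where "s a y = (app v a y, \<lambda>(b, p)\<in>D a. app u b (cl P V b a p y))" for a y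
    have s_snd: "snd (s a y) (b, p) = app u b (cl P V b a p y)" if "b \<in> Ob B" "p \<in> omap P (b, a)" for a y b p
      using that by (simp add: s_def D_def)
    have s: "s a y \<in> S a" if a: "a \<in> Ob A" and y: "y \<in> omap V a" for a y
    proof -
      have "(app v a y, snd (s a y)) \<in> S a"
      proof (rule SI)
        show "app v a y \<in> omap X a" by (rule psh_in[OF v' a y])
        show "snd (s a y) \<in> extensional (D a)" by (simp add: s_def)
        show "snd (s a y) (b, p) \<in> omap K b" if "b \<in> Ob B" "p \<in> omap P (b, a)" for b p
          using s_snd[OF that] psh_in[OF u' that(1)] cl_in[where X = V and x = y, OF a that(2) y] that(1) by simp
        show "app k b (snd (s a y) (b, p)) = cl P X b a p (app v a y)" if "b \<in> Ob B" "p \<in> omap P (b, a)" for b p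
          using s_snd[OF that] ku'[OF that(1) a that(2) y] by simp
        show "snd (s a y) (b, ract P a g p) = act K g (snd (s a y) (b', p))"
          if g: "g \<in> homs B b b'" and p: "p \<in> omap P (b', a)" for b b' g p
        proof -
          note obb = cat_hom_ob[OF B.cat g]
          show ?thesis
            using s_snd[OF obb(1) ract_in[OF P' g a p]] s_snd[OF obb(2) p] psh_nat[OF u' g, of "cl P V b' a p y"]
              cl_in[where X = V and x = y, OF a p y] obb ext_act[OF P' V' g a p y] by simp
        qed
      qed
      then show ?thesis by (simp add: s_def)
    qed
    have s_act: "s a (act V f y) = \<phi> f (s a' y)" if f: "f \<in> homs A a a'" and y: "y \<in> omap V a'" for f a a' y
    proof (rule S_eqI[OF s \<phi>_in[OF f s]])
      note ob = cat_hom_ob[OF A.cat f]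
      show "a \<in> Ob A" "a' \<in> Ob A" by (fact ob)+
      show "act V f y \<in> omap V a" by (rule psh_act[OF V' f y])
      show "y \<in> omap V a'" by (rule y)
      show "fst (s a (act V f y)) = fst (\<phi> f (s a' y))" using psh_nat[OF v' f y] by (simp add: s_def \<phi>_def)
      show "snd (s a (act V f y)) (b, p) = snd (\<phi> f (s a' y)) (b, p)" if "b \<in> Ob B" "p \<in> omap P (b, a)" for b p
        using s_snd[OF that] \<phi>_snd[OF f that] s_snd[OF that(1) lact_in[OF P' that(1) f that(2)]] cl_slide[OF P' V' that(1) f that(2) y]
        by simp
    qed
    define t where "t = psh_nt A V W (\<lambda>a y. e a (s a y))"
    have t': "t \<in> homs (PSh A) V W"
      unfolding t_def by (rule psh_nt_hom[OF V' W']) (use ein s s_act eact cat_hom_ob[OF A.cat] in auto)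
    have tapp: "app t a y = e a (s a y)" if "a \<in> Ob A" "y \<in> omap V a" for a y
      using that by (simp add: t_def psh_nt_app)
    have t: "t \<in> homs SA V W" using t' V W by (simp add: A.StPSh_hom)
    have wt: "Cmp (PSh A) w t = v"
      by (rule psh_eqI[OF cat_comp[OF category_PSh[OF A.cat] t' w'] v'])
         (use ein s in \<open>simp add: psh_cmp[OF t'] tapp wapp de\<close>, simp add: s_def)
    have ct: "Cmp (PSh B) c (ext_map P t) = u"
      by (rule ext_eqI[OF cat_comp[OF category_PSh[OF B.cat] ext_map_hom[OF P' t'] c'] u'])
         (use ein s in \<open>simp add: psh_cmp[OF ext_map_hom[OF P' t']] cl_in ext_map_app[OF P' t'] tapp capp de s_snd\<close>)
    show ?thesis
    proof (intro ex1I[of _ t] conjI)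
      show "t \<in> homs SA V W" by (rule t)
      show "Cmp SA w t = v" using wt by simp
      show "Cmp SB c (amap (ext P) t) = u" using ct st_ext_ar[OF t] by simp
      fix r assume r: "r \<in> homs SA V W \<and> Cmp SA w r = v \<and> Cmp SB c (amap (ext P) r) = u"
      then have r': "r \<in> homs (PSh A) V W" and rs: "r \<in> homs SA V W" by (simp_all add: A.StPSh_hom)
      have wr: "Cmp (PSh A) w r = v" and cr: "Cmp (PSh B) c (ext_map P r) = u" using r st_ext_ar[OF rs] by simp_all
      show "r = t"
      proof (rule psh_eqI[OF r' t'])
        fix a y assume a: "a \<in> Ob A" and y: "y \<in> omap V a"
        note ry = psh_in[OF r' a y]
        have "d a (app r a y) = s a y"
        proof (rule S_eqI[OF d(1)[OF a ry] s[OF a y]])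
          show "fst (d a (app r a y)) = fst (s a y)"
            using wr psh_cmp[OF r' a y, of w] wapp[OF a ry] by (simp add: s_def)
          show "snd (d a (app r a y)) (b, p) = snd (s a y) (b, p)" if "b \<in> Ob B" "p \<in> omap P (b, a)" for b p
            using cr psh_cmp[OF ext_map_hom[OF P' r'] that(1), of "cl P V b a p y" c] cl_in[where X = V and x = y, OF a that(2) y] that(1)
              ext_map_app[OF P' r' that(1) a that(2) y] capp[OF that(1) a that(2) ry] s_snd[OF that] by simp
        qed
        then show "app r a y = app t a y" using d(2)[OF a ry] tapp[OF a y] by simp
      qed
    qed
  qed
  have kc': "Cmp SB k c = amap (ext P) w" using kc st_ext_ar[OF w] by simp
  show "\<exists>W. \<exists>w\<in>homs SA W X. \<exists>c\<in>homs SB (omap (ext P) W) K.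
      Cmp SB k c = amap (ext P) w \<and>
      (\<forall>V. \<forall>v\<in>homs SA V X. \<forall>u\<in>homs SB (omap (ext P) V) K.
        Cmp SB k u = amap (ext P) v \<longrightarrow>
        (\<exists>!t. t \<in> homs SA V W \<and> Cmp SA w t = v \<and> Cmp SB c (amap (ext P) t) = u))"
    by (intro exI[of _ W] bexI[OF _ w] bexI[OF _ c] conjI kc' allI ballI impI univ)
qed

text \<open>
  The left adjoint sends \<open>k\<close> to the presheaf of quadruples \<open>(b, p, z, x)\<close> with \<open>k z\<close> the class of \<open>(a, p, x)\<close>, modulo
  the action of \<open>B\<close>. The transposition is well defined because the fibre of \<open>V \<rightarrow> X\<close> over \<open>x\<close> is in bijection
  with the fibre over the class of \<open>(a, p, x)\<close>, by \<open>cl_cancel\<close>.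
\<close>

lemma st_ext_universal:
  assumes P: "sprof P" and X: "A.st X"
  shows "slice_universal SA SB (ext P) X"
  unfolding slice_universal_def
proof (intro allI ballI)
  note P' = sprof_prof[OF P] and X' = A.st_psh[OF X]
  fix K k assume k: "k \<in> homs SB K (omap (ext P) X)"
  then have k': "k \<in> homs (PSh B) K (ext_ob P X)" and K: "B.st K"
    using X by (simp_all add: B.StPSh_hom st_ext_ob)
  note K' = B.st_psh[OF K]
  define R where "R a = {(b, p, z, x). b \<in> Ob B \<and> p \<in> omap P (b, a) \<and> z \<in> omap K b \<and> x \<in> omap X a \<and>
    app k b z = cl P X b a p x}" for a
  define tr where "tr g a t = (case t of (b, p, z, x) \<Rightarrow> (Dom B g, ract P a g p, act K g z, x))" for g a and t :: "'u \<times> 'u \<times> 'u \<times> 'u"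
  \<comment> \<open>Orbits of the simultaneous action of \<open>B\<close> on \<open>p\<close> and
    \<open>z\<close>. Since arrows of \<open>B\<close> are invertible, one arrow always suffices and
    this is an equivalence relation on \<open>R a\<close>.\<close>
  define eqv where "eqv a t t' \<longleftrightarrow> (\<exists>g\<in>Ar B. fst t = Cod B g \<and> t' = tr g a t)" for a t t'
  define cs where "cs a t = {t'. eqv a t t'}" for a t
  \<comment> \<open>The presheaf action moves \<open>x\<close> backwards along \<open>f\<close>; the
    covariant component \<open>p\<close> has to be moved back by the inverse of \<open>f\<close>, so
    that the class of \<open>(a, p, x)\<close> under \<open>k z\<close> stays the same.\<close>
  define mv where "mv f t = (case t of (b, p, z, x) \<Rightarrow> (b, lact P b (A.ginv f) p, z, act X f x))" for f and t :: "'u \<times> 'u \<times> 'u \<times> 'u"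
  have RI: "(b, p, z, x) \<in> R a \<longleftrightarrow> b \<in> Ob B \<and> p \<in> omap P (b, a) \<and> z \<in> omap K b \<and> x \<in> omap X a \<and>
    app k b z = cl P X b a p x" for a b p z x
    by (simp add: R_def)
  have eqvI: "eqv a (b, p, z, x) (b', ract P a g p, act K g z, x)" if "g \<in> homs B b' b" for a b b' p z x g
    unfolding eqv_def using homsD[OF that] by (intro bexI[of _ g]) (simp_all add: tr_def)
  have eqvD: "\<exists>g\<in>homs B b' b. p' = ract P a g p \<and> z' = act K g z \<and> x' = x"
    if "eqv a (b, p, z, x) (b', p', z', x')" for a b p z x b' p' z' x'
    using that by (auto simp: eqv_def tr_def homs_def)
  have eqv_R: "t' \<in> R a" if a: "a \<in> Ob A" and t: "t \<in> R a" and eq: "eqv a t t'" for a t t'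
  proof -
    obtain b p z x b' p' z' x' where tt: "t = (b, p, z, x)" "t' = (b', p', z', x')" by (cases t, cases t') auto
    obtain g where g: "g \<in> homs B b' b" "p' = ract P a g p" "z' = act K g z" "x' = x"
      using eqvD eq unfolding tt by blast
    note t' = t[unfolded tt RI]
    show ?thesis
      unfolding tt(2) RI using t' g cat_hom_ob[OF B.cat g(1)] ract_in[OF P' g(1) a] psh_act[OF K' g(1)]
        psh_nat[OF k' g(1)] ext_act[OF P' X' g(1) a] by simp
  qed
  have eqv_refl: "eqv a t t" if a: "a \<in> Ob A" and t: "t \<in> R a" for a t
  proof -
    obtain b p z x where tt: "t = (b, p, z, x)" by (cases t) auto
    note t' = t[unfolded tt RI]
    have "ract P a (Idt B b) p = p" "act K (Idt B b) z = z"
      using t' ract_id[OF P' _ a] psh_id[OF K'] by simp_all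
    then show ?thesis
      using eqvI[OF cat_id[OF B.cat], of b a p z x] t' by (simp add: tt)
  qed
  have eqv_sym: "eqv a t' t" if a: "a \<in> Ob A" and t: "t \<in> R a" and eq: "eqv a t t'" for a t t'
  proof -
    obtain b p z x b' p' z' x' where tt: "t = (b, p, z, x)" "t' = (b', p', z', x')" by (cases t, cases t') auto
    obtain g where g: "g \<in> homs B b' b" "p' = ract P a g p" "z' = act K g z" "x' = x"
      using eqvD eq unfolding tt by blast
    note t' = t[unfolded tt RI] and gi = B.ginv[OF g(1)]
    have "ract P a (B.ginv g) p' = p" "act K (B.ginv g) z' = z"
      using t' g ract_comp[OF P' gi(1) g(1) a] gi(3) ract_id[OF P' _ a] psh_comp[OF K' gi(1) g(1)] psh_id[OF K'] by auto
    then show ?thesis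
      using eqvI[OF gi(1), of a p' z' x'] g(4) by (simp add: tt)
  qed
  have eqv_trans: "eqv a t t''" if a: "a \<in> Ob A" and t: "t \<in> R a" and eq: "eqv a t t'" "eqv a t' t''" for a t t' t''
  proof -
    obtain b p z x b' p' z' x' b'' p'' z'' x'' where tt: "t = (b, p, z, x)" "t' = (b', p', z', x')" "t'' = (b'', p'', z'', x'')"
      by (cases t, cases t', cases t'') auto
    obtain g where g: "g \<in> homs B b' b" "p' = ract P a g p" "z' = act K g z" "x' = x"
      using eqvD eq(1) unfolding tt by blast
    obtain h where h: "h \<in> homs B b'' b'" "p'' = ract P a h p'" "z'' = act K h z'" "x'' = x'"
      using eqvD eq(2) unfolding tt by blast
    note t' = t[unfolded tt RI]
    show ?thesis
      using eqvI[OF cat_comp[OF B.cat h(1) g(1)], of a p z x] g h t' ract_comp[OF P' h(1) g(1) a] psh_comp[OF K' h(1) g(1)]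
      by (simp add: tt)
  qed
  have cs_eq: "cs a t = cs a t' \<longleftrightarrow> eqv a t t'" if a: "a \<in> Ob A" and t: "t \<in> R a" and t': "t' \<in> R a" for a t t'
  proof
    assume "cs a t = cs a t'"
    then show "eqv a t t'" using eqv_refl[OF a t'] by (auto simp: cs_def)
  next
    assume eq: "eqv a t t'"
    show "cs a t = cs a t'"
      unfolding cs_def using eqv_trans[OF a t' eqv_sym[OF a t eq]] eqv_trans[OF a t eq] by blast
  qed
  have mv_R: "mv f t \<in> R a" if f: "f \<in> homs A a a'" and t: "t \<in> R a'" for f a a' t
  proof -
    obtain b p z x where tt: "t = (b, p, z, x)" by (cases t) auto
    note t' = t[unfolded tt RI]
    then have b: "b \<in> Ob B" and p: "p \<in> omap P (b, a')" and x: "x \<in> omap X a'" by simp_all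
    note gp = lact_in[OF P' b A.ginv(1)[OF f] p]
    show ?thesis
      using t' gp psh_act[OF X' f x] cl_slide[OF P' X' b f gp x] lact_ginv'[OF P' b f p] by (simp add: tt mv_def RI)
  qed
  have mv_eqv: "eqv a (mv f t) (mv f t')" if f: "f \<in> homs A a a'" and t: "t \<in> R a'" and eq: "eqv a' t t'" for f a a' t t'
  proof -
    obtain b p z x b' p' z' x' where tt: "t = (b, p, z, x)" "t' = (b', p', z', x')" by (cases t, cases t') auto
    obtain g where g: "g \<in> homs B b' b" "p' = ract P a' g p" "z' = act K g z" "x' = x"
      using eqvD eq unfolding tt by blast
    note t' = t[unfolded tt RI]
    show ?thesis
      using eqvI[OF g(1), of a "lact P b (A.ginv f) p" z "act X f x"] g t' lact_ract[OF P' g(1) A.ginv(1)[OF f]]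
      by (simp add: tt mv_def)
  qed
  define S where "S a = cs a ` R a" for a
  define \<phi> where "\<phi> f c = (\<Union>t\<in>c. cs (Dom A f) (mv f t))" for f c
  have \<phi>_cs: "\<phi> f (cs a' t) = cs a (mv f t)" if f: "f \<in> homs A a a'" and t: "t \<in> R a'" for f a a' t
  proof -
    note ob = cat_hom_ob[OF A.cat f]
    have "cs a (mv f t') = cs a (mv f t)" if "t' \<in> cs a' t" for t'
    proof -
      have eq: "eqv a' t t'" using that by (simp add: cs_def)
      have "t' \<in> R a'" by (rule eqv_R[OF ob(2) t eq])
      from cs_eq[OF ob(1) mv_R[OF f t] mv_R[OF f this]] show ?thesis
        using mv_eqv[OF f t eq] by simp
    qed
    moreover have "t \<in> cs a' t" using eqv_refl[OF ob(2) t] by (simp add: cs_def)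
    ultimately show ?thesis unfolding \<phi>_def homsD(2)[OF f] by blast
  qed
  have "\<exists>(W :: 'u psh) (e :: 'u \<Rightarrow> ('u \<times> 'u \<times> 'u \<times> 'u) set \<Rightarrow> 'u). psh A W \<and>
    (\<forall>a\<in>Ob A. bij_betw (e a) (S a) (omap W a)) \<and>
    (\<forall>b a. \<forall>f\<in>homs A a b. \<forall>t\<in>S b. act W f (e b t) = e a (\<phi> f t))"
  proof (rule ex_psh[OF A.cat])
    show "S a \<prec> (UNIV :: 'u set)" if a: "a \<in> Ob A" for a
      unfolding S_def
    proof (rule lesspoll_image, rule lesspoll_subset)
      show "(SIGMA b:Ob B. omap P (b, a) \<times> omap K b \<times> omap X a) \<prec> (UNIV :: 'u set)"
        using B.small_Ob prof_small[OF P' _ a] psh_small[OF K'] psh_small[OF X' a]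
        by (intro lesspoll_Sigma[OF A.U]) (auto simp: small_def)
      show "R a \<subseteq> (SIGMA b:Ob B. omap P (b, a) \<times> omap K b \<times> omap X a)" by (auto simp: R_def)
    qed
    show "\<phi> f c \<in> S a" if "f \<in> homs A a b" "c \<in> S b" for f a b c
      using that(2) \<phi>_cs[OF that(1)] mv_R[OF that(1)] by (auto simp: S_def)
    show "\<phi> (Idt A a) c = c" if a: "a \<in> Ob A" and c: "c \<in> S a" for a c
    proof -
      obtain t where t: "t \<in> R a" "c = cs a t" using c by (auto simp: S_def)
      obtain b p z x where tt: "t = (b, p, z, x)" by (cases t) auto
      note t' = t(1)[unfolded tt RI] and id = cat_id[OF A.cat a]
      have "lact P b (A.ginv (Idt A a)) p = p" "act X (Idt A a) x = x"
        using lact_ginv[OF P' _ id, of b p] lact_id[OF P' _ a, of b p] psh_id[OF X' a] t' by simp_all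
      then have "mv (Idt A a) t = t" by (simp add: mv_def tt)
      then show ?thesis using \<phi>_cs[OF id t(1)] t(2) by simp
    qed
    show "\<phi> (Cmp A g f) c = \<phi> f (\<phi> g c)" if f: "f \<in> homs A a b" and g: "g \<in> homs A b a'" and c: "c \<in> S a'" for f g a b a' c
    proof -
      obtain t where t: "t \<in> R a'" "c = cs a' t" using c by (auto simp: S_def)
      obtain b' p z x where tt: "t = (b', p, z, x)" by (cases t) auto
      note t' = t(1)[unfolded tt RI] and gf = cat_comp[OF A.cat f g]
      then have b: "b' \<in> Ob B" and p: "p \<in> omap P (b', a')" and x: "x \<in> omap X a'" by simp_all
      define q where "q = lact P b' (A.ginv f) (lact P b' (A.ginv g) p)"
      have q: "q \<in> omap P (b', a)"
        unfolding q_def using lact_in[OF P' b A.ginv(1)[OF f] lact_in[OF P' b A.ginv(1)[OF g] p]] .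
      have "p = lact P b' (Cmp A g f) q"
        using lact_comp[OF P' b f g q] lact_ginv'[OF P' b f lact_in[OF P' b A.ginv(1)[OF g] p]] lact_ginv'[OF P' b g p]
        by (simp add: q_def)
      then have "lact P b' (A.ginv (Cmp A g f)) p = q"
        using lact_ginv[OF P' b gf q] by simp
      then have "mv (Cmp A g f) t = mv f (mv g t)"
        using psh_comp[OF X' f g x] by (simp add: mv_def tt q_def)
      then show ?thesis
        using \<phi>_cs[OF gf t(1)] \<phi>_cs[OF g t(1)] \<phi>_cs[OF f mv_R[OF g t(1)]] t(2) by simp
    qed
  qed
  then obtain W :: "'u psh" and e :: "'u \<Rightarrow> ('u \<times> 'u \<times> 'u \<times> 'u) set \<Rightarrow> 'u" where We: "psh A W \<and>
    (\<forall>a\<in>Ob A. bij_betw (e a) (S a) (omap W a)) \<and>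
    (\<forall>b a. \<forall>f\<in>homs A a b. \<forall>t\<in>S b. act W f (e b t) = e a (\<phi> f t))"
    by (elim exE) (rule that)
  then have W': "psh A W" by (rule conjunct1)
  have e: "bij_betw (e a) (S a) (omap W a)" if "a \<in> Ob A" for a
    using We that by blast
  have eact: "act W f (e b t) = e a (\<phi> f t)" if "f \<in> homs A a b" "t \<in> S b" for f a b t
    using We that by blast
  define q where "q a t = e a (cs a t)" for a t
  have q_in: "q a t \<in> omap W a" if "a \<in> Ob A" "t \<in> R a" for a t
    using bij_betwE[OF e[OF that(1)]] that(2) by (auto simp: q_def S_def)
  have q_eq: "q a t = q a t' \<longleftrightarrow> eqv a t t'" if "a \<in> Ob A" "t \<in> R a" "t' \<in> R a" for a t t'
    using inj_on_eq_iff[OF bij_betw_imp_inj_on[OF e[OF that(1)]], of "cs a t" "cs a t'"] that cs_eq[OF that]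
    by (auto simp: q_def S_def)
  have q_ex: "\<exists>t\<in>R a. y = q a t" if "a \<in> Ob A" "y \<in> omap W a" for a y
    using bij_betw_imp_surj_on[OF e[OF that(1)]] that(2) by (auto simp: q_def S_def)
  have q_act: "act W f (q a' t) = q a (mv f t)" if "f \<in> homs A a a'" "t \<in> R a'" for f a a' t
    using eact[OF that(1), of "cs a' t"] \<phi>_cs[OF that] that(2) by (auto simp: q_def S_def)
  \<comment> \<open>The universal property of the quotient: maps out of \<open>W\<close> are given
    on quadruples, constant on orbits and compatible with \<open>mv\<close>.\<close>
  have lift: "\<exists>\<tau>. \<tau> \<in> homs (PSh A) W Y \<and> (\<forall>a\<in>Ob A. \<forall>t\<in>R a. app \<tau> a (q a t) = h a t)"
    if Y: "psh A Y" and h: "\<And>a t. a \<in> Ob A \<Longrightarrow> t \<in> R a \<Longrightarrow> h a t \<in> omap Y a"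
      and inv: "\<And>a t t'. a \<in> Ob A \<Longrightarrow> t \<in> R a \<Longrightarrow> t' \<in> R a \<Longrightarrow> eqv a t t' \<Longrightarrow> h a t = h a t'"
      and nat: "\<And>f a a' t. f \<in> homs A a a' \<Longrightarrow> t \<in> R a' \<Longrightarrow> h a (mv f t) = act Y f (h a' t)" for Y h
  proof -
    define \<psi> where "\<psi> a y = h a (SOME t. t \<in> R a \<and> y = q a t)" for a y
    have \<psi>: "\<psi> a (q a t) = h a t" if a: "a \<in> Ob A" and t: "t \<in> R a" for a t
    proof -
      have "\<exists>t'. t' \<in> R a \<and> q a t = q a t'" using t by blast
      from someI_ex[OF this] show ?thesis
        unfolding \<psi>_def using inv[OF a t] q_eq[OF a t] by metis
    qed
    have "psh_nt A W Y \<psi> \<in> homs (PSh A) W Y"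
    proof (rule psh_nt_hom[OF W' Y])
      show "\<psi> a y \<in> omap Y a" if "a \<in> Ob A" "y \<in> omap W a" for a y
        using q_ex[OF that] \<psi>[OF that(1)] h[OF that(1)] by auto
      show "\<psi> a (act W f y) = act Y f (\<psi> a' y)" if f: "f \<in> homs A a a'" and y: "y \<in> omap W a'" for f a a' y
      proof -
        note ob = cat_hom_ob[OF A.cat f]
        obtain t where t: "t \<in> R a'" "y = q a' t" using q_ex[OF ob(2) y] by blast
        show ?thesis
          unfolding t(2) q_act[OF f t(1)] \<psi>[OF ob(1) mv_R[OF f t(1)]] \<psi>[OF ob(2) t(1)] by (rule nat[OF f t(1)])
      qed
    qed
    moreover have "\<forall>a\<in>Ob A. \<forall>t\<in>R a. app (psh_nt A W Y \<psi>) a (q a t) = h a t"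
      using \<psi> q_in by (simp add: psh_nt_app)
    ultimately show ?thesis by blast
  qed
  have "\<exists>w. w \<in> homs (PSh A) W X \<and> (\<forall>a\<in>Ob A. \<forall>t\<in>R a. app w a (q a t) = snd (snd (snd t)))"
    by (rule lift[OF X']) (auto simp: R_def mv_def eqv_def tr_def)
  then obtain w where w': "w \<in> homs (PSh A) W X"
    and wapp: "\<And>a t. a \<in> Ob A \<Longrightarrow> t \<in> R a \<Longrightarrow> app w a (q a t) = snd (snd (snd t))" by blast
  have w: "w \<in> homs SA W X" and W: "A.st W"
    using A.StPSh_over[OF w' X] A.st_over[OF w' X] by auto
  have k_cl: "\<exists>a p x. a \<in> Ob A \<and> (b, p, z, x) \<in> R a" if b: "b \<in> Ob B" and z: "z \<in> omap K b" for b z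
  proof -
    have "app k b z \<in> coend A B P X b" using psh_in[OF k' b z] b by simp
    then show ?thesis by (rule coendE) (use b z in \<open>auto simp: RI\<close>)
  qed
  define \<eta> where "\<eta> b z = (SOME y. \<exists>a p x. a \<in> Ob A \<and> (b, p, z, x) \<in> R a \<and> y = cl P W b a p (q a (b, p, z, x)))" for b z
  \<comment> \<open>Two presentations of \<open>k z\<close> differ by an arrow \<open>f\<close> of
    \<open>A\<close>. As \<open>mv f\<close> carries one quadruple to the other, sliding along
    \<open>f\<close> in the coend over \<open>W\<close> shows that the unit at \<open>z\<close> is
    independent of the presentation.\<close>
  have \<eta>: "\<eta> b z = cl P W b a p (q a (b, p, z, x))" if a: "a \<in> Ob A" and t: "(b, p, z, x) \<in> R a" for b z a p x
    unfolding \<eta>_def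
  proof (rule some_equality)
    show "\<exists>a' p' x'. a' \<in> Ob A \<and> (b, p', z, x') \<in> R a' \<and> cl P W b a p (q a (b, p, z, x)) = cl P W b a' p' (q a' (b, p', z, x'))"
      using a t by blast
    fix y assume "\<exists>a' p' x'. a' \<in> Ob A \<and> (b, p', z, x') \<in> R a' \<and> y = cl P W b a' p' (q a' (b, p', z, x'))"
    then obtain a' p' x' where a': "a' \<in> Ob A" and t': "(b, p', z, x') \<in> R a'"
      and y: "y = cl P W b a' p' (q a' (b, p', z, x'))" by blast
    note r = t[unfolded RI] and r' = t'[unfolded RI]
    have "cl P X b a p x = cl P X b a' p' x'" using r r' by simp
    then obtain f where f: "f \<in> homs A a a'" "p' = lact P b f p" "x = act X f x'"
      using cl_eq_iff[OF P' X', of b a p x a' p' x'] a a' r r' by blast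
    have "mv f (b, p', z, x') = (b, p, z, x)"
      using f lact_ginv[OF P' _ f(1), of b p] r by (simp add: mv_def)
    then have "act W f (q a' (b, p', z, x')) = q a (b, p, z, x)"
      using q_act[OF f(1) t'] by simp
    then show "y = cl P W b a p (q a (b, p, z, x))"
      using cl_slide[OF P' W' _ f(1), of b p "q a' (b, p', z, x')"] r q_in[OF a' t'] f(2) y by simp
  qed
  define c where "c = psh_nt B K (ext_ob P W) \<eta>"
  have c': "c \<in> homs (PSh B) K (ext_ob P W)"
    unfolding c_def
  proof (rule psh_nt_hom[OF K' ext_ob_functor[OF P' W']])
    show "\<eta> b z \<in> omap (ext_ob P W) b" if bz: "b \<in> Ob B" "z \<in> omap K b" for b z
    proof -
      obtain a p x where t: "a \<in> Ob A" "(b, p, z, x) \<in> R a" using k_cl[OF bz] by blast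
      show ?thesis
        using \<eta>[OF t] cl_in[where X = W, OF t(1) _ q_in[OF t]] t(2)[unfolded RI] bz(1) by simp
    qed
    show "\<eta> b (act K g z) = act (ext_ob P W) g (\<eta> b' z)" if g: "g \<in> homs B b b'" and z: "z \<in> omap K b'" for g b b' z
    proof -
      note ob = cat_hom_ob[OF B.cat g]
      obtain a p x where t: "a \<in> Ob A" "(b', p, z, x) \<in> R a" using k_cl[OF ob(2) z] by blast
      note eq = eqvI[OF g, of a p z x]
      note t' = eqv_R[OF t eq]
      show ?thesis
        unfolding \<eta>[OF t(1) t'] \<eta>[OF t] using ext_act[OF P' W' g t(1) _ q_in[OF t]] t(2)[unfolded RI] q_eq[OF t t'] eq by simp
    qed
  qed
  have capp: "app c b z = cl P W b a p (q a (b, p, z, x))" if "a \<in> Ob A" "(b, p, z, x) \<in> R a" for b z a p x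
    using \<eta>[OF that] that(2)[unfolded RI] by (simp add: c_def psh_nt_app)
  have c: "c \<in> homs SB K (omap (ext P) W)"
    using c' K W ext_st[OF P W] by (simp add: B.StPSh_hom st_ext_ob)
  note Tw' = ext_map_hom[OF P' w']
  have wc: "Cmp (PSh B) (ext_map P w) c = k"
  proof (rule psh_eqI[OF cat_comp[OF category_PSh[OF B.cat] c' Tw'] k'])
    fix b z assume bz: "b \<in> Ob B" "z \<in> omap K b"
    obtain a p x where t: "a \<in> Ob A" "(b, p, z, x) \<in> R a" using k_cl[OF bz] by blast
    show "app (Cmp (PSh B) (ext_map P w) c) b z = app k b z"
      using psh_cmp[OF c' bz] capp[OF t] ext_map_app[OF P' w' bz(1) t(1) _ q_in[OF t]] wapp[OF t] t(2)[unfolded RI] by simp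
  qed
  have univ: "\<exists>!t. t \<in> homs SA W V \<and> Cmp SA v t = w \<and> Cmp SB (amap (ext P) t) c = u"
    if v: "v \<in> homs SA V X" and u: "u \<in> homs SB K (omap (ext P) V)"
      and vu: "Cmp SB (amap (ext P) v) u = k" for V v u
  proof -
    have v': "v \<in> homs (PSh A) V X" and V: "A.st V" using v by (simp_all add: A.StPSh_hom)
    have u': "u \<in> homs (PSh B) K (ext_ob P V)" using u V by (simp add: B.StPSh_hom st_ext_ob)
    note V' = A.st_psh[OF V]
    have vu': "app (ext_map P v) b (app u b z) = app k b z" if "b \<in> Ob B" "z \<in> omap K b" for b z
      using vu psh_cmp[OF u' that, of "ext_map P v"] st_ext_ar[OF v] by simp
    \<comment> \<open>The candidates for the image of the class of \<open>t = (b, p, z, x)\<close>: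
      elements over \<open>x\<close> whose class together with \<open>p\<close> is
      \<open>u z\<close>.\<close>
    define good where "good a t y \<longleftrightarrow> y \<in> omap V a \<and> app v a y = snd (snd (snd t)) \<and>
      app u (fst t) (fst (snd (snd t))) = cl P V (fst t) a (fst (snd t)) y" for a t y
    \<comment> \<open>\<open>u z\<close> is presented by some \<open>(a0, p0, y0)\<close> in the
      coend over \<open>V\<close>. It lies over \<open>k z\<close>, the class of
      \<open>(a, p, x)\<close>, so an arrow \<open>f\<close> from \<open>a0\<close> to
      \<open>a\<close> takes \<open>p0\<close> to \<open>p\<close>; transporting \<open>y0\<close>
      along \<open>f\<close> gives the required element.\<close>
    have good_ex: "\<exists>y. good a t y" if a: "a \<in> Ob A" and t: "t \<in> R a" for a t
    proof -
      obtain b p z x where tt: "t = (b, p, z, x)" by (cases t) auto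
      note r = t[unfolded tt RI]
      then have b: "b \<in> Ob B" and p: "p \<in> omap P (b, a)" and z: "z \<in> omap K b" and x: "x \<in> omap X a" by simp_all
      have "app u b z \<in> coend A B P V b" using psh_in[OF u' b z] b by simp
      then obtain a0 p0 y0 where t0: "a0 \<in> Ob A" "p0 \<in> omap P (b, a0)" "y0 \<in> omap V a0" "app u b z = cl P V b a0 p0 y0"
        by (rule coendE)
      have "cl P X b a0 p0 (app v a0 y0) = cl P X b a p x"
        using vu'[OF b z] ext_map_app[OF P' v' b t0(1-3)] t0(4) r by simp
      then obtain f where f: "f \<in> homs A a0 a" "p = lact P b f p0" "app v a0 y0 = act X f x"
        using cl_eq_iff[OF P' X' b t0(1,2) psh_in[OF v' t0(1,3)] a p x] by blast
      define y where "y = act V (A.ginv f) y0"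
      note fi = A.ginv[OF f(1)]
      have y: "y \<in> omap V a" unfolding y_def by (rule psh_act[OF V' fi(1) t0(3)])
      have "act V f y = y0"
        unfolding y_def using psh_comp[OF V' f(1) fi(1) t0(3)] fi(2) psh_id[OF V' t0(1,3)] by simp
      then have "cl P V b a p y = app u b z"
        using cl_slide[OF P' V' b f(1) t0(2) y] f(2) t0(4) by simp
      moreover have "app v a y = x"
        unfolding y_def using psh_nat[OF v' fi(1) t0(3)] f(3) psh_ginv[OF X' f(1) x] by simp
      ultimately show ?thesis using y by (auto simp: good_def tt)
    qed
    have good_uniq: "y = y'" if a: "a \<in> Ob A" and t: "t \<in> R a" and "good a t y" "good a t y'" for a t y y'
    proof -
      obtain b p z x where tt: "t = (b, p, z, x)" by (cases t) auto
      show ?thesis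
        using that(3,4) t[unfolded tt RI] unfolding good_def tt
        by (intro cl_cancel[OF P v' X _ a, of b p y y']) auto
    qed
    define h where "h a t = (SOME y. good a t y)" for a t
    have h: "good a t (h a t)" if "a \<in> Ob A" "t \<in> R a" for a t
      unfolding h_def by (rule someI_ex[OF good_ex[OF that]])
    have "\<exists>s. s \<in> homs (PSh A) W V \<and> (\<forall>a\<in>Ob A. \<forall>t\<in>R a. app s a (q a t) = h a t)"
    proof (rule lift[OF V'])
      show "h a t \<in> omap V a" if "a \<in> Ob A" "t \<in> R a" for a t using h[OF that] by (simp add: good_def)
      show "h a t = h a t'" if a: "a \<in> Ob A" and t: "t \<in> R a" and t': "t' \<in> R a" and eq: "eqv a t t'" for a t t'
      proof (rule good_uniq[OF a t' _ h[OF a t']])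
        obtain b p z x b' p' z' x' where tt: "t = (b, p, z, x)" "t' = (b', p', z', x')" by (cases t, cases t') auto
        obtain g where g: "g \<in> homs B b' b" "p' = ract P a g p" "z' = act K g z" "x' = x"
          using eqvD eq unfolding tt by blast
        note r = t[unfolded tt RI]
        show "good a t' (h a t)"
          using h[OF a t] psh_nat[OF u' g(1)] ext_act[OF P' V' g(1) a] r g by (simp add: good_def tt)
      qed
      show "h a (mv f t) = act V f (h a' t)" if f: "f \<in> homs A a a'" and t: "t \<in> R a'" for f a a' t
      proof (rule good_uniq)
        note ob = cat_hom_ob[OF A.cat f]
        show "a \<in> Ob A" by (rule ob(1))
        show "mv f t \<in> R a" by (rule mv_R[OF f t])
        show "good a (mv f t) (h a (mv f t))" by (rule h[OF ob(1) mv_R[OF f t]])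
        obtain b p z x where tt: "t = (b, p, z, x)" by (cases t) auto
        note r = t[unfolded tt RI]
        then have b: "b \<in> Ob B" and p: "p \<in> omap P (b, a')" by simp_all
        note gd = h[OF ob(2) t, unfolded good_def tt]
        note gp = lact_in[OF P' b A.ginv(1)[OF f] p]
        show "good a (mv f t) (act V f (h a' t))"
          using gd psh_act[OF V' f] psh_nat[OF v' f] cl_slide[OF P' V' b f gp] lact_ginv'[OF P' b f p]
          by (simp add: good_def tt mv_def)
      qed
    qed
    then obtain s where s': "s \<in> homs (PSh A) W V"
      and sapp: "\<And>a t. a \<in> Ob A \<Longrightarrow> t \<in> R a \<Longrightarrow> app s a (q a t) = h a t" by blast
    have s: "s \<in> homs SA W V" using s' V W by (simp add: A.StPSh_hom)
    have vs: "Cmp (PSh A) v s = w"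
    proof (rule psh_eqI[OF cat_comp[OF category_PSh[OF A.cat] s' v'] w'])
      fix a y assume a: "a \<in> Ob A" and y: "y \<in> omap W a"
      obtain t where t: "t \<in> R a" "y = q a t" using q_ex[OF a y] by blast
      show "app (Cmp (PSh A) v s) a y = app w a y"
        using psh_cmp[OF s' a y, of v] sapp[OF a t(1)] wapp[OF a t(1)] h[OF a t(1)] t(2) by (simp add: good_def)
    qed
    have sc: "Cmp (PSh B) (ext_map P s) c = u"
    proof (rule psh_eqI[OF cat_comp[OF category_PSh[OF B.cat] c' ext_map_hom[OF P' s']] u'])
      fix b z assume bz: "b \<in> Ob B" "z \<in> omap K b"
      obtain a p x where t: "a \<in> Ob A" "(b, p, z, x) \<in> R a" using k_cl[OF bz] by blast
      show "app (Cmp (PSh B) (ext_map P s) c) b z = app u b z"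
        using psh_cmp[OF c' bz, of "ext_map P s"] capp[OF t] ext_map_app[OF P' s' bz(1) t(1) _ q_in[OF t]] sapp[OF t]
          h[OF t] t(2)[unfolded RI] by (simp add: good_def)
    qed
    show ?thesis
    proof (intro ex1I[of _ s] conjI)
      show "s \<in> homs SA W V" by (rule s)
      show "Cmp SA v s = w" using vs by simp
      show "Cmp SB (amap (ext P) s) c = u" using sc st_ext_ar[OF s] by simp
      fix r assume r: "r \<in> homs SA W V \<and> Cmp SA v r = w \<and> Cmp SB (amap (ext P) r) c = u"
      then have r': "r \<in> homs (PSh A) W V" and rs: "r \<in> homs SA W V" by (simp_all add: A.StPSh_hom)
      have vr: "Cmp (PSh A) v r = w" and rc: "Cmp (PSh B) (ext_map P r) c = u" using r st_ext_ar[OF rs] by simp_all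
      show "r = s"
      proof (rule psh_eqI[OF r' s'])
        fix a y assume a: "a \<in> Ob A" and y: "y \<in> omap W a"
        obtain t where t: "t \<in> R a" "y = q a t" using q_ex[OF a y] by blast
        obtain b p z x where tt: "t = (b, p, z, x)" by (cases t) auto
        note R' = t(1)[unfolded tt]
        note rr = R'[unfolded RI]
        have "app v a (app r a y) = x"
          using vr psh_cmp[OF r' a y, of v] wapp[OF a t(1)] t(2) by (simp add: tt)
        moreover have "app u b z = cl P V b a p (app r a y)"
          using rc psh_cmp[OF c', of b z "ext_map P r"] capp[OF a R'] ext_map_app[OF P' r' _ a _ y] rr t(2) tt by simp
        ultimately have "good a t (app r a y)" using psh_in[OF r' a y] by (simp add: good_def tt)
        then show "app r a y = app s a y"
          using good_uniq[OF a t(1) _ h[OF a t(1)]] sapp[OF a t(1)] t(2) by simp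
      qed
    qed
  qed
  have wc': "Cmp SB (amap (ext P) w) c = k" using wc st_ext_ar[OF w] by simp
  show "\<exists>W. \<exists>w\<in>homs SA W X. \<exists>c\<in>homs SB K (omap (ext P) W).
      Cmp SB (amap (ext P) w) c = k \<and>
      (\<forall>V. \<forall>v\<in>homs SA V X. \<forall>u\<in>homs SB K (omap (ext P) V).
        Cmp SB (amap (ext P) v) u = k \<longrightarrow>
        (\<exists>!t. t \<in> homs SA W V \<and> Cmp SA v t = w \<and> Cmp SB (amap (ext P) t) c = u))"
    by (intro exI[of _ W] bexI[OF _ w] bexI[OF _ c] conjI wc' allI ballI impI univ)
qed

text \<open>Preservation of colimits and of epimorphisms is a consequence of the right adjoints on
  slices, because stabilized presheaves have binary products.\<close>

lemma linear_st_ext: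
  assumes P: "sprof P"
  shows "lin (ext P)"
proof -
  note T = functor_st_ext[OF P]
  have cu: "slice_couniversal SA SB (ext P) X" if "X \<in> Ob SA" for X
    using st_ext_couniversal[OF P] that by simp
  have su: "slice_universal SA SB (ext P) X" if "X \<in> Ob SA" for X
    using st_ext_universal[OF P] that by simp
  have pc: "preserves_colimits_of_shape J SA SB (ext P)" for J :: "('u, 'u) cat"
    unfolding preserves_colimits_of_shape_def
  proof (intro allI impI)
    fix E c l assume colim: "is_colimit J SA E c l"
    then have "c \<in> Ob SA" unfolding is_colimit_def is_cocone_def by blast
    then show "is_colimit J SB (comp_functor J (ext P) E) (omap (ext P) c)
        (\<lambda>i. amap (ext P) (l i))"
      by (rule slice_couniversal_preserves_colimit[OF T B.has_products_StPSh cu colim])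
  qed
  have pe: "preserves_epis SA SB (ext P)"
    by (rule slice_couniversal_preserves_epi[OF T B.has_products_StPSh cu])
  show ?thesis
    unfolding linear_def stable_def slice_left_adjoint_iff[OF T] slice_right_adjoint_iff[OF T]
    by (intro conjI ballI allI impI T pc pe su cu)
qed

section \<open>The extension functor\<close>

abbreviation PC where "PC \<equiv> fun_cat (prod_cat (op_cat B) A) (set_cat :: ('u set, 'u smap) cat)"

lemma category_PC: "category PC"
  by (intro category_fun_cat category_prod_cat category_op_cat A.cat B.cat category_set_cat)

lemma PC_prof: "\<theta> \<in> homs PC P Q \<Longrightarrow> prof P" "\<theta> \<in> homs PC P Q \<Longrightarrow> prof Q"
  using nt_homD(1,2)[of \<theta> "prod_cat (op_cat B) A" set_cat P Q] by (simp_all add: prof_def)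

lemma PC_in: "\<theta> \<in> homs PC P Q \<Longrightarrow> b \<in> Ob B \<Longrightarrow> a \<in> Ob A \<Longrightarrow> p \<in> omap P (b, a) \<Longrightarrow> app \<theta> (b, a) p \<in> omap Q (b, a)"
  using snt_in[of \<theta> "prod_cat (op_cat B) A" P Q "(b, a)" p] by simp

lemma PC_nat:
  "\<theta> \<in> homs PC P Q \<Longrightarrow> g \<in> homs B b b' \<Longrightarrow> f \<in> homs A a a' \<Longrightarrow> p \<in> omap P (b', a) \<Longrightarrow>
   app \<theta> (b, a') (act P (g, f) p) = act Q (g, f) (app \<theta> (b', a) p)"
  using snt_nat[of \<theta> "prod_cat (op_cat B) A" P Q "(g, f)" "(b', a)" "(b, a')" p] by simp

lemma PC_lact:
  "\<theta> \<in> homs PC P Q \<Longrightarrow> b \<in> Ob B \<Longrightarrow> f \<in> homs A a a' \<Longrightarrow> p \<in> omap P (b, a) \<Longrightarrow>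
   app \<theta> (b, a') (lact P b f p) = lact Q b f (app \<theta> (b, a) p)"
  unfolding lact_def by (rule PC_nat[OF _ cat_id[OF B.cat]])

lemma PC_ract:
  "\<theta> \<in> homs PC P Q \<Longrightarrow> g \<in> homs B b b' \<Longrightarrow> a \<in> Ob A \<Longrightarrow> p \<in> omap P (b', a) \<Longrightarrow>
   app \<theta> (b, a) (ract P a g p) = ract Q a g (app \<theta> (b', a) p)"
  unfolding ract_def by (rule PC_nat[OF _ _ cat_id[OF A.cat]])

lemma PC_eqI:
  assumes "\<theta> \<in> homs PC P Q" "\<zeta> \<in> homs PC P Q"
    and "\<And>b a p. b \<in> Ob B \<Longrightarrow> a \<in> Ob A \<Longrightarrow> p \<in> omap P (b, a) \<Longrightarrow> app \<theta> (b, a) p = app \<zeta> (b, a) p"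
  shows "\<theta> = \<zeta>"
  using assms by (intro snt_eqI[OF assms(1,2)]) auto

lemma PC_cmp:
  "\<theta> \<in> homs PC P Q \<Longrightarrow> b \<in> Ob B \<Longrightarrow> a \<in> Ob A \<Longrightarrow> p \<in> omap P (b, a) \<Longrightarrow>
   app (Cmp PC \<zeta> \<theta>) (b, a) p = app \<zeta> (b, a) (app \<theta> (b, a) p)"
  using snt_comp[of \<theta> "prod_cat (op_cat B) A" P Q "(b, a)" p \<zeta>] by simp

lemma PC_idt: "b \<in> Ob B \<Longrightarrow> a \<in> Ob A \<Longrightarrow> p \<in> omap P (b, a) \<Longrightarrow> app (Idt PC P) (b, a) p = p"
  using snt_id[of "(b, a)" "prod_cat (op_cat B) A" p P] by simp

definition ext_nt :: "'u prof_map \<Rightarrow> 'u psh \<Rightarrow> 'u psh_map" where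
  "ext_nt \<theta> X = \<lparr>nsrc = ext_ob (nsrc \<theta>) X, ntgt = ext_ob (ntgt \<theta>) X,
         ncomp = (\<lambda>b\<in>Ob B. coend_map A B (nsrc \<theta>, X, b) (ntgt \<theta>, X, b)
                             (\<lambda>(a, p, x). (a, app \<theta> (b, a) p, x)))\<rparr>"

lemma ext_nt_app:
  assumes \<theta>: "\<theta> \<in> homs PC P Q" and X: "psh A X" and b: "b \<in> Ob B"
    and t: "a \<in> Ob A" "p \<in> omap P (b, a)" "x \<in> omap X a"
  shows "app (ext_nt \<theta> X) b (cl P X b a p x) = cl Q X b a (app \<theta> (b, a) p) x"
proof -
  note P = PC_prof(1)[OF \<theta>] and Q = PC_prof(2)[OF \<theta>]
  have src: "nsrc \<theta> = P" "ntgt \<theta> = Q" using nt_homD(6,7)[OF \<theta>] by auto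
  have "coend_in A B Q X b ((\<lambda>(a, p, x). (a, app \<theta> (b, a) p, x)) (inv_into UNIV triple_code (cl P X b a p x)))
     = coend_in A B Q X b ((\<lambda>(a, p, x). (a, app \<theta> (b, a) p, x)) (a, p, x))"
  proof (rule coend_map_fun[OF P X b _ t])
    fix a a' p x f assume f: "f \<in> homs A a a'" and p: "p \<in> omap P (b, a)" and x: "x \<in> omap X a'"
    note oba = cat_hom_ob[OF A.cat f]
    show "coend_in A B Q X b (case (a', lact P b f p, x) of (a, p, x) \<Rightarrow> (a, app \<theta> (b, a) p, x)) =
        coend_in A B Q X b (case (a, p, act X f x) of (a, p, x) \<Rightarrow> (a, app \<theta> (b, a) p, x))"
      using cl_slide[OF Q X b f PC_in[OF \<theta> b oba(1) p] x] PC_lact[OF \<theta> b f p] by (simp add: cl_def)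
  qed
  then show ?thesis
    using b cl_in[where x = x and X = X, OF t] by (simp add: ext_nt_def coend_map_def src cl_def)
qed

lemma ext_nt_hom:
  assumes \<theta>: "\<theta> \<in> homs PC P Q" and X: "psh A X"
  shows "ext_nt \<theta> X \<in> homs (PSh B) (ext_ob P X) (ext_ob Q X)"
proof -
  note P = PC_prof(1)[OF \<theta>] and Q = PC_prof(2)[OF \<theta>]
  have src: "nsrc \<theta> = P" "ntgt \<theta> = Q" using nt_homD(6,7)[OF \<theta>] by auto
  show ?thesis
    unfolding PSh_def
  proof (rule snt_homI[OF ext_ob_functor[OF P X] ext_ob_functor[OF Q X]])
    show "app (ext_nt \<theta> X) b k \<in> omap (ext_ob Q X) b"
      if b: "b \<in> Ob (op_cat B)" and k: "k \<in> omap (ext_ob P X) b" for b k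
    proof -
      have "k \<in> coend A B P X b" using b k by simp
      then obtain a p x where t: "a \<in> Ob A" "p \<in> omap P (b, a)" "x \<in> omap X a" "k = cl P X b a p x" by (rule coendE)
      show ?thesis
        using b ext_nt_app[OF \<theta> X _ t(1-3)] cl_in[where X = X and x = x, OF t(1) PC_in[OF \<theta> _ t(1,2)] t(3)] by (simp add: t(4))
    qed
    show "app (ext_nt \<theta> X) b' (act (ext_ob P X) g k) = act (ext_ob Q X) g (app (ext_nt \<theta> X) b k)"
      if "g \<in> homs (op_cat B) b b'" and k: "k \<in> omap (ext_ob P X) b" for g b b' k
    proof -
      have g: "g \<in> homs B b' b" using that by simp
      note ob = cat_hom_ob[OF B.cat g]
      have "k \<in> coend A B P X b" using ob k by simp
      then obtain a p x where t: "a \<in> Ob A" "p \<in> omap P (b, a)" "x \<in> omap X a" "k = cl P X b a p x" by (rule coendE)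
      show ?thesis
        unfolding t(4) ext_act[OF P X g t(1-3)] ext_nt_app[OF \<theta> X ob(2) t(1-3)]
          ext_nt_app[OF \<theta> X ob(1) t(1) ract_in[OF P g t(1,2)] t(3)] ext_act[OF Q X g t(1) PC_in[OF \<theta> ob(2) t(1,2)] t(3)]
          PC_ract[OF \<theta> g t(1,2)] ..
    qed
  qed (auto simp: ext_nt_def coend_map_def src)
qed

lemma ext_nt_nat:
  assumes \<theta>: "\<theta> \<in> homs PC P Q" and h: "h \<in> homs (PSh A) X Y"
  shows "Cmp (PSh B) (ext_nt \<theta> Y) (ext_map P h) = Cmp (PSh B) (ext_map Q h) (ext_nt \<theta> X)"
proof (rule ext_eqI)
  note P = PC_prof(1)[OF \<theta>] and Q = PC_prof(2)[OF \<theta>] and XY = psh_hom_ob[OF h]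
  note Ph = ext_map_hom[OF P h] and Qh = ext_map_hom[OF Q h] and tX = ext_nt_hom[OF \<theta> XY(1)] and tY = ext_nt_hom[OF \<theta> XY(2)]
  show "Cmp (PSh B) (ext_nt \<theta> Y) (ext_map P h) \<in> homs (PSh B) (ext_ob P X) (ext_ob Q Y)"
    by (rule cat_comp[OF category_PSh[OF B.cat] Ph tY])
  show "Cmp (PSh B) (ext_map Q h) (ext_nt \<theta> X) \<in> homs (PSh B) (ext_ob P X) (ext_ob Q Y)"
    by (rule cat_comp[OF category_PSh[OF B.cat] tX Qh])
  show "app (Cmp (PSh B) (ext_nt \<theta> Y) (ext_map P h)) b (cl P X b a p x) =
      app (Cmp (PSh B) (ext_map Q h) (ext_nt \<theta> X)) b (cl P X b a p x)"
    if "b \<in> Ob B" "a \<in> Ob A" "p \<in> omap P (b, a)" "x \<in> omap X a" for b a p x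
    using that by (simp add: psh_cmp[OF Ph] psh_cmp[OF tX] cl_in ext_map_app[OF P h] ext_nt_app[OF \<theta> XY(1)]
      ext_nt_app[OF \<theta> XY(2)] ext_map_app[OF Q h] psh_in[OF h] PC_in[OF \<theta>])
qed

lemma st_ext_map_comp: "A.st X \<Longrightarrow> ncomp (st_ext_map A \<A> B \<theta>) X = ext_nt \<theta> X"
  using A.StPSh_ob[of X] by (simp add: st_ext_map_def ext_nt_def)

lemma ext_nt_hom_st:
  assumes \<theta>: "\<theta> \<in> homs PC P Q" and P: "sprof P" and Q: "sprof Q" and X: "A.st X"
  shows "ext_nt \<theta> X \<in> homs SB (ext_ob P X) (ext_ob Q X)"
  using ext_nt_hom[OF \<theta> A.st_psh[OF X]] ext_st[OF P X] ext_st[OF Q X] by (simp add: B.StPSh_hom)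

lemma st_ext_map_hom:
  assumes \<theta>: "\<theta> \<in> homs PC P Q" and P: "sprof P" and Q: "sprof Q"
  shows "st_ext_map A \<A> B \<theta> \<in> homs (fun_cat SA SB) (ext P) (ext Q)"
proof (rule nt_homI[OF functor_st_ext[OF P] functor_st_ext[OF Q]])
  show "ncomp (st_ext_map A \<A> B \<theta>) X \<in> homs SB (omap (ext P) X) (omap (ext Q) X)" if "X \<in> Ob SA" for X
    using that ext_nt_hom_st[OF \<theta> P Q] by (simp add: st_ext_map_comp st_ext_ob)
  show "Cmp SB (ncomp (st_ext_map A \<A> B \<theta>) Y) (amap (ext P) f) =
      Cmp SB (amap (ext Q) f) (ncomp (st_ext_map A \<A> B \<theta>) X)" if f: "f \<in> homs SA X Y" for f X Y
    using f ext_nt_nat[OF \<theta>, of f X Y] by (simp add: st_ext_ar[OF f] A.StPSh_hom st_ext_map_comp)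
qed (use nt_homD(6,7)[OF \<theta>] in \<open>simp_all add: st_ext_map_def\<close>)

text \<open>Existence: matching classes \<open>(a', q, x)\<close> and \<open>(a, p, y)\<close> in
  the coend of \<open>Q\<close> over \<open>Y\<close> are linked by an arrow \<open>f\<close>, and
  \<open>(a, p, x \<cdot> f)\<close> presents the lift. Uniqueness: two lifts with the same image
  over \<open>Y\<close> can be written with the same \<open>a\<close> and \<open>p\<close>; their
  last components agree in \<open>Y\<close> and have equal classes for \<open>Q\<close>, so
  \<open>cl_cancel\<close> for \<open>Q\<close> identifies them.\<close>

lemma cartesian_st_ext_map:
  assumes \<theta>: "\<theta> \<in> homs PC P Q" and P: "sprof P" and Q: "sprof Q"
  shows "cartesian SA SB (st_ext_map A \<A> B \<theta>)"
  unfolding cartesian_def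
proof
  fix h assume "h \<in> Ar SA"
  then obtain X Y where h: "h \<in> homs SA X Y" by (blast dest: ar_hom)
  then have h': "h \<in> homs (PSh A) X Y" and X: "A.st X" and Y: "A.st Y" by (simp_all add: A.StPSh_hom)
  note X' = A.st_psh[OF X] and Y' = A.st_psh[OF Y] and P' = sprof_prof[OF P] and Q' = sprof_prof[OF Q]
  note Ph = ext_map_hom[OF P' h'] and Qh = ext_map_hom[OF Q' h']
  have "is_pullback SB (ext_nt \<theta> X) (ext_map P h) (ext_map Q h) (ext_nt \<theta> Y)"
  proof (rule B.StPSh_pullback[OF ext_nt_hom_st[OF \<theta> P Q X] _ _ ext_nt_hom_st[OF \<theta> P Q Y]])
    show "ext_map P h \<in> homs SB (ext_ob P X) (ext_ob P Y)"
      using Ph ext_st[OF P X] ext_st[OF P Y] by (simp add: B.StPSh_hom)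
    show "ext_map Q h \<in> homs SB (ext_ob Q X) (ext_ob Q Y)"
      using Qh ext_st[OF Q X] ext_st[OF Q Y] by (simp add: B.StPSh_hom)
    show "Cmp SB (ext_map Q h) (ext_nt \<theta> X) = Cmp SB (ext_nt \<theta> Y) (ext_map P h)"
      using ext_nt_nat[OF \<theta> h'] by simp
  next
    fix b k l assume b: "b \<in> Ob B" and k: "k \<in> omap (ext_ob Q X) b" and l: "l \<in> omap (ext_ob P Y) b"
      and eq: "app (ext_map Q h) b k = app (ext_nt \<theta> Y) b l"
    have "k \<in> coend A B Q X b" "l \<in> coend A B P Y b" using k l b by simp_all
    then obtain a' q x a p y where t': "a' \<in> Ob A" "q \<in> omap Q (b, a')" "x \<in> omap X a'" "k = cl Q X b a' q x"
      and t: "a \<in> Ob A" "p \<in> omap P (b, a)" "y \<in> omap Y a" "l = cl P Y b a p y"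
      by (elim coendE) (rule that)
    note tp = PC_in[OF \<theta> b t(1,2)]
    have "cl Q Y b a (app \<theta> (b, a) p) y = cl Q Y b a' q (app h a' x)"
      using eq ext_map_app[OF Q' h' b t'(1-3)] ext_nt_app[OF \<theta> Y' b t(1-3)] by (simp add: t(4) t'(4))
    then obtain f where f: "f \<in> homs A a a'" "q = lact Q b f (app \<theta> (b, a) p)" "y = act Y f (app h a' x)"
      using cl_eq_iff[OF Q' Y' b t(1) tp t(3) t'(1,2) psh_in[OF h' t'(1,3)]] by blast
    note fx = psh_act[OF X' f(1) t'(3)]
    show "\<exists>w\<in>omap (ext_ob P X) b. app (ext_nt \<theta> X) b w = k \<and> app (ext_map P h) b w = l"
    proof (intro bexI[of _ "cl P X b a p (act X f x)"] conjI)
      show "app (ext_nt \<theta> X) b (cl P X b a p (act X f x)) = k"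
        using ext_nt_app[OF \<theta> X' b t(1,2) fx] cl_slide[OF Q' X' b f(1) tp t'(3)] f(2) t'(4) by simp
      show "app (ext_map P h) b (cl P X b a p (act X f x)) = l"
        using ext_map_app[OF P' h' b t(1,2) fx] psh_nat[OF h' f(1) t'(3)] f(3) t(4) by simp
      show "cl P X b a p (act X f x) \<in> omap (ext_ob P X) b"
        using cl_in[where X = X and x = "act X f x", OF t(1,2) fx] b by simp
    qed
  next
    fix b w w' assume b: "b \<in> Ob B" and w: "w \<in> omap (ext_ob P X) b" and w': "w' \<in> omap (ext_ob P X) b"
      and eq1: "app (ext_nt \<theta> X) b w = app (ext_nt \<theta> X) b w'" and eq2: "app (ext_map P h) b w = app (ext_map P h) b w'"
    have "w \<in> coend A B P X b" "w' \<in> coend A B P X b" using w w' b by simp_all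
    then obtain a p x a' p' x' where t: "a \<in> Ob A" "p \<in> omap P (b, a)" "x \<in> omap X a" "w = cl P X b a p x"
      and t': "a' \<in> Ob A" "p' \<in> omap P (b, a')" "x' \<in> omap X a'" "w' = cl P X b a' p' x'"
      by (elim coendE) (rule that)
    have "cl P Y b a p (app h a x) = cl P Y b a' p' (app h a' x')"
      using eq2 ext_map_app[OF P' h' b t(1-3)] ext_map_app[OF P' h' b t'(1-3)] by (simp add: t(4) t'(4))
    then obtain f where f: "f \<in> homs A a a'" "p' = lact P b f p" "app h a x = act Y f (app h a' x')"
      using cl_eq_iff[OF P' Y' b t(1,2) psh_in[OF h' t(1,3)] t'(1,2) psh_in[OF h' t'(1,3)]] by blast
    note fx = psh_act[OF X' f(1) t'(3)]
    have w'eq: "w' = cl P X b a p (act X f x')"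
      using cl_slide[OF P' X' b f(1) t(2) t'(3)] f(2) t'(4) by simp
    have "x = act X f x'"
    proof (rule cl_cancel[OF Q h' Y b t(1) PC_in[OF \<theta> b t(1,2)] t(3) fx])
      show "app h a x = app h a (act X f x')" using f(3) psh_nat[OF h' f(1) t'(3)] by simp
      show "cl Q X b a (app \<theta> (b, a) p) x = cl Q X b a (app \<theta> (b, a) p) (act X f x')"
        using eq1 ext_nt_app[OF \<theta> X' b t(1-3)] ext_nt_app[OF \<theta> X' b t(1,2) fx] by (simp add: t(4) w'eq)
    qed
    then show "w = w'" using t(4) w'eq by simp
  qed
  then show "is_pullback SB (ncomp (st_ext_map A \<A> B \<theta>) (Dom SA h)) (amap (nsrc (st_ext_map A \<A> B \<theta>)) h)
      (amap (ntgt (st_ext_map A \<A> B \<theta>)) h) (ncomp (st_ext_map A \<A> B \<theta>) (Cod SA h))"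
    using X Y homsD(2,3)[OF h] nt_homD(6,7)[OF \<theta>]
    by (simp add: st_ext_map_comp st_ext_ar[OF h] st_ext_map_def[of A \<A> B \<theta>] flip: st_ext_map_comp)
qed

section \<open>The category of linear functors and the functor into it\<close>

lemma linear_functor: "lin L \<Longrightarrow> is_functor SA SB L"
  by (simp add: linear_def stable_def)

lemma Lin_simps [simp]:
  "L \<in> Ob (Lin A \<A> B \<B>) \<longleftrightarrow> lin L"
  "Dom (Lin A \<A> B \<B>) = nsrc" "Cod (Lin A \<A> B \<B>) = ntgt"
  "Idt (Lin A \<A> B \<B>) = Idt (fun_cat SA SB)" "Cmp (Lin A \<A> B \<B>) = Cmp (fun_cat SA SB)"
  using linear_functor[of L] by (auto simp: Lin_def Let_def)

lemma Lin_hom: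
  "\<tau> \<in> homs (Lin A \<A> B \<B>) L M \<longleftrightarrow> \<tau> \<in> homs (fun_cat SA SB) L M \<and> lin L \<and> lin M \<and> cartesian SA SB \<tau>"
  by (auto simp: Lin_def Let_def homs_def)

lemma category_fun_SA_SB: "category (fun_cat SA SB)"
  by (intro category_fun_cat A.category_StPSh B.category_StPSh)

lemma category_Lin: "category (Lin A \<A> B \<B>)"
proof (rule categoryI)
  let ?L = "Lin A \<A> B \<B>"
  note FC = category_fun_SA_SB
  show "Dom ?L f \<in> Ob ?L" "Cod ?L f \<in> Ob ?L" if "f \<in> Ar ?L" for f
    using ar_hom[OF that] by (simp_all add: Lin_hom)
  show "Idt ?L L \<in> homs ?L L L" if "L \<in> Ob ?L" for L
  proof -
    have L: "lin L" using that by simp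
    note F = linear_functor[OF L]
    have id: "Idt (fun_cat SA SB) L \<in> homs (fun_cat SA SB) L L" using cat_id[OF FC] F by simp
    have "cartesian SA SB (Idt (fun_cat SA SB) L)"
      by (rule cartesian_iso[OF id]) (use functor_ob[OF F] in \<open>simp add: is_iso_id[OF B.category_StPSh] del: A.StPSh_ob B.StPSh_ob B.StPSh_simps\<close>)
    with id L show ?thesis by (simp add: Lin_hom)
  qed
  show "Cmp ?L g f \<in> homs ?L a c" if "f \<in> homs ?L a b" "g \<in> homs ?L b c" for f g a b c
    using that cat_comp[OF FC, of f a b g c] cartesian_comp[of f SA SB a b g c] by (simp add: Lin_hom)
  show "Cmp ?L f (Idt ?L a) = f" "Cmp ?L (Idt ?L b) f = f" if "f \<in> homs ?L a b" for f a b
    using that cat_id_left[OF FC, of f a b] cat_id_right[OF FC, of f a b] by (simp_all add: Lin_hom)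
  show "Cmp ?L h (Cmp ?L g f) = Cmp ?L (Cmp ?L h g) f"
    if "f \<in> homs ?L a b" "g \<in> homs ?L b c" "h \<in> homs ?L c d" for f g h a b c d
    using that cat_assoc[OF FC, of f a b g c h d] by (simp add: Lin_hom)
qed

lemma category_SProf: "category (SProf A \<A> B \<B>)"
  unfolding SProf_def Prof_def by (rule category_full_subcat[OF category_PC])

lemma SProf_simps [simp]: "Idt (SProf A \<A> B \<B>) = Idt PC" "Cmp (SProf A \<A> B \<B>) = Cmp PC"
  "Dom (SProf A \<A> B \<B>) = nsrc" "Cod (SProf A \<A> B \<B>) = ntgt"
  by (simp_all add: SProf_def Prof_def)

abbreviation Ext where "Ext \<equiv> st_ext_functor A \<A> B \<B>"

lemma Ext_simps:
  "sprof P \<Longrightarrow> omap Ext P = ext P"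
  "\<theta> \<in> homs (SProf A \<A> B \<B>) P Q \<Longrightarrow> amap Ext \<theta> = st_ext_map A \<A> B \<theta>"
  using SProf_ob[of P] homsD(1)[of \<theta> "SProf A \<A> B \<B>" P Q] by (simp_all add: st_ext_functor_def)

lemma functor_Ext: "is_functor (SProf A \<A> B \<B>) (Lin A \<A> B \<B>) Ext"
proof (rule functorI[OF category_SProf category_Lin])
  let ?S = "SProf A \<A> B \<B>" and ?L = "Lin A \<A> B \<B>"
  show "omap Ext \<in> extensional (Ob ?S)" "amap Ext \<in> extensional (Ar ?S)"
    by (simp_all add: st_ext_functor_def)
  show "omap Ext P \<in> Ob ?L" if "P \<in> Ob ?S" for P
    using that linear_st_ext by (simp add: Ext_simps)
  show "amap Ext \<theta> \<in> homs ?L (omap Ext P) (omap Ext Q)" if \<theta>: "\<theta> \<in> homs ?S P Q" for \<theta> P Q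
    using \<theta> st_ext_map_hom[of \<theta> P Q] cartesian_st_ext_map[of \<theta> P Q] linear_st_ext
    by (simp add: Ext_simps(2)[OF \<theta>]) (simp add: SProf_hom Ext_simps(1) Lin_hom)
  show "amap Ext (Idt ?S P) = Idt ?L (omap Ext P)" if P: "P \<in> Ob ?S" for P
  proof -
    have P': "sprof P" using P by simp
    have id: "Idt PC P \<in> homs PC P P" using cat_id[OF category_SProf P] by (simp add: SProf_hom)
    have "st_ext_map A \<A> B (Idt PC P) = Idt (fun_cat SA SB) (ext P)"
    proof (rule nt_hom_eqI[OF st_ext_map_hom[OF id P' P'] cat_id[OF category_fun_SA_SB]])
      show "ext P \<in> Ob (fun_cat SA SB)" using functor_st_ext[OF P'] by simp
      fix X assume X: "X \<in> Ob SA"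
      then have X': "A.st X" by simp
      note X'' = A.st_psh[OF X']
      have "ext_nt (Idt PC P) X = Idt (PSh B) (ext_ob P X)"
        by (rule ext_eqI[OF ext_nt_hom[OF id X''] cat_id[OF category_PSh[OF B.cat]]])
           (use ext_ob_functor[OF sprof_prof[OF P'] X''] in \<open>simp_all add: ext_nt_app[OF id X''] PC_idt psh_idt cl_in\<close>)
      then show "ncomp (st_ext_map A \<A> B (Idt PC P)) X = ncomp (Idt (fun_cat SA SB) (ext P)) X"
        using X X' by (simp add: st_ext_map_comp st_ext_ob)
    qed
    then show ?thesis
      using Ext_simps(2)[OF cat_id[OF category_SProf P]] Ext_simps(1)[OF P'] by simp
  qed
  show "amap Ext (Cmp ?S \<zeta> \<theta>) = Cmp ?L (amap Ext \<zeta>) (amap Ext \<theta>)"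
    if \<theta>: "\<theta> \<in> homs ?S P Q" and \<zeta>: "\<zeta> \<in> homs ?S Q R" for \<theta> \<zeta> P Q R
  proof -
    have \<theta>': "\<theta> \<in> homs PC P Q" and \<zeta>': "\<zeta> \<in> homs PC Q R" and PQR: "sprof P" "sprof Q" "sprof R"
      using \<theta> \<zeta> by (simp_all add: SProf_hom)
    note c = cat_comp[OF category_PC \<theta>' \<zeta>']
    have "st_ext_map A \<A> B (Cmp PC \<zeta> \<theta>) = Cmp (fun_cat SA SB) (st_ext_map A \<A> B \<zeta>) (st_ext_map A \<A> B \<theta>)"
    proof (rule nt_hom_eqI[OF st_ext_map_hom[OF c PQR(1,3)]
          cat_comp[OF category_fun_SA_SB st_ext_map_hom[OF \<theta>' PQR(1,2)] st_ext_map_hom[OF \<zeta>' PQR(2,3)]]])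
      fix X assume X: "X \<in> Ob SA"
      then have X': "A.st X" by simp
      note X'' = A.st_psh[OF X']
      note t = ext_nt_hom[OF \<theta>' X''] and z = ext_nt_hom[OF \<zeta>' X'']
      have "ext_nt (Cmp PC \<zeta> \<theta>) X = Cmp (PSh B) (ext_nt \<zeta> X) (ext_nt \<theta> X)"
        by (rule ext_eqI[OF ext_nt_hom[OF c X''] cat_comp[OF category_PSh[OF B.cat] t z]])
           (simp add: psh_cmp[OF t] cl_in ext_nt_app[OF c X''] ext_nt_app[OF \<theta>' X''] ext_nt_app[OF \<zeta>' X''] PC_cmp[OF \<theta>'] PC_in[OF \<theta>']
             del: fun_cat_simps)
      then show "ncomp (st_ext_map A \<A> B (Cmp PC \<zeta> \<theta>)) X =
          ncomp (Cmp (fun_cat SA SB) (st_ext_map A \<A> B \<zeta>) (st_ext_map A \<A> B \<theta>)) X"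
        using X X' by (simp add: st_ext_map_comp)
    qed
    then show ?thesis
      using Ext_simps(2)[OF cat_comp[OF category_SProf \<theta> \<zeta>]] Ext_simps(2)[OF \<theta>] Ext_simps(2)[OF \<zeta>] by simp
  qed
qed

section \<open>The linear trace\<close>

abbreviation tr where "tr L \<equiv> tr_lin_ob A B L"

lemma yoneda_simps: "a \<in> Ob A \<Longrightarrow> omap (yoneda A) a = yoneda_ob A a"
  by (simp add: yoneda_def)

lemma L_st: "is_functor SA SB L \<Longrightarrow> A.st X \<Longrightarrow> B.st (omap L X)"
  using functor_ob[of SA SB L X] by simp

lemma L_hom: "is_functor SA SB L \<Longrightarrow> \<tau> \<in> homs SA X Y \<Longrightarrow> amap L \<tau> \<in> homs (PSh B) (omap L X) (omap L Y)"
  using functor_hom[of SA SB L \<tau> X Y] by (simp add: B.StPSh_hom)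

lemma L_comp: "is_functor SA SB L \<Longrightarrow> \<tau> \<in> homs SA X Y \<Longrightarrow> \<sigma> \<in> homs SA Y Z \<Longrightarrow>
   amap L (Cmp (PSh A) \<sigma> \<tau>) = Cmp (PSh B) (amap L \<sigma>) (amap L \<tau>)"
  using functor_comp[of SA SB L \<tau> X Y \<sigma> Z] by simp

lemma L_id: "is_functor SA SB L \<Longrightarrow> A.st X \<Longrightarrow> amap L (Idt (PSh A) X) = Idt (PSh B) (omap L X)"
  using functor_id[of SA SB L X] by simp

lemma L_app:
  assumes "is_functor SA SB L" "\<tau> \<in> homs SA X Y" "\<sigma> \<in> homs SA Y Z" "b \<in> Ob B" "p \<in> omap (omap L X) b"
  shows "app (amap L \<sigma>) b (app (amap L \<tau>) b p) = app (amap L (Cmp (PSh A) \<sigma> \<tau>)) b p"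
  using L_comp[OF assms(1-3)] psh_cmp[OF L_hom[OF assms(1,2)] assms(4,5)] by simp

lemma L_id_app:
  "is_functor SA SB L \<Longrightarrow> A.st X \<Longrightarrow> b \<in> Ob B \<Longrightarrow> p \<in> omap (omap L X) b \<Longrightarrow> app (amap L (Idt (PSh A) X)) b p = p"
  by (simp add: L_id psh_idt)

lemma tr_ob: "b \<in> Ob B \<Longrightarrow> a \<in> Ob A \<Longrightarrow> omap (tr L) (b, a) = omap (omap L (yoneda_ob A a)) b"
  by (simp add: tr_lin_ob_def Let_def comp_functor_simps yoneda_simps)

lemma tr_ar:
  assumes g: "g \<in> homs B b b'" and f: "f \<in> homs A a a'"
  shows "amap (tr L) (g, f) = Cmp set_cat (ncomp (amap L (A.ymap f)) b) (amap (omap L (yoneda_ob A a)) g)"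
  using homsD[OF g] homsD[OF f] cat_hom_ob[OF A.cat f]
  by (simp add: tr_lin_ob_def Let_def comp_functor_simps yoneda_simps A.ymap_def)

lemma tr_act:
  assumes L: "is_functor SA SB L" and g: "g \<in> homs B b b'" and f: "f \<in> homs A a a'" and p: "p \<in> omap (tr L) (b', a)"
  shows "act (tr L) (g, f) p = app (amap L (A.ymap f)) b (act (omap L (yoneda_ob A a)) g p)"
proof -
  note ob = cat_hom_ob[OF A.cat f] and obb = cat_hom_ob[OF B.cat g]
  have "psh B (omap L (yoneda_ob A a))"
    by (rule B.st_psh[OF L_st[OF L A.yoneda_st[OF ob(1)]]])
  then have "sdom (amap (omap L (yoneda_ob A a)) g) = omap (omap L (yoneda_ob A a)) b'"
    using sf_hom[of "op_cat B" _ g b' b] g by simp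
  then show ?thesis
    unfolding tr_ar[OF g f] using p tr_ob[OF obb(2) ob(1)] by simp
qed

lemma prof_tr:
  assumes L: "is_functor SA SB L"
  shows "prof (tr L)"
  unfolding prof_def
proof (rule functorI)
  let ?C = "prod_cat (op_cat B) A"
  show "category ?C" by (intro category_prod_cat category_op_cat A.cat B.cat)
  show "category set_cat" by (rule category_set_cat)
  show "omap (tr L) \<in> extensional (Ob ?C)" "amap (tr L) \<in> extensional (Ar ?C)"
    by (auto simp: tr_lin_ob_def Let_def)
  have psh: "psh B (omap L (yoneda_ob A a))" if "a \<in> Ob A" for a
    by (rule B.st_psh[OF L_st[OF L A.yoneda_st[OF that]]])
  show "omap (tr L) x \<in> Ob set_cat" if x: "x \<in> Ob ?C" for x
  proof -
    obtain b a where ba: "x = (b, a)" "b \<in> Ob B" "a \<in> Ob A" using x by auto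
    show ?thesis using psh_small[OF psh[OF ba(3)] ba(2)] by (simp add: ba tr_ob)
  qed
  have hom: "amap (tr L) (g, f) \<in> homs set_cat (omap (tr L) (b', a)) (omap (tr L) (b, a'))"
    if g: "g \<in> homs B b b'" and f: "f \<in> homs A a a'" for g f b b' a a'
  proof -
    note ob = cat_hom_ob[OF A.cat f] and obb = cat_hom_ob[OF B.cat g]
    have "amap (omap L (yoneda_ob A a)) g \<in> homs set_cat (omap (tr L) (b', a)) (omap (tr L) (b, a))"
      using functor_hom[OF psh[OF ob(1)], of g b' b] g by (simp add: tr_ob ob obb)
    moreover have "ncomp (amap L (A.ymap f)) b \<in> homs set_cat (omap (tr L) (b, a)) (omap (tr L) (b, a'))"
      using nt_homD(4)[OF L_hom[OF L A.ymap_hom_st[OF f], unfolded PSh_def], of b] obb by (simp add: tr_ob ob)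
    ultimately show ?thesis
      unfolding tr_ar[OF g f] by (rule cat_comp[OF category_set_cat])
  qed
  show "amap (tr L) t \<in> homs set_cat (omap (tr L) x) (omap (tr L) y)" if t: "t \<in> homs ?C x y" for t x y
  proof -
    obtain g f b' a b a' where "t = (g, f)" "x = (b', a)" "y = (b, a')" by (cases t, cases x, cases y) auto
    then show ?thesis using t hom by auto
  qed
  show "amap (tr L) (Idt ?C x) = Idt set_cat (omap (tr L) x)" if x: "x \<in> Ob ?C" for x
  proof -
    obtain b a where ba: "x = (b, a)" "b \<in> Ob B" "a \<in> Ob A" using x by auto
    note ia = cat_id[OF A.cat ba(3)] and ib = cat_id[OF B.cat ba(2)]
    have small: "small (omap (tr L) (b, a))" using psh_small[OF psh[OF ba(3)] ba(2)] by (simp add: ba tr_ob)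
    have "amap (tr L) (Idt B b, Idt A a) = Idt set_cat (omap (tr L) (b, a))"
    proof (rule set_hom_eqI[OF hom[OF ib ia] cat_id[OF category_set_cat]])
      fix p assume p: "p \<in> omap (tr L) (b, a)"
      then have p': "p \<in> omap (omap L (yoneda_ob A a)) b" by (simp add: tr_ob ba)
      show "act (tr L) (Idt B b, Idt A a) p = sfun (Idt set_cat (omap (tr L) (b, a))) p"
        using tr_act[OF L ib ia p] psh_id[OF psh[OF ba(3)] ba(2) p'] A.ymap_id[OF ba(3)]
          L_id_app[OF L A.yoneda_st[OF ba(3)] ba(2) p'] p by simp
    qed (use small in simp)
    then show ?thesis by (simp add: ba)
  qed
  show "amap (tr L) (Cmp ?C t' t) = Cmp set_cat (amap (tr L) t') (amap (tr L) t)"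
    if t: "t \<in> homs ?C x y" and t': "t' \<in> homs ?C y z" for t t' x y z
  proof -
    obtain g f b'' a where tt: "t = (g, f)" "x = (b'', a)" by (cases t, cases x) auto
    obtain g' f' b' a' where tt': "t' = (g', f')" "y = (b', a')" by (cases t', cases y) auto
    obtain b a'' where zz: "z = (b, a'')" by (cases z) auto
    have g: "g \<in> homs B b' b''" and f: "f \<in> homs A a a'" and g': "g' \<in> homs B b b'" and f': "f' \<in> homs A a' a''"
      using t t' by (simp_all add: tt tt' zz)
    note gg = cat_comp[OF B.cat g' g] and ff = cat_comp[OF A.cat f f']
    note ob = cat_hom_ob[OF A.cat f] and obb = cat_hom_ob[OF B.cat g] and obb' = cat_hom_ob[OF B.cat g']
    have "amap (tr L) (Cmp B g g', Cmp A f' f) = Cmp set_cat (amap (tr L) (g', f')) (amap (tr L) (g, f))"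
    proof (rule set_hom_eqI[OF hom[OF gg ff] cat_comp[OF category_set_cat hom[OF g f] hom[OF g' f']]])
      fix p assume p: "p \<in> omap (tr L) (b'', a)"
      then have p': "p \<in> omap (omap L (yoneda_ob A a)) b''" using obb ob by (simp add: tr_ob)
      note gp = psh_act[OF psh[OF ob(1)] g p']
      note ggp = psh_act[OF psh[OF ob(1)] g' gp]
      note Lf = L_hom[OF L A.ymap_hom_st[OF f]]
      have fgp: "act (tr L) (g, f) p \<in> omap (tr L) (b', a')"
        using hom[OF g f] p by (auto simp: set_hom_iff)
      have "sfun (Cmp set_cat (amap (tr L) (g', f')) (amap (tr L) (g, f))) p = act (tr L) (g', f') (act (tr L) (g, f) p)"
        using hom[OF g f] p by (simp add: set_hom_iff)
      also have "\<dots> = app (amap L (A.ymap f')) b (act (omap L (yoneda_ob A a')) g' (app (amap L (A.ymap f)) b' (act (omap L (yoneda_ob A a)) g p)))"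
        using tr_act[OF L g' f' fgp] tr_act[OF L g f p] by simp
      also have "\<dots> = app (amap L (A.ymap f')) b (app (amap L (A.ymap f)) b (act (omap L (yoneda_ob A a)) g' (act (omap L (yoneda_ob A a)) g p)))"
        using psh_nat[OF Lf g' gp] by simp
      also have "\<dots> = app (amap L (A.ymap (Cmp A f' f))) b (act (omap L (yoneda_ob A a)) (Cmp B g g') p)"
        using L_app[OF L A.ymap_hom_st[OF f] A.ymap_hom_st[OF f'] obb'(1) ggp] A.ymap_comp[OF f f']
          psh_comp[OF psh[OF ob(1)] g' g p'] by simp
      also have "\<dots> = act (tr L) (Cmp B g g', Cmp A f' f) p"
        using tr_act[OF L gg ff p] by simp
      finally show "act (tr L) (Cmp B g g', Cmp A f' f) p =
          sfun (Cmp set_cat (amap (tr L) (g', f')) (amap (tr L) (g, f))) p" by simp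
    qed
    then show ?thesis by (simp add: tt tt')
  qed
qed

lemma tr_lact:
  assumes L: "is_functor SA SB L" and b: "b \<in> Ob B" and f: "f \<in> homs A a a'" and p: "p \<in> omap (tr L) (b, a)"
  shows "lact (tr L) b f p = app (amap L (A.ymap f)) b p"
proof -
  note ob = cat_hom_ob[OF A.cat f]
  have "p \<in> omap (omap L (yoneda_ob A a)) b" using p tr_ob[OF b ob(1)] by simp
  then show ?thesis
    unfolding lact_def using tr_act[OF L cat_id[OF B.cat b] f p] psh_id[OF B.st_psh[OF L_st[OF L A.yoneda_st[OF ob(1)]]] b] by simp
qed

lemma tr_ract:
  assumes L: "is_functor SA SB L" and g: "g \<in> homs B b b'" and a: "a \<in> Ob A" and p: "p \<in> omap (tr L) (b', a)"
  shows "ract (tr L) a g p = act (omap L (yoneda_ob A a)) g p"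
proof -
  note obb = cat_hom_ob[OF B.cat g]
  have "p \<in> omap (omap L (yoneda_ob A a)) b'" using p tr_ob[OF obb(2) a] by simp
  then have "act (omap L (yoneda_ob A a)) g p \<in> omap (omap L (yoneda_ob A a)) b"
    using psh_act[OF B.st_psh[OF L_st[OF L A.yoneda_st[OF a]]] g] by simp
  then show ?thesis
    unfolding ract_def using tr_act[OF L g cat_id[OF A.cat a] p] A.ymap_id[OF a] L_id_app[OF L A.yoneda_st[OF a] obb(1)] by simp
qed

text \<open>The comparison from the left Kan extension: \<open>p\<close> in \<open>L (y a)\<close>
  is pushed forward along \<open>L\<close> of the map \<open>y a -> X\<close> that names
  \<open>x\<close>. These values determine the map by \<open>ext_eqI\<close>, so nothing depends on
  the choice.\<close>

definition eps :: "'u psh_ftor \<Rightarrow> 'u psh \<Rightarrow> 'u psh_map" where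
  "eps L X = (SOME \<tau>. \<tau> \<in> homs (PSh B) (ext_ob (tr L) X) (omap L X) \<and>
     (\<forall>b\<in>Ob B. \<forall>a\<in>Ob A. \<forall>p\<in>omap (tr L) (b, a). \<forall>x\<in>omap X a.
        app \<tau> b (cl (tr L) X b a p x) = app (amap L (A.yon X a x)) b p))"

lemma eps:
  assumes L: "is_functor SA SB L" and X: "A.st X"
  shows "eps L X \<in> homs (PSh B) (ext_ob (tr L) X) (omap L X)"
    and "\<And>b a p x. b \<in> Ob B \<Longrightarrow> a \<in> Ob A \<Longrightarrow> p \<in> omap (tr L) (b, a) \<Longrightarrow> x \<in> omap X a \<Longrightarrow>
      app (eps L X) b (cl (tr L) X b a p x) = app (amap L (A.yon X a x)) b p"
proof -
  note X' = A.st_psh[OF X]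
  obtain \<tau> where "\<tau> \<in> homs (PSh B) (ext_ob (tr L) X) (omap L X)"
    "\<And>b a p x. b \<in> Ob B \<Longrightarrow> a \<in> Ob A \<Longrightarrow> p \<in> omap (tr L) (b, a) \<Longrightarrow> x \<in> omap X a \<Longrightarrow>
      app \<tau> b (cl (tr L) X b a p x) = app (amap L (A.yon X a x)) b p"
  proof (rule ex_ext_map[OF prof_tr[OF L] X' B.st_psh[OF L_st[OF L X]]])
    show "app (amap L (A.yon X a x)) b p \<in> omap (omap L X) b"
      if "b \<in> Ob B" "a \<in> Ob A" "p \<in> omap (tr L) (b, a)" "x \<in> omap X a" for b a p x
      using psh_in[OF L_hom[OF L A.yon_hom_st[OF X that(2,4)]] that(1)] that(3) by (simp add: tr_ob that)
    show "app (amap L (A.yon X a' x)) b (lact (tr L) b f p) = app (amap L (A.yon X a (act X f x))) b p"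
      if b: "b \<in> Ob B" and f: "f \<in> homs A a a'" and p: "p \<in> omap (tr L) (b, a)" and x: "x \<in> omap X a'" for b f a a' p x
    proof -
      note ob = cat_hom_ob[OF A.cat f]
      have p': "p \<in> omap (omap L (yoneda_ob A a)) b" using p by (simp add: tr_ob b ob)
      show ?thesis
        using tr_lact[OF L b f p] L_app[OF L A.ymap_hom_st[OF f] A.yon_hom_st[OF X ob(2) x] b p'] A.yon_ymap[OF X' f x] by simp
    qed
    show "app (amap L (A.yon X a x)) b (ract (tr L) a g p) = act (omap L X) g (app (amap L (A.yon X a x)) b' p)"
      if g: "g \<in> homs B b b'" and a: "a \<in> Ob A" and p: "p \<in> omap (tr L) (b', a)" and x: "x \<in> omap X a" for b b' g a p x
      using tr_ract[OF L g a p] psh_nat[OF L_hom[OF L A.yon_hom_st[OF X a x]] g, of p] p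
      by (simp add: tr_ob[OF cat_hom_ob(2)[OF B.cat g] a])
  qed (rule that)
  then have "\<exists>\<tau>. \<tau> \<in> homs (PSh B) (ext_ob (tr L) X) (omap L X) \<and>
     (\<forall>b\<in>Ob B. \<forall>a\<in>Ob A. \<forall>p\<in>omap (tr L) (b, a). \<forall>x\<in>omap X a.
        app \<tau> b (cl (tr L) X b a p x) = app (amap L (A.yon X a x)) b p)" by blast
  from someI_ex[OF this, folded eps_def]
  show "eps L X \<in> homs (PSh B) (ext_ob (tr L) X) (omap L X)"
    and "\<And>b a p x. b \<in> Ob B \<Longrightarrow> a \<in> Ob A \<Longrightarrow> p \<in> omap (tr L) (b, a) \<Longrightarrow> x \<in> omap X a \<Longrightarrow>
      app (eps L X) b (cl (tr L) X b a p x) = app (amap L (A.yon X a x)) b p"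
    by blast+
qed

text \<open>
  \<open>eps L X\<close> is an object of the slice over \<open>L X\<close>, and \<open>X\<close> is the colimit in its own slice of its elements, which the
  left adjoint slice functor preserves: this yields the inverse of \<open>eps L X\<close>. Colimits of stabilized presheaves outside
  of slices need not be colimits of presheaves.
\<close>

lemma eps_bij:
  assumes L: "is_functor SA SB L" and X: "A.st X" and cu: "slice_couniversal SA SB L X" and b: "b \<in> Ob B"
  shows "bij_betw (sfun (ncomp (eps L X) b)) (omap (ext_ob (tr L) X) b) (omap (omap L X) b)"
proof -
  note X' = A.st_psh[OF X] and P = prof_tr[OF L] and ep = eps[OF L X]
  let ?E = "ext_ob (tr L) X"
  note LX = L_st[OF L X]
  have k: "eps L X \<in> homs SB ?E (omap L X)" by (rule B.StPSh_over[OF ep(1) LX])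
  then have E: "B.st ?E" by (simp add: B.StPSh_hom)
  obtain W w e where w: "w \<in> homs SA W X" and e: "e \<in> homs SB (omap L W) ?E" and ke: "Cmp SB (eps L X) e = amap L w"
    and lift: "\<And>V v u. v \<in> homs SA V X \<Longrightarrow> u \<in> homs SB (omap L V) ?E \<Longrightarrow> Cmp SB (eps L X) u = amap L v \<Longrightarrow>
       \<exists>!t. t \<in> homs SA V W \<and> Cmp SA w t = v \<and> Cmp SB e (amap L t) = u"
    by (rule slice_couniversalD[OF cu k]) (rule that)
  have w': "w \<in> homs (PSh A) W X" and W: "A.st W" using w by (simp_all add: A.StPSh_hom)
  have e': "e \<in> homs (PSh B) (omap L W) ?E" using e by (simp add: B.StPSh_hom)
  note W' = A.st_psh[OF W]
  \<comment> \<open>The coprojection of the coend at the element \<open>x\<close>. By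
    \<open>ku\<close> it is an arrow over \<open>L X\<close> from \<open>L\<close> of the
    representable, so it can be transposed.\<close>
  define u where "u a x = psh_nt B (omap L (yoneda_ob A a)) ?E (\<lambda>b p. cl (tr L) X b a p x)" for a x
  have u: "u a x \<in> homs (PSh B) (omap L (yoneda_ob A a)) ?E" if a: "a \<in> Ob A" and x: "x \<in> omap X a" for a x
    unfolding u_def
  proof (rule psh_nt_hom[OF B.st_psh[OF L_st[OF L A.yoneda_st[OF a]]] B.st_psh[OF E]])
    show "cl (tr L) X b a p x \<in> omap ?E b" if "b \<in> Ob B" "p \<in> omap (omap L (yoneda_ob A a)) b" for b p
      using that cl_in[where X = X and x = x and P = "tr L" and b = b and p = p, OF a _ x] by (simp add: tr_ob a)
    show "cl (tr L) X b a (act (omap L (yoneda_ob A a)) g p) x = act ?E g (cl (tr L) X b' a p x)"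
      if g: "g \<in> homs B b b'" and p: "p \<in> omap (omap L (yoneda_ob A a)) b'" for g b b' p
    proof -
      have p': "p \<in> omap (tr L) (b', a)" using p tr_ob[OF cat_hom_ob(2)[OF B.cat g] a] by simp
      show ?thesis using ext_act[OF P X' g a p' x] tr_ract[OF L g a p'] by simp
    qed
  qed
  have uapp: "app (u a x) b p = cl (tr L) X b a p x" if "b \<in> Ob B" "p \<in> omap (omap L (yoneda_ob A a)) b" for a x b p
    using that by (simp add: u_def psh_nt_app)
  have uS: "u a x \<in> homs SB (omap L (yoneda_ob A a)) ?E" if "a \<in> Ob A" "x \<in> omap X a" for a x
    using u[OF that] E L_st[OF L A.yoneda_st[OF that(1)]] by (simp add: B.StPSh_hom)
  have ku: "Cmp SB (eps L X) (u a x) = amap L (A.yon X a x)" if a: "a \<in> Ob A" and x: "x \<in> omap X a" for a x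
  proof -
    have "Cmp (PSh B) (eps L X) (u a x) = amap L (A.yon X a x)"
    proof (rule psh_eqI[OF cat_comp[OF category_PSh[OF B.cat] u[OF a x] ep(1)] L_hom[OF L A.yon_hom_st[OF X a x]]])
      fix b p assume b: "b \<in> Ob B" and p: "p \<in> omap (omap L (yoneda_ob A a)) b"
      show "app (Cmp (PSh B) (eps L X) (u a x)) b p = app (amap L (A.yon X a x)) b p"
        using psh_cmp[OF u[OF a x] b p, of "eps L X"] uapp[OF b p] ep(2)[OF b a _ x] p by (simp add: tr_ob b a)
    qed
    then show ?thesis by simp
  qed
  \<comment> \<open>The transposes of the coprojections. By \<open>t_nat\<close> they form a cocone
    on the elements of \<open>X\<close> with vertex \<open>W\<close>.\<close>
  define t where "t a x = (SOME t. t \<in> homs SA (yoneda_ob A a) W \<and> Cmp SA w t = A.yon X a x \<and> Cmp SB e (amap L t) = u a x)" for a x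
  have t: "t a x \<in> homs SA (yoneda_ob A a) W" "Cmp (PSh A) w (t a x) = A.yon X a x" "Cmp (PSh B) e (amap L (t a x)) = u a x"
    if "a \<in> Ob A" "x \<in> omap X a" for a x
  proof -
    have "\<exists>t. t \<in> homs SA (yoneda_ob A a) W \<and> Cmp SA w t = A.yon X a x \<and> Cmp SB e (amap L t) = u a x"
      using lift[OF A.yon_hom_st[OF X that] uS[OF that] ku[OF that]] by blast
    from someI_ex[OF this, folded t_def]
    show "t a x \<in> homs SA (yoneda_ob A a) W" "Cmp (PSh A) w (t a x) = A.yon X a x" "Cmp (PSh B) e (amap L (t a x)) = u a x"
      by simp_all
  qed
  have t': "t a x \<in> homs (PSh A) (yoneda_ob A a) W" if "a \<in> Ob A" "x \<in> omap X a" for a x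
    using t(1)[OF that] by (simp add: A.StPSh_hom)
  have t_nat: "Cmp (PSh A) (t a' x) (A.ymap f) = t a (act X f x)" if f: "f \<in> homs A a a'" and x: "x \<in> omap X a'" for f a a' x
  proof -
    note ob = cat_hom_ob[OF A.cat f] and fx = psh_act[OF X' f x]
    have tf: "Cmp SA (t a' x) (A.ymap f) \<in> homs SA (yoneda_ob A a) W"
      by (rule cat_comp[OF A.category_StPSh A.ymap_hom_st[OF f] t(1)[OF ob(2) x]])
    have "Cmp SA w (Cmp SA (t a' x) (A.ymap f)) = A.yon X a (act X f x)"
      using cat_assoc[OF category_PSh[OF A.cat] A.ymap_hom[OF f] t'[OF ob(2) x] w'] t(2)[OF ob(2) x] A.yon_ymap[OF X' f x] by simp
    moreover have "Cmp SB e (amap L (Cmp SA (t a' x) (A.ymap f))) = u a (act X f x)"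
    proof -
      note Lf = L_hom[OF L A.ymap_hom_st[OF f]] and Lt = L_hom[OF L t(1)[OF ob(2) x]]
      have "Cmp (PSh B) e (amap L (Cmp (PSh A) (t a' x) (A.ymap f))) = Cmp (PSh B) (u a' x) (amap L (A.ymap f))"
        using L_comp[OF L A.ymap_hom_st[OF f] t(1)[OF ob(2) x]] cat_assoc[OF category_PSh[OF B.cat] Lf Lt e'] t(3)[OF ob(2) x] by simp
      also have "\<dots> = u a (act X f x)"
      proof (rule psh_eqI[OF cat_comp[OF category_PSh[OF B.cat] Lf u[OF ob(2) x]] u[OF ob(1) fx]])
        fix b p assume b: "b \<in> Ob B" and p: "p \<in> omap (omap L (yoneda_ob A a)) b"
        then have p': "p \<in> omap (tr L) (b, a)" by (simp add: tr_ob ob)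
        show "app (Cmp (PSh B) (u a' x) (amap L (A.ymap f))) b p = app (u a (act X f x)) b p"
          using psh_cmp[OF Lf b p, of "u a' x"] uapp[OF b psh_in[OF Lf b p]] uapp[OF b p] cl_slide[OF P X' b f p' x] tr_lact[OF L b f p'] by simp
      qed
      finally show ?thesis by simp
    qed
    ultimately have "Cmp SA (t a' x) (A.ymap f) = t a (act X f x)"
      using t[OF ob(1) fx] tf
      by (intro ex1_eq[OF lift[OF A.yon_hom_st[OF X ob(1) fx] uS[OF ob(1) fx] ku[OF ob(1) fx]]]) simp_all
    then show ?thesis by simp
  qed
  \<comment> \<open>The map induced by this cocone: a map from a representable is an element, so
    \<open>x\<close> is sent to the element of \<open>W\<close> named by
    \<open>t a x\<close>.\<close>
  define s where "s = psh_nt A X W (\<lambda>a x. app (t a x) a (Idt A a))"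
  have s': "s \<in> homs (PSh A) X W"
    unfolding s_def
  proof (rule psh_nt_hom[OF X' W'])
    show "app (t a x) a (Idt A a) \<in> omap W a" if "a \<in> Ob A" "x \<in> omap X a" for a x
      using psh_in[OF t'[OF that] that(1)] cat_id[OF A.cat that(1)] that(1) by simp
    show "app (t a (act X f x)) a (Idt A a) = act W f (app (t a' x) a' (Idt A a'))"
      if f: "f \<in> homs A a a'" and x: "x \<in> omap X a'" for f a a' x
    proof -
      note ob = cat_hom_ob[OF A.cat f]
      note ia = cat_id[OF A.cat ob(1)] and ia' = cat_id[OF A.cat ob(2)]
      have "app (t a (act X f x)) a (Idt A a) = app (t a' x) a f"
        using t_nat[OF f x] psh_cmp[OF A.ymap_hom[OF f] ob(1), of "Idt A a" "t a' x"] ia ob A.ymap_app[OF f ia] cat_id_right[OF A.cat f]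
        by (metis A.yoneda_omap)
      also have "\<dots> = act W f (app (t a' x) a' (Idt A a'))"
        using psh_nat[OF t'[OF ob(2) x] f, of "Idt A a'"] A.yoneda_act[OF f ia'] cat_id_left[OF A.cat f] ia' ob by simp
      finally show ?thesis .
    qed
  qed
  have sS: "s \<in> homs SA X W" using s' X W by (simp add: A.StPSh_hom)
  have s_yon: "Cmp (PSh A) s (A.yon X a x) = t a x" if a: "a \<in> Ob A" and x: "x \<in> omap X a" for a x
  proof (rule A.yon_eqI[OF _ t'[OF a x] a])
    note y = A.yon_hom[OF X' a x] and ia = cat_id[OF A.cat a]
    show "Cmp (PSh A) s (A.yon X a x) \<in> homs (PSh A) (yoneda_ob A a) W" by (rule cat_comp[OF category_PSh[OF A.cat] y s'])
    show "app (Cmp (PSh A) s (A.yon X a x)) a (Idt A a) = app (t a x) a (Idt A a)"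
      using psh_cmp[OF y a, of "Idt A a" s] a ia A.yon_app[OF ia] psh_id[OF X' a x] x by (simp add: s_def psh_nt_app)
  qed
  \<comment> \<open>Each \<open>t a x\<close> lies over the map naming \<open>x\<close>, hence
    \<open>s\<close> is a section of \<open>w\<close>. Applying \<open>L\<close> to it provides the
    arrow into the domain of \<open>e\<close>.\<close>
  have ws: "Cmp (PSh A) w s = Idt (PSh A) X"
  proof (rule psh_eqI[OF cat_comp[OF category_PSh[OF A.cat] s' w'] cat_id[OF category_PSh[OF A.cat]]])
    show "X \<in> Ob (PSh A)" using X' by simp
    fix a x assume a: "a \<in> Ob A" and x: "x \<in> omap X a"
    note ia = cat_id[OF A.cat a]
    have "app (Cmp (PSh A) w s) a x = app (Cmp (PSh A) w (t a x)) a (Idt A a)"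
      using psh_cmp[OF s' a x, of w] psh_cmp[OF t'[OF a x] a, of "Idt A a" w] a ia x by (simp add: s_def psh_nt_app)
    also have "\<dots> = x" using t(2)[OF a x] A.yon_app[OF ia] psh_id[OF X' a x] by simp
    finally show "app (Cmp (PSh A) w s) a x = app (Idt (PSh A) X) a x" using psh_idt[OF a x] by simp
  qed
  note Ls = L_hom[OF L sS]
  \<comment> \<open>The inverse of the comparison is \<open>e\<close> after \<open>L s\<close>. In
    this direction it uses that \<open>e\<close> lies over \<open>L X\<close>; in the other that
    \<open>e\<close> returns the coprojections.\<close>
  have inv1: "app (eps L X) b (app e b (app (amap L s) b y)) = y" if y: "y \<in> omap (omap L X) b" for y
  proof -
    have "app (eps L X) b (app e b (app (amap L s) b y)) = app (amap L w) b (app (amap L s) b y)"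
      using ke psh_cmp[OF e' b psh_in[OF Ls b y], of "eps L X"] by simp
    also have "\<dots> = y"
      using L_app[OF L sS w b y] ws L_id_app[OF L X b y] by simp
    finally show ?thesis .
  qed
  have inv2: "app e b (app (amap L s) b (app (eps L X) b k)) = k" if k: "k \<in> omap ?E b" for k
  proof -
    have "k \<in> coend A B (tr L) X b" using k b by simp
    then obtain a p x where tr: "a \<in> Ob A" "p \<in> omap (tr L) (b, a)" "x \<in> omap X a" "k = cl (tr L) X b a p x" by (rule coendE)
    have p: "p \<in> omap (omap L (yoneda_ob A a)) b" using tr(2) by (simp add: tr_ob b tr(1))
    note Lt = L_hom[OF L t(1)[OF tr(1,3)]]
    have "app e b (app (amap L s) b (app (eps L X) b k)) = app e b (app (amap L (t a x)) b p)"
      using ep(2)[OF b tr(1-3)] L_app[OF L A.yon_hom_st[OF X tr(1,3)] sS b p] s_yon[OF tr(1,3)] tr(4) by simp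
    also have "\<dots> = k"
      using t(3)[OF tr(1,3)] psh_cmp[OF Lt b p, of e] uapp[OF b p] tr(4) by simp
    finally show ?thesis .
  qed
  show ?thesis
    by (rule bij_betw_byWitness[where f' = "\<lambda>y. app e b (app (amap L s) b y)"])
       (use inv1 inv2 psh_in[OF ep(1) b] psh_in[OF e' b] psh_in[OF Ls b] in auto)
qed

lemma linear_couniversal:
  assumes Lin: "lin L" and X: "A.st X"
  shows "slice_couniversal SA SB L X"
proof -
  have "X \<in> Ob SA" using X by simp
  with Lin have "is_left_adjoint (slice_cat SA X) (slice_cat SB (omap L X)) (slice_functor SA L X)"
    unfolding linear_def by blast
  then show ?thesis by (simp only: slice_left_adjoint_iff[OF linear_functor[OF Lin]])
qed

lemma linear_universal:
  assumes Lin: "lin L" and X: "A.st X"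
  shows "slice_universal SA SB L X"
proof -
  have "X \<in> Ob SA" using X by simp
  with Lin have "is_right_adjoint (slice_cat SA X) (slice_cat SB (omap L X)) (slice_functor SA L X)"
    unfolding linear_def stable_def by blast
  then show ?thesis by (simp only: slice_right_adjoint_iff[OF linear_functor[OF Lin]])
qed

text \<open>
  If \<open>\<alpha> \<noteq> Idt A a\<close>, the equalizer of \<open>\<alpha>\<close> and the identity of \<open>y a\<close> in the slice over the quotient by a subgroup
  containing \<open>\<alpha>\<close> is empty. The right adjoint slice functor preserves it, and \<open>L\<close> preserves the empty presheaf.
\<close>

lemma tr_free:
  assumes Lin: "lin L" and a: "a \<in> Ob A" and b: "b \<in> Ob B" and p: "p \<in> omap (tr L) (b, a)"
    and \<alpha>: "\<alpha> \<in> homs A a a" "\<alpha> \<in> \<Union>(\<A> a)" and fixed: "lact (tr L) b \<alpha> p = p"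
  shows "\<alpha> = Idt A a"
proof -
  note L = linear_functor[OF Lin]
  obtain H where H: "H \<in> \<A> a" "\<alpha> \<in> H" using \<alpha>(2) by blast
  obtain X q where X: "A.st X" and q': "q \<in> homs (PSh A) (yoneda_ob A a) X" and q\<alpha>: "Cmp (PSh A) q (A.ymap \<alpha>) = q"
    using A.ex_quotient[OF a H(1)] H(2) by blast
  note ya = A.yoneda_st[OF a]
  have q: "q \<in> homs SA (yoneda_ob A a) X" using q' X ya by (simp add: A.StPSh_hom)
  have p': "p \<in> omap (omap L (yoneda_ob A a)) b" using p by (simp add: tr_ob a b)
  note Lq = L_hom[OF L q] and Lya = L_st[OF L ya] and LX = L_st[OF L X]
  \<comment> \<open>By Yoneda, \<open>p\<close> and its image in \<open>L X\<close> are maps from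
    the representable of \<open>b\<close>. The universal arrow from the latter makes
    \<open>p\<close> factor through \<open>L t\<close> for a unique \<open>t\<close> over
    \<open>X\<close>.\<close>
  let ?k = "B.yon (omap L X) b (app (amap L q) b p)" and ?u = "B.yon (omap L (yoneda_ob A a)) b p"
  have k: "?k \<in> homs SB (yoneda_ob B b) (omap L X)" by (rule B.yon_hom_st[OF LX b psh_in[OF Lq b p']])
  have u: "?u \<in> homs SB (yoneda_ob B b) (omap L (yoneda_ob A a))" by (rule B.yon_hom_st[OF Lya b p'])
  obtain W w e where w: "w \<in> homs SA W X" and e: "e \<in> homs SB (yoneda_ob B b) (omap L W)" and "Cmp SB (amap L w) e = ?k"
    and lift: "\<And>V v u. v \<in> homs SA V X \<Longrightarrow> u \<in> homs SB (yoneda_ob B b) (omap L V) \<Longrightarrow> Cmp SB (amap L v) u = ?k \<Longrightarrow>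
       \<exists>!t. t \<in> homs SA W V \<and> Cmp SA v t = w \<and> Cmp SB (amap L t) e = u"
    by (rule slice_universalD[OF linear_universal[OF Lin X] k]) (rule that)
  have W: "A.st W" using w by (simp add: A.StPSh_hom)
  have e': "e \<in> homs (PSh B) (yoneda_ob B b) (omap L W)" using e by (simp add: B.StPSh_hom)
  have "Cmp SB (amap L q) ?u = ?k" using B.map_yon[OF Lq b p'] by simp
  note ex1 = lift[OF q u this]
  from ex1_implies_ex[OF ex1] obtain t where tt: "t \<in> homs SA W (yoneda_ob A a) \<and> Cmp SA q t = w \<and> Cmp SB (amap L t) e = ?u" ..
  then have t: "t \<in> homs SA W (yoneda_ob A a)" and qt: "Cmp (PSh A) q t = w" and te: "Cmp (PSh B) (amap L t) e = ?u"
    by simp_all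
  have t': "t \<in> homs (PSh A) W (yoneda_ob A a)" using t by (simp add: A.StPSh_hom)
  note y\<alpha> = A.ymap_hom_st[OF \<alpha>(1)] and y\<alpha>' = A.ymap_hom[OF \<alpha>(1)]
  \<comment> \<open>\<alpha> becomes trivial after \<open>q\<close> and fixes \<open>p\<close>, so
    \<alpha> after \<open>t\<close> satisfies the two equations that characterize
    \<open>t\<close>.\<close>
  have "Cmp SA (A.ymap \<alpha>) t = t"
  proof -
    have "Cmp SA (A.ymap \<alpha>) t \<in> homs SA W (yoneda_ob A a)" by (rule cat_comp[OF A.category_StPSh t y\<alpha>])
    moreover have "Cmp SA q (Cmp SA (A.ymap \<alpha>) t) = w"
      using cat_assoc[OF category_PSh[OF A.cat] t' y\<alpha>' q'] q\<alpha> qt by simp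
    moreover have "Cmp SB (amap L (Cmp SA (A.ymap \<alpha>) t)) e = ?u"
      using L_comp[OF L t y\<alpha>] cat_assoc[OF category_PSh[OF B.cat] e' L_hom[OF L t] L_hom[OF L y\<alpha>]] te
        B.map_yon[OF L_hom[OF L y\<alpha>] b p'] tr_lact[OF L b \<alpha>(1) p] fixed by simp
    ultimately show ?thesis
      by (intro ex1_eq[OF ex1 _ tt] conjI)
  qed
  then have \<alpha>t: "Cmp (PSh A) (A.ymap \<alpha>) t = t" by simp
  \<comment> \<open>\<open>L W\<close> has an element, and by \<open>eps_bij\<close> every element
    of it comes from a triple that contains an element of \<open>W\<close>. So \<open>W\<close> is
    not empty and \<open>t\<close> has a value.\<close>
  have "app e b (Idt B b) \<in> omap (omap L W) b"
    using psh_in[OF e' b] cat_id[OF B.cat b] b by simp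
  then have "omap (ext_ob (tr L) W) b \<noteq> {}"
    using bij_betw_imp_surj_on[OF eps_bij[OF L W linear_couniversal[OF Lin W] b]] by auto
  then obtain k where "k \<in> coend A B (tr L) W b" using b by auto
  then obtain c y where c: "c \<in> Ob A" and y: "y \<in> omap W c" by (rule coendE) (rule that)
  \<comment> \<open>Any value \<open>h\<close> of \<open>t\<close> is an arrow into \<open>a\<close>
    with \<open>\<alpha> h = h\<close>; cancelling the invertible \<open>h\<close> leaves the
    identity.\<close>
  define h where "h = app t c y"
  have h: "h \<in> homs A c a" using psh_in[OF t' c y] c by (simp add: h_def)
  have "Cmp A \<alpha> h = h"
    using \<alpha>t psh_cmp[OF t' c y, of "A.ymap \<alpha>"] A.ymap_app[OF \<alpha>(1) h] by (simp add: h_def)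
  then have "Cmp A (Cmp A \<alpha> h) (A.ginv h) = Cmp A h (A.ginv h)" by simp
  then show ?thesis
    using cat_assoc[OF A.cat A.ginv(1)[OF h] h \<alpha>(1)] A.ginv(3)[OF h] cat_id_right[OF A.cat \<alpha>(1)] by simp
qed

text \<open>For the first condition, \<alpha> disappears in the quotient of the representable by a
  subgroup containing it; so \<beta> alone fixes the image of \<open>p\<close> under
  \<open>L\<close>, where stabilizers are covered by the kit. For the second, it is not enough to
  treat the given \<alpha>: a whole orthogonal subgroup containing it has to be found.\<close>

lemma sprof_tr:
  assumes Lin: "lin L"
  shows "sprof (tr L)"
proof -
  note L = linear_functor[OF Lin]
  note P = prof_tr[OF L]
  have stab: "\<beta> \<in> \<Union>(\<B> b)"
    if a: "a \<in> Ob A" and b: "b \<in> Ob B" and p: "p \<in> omap (tr L) (b, a)" and \<alpha>: "\<alpha> \<in> homs A a a" and \<beta>: "\<beta> \<in> homs B b b"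
      and fixed: "act (tr L) (\<beta>, \<alpha>) p = p" and \<alpha>K: "\<alpha> \<in> \<Union>(\<A> a)" for a b p \<alpha> \<beta>
  proof -
    obtain H where H: "H \<in> \<A> a" "\<alpha> \<in> H" using \<alpha>K by blast
    obtain X q where X: "A.st X" and q': "q \<in> homs (PSh A) (yoneda_ob A a) X" and q\<alpha>: "Cmp (PSh A) q (A.ymap \<alpha>) = q"
      using A.ex_quotient[OF a H(1)] H(2) by blast
    note ya = A.yoneda_st[OF a]
    have q: "q \<in> homs SA (yoneda_ob A a) X" using q' X ya by (simp add: A.StPSh_hom)
    have p': "p \<in> omap (omap L (yoneda_ob A a)) b" using p by (simp add: tr_ob a b)
    note Lq = L_hom[OF L q] and \<beta>p = psh_act[OF B.st_psh[OF L_st[OF L ya]] \<beta> p']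
    have "act (omap L X) \<beta> (app (amap L q) b p) = app (amap L q) b (act (omap L (yoneda_ob A a)) \<beta> p)"
      using psh_nat[OF Lq \<beta> p'] by simp
    also have "\<dots> = app (amap L q) b (app (amap L (A.ymap \<alpha>)) b (act (omap L (yoneda_ob A a)) \<beta> p))"
      using L_app[OF L A.ymap_hom_st[OF \<alpha>] q b \<beta>p] q\<alpha> by simp
    also have "\<dots> = app (amap L q) b p"
      using tr_act[OF L \<beta> \<alpha> p] fixed by simp
    finally show ?thesis
      by (rule B.st_stab[OF L_st[OF L X] b psh_in[OF Lq b p'] \<beta>])
  qed
  have "\<alpha> \<in> \<Union>(kit_perp A \<A> a)"
    if a: "a \<in> Ob A" and b: "b \<in> Ob B" and p: "p \<in> omap (tr L) (b, a)" and \<alpha>: "\<alpha> \<in> homs A a a" and \<beta>: "\<beta> \<in> homs B b b"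
      and fixed: "act (tr L) (\<beta>, \<alpha>) p = p" and \<beta>K: "\<beta> \<in> \<Union>(kit_perp B \<B> b)" for a b p \<alpha> \<beta>
  proof -
    obtain K where K: "K \<in> kit_perp B \<B> b" "\<beta> \<in> K" using \<beta>K by blast
    have "subgroup K (End_group B b)" using K(1) B.perp_iff[OF b] by blast
    note KG = this[unfolded B.End_iff[OF b]]
    \<comment> \<open>All \<alpha> that some element of \<open>K\<close> compensates at
      \<open>p\<close>. This is the subgroup that will witness membership in the orthogonal
      kit.\<close>
    define H where "H = {\<alpha> \<in> homs A a a. \<exists>\<beta>\<in>K. act (tr L) (\<beta>, \<alpha>) p = p}"
    have "subgroup H (End_group A a)"
      unfolding A.End_iff[OF a]
    proof (intro conjI ballI)
      show "H \<subseteq> homs A a a" by (auto simp: H_def)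
      show "Idt A a \<in> H" using KG cat_id[OF A.cat a] prof_id[OF P b a p] by (auto simp: H_def)
      fix f assume f: "f \<in> H"
      then obtain \<gamma> where fh: "f \<in> homs A a a" and \<gamma>: "\<gamma> \<in> K" "act (tr L) (\<gamma>, f) p = p" by (auto simp: H_def)
      have \<gamma>h: "\<gamma> \<in> homs B b b" using KG \<gamma>(1) by blast
      show "Cmp A g f \<in> H" if g: "g \<in> H" for g
      proof -
        obtain \<delta> where gh: "g \<in> homs A a a" and \<delta>: "\<delta> \<in> K" "act (tr L) (\<delta>, g) p = p" using g by (auto simp: H_def)
        have \<delta>h: "\<delta> \<in> homs B b b" using KG \<delta>(1) by blast
        \<comment> \<open>\<open>B\<close> acts contravariantly, so its factors are composed in the
          opposite order.\<close>
        have "act (tr L) (Cmp B \<gamma> \<delta>, Cmp A g f) p = p"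
          using prof_comp[OF P \<delta>h \<gamma>h fh gh p] \<gamma>(2) \<delta>(2) by simp
        moreover have "Cmp B \<gamma> \<delta> \<in> K" using KG \<gamma>(1) \<delta>(1) by blast
        ultimately show ?thesis using cat_comp[OF A.cat fh gh] by (auto simp: H_def)
      qed
      obtain \<delta> where \<delta>: "\<delta> \<in> K" "Cmp B \<gamma> \<delta> = Idt B b" using KG \<gamma>(1) by blast
      have \<delta>h: "\<delta> \<in> homs B b b" using KG \<delta>(1) by blast
      note fi = A.ginv[OF fh]
      have "act (tr L) (\<delta>, A.ginv f) p = p"
        using prof_comp[OF P \<delta>h \<gamma>h fh fi(1) p] \<gamma>(2) \<delta>(2) fi(2) prof_id[OF P b a p] by simp
      then have "A.ginv f \<in> H" using fi(1) \<delta>(1) by (auto simp: H_def)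
      then show "\<exists>g\<in>H. Cmp A g f = Idt A a \<and> Cmp A f g = Idt A a" using fi by blast
    qed
    moreover have "G \<inter> H = {Idt A a}" if G: "G \<in> \<A> a" for G
    proof -
      have "Idt A a \<in> G" "Idt A a \<in> H"
        using A.kit_subgroup[OF a G] \<open>subgroup H (End_group A a)\<close> A.End_iff[OF a] by blast+
      moreover have "\<gamma> = Idt A a" if \<gamma>: "\<gamma> \<in> G" "\<gamma> \<in> H" for \<gamma>
      proof -
        obtain \<delta> where \<gamma>h: "\<gamma> \<in> homs A a a" and \<delta>: "\<delta> \<in> K" "act (tr L) (\<delta>, \<gamma>) p = p" using \<gamma>(2) by (auto simp: H_def)
        have \<delta>h: "\<delta> \<in> homs B b b" using KG \<delta>(1) by blast
        have \<gamma>G: "\<gamma> \<in> \<Union>(\<A> a)" using \<gamma>(1) G by blast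
        \<comment> \<open>The first condition covers \<delta> by the kit of \<open>B\<close>, while
          \<open>K\<close> is orthogonal to that kit. Hence \<gamma> fixes \<open>p\<close> on its
          own and \<open>tr_free\<close> applies.\<close>
        have "\<delta> = Idt B b"
          by (rule B.perp_disjoint[OF b stab[OF a b p \<gamma>h \<delta>h \<delta>(2) \<gamma>G]]) (use \<delta>(1) K(1) in blast)
        then have "lact (tr L) b \<gamma> p = p" using \<delta>(2) by (simp add: lact_def)
        then show ?thesis by (rule tr_free[OF Lin a b p \<gamma>h \<gamma>G])
      qed
      ultimately show ?thesis by blast
    qed
    ultimately have "H \<in> kit_perp A \<A> a" unfolding A.perp_iff[OF a] by blast
    moreover have "\<alpha> \<in> H" using \<alpha> fixed K(2) by (auto simp: H_def)
    ultimately show ?thesis by blast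
  qed
  with stab P show ?thesis
    unfolding sprof_def stabilized_def by blast
qed

section \<open>The equivalence\<close>

abbreviation Tr where "Tr \<equiv> tr_lin_functor A \<A> B \<B>"

lemma tr_map_app:
  "b \<in> Ob B \<Longrightarrow> a \<in> Ob A \<Longrightarrow> ncomp (tr_lin_map A B \<tau>) (b, a) = ncomp (ncomp \<tau> (yoneda_ob A a)) b"
  by (simp add: tr_lin_map_def yoneda_simps)

lemma nt_psh_hom:
  "\<tau> \<in> homs (fun_cat SA SB) L M \<Longrightarrow> A.st X \<Longrightarrow> ncomp \<tau> X \<in> homs (PSh B) (omap L X) (omap M X)"
  using nt_homD(4)[of \<tau> SA SB L M X] by (simp add: B.StPSh_hom)

lemma nt_psh_nat:
  assumes \<tau>: "\<tau> \<in> homs (fun_cat SA SB) L M" and h: "h \<in> homs SA X Y" and b: "b \<in> Ob B" and p: "p \<in> omap (omap L X) b"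
  shows "app (ncomp \<tau> Y) b (app (amap L h) b p) = app (amap M h) b (app (ncomp \<tau> X) b p)"
proof -
  note L = nt_homD(1)[OF \<tau>]
  have X: "A.st X" using h by (simp add: A.StPSh_hom)
  have "Cmp (PSh B) (ncomp \<tau> Y) (amap L h) = Cmp (PSh B) (amap M h) (ncomp \<tau> X)"
    using nt_homD(5)[OF \<tau> h] by simp
  then show ?thesis
    using psh_cmp[OF L_hom[OF L h] b p, of "ncomp \<tau> Y"] psh_cmp[OF nt_psh_hom[OF \<tau> X] b p, of "amap M h"] by simp
qed

lemma tr_map_hom:
  assumes \<tau>: "\<tau> \<in> homs (fun_cat SA SB) L M"
  shows "tr_lin_map A B \<tau> \<in> homs PC (tr L) (tr M)"
proof -
  note L = nt_homD(1)[OF \<tau>] and M = nt_homD(2)[OF \<tau>]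
  have hom: "ncomp (ncomp \<tau> (yoneda_ob A a)) b \<in> homs set_cat (omap (tr L) (b, a)) (omap (tr M) (b, a))"
    if "b \<in> Ob B" "a \<in> Ob A" for b a
    using nt_homD(4)[OF nt_psh_hom[OF \<tau> A.yoneda_st[OF that(2)], unfolded PSh_def], of b] that by (simp add: tr_ob)
  have in': "app (ncomp \<tau> (yoneda_ob A a)) b p \<in> omap (tr M) (b, a)"
    if "b \<in> Ob B" "a \<in> Ob A" "p \<in> omap (tr L) (b, a)" for b a p
    using hom[OF that(1,2)] that(3) by (auto simp: set_hom_iff)
  show ?thesis
  proof (rule snt_homI[OF prof_tr[OF L, unfolded prof_def] prof_tr[OF M, unfolded prof_def]])
    show "app (tr_lin_map A B \<tau>) y (act (tr L) t p) = act (tr M) t (app (tr_lin_map A B \<tau>) x p)"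
      if t: "t \<in> homs (prod_cat (op_cat B) A) x y" and p: "p \<in> omap (tr L) x" for t x y p
    proof -
      obtain g f b' a b a' where tt: "t = (g, f)" "x = (b', a)" "y = (b, a')" by (cases t, cases x, cases y) auto
      have g: "g \<in> homs B b b'" and f: "f \<in> homs A a a'" using t by (simp_all add: tt)
      note ob = cat_hom_ob[OF A.cat f] and obb = cat_hom_ob[OF B.cat g]
      have p1: "p \<in> omap (tr L) (b', a)" using p by (simp add: tt)
      then have p': "p \<in> omap (omap L (yoneda_ob A a)) b'" by (simp add: tr_ob ob obb)
      note gp = psh_act[OF B.st_psh[OF L_st[OF L A.yoneda_st[OF ob(1)]]] g p']
      have "app (ncomp \<tau> (yoneda_ob A a')) b (act (tr L) (g, f) p)
          = act (tr M) (g, f) (app (ncomp \<tau> (yoneda_ob A a)) b' p)"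
        using tr_act[OF L g f p1] tr_act[OF M g f in'[OF obb(2) ob(1) p1]]
          nt_psh_nat[OF \<tau> A.ymap_hom_st[OF f] obb(1) gp] psh_nat[OF nt_psh_hom[OF \<tau> A.yoneda_st[OF ob(1)]] g p'] by simp
      then show ?thesis by (simp add: tt tr_map_app ob obb)
    qed
    show "ncomp (tr_lin_map A B \<tau>) \<in> extensional (Ob (prod_cat (op_cat B) A))"
      by (auto simp: tr_lin_map_def)
    show "app (tr_lin_map A B \<tau>) x p \<in> omap (tr M) x"
      if x: "x \<in> Ob (prod_cat (op_cat B) A)" and p: "p \<in> omap (tr L) x" for x p
      using x p in' by (cases x) (simp add: tr_map_app)
    show "sdom (ncomp (tr_lin_map A B \<tau>) x) = omap (tr L) x" "scod (ncomp (tr_lin_map A B \<tau>) x) = omap (tr M) x"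
      "sfun (ncomp (tr_lin_map A B \<tau>) x) \<in> extensional (omap (tr L) x)" if x: "x \<in> Ob (prod_cat (op_cat B) A)" for x
      using x hom by (cases x; force simp: tr_map_app set_hom_iff PiE_def)+
  qed (use nt_homD(6,7)[OF \<tau>] in \<open>simp_all add: tr_lin_map_def\<close>)
qed

lemma Tr_simps:
  "lin L \<Longrightarrow> omap Tr L = tr L"
  "\<tau> \<in> homs (Lin A \<A> B \<B>) L M \<Longrightarrow> amap Tr \<tau> = tr_lin_map A B \<tau>"
  using Lin_simps(1)[of L] homsD(1)[of \<tau> "Lin A \<A> B \<B>" L M] by (simp_all add: tr_lin_functor_def)

lemma functor_Tr: "is_functor (Lin A \<A> B \<B>) (SProf A \<A> B \<B>) Tr"
proof (rule functorI[OF category_Lin category_SProf])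
  let ?S = "SProf A \<A> B \<B>" and ?L = "Lin A \<A> B \<B>"
  show "omap Tr \<in> extensional (Ob ?L)" "amap Tr \<in> extensional (Ar ?L)"
    by (simp_all add: tr_lin_functor_def)
  show "omap Tr L \<in> Ob ?S" if "L \<in> Ob ?L" for L
    using that sprof_tr by (simp add: Tr_simps)
  show "amap Tr \<tau> \<in> homs ?S (omap Tr L) (omap Tr M)" if \<tau>: "\<tau> \<in> homs ?L L M" for \<tau> L M
    using \<tau> tr_map_hom[of \<tau> L M] sprof_tr[of L] sprof_tr[of M]
    by (simp add: Tr_simps(2)[OF \<tau>]) (simp add: Lin_hom SProf_hom Tr_simps(1))
  show "amap Tr (Idt ?L L) = Idt ?S (omap Tr L)" if L: "L \<in> Ob ?L" for L
  proof -
    have L': "lin L" using L by simp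
    note F = linear_functor[OF L']
    have id: "Idt (fun_cat SA SB) L \<in> homs (fun_cat SA SB) L L" using cat_id[OF category_fun_SA_SB] F by simp
    have "tr_lin_map A B (Idt (fun_cat SA SB) L) = Idt PC (tr L)"
    proof (rule PC_eqI[OF tr_map_hom[OF id] cat_id[OF category_PC]])
      show "tr L \<in> Ob PC" using prof_tr[OF F] by (simp add: prof_def)
      fix b a p assume b: "b \<in> Ob B" and a: "a \<in> Ob A" and p: "p \<in> omap (tr L) (b, a)"
      have "yoneda_ob A a \<in> Ob SA" using A.yoneda_st[OF a] by simp
      then have "ncomp (Idt (fun_cat SA SB) L) (yoneda_ob A a) = Idt (PSh B) (omap L (yoneda_ob A a))"
        using fun_cat_simps(9)[of "yoneda_ob A a" SA SB L] by simp
      then show "app (tr_lin_map A B (Idt (fun_cat SA SB) L)) (b, a) p = app (Idt PC (tr L)) (b, a) p"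
        using tr_map_app[OF b a] PC_idt[OF b a p] psh_idt[OF b, of p "omap L (yoneda_ob A a)"] p by (simp add: tr_ob a b)
    qed
    then show ?thesis
      using Tr_simps(2)[OF cat_id[OF category_Lin L]] Tr_simps(1)[OF L'] by simp
  qed
  show "amap Tr (Cmp ?L \<sigma> \<tau>) = Cmp ?S (amap Tr \<sigma>) (amap Tr \<tau>)"
    if \<tau>: "\<tau> \<in> homs ?L L M" and \<sigma>: "\<sigma> \<in> homs ?L M N" for \<sigma> \<tau> L M N
  proof -
    have \<tau>': "\<tau> \<in> homs (fun_cat SA SB) L M" and \<sigma>': "\<sigma> \<in> homs (fun_cat SA SB) M N" using \<tau> \<sigma> by (simp_all add: Lin_hom)
    note c = cat_comp[OF category_fun_SA_SB \<tau>' \<sigma>']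
    have "tr_lin_map A B (Cmp (fun_cat SA SB) \<sigma> \<tau>) = Cmp PC (tr_lin_map A B \<sigma>) (tr_lin_map A B \<tau>)"
    proof (rule PC_eqI[OF tr_map_hom[OF c] cat_comp[OF category_PC tr_map_hom[OF \<tau>'] tr_map_hom[OF \<sigma>']]])
      fix b a p assume b: "b \<in> Ob B" and a: "a \<in> Ob A" and p: "p \<in> omap (tr L) (b, a)"
      have "yoneda_ob A a \<in> Ob SA" using A.yoneda_st[OF a] by simp
      then have "ncomp (Cmp (fun_cat SA SB) \<sigma> \<tau>) (yoneda_ob A a) = Cmp (PSh B) (ncomp \<sigma> (yoneda_ob A a)) (ncomp \<tau> (yoneda_ob A a))"
        using fun_cat_simps(10)[of "yoneda_ob A a" SA SB \<sigma> \<tau>] by simp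
      then show "app (tr_lin_map A B (Cmp (fun_cat SA SB) \<sigma> \<tau>)) (b, a) p = app (Cmp PC (tr_lin_map A B \<sigma>) (tr_lin_map A B \<tau>)) (b, a) p"
        using PC_cmp[OF tr_map_hom[OF \<tau>'] b a p] tr_map_app[OF b a, of \<tau>] tr_map_app[OF b a, of \<sigma>]
          tr_map_app[OF b a, of "Cmp (fun_cat SA SB) \<sigma> \<tau>"]
          psh_cmp[OF nt_psh_hom[OF \<tau>' A.yoneda_st[OF a]] b, of p "ncomp \<sigma> (yoneda_ob A a)"] p tr_ob[OF b a, of L] by simp
    qed
    then show ?thesis
      using Tr_simps(2)[OF cat_comp[OF category_Lin \<tau> \<sigma>]] Tr_simps(2)[OF \<tau>] Tr_simps(2)[OF \<sigma>] by simp
  qed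
qed

section \<open>The unit\<close>

definition eta :: "'u prof \<Rightarrow> 'u prof_map" where
  "eta P = set_nt (prod_cat (op_cat B) A) P (tr (ext P))
     (\<lambda>(b, a) p. cl P (yoneda_ob A a) b a p (Idt A a))"

lemma tr_ext_ob:
  "b \<in> Ob B \<Longrightarrow> a \<in> Ob A \<Longrightarrow> omap (tr (ext P)) (b, a) = coend A B P (yoneda_ob A a) b"
  using A.yoneda_st[of a] by (simp add: tr_ob st_ext_ob)

lemma eta_app: "b \<in> Ob B \<Longrightarrow> a \<in> Ob A \<Longrightarrow> p \<in> omap P (b, a) \<Longrightarrow> app (eta P) (b, a) p = cl P (yoneda_ob A a) b a p (Idt A a)"
  unfolding eta_def by (subst set_nt_app) auto

lemma eta_hom:
  assumes P: "sprof P"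
  shows "eta P \<in> homs PC P (tr (ext P))"
  unfolding eta_def
proof (rule set_nt_hom)
  note P' = sprof_prof[OF P] and T = functor_st_ext[OF P]
  show "is_functor (prod_cat (op_cat B) A) set_cat P" using P' by (simp add: prof_def)
  show "is_functor (prod_cat (op_cat B) A) set_cat (tr (ext P))" using prof_tr[OF T] by (simp add: prof_def)
  have ya_id: "Idt A a \<in> omap (yoneda_ob A a) a" if "a \<in> Ob A" for a
    using that cat_id[OF A.cat that] by simp
  show "(case x of (b, a) \<Rightarrow> \<lambda>p. cl P (yoneda_ob A a) b a p (Idt A a)) p \<in> omap (tr (ext P)) x"
    if "x \<in> Ob (prod_cat (op_cat B) A)" "p \<in> omap P x" for x p
    using that by (cases x) (auto simp: tr_ext_ob intro!: cl_in ya_id)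
  show "(case y of (b, a) \<Rightarrow> \<lambda>p. cl P (yoneda_ob A a) b a p (Idt A a)) (act P t p) =
      act (tr (ext P)) t ((case x of (b, a) \<Rightarrow> \<lambda>p. cl P (yoneda_ob A a) b a p (Idt A a)) p)"
    if t: "t \<in> homs (prod_cat (op_cat B) A) x y" and p: "p \<in> omap P x" for t x y p
  proof -
    obtain g f b' a b a' where tt: "t = (g, f)" "x = (b', a)" "y = (b, a')" by (cases t, cases x, cases y) auto
    have g: "g \<in> homs B b b'" and f: "f \<in> homs A a a'" using t by (simp_all add: tt)
    note ob = cat_hom_ob[OF A.cat f] and obb = cat_hom_ob[OF B.cat g]
    note ia = cat_id[OF A.cat ob(1)] and ia' = cat_id[OF A.cat ob(2)]
    have p1: "p \<in> omap P (b', a)" using p by (simp add: tt)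
    note gp = ract_in[OF P' g ob(1) p1]
    note Y = A.yoneda_functor[OF ob(1)] and Y' = A.yoneda_functor[OF ob(2)]
    have cl_in': "cl P (yoneda_ob A a) b' a p (Idt A a) \<in> omap (tr (ext P)) (b', a)"
      using cl_in[where X = "yoneda_ob A a", OF ob(1) p1 ya_id[OF ob(1)]] by (simp add: tr_ext_ob ob obb)
    have "cl P (yoneda_ob A a') b a' (act P (g, f) p) (Idt A a') = cl P (yoneda_ob A a') b a (ract P a g p) f"
      using act_split(1)[OF P' g f p1] cl_slide[OF P' Y' obb(1) f gp ya_id[OF ob(2)]] A.yoneda_act[OF f ia'] cat_id_left[OF A.cat f] by simp
    moreover have "act (tr (ext P)) (g, f) (cl P (yoneda_ob A a) b' a p (Idt A a)) = cl P (yoneda_ob A a') b a (ract P a g p) f"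
      using tr_act[OF T g f cl_in'] st_ext_ob[OF A.yoneda_st[OF ob(1)], of P] ext_act[OF P' Y g ob(1) p1 ya_id[OF ob(1)]]
        st_ext_ar[OF A.ymap_hom_st[OF f], of P] ext_map_app[OF P' A.ymap_hom[OF f] obb(1) ob(1) gp ya_id[OF ob(1)]]
        A.ymap_app[OF f ia] cat_id_right[OF A.cat f] by simp
    ultimately show ?thesis by (simp add: tt)
  qed
qed

text \<open>The co-Yoneda lemma: sliding along \<open>h\<close> turns a triple
  \<open>(c, p, h)\<close> into \<open>(a, h \<cdot> p, id)\<close>, which gives surjectivity. An
  arrow linking two triples that both end in the identity is itself the identity, which gives
  injectivity.\<close>

lemma eta_iso:
  assumes P: "sprof P"
  shows "is_iso (SProf A \<A> B \<B>) (eta P)"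
proof -
  note P' = sprof_prof[OF P] and e = eta_hom[OF P]
  note trP = sprof_tr[OF linear_st_ext[OF P]]
  have bij: "bij_betw (sfun (ncomp (eta P) x)) (omap P x) (omap (tr (ext P)) x)" if "x \<in> Ob (prod_cat (op_cat B) A)" for x
  proof -
    obtain b a where x: "x = (b, a)" and b: "b \<in> Ob B" and a: "a \<in> Ob A" using \<open>x \<in> _\<close> by auto
    note ia = cat_id[OF A.cat a] and Y = A.yoneda_functor[OF a]
    have yid: "Idt A a \<in> omap (yoneda_ob A a) a" using a ia by simp
    have "inj_on (app (eta P) (b, a)) (omap P (b, a))"
    proof (rule inj_onI)
      fix p p' assume p: "p \<in> omap P (b, a)" and p': "p' \<in> omap P (b, a)" and eq: "app (eta P) (b, a) p = app (eta P) (b, a) p'"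
      have "cl P (yoneda_ob A a) b a p (Idt A a) = cl P (yoneda_ob A a) b a p' (Idt A a)"
        using eq by (simp add: eta_app b a p p')
      then obtain f where f: "f \<in> homs A a a" "p' = lact P b f p" "Idt A a = act (yoneda_ob A a) f (Idt A a)"
        using cl_eq_iff[OF P' Y b a p yid a p' yid] by blast
      have "f = Idt A a" using f(3) A.yoneda_act[OF f(1) ia] cat_id_left[OF A.cat f(1)] by simp
      then show "p = p'" using f(2) lact_id[OF P' b a p] by simp
    qed
    moreover have "k \<in> app (eta P) (b, a) ` omap P (b, a)" if k: "k \<in> omap (tr (ext P)) (b, a)" for k
    proof -
      have "k \<in> coend A B P (yoneda_ob A a) b" using k by (simp add: tr_ext_ob a b)
      then obtain c p h where t: "c \<in> Ob A" "p \<in> omap P (b, c)" "h \<in> omap (yoneda_ob A a) c" "k = cl P (yoneda_ob A a) b c p h"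
        by (rule coendE)
      have h: "h \<in> homs A c a" using t(1,3) by simp
      note hp = lact_in[OF P' b h t(2)]
      have "k = cl P (yoneda_ob A a) b a (lact P b h p) (Idt A a)"
        using cl_slide[OF P' Y b h t(2) yid] A.yoneda_act[OF h ia] cat_id_left[OF A.cat h] t(4) by simp
      then show ?thesis using hp eta_app[OF b a hp] by (intro image_eqI[of _ _ "lact P b h p"]) simp_all
    qed
    moreover have "app (eta P) (b, a) ` omap P (b, a) \<subseteq> omap (tr (ext P)) (b, a)"
      using PC_in[OF e b a] by auto
    ultimately show ?thesis unfolding x bij_betw_def by blast
  qed
  obtain \<sigma> where \<sigma>: "\<sigma> \<in> homs PC (tr (ext P)) P" "inverse_arrows PC (eta P) \<sigma>"
    by (rule snt_iso[OF e bij]) (assumption, rule that)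
  have "inverse_arrows (SProf A \<A> B \<B>) (eta P) \<sigma>"
    using inverse_arrowsD(2,3)[OF \<sigma>(2) e] \<sigma>(1) e P trP
    by (intro inverse_arrowsI[where a = P and b = "tr (ext P)"]) (simp_all add: SProf_hom)
  then show ?thesis by (auto simp: is_iso_def)
qed

text \<open>Both composites send \<open>p\<close> to the class of its image under \<theta> together
  with the identity.\<close>

lemma eta_nat:
  assumes \<theta>: "\<theta> \<in> homs PC P Q" and P: "sprof P" and Q: "sprof Q"
  shows "Cmp PC (eta Q) \<theta> = Cmp PC (tr_lin_map A B (st_ext_map A \<A> B \<theta>)) (eta P)"
proof (rule PC_eqI)
  note s = st_ext_map_hom[OF \<theta> P Q]
  note tm = tr_map_hom[OF s]
  show "Cmp PC (eta Q) \<theta> \<in> homs PC P (tr (ext Q))" by (rule cat_comp[OF category_PC \<theta> eta_hom[OF Q]])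
  show "Cmp PC (tr_lin_map A B (st_ext_map A \<A> B \<theta>)) (eta P) \<in> homs PC P (tr (ext Q))"
    by (rule cat_comp[OF category_PC eta_hom[OF P] tm])
  fix b a p assume b: "b \<in> Ob B" and a: "a \<in> Ob A" and p: "p \<in> omap P (b, a)"
  have yid: "Idt A a \<in> omap (yoneda_ob A a) a" using a cat_id[OF A.cat a] by simp
  show "app (Cmp PC (eta Q) \<theta>) (b, a) p = app (Cmp PC (tr_lin_map A B (st_ext_map A \<A> B \<theta>)) (eta P)) (b, a) p"
    using PC_cmp[OF \<theta> b a p, of "eta Q"] PC_cmp[OF eta_hom[OF P] b a p, of "tr_lin_map A B (st_ext_map A \<A> B \<theta>)"]
      eta_app[OF b a p] eta_app[OF b a PC_in[OF \<theta> b a p]] tr_map_app[OF b a, of "st_ext_map A \<A> B \<theta>"]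
      st_ext_map_comp[OF A.yoneda_st[OF a], of \<theta>] ext_nt_app[OF \<theta> A.yoneda_functor[OF a] b a p yid] by simp
qed

section \<open>The counit\<close>

definition epsnt :: "'u psh_ftor \<Rightarrow> 'u psh_ftor_map" where
  "epsnt L = \<lparr>nsrc = ext (tr L), ntgt = L, ncomp = (\<lambda>X\<in>Ob SA. eps L X)\<rparr>"

lemma epsnt_comp: "A.st X \<Longrightarrow> ncomp (epsnt L) X = eps L X"
  using A.StPSh_ob[of X] by (simp add: epsnt_def)

lemma epsnt_hom:
  assumes Lin: "lin L"
  shows "epsnt L \<in> homs (fun_cat SA SB) (ext (tr L)) L"
proof -
  note L = linear_functor[OF Lin] and P = sprof_tr[OF Lin]
  note P' = sprof_prof[OF P]
  show ?thesis
  proof (rule nt_homI[OF functor_st_ext[OF P] L])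
    show "ncomp (epsnt L) X \<in> homs SB (omap (ext (tr L)) X) (omap L X)" if "X \<in> Ob SA" for X
      using that eps(1)[OF L, of X] ext_st[OF P, of X] L_st[OF L, of X] by (simp add: epsnt_comp st_ext_ob B.StPSh_hom)
    show "Cmp SB (ncomp (epsnt L) Y) (amap (ext (tr L)) h) = Cmp SB (amap L h) (ncomp (epsnt L) X)"
      if h: "h \<in> homs SA X Y" for h X Y
    proof -
      have h': "h \<in> homs (PSh A) X Y" and X: "A.st X" and Y: "A.st Y" using h by (simp_all add: A.StPSh_hom)
      note eX = eps[OF L X] and eY = eps[OF L Y] and Lh = L_hom[OF L h] and Ph = ext_map_hom[OF P' h']
      have "Cmp (PSh B) (eps L Y) (ext_map (tr L) h) = Cmp (PSh B) (amap L h) (eps L X)"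
      proof (rule ext_eqI[OF cat_comp[OF category_PSh[OF B.cat] Ph eY(1)] cat_comp[OF category_PSh[OF B.cat] eX(1) Lh]])
        fix b a p x assume t: "b \<in> Ob B" "a \<in> Ob A" "p \<in> omap (tr L) (b, a)" "x \<in> omap X a"
        have p: "p \<in> omap (omap L (yoneda_ob A a)) b" using t by (simp add: tr_ob)
        have c: "cl (tr L) X b a p x \<in> omap (ext_ob (tr L) X) b"
          using cl_in[where X = X and x = x, OF t(2-4)] t(1) by simp
        show "app (Cmp (PSh B) (eps L Y) (ext_map (tr L) h)) b (cl (tr L) X b a p x) =
            app (Cmp (PSh B) (amap L h) (eps L X)) b (cl (tr L) X b a p x)"
          using psh_cmp[OF Ph t(1) c, of "eps L Y"] psh_cmp[OF eX(1) t(1) c, of "amap L h"] ext_map_app[OF P' h' t]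
            eX(2)[OF t] eY(2)[OF t(1-3) psh_in[OF h' t(2,4)]] L_app[OF L A.yon_hom_st[OF X t(2,4)] h t(1) p] A.map_yon[OF h' t(2,4)] by simp
      qed
      then show ?thesis using X Y by (simp add: epsnt_comp st_ext_ar[OF h])
    qed
  qed (simp_all add: epsnt_def)
qed

lemma eps_iso:
  assumes Lin: "lin L" and X: "A.st X"
  shows "is_iso SB (ncomp (epsnt L) X)"
proof -
  note L = linear_functor[OF Lin]
  have "X \<in> Ob SA" using X by simp
  from nt_homD(4)[OF epsnt_hom[OF Lin] this] have "eps L X \<in> homs SB (ext_ob (tr L) X) (omap L X)"
    using X by (simp add: epsnt_comp st_ext_ob)
  then show ?thesis
    using B.StPSh_iso eps_bij[OF L X linear_couniversal[OF Lin X]] by (simp add: epsnt_comp X)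
qed

text \<open>An isomorphism of functors is cartesian, and so is its inverse; hence the inverse does
  not leave the category of linear functors.\<close>

lemma epsnt_Lin:
  assumes Lin: "lin L"
  shows "epsnt L \<in> homs (Lin A \<A> B \<B>) (ext (tr L)) L" "is_iso (Lin A \<A> B \<B>) (epsnt L)"
proof -
  note e = epsnt_hom[OF Lin] and lin = linear_st_ext[OF sprof_tr[OF Lin]]
  have iso: "is_iso SB (ncomp (epsnt L) X)" if "X \<in> Ob SA" for X
    using that eps_iso[OF Lin] by simp
  show eL: "epsnt L \<in> homs (Lin A \<A> B \<B>) (ext (tr L)) L"
    using e Lin lin cartesian_iso[OF e iso] by (simp add: Lin_hom)
  obtain \<sigma> where \<sigma>: "\<sigma> \<in> homs (fun_cat SA SB) L (ext (tr L))" "inverse_arrows (fun_cat SA SB) (epsnt L) \<sigma>"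
    "\<And>X. X \<in> Ob SA \<Longrightarrow> is_iso SB (ncomp \<sigma> X)"
    by (rule nt_inverse[OF e iso]) (assumption, rule that)
  have "\<sigma> \<in> homs (Lin A \<A> B \<B>) L (ext (tr L))"
    using \<sigma>(1) Lin lin cartesian_iso[OF \<sigma>(1,3)] by (simp add: Lin_hom)
  then have "inverse_arrows (Lin A \<A> B \<B>) (epsnt L) \<sigma>"
    using inverse_arrowsD(2,3)[OF \<sigma>(2) e] by (intro inverse_arrowsI[OF eL]) simp_all
  then show "is_iso (Lin A \<A> B \<B>) (epsnt L)" by (auto simp: is_iso_def)
qed

text \<open>On the class of \<open>(a, p, x)\<close> this is the naturality of \<tau> at the map
  that names \<open>x\<close>.\<close>

lemma epsnt_nat:
  assumes \<tau>: "\<tau> \<in> homs (fun_cat SA SB) L M" and L: "lin L" and M: "lin M"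
  shows "Cmp (fun_cat SA SB) (epsnt M) (st_ext_map A \<A> B (tr_lin_map A B \<tau>)) = Cmp (fun_cat SA SB) \<tau> (epsnt L)"
proof (rule nt_hom_eqI)
  note FL = linear_functor[OF L] and FM = linear_functor[OF M]
  note tm = tr_map_hom[OF \<tau>]
  note s = st_ext_map_hom[OF tm sprof_tr[OF L] sprof_tr[OF M]]
  show "Cmp (fun_cat SA SB) (epsnt M) (st_ext_map A \<A> B (tr_lin_map A B \<tau>)) \<in> homs (fun_cat SA SB) (ext (tr L)) M"
    by (rule cat_comp[OF category_fun_SA_SB s epsnt_hom[OF M]])
  show "Cmp (fun_cat SA SB) \<tau> (epsnt L) \<in> homs (fun_cat SA SB) (ext (tr L)) M"
    by (rule cat_comp[OF category_fun_SA_SB epsnt_hom[OF L] \<tau>])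
  fix X assume XS: "X \<in> Ob SA"
  then have X: "A.st X" by simp
  note X' = A.st_psh[OF X] and tX = nt_psh_hom[OF \<tau> X]
  note en = ext_nt_hom[OF tm X'] and eL = eps[OF FL X] and eM = eps[OF FM X]
  have "Cmp (PSh B) (eps M X) (ext_nt (tr_lin_map A B \<tau>) X) = Cmp (PSh B) (ncomp \<tau> X) (eps L X)"
  proof (rule ext_eqI[OF cat_comp[OF category_PSh[OF B.cat] en eM(1)] cat_comp[OF category_PSh[OF B.cat] eL(1) tX]])
    fix b a p x assume t: "b \<in> Ob B" "a \<in> Ob A" "p \<in> omap (tr L) (b, a)" "x \<in> omap X a"
    have p: "p \<in> omap (omap L (yoneda_ob A a)) b" using t by (simp add: tr_ob)
    have c: "cl (tr L) X b a p x \<in> omap (ext_ob (tr L) X) b"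
      using cl_in[where X = X and x = x, OF t(2-4)] t(1) by simp
    show "app (Cmp (PSh B) (eps M X) (ext_nt (tr_lin_map A B \<tau>) X)) b (cl (tr L) X b a p x) =
        app (Cmp (PSh B) (ncomp \<tau> X) (eps L X)) b (cl (tr L) X b a p x)"
      using psh_cmp[OF en t(1) c, of "eps M X"] psh_cmp[OF eL(1) t(1) c, of "ncomp \<tau> X"] ext_nt_app[OF tm X' t]
        eL(2)[OF t] eM(2)[OF t(1,2) PC_in[OF tm t(1-3)] t(4)] tr_map_app[OF t(1,2), of \<tau>]
        nt_psh_nat[OF \<tau> A.yon_hom_st[OF X t(2,4)] t(1) p] by simp
  qed
  then show "ncomp (Cmp (fun_cat SA SB) (epsnt M) (st_ext_map A \<A> B (tr_lin_map A B \<tau>))) X = ncomp (Cmp (fun_cat SA SB) \<tau> (epsnt L)) X"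
    using fun_cat_simps(10)[OF XS, of SB] by (simp add: epsnt_comp[OF X] st_ext_map_comp[OF X])
qed

text \<open>The unit replaces \<open>p\<close> by the class of \<open>(a, p, id)\<close>; the counit
  then applies the extension to the map naming \<open>x\<close>, which sends the identity to
  \<open>x\<close> and so returns the class of \<open>(a, p, x)\<close>.\<close>

lemma ext_triangle:
  assumes P: "sprof P"
  shows "Cmp (fun_cat SA SB) (epsnt (ext P)) (st_ext_map A \<A> B (eta P)) = Idt (fun_cat SA SB) (ext P)"
proof (rule nt_hom_eqI)
  let ?T = "ext P"
  note lin = linear_st_ext[OF P]
  note T = functor_st_ext[OF P] and trT = sprof_tr[OF lin] and e = eta_hom[OF P] and P' = sprof_prof[OF P]
  note s = st_ext_map_hom[OF e P trT]
  show "Cmp (fun_cat SA SB) (epsnt ?T) (st_ext_map A \<A> B (eta P)) \<in> homs (fun_cat SA SB) ?T ?T"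
    by (rule cat_comp[OF category_fun_SA_SB s epsnt_hom[OF lin]])
  show "Idt (fun_cat SA SB) ?T \<in> homs (fun_cat SA SB) ?T ?T" using cat_id[OF category_fun_SA_SB] T by simp
  fix X assume XS: "X \<in> Ob SA"
  then have X: "A.st X" by simp
  note X' = A.st_psh[OF X]
  note en = ext_nt_hom[OF e X'] and ep = eps[OF T X]
  have TX: "omap ?T X = ext_ob P X" by (rule st_ext_ob[OF X])
  have "Cmp (PSh B) (eps ?T X) (ext_nt (eta P) X) = Idt (PSh B) (ext_ob P X)"
  proof (rule ext_eqI[OF cat_comp[OF category_PSh[OF B.cat] en ep(1)[unfolded TX]] cat_id[OF category_PSh[OF B.cat]]])
    show "ext_ob P X \<in> Ob (PSh B)" using ext_ob_functor[OF P' X'] by simp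
    fix b a p x assume t: "b \<in> Ob B" "a \<in> Ob A" "p \<in> omap P (b, a)" "x \<in> omap X a"
    have c: "cl P X b a p x \<in> omap (ext_ob P X) b"
      using cl_in[where X = X and x = x, OF t(2-4)] t(1) by simp
    note ia = cat_id[OF A.cat t(2)]
    have yid: "Idt A a \<in> omap (yoneda_ob A a) a" using t(2) ia by simp
    have "app (eps ?T X) b (app (ext_nt (eta P) X) b (cl P X b a p x)) = app (ext_map P (A.yon X a x)) b (cl P (yoneda_ob A a) b a p (Idt A a))"
      using ext_nt_app[OF e X' t] ep(2)[OF t(1,2) PC_in[OF e t(1-3)] t(4)] eta_app[OF t(1-3)] st_ext_ar[OF A.yon_hom_st[OF X t(2,4)], of P] by simp
    also have "\<dots> = cl P X b a p x"
      using ext_map_app[OF P' A.yon_hom[OF X' t(2,4)] t(1-3) yid] A.yon_app[OF ia] psh_id[OF X' t(2,4)] by simp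
    finally show "app (Cmp (PSh B) (eps ?T X) (ext_nt (eta P) X)) b (cl P X b a p x) =
        app (Idt (PSh B) (ext_ob P X)) b (cl P X b a p x)"
      using psh_cmp[OF en t(1) c, of "eps ?T X"] psh_idt[OF t(1) c] by simp
  qed
  then show "ncomp (Cmp (fun_cat SA SB) (epsnt ?T) (st_ext_map A \<A> B (eta P))) X = ncomp (Idt (fun_cat SA SB) ?T) X"
    using fun_cat_simps(10)[OF XS, of SB] fun_cat_simps(9)[OF XS, of SB] by (simp add: epsnt_comp[OF X] st_ext_map_comp[OF X] TX)
qed

text \<open>The element named by the identity map of a representable is the identity arrow, so the
  counit acts on the class of \<open>(a, p, id)\<close> by \<open>L\<close> of an identity.\<close>

lemma tr_triangle:
  assumes Lin: "lin L"
  shows "Cmp PC (tr_lin_map A B (epsnt L)) (eta (tr L)) = Idt PC (tr L)"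
proof (rule PC_eqI)
  note L = linear_functor[OF Lin] and P = sprof_tr[OF Lin]
  note tm = tr_map_hom[OF epsnt_hom[OF Lin]] and e = eta_hom[OF P]
  show "Cmp PC (tr_lin_map A B (epsnt L)) (eta (tr L)) \<in> homs PC (tr L) (tr L)" by (rule cat_comp[OF category_PC e tm])
  show "Idt PC (tr L) \<in> homs PC (tr L) (tr L)" using cat_id[OF category_PC] sprof_prof[OF P] by (simp add: prof_def)
  fix b a p assume t: "b \<in> Ob B" "a \<in> Ob A" "p \<in> omap (tr L) (b, a)"
  note ya = A.yoneda_st[OF t(2)]
  have yid: "Idt A a \<in> omap (yoneda_ob A a) a" using t(2) cat_id[OF A.cat t(2)] by simp
  have p: "p \<in> omap (omap L (yoneda_ob A a)) b" using t by (simp add: tr_ob)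
  show "app (Cmp PC (tr_lin_map A B (epsnt L)) (eta (tr L))) (b, a) p = app (Idt PC (tr L)) (b, a) p"
    using PC_cmp[OF e t, of "tr_lin_map A B (epsnt L)"] PC_idt[OF t] eta_app[OF t] tr_map_app[OF t(1,2), of "epsnt L"]
      epsnt_comp[OF ya, of L] eps(2)[OF L ya t yid] A.yon_id[OF t(2)] L_id_app[OF L ya t(1) p] by simp
qed

lemma adjoint_equivalence_Ext_Tr:
  "\<exists>\<eta> \<epsilon>. adjoint_equivalence (SProf A \<A> B \<B>) (Lin A \<A> B \<B>) Ext Tr \<eta> \<epsilon>"
proof -
  let ?S = "SProf A \<A> B \<B>" and ?L = "Lin A \<A> B \<B>"
  define \<eta> where "\<eta> = \<lparr>nsrc = id_functor ?S, ntgt = comp_functor ?S Tr Ext, ncomp = (\<lambda>P\<in>Ob ?S. eta P)\<rparr>"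
  define \<epsilon> where "\<epsilon> = \<lparr>nsrc = comp_functor ?L Ext Tr, ntgt = id_functor ?L, ncomp = (\<lambda>L\<in>Ob ?L. epsnt L)\<rparr>"
  have \<eta>c: "ncomp \<eta> P = eta P" if "sprof P" for P using that SProf_ob[of P] by (simp add: \<eta>_def)
  have \<epsilon>c: "ncomp \<epsilon> L = epsnt L" if "lin L" for L using that Lin_simps(1)[of L] by (simp add: \<epsilon>_def)
  have etaS: "eta P \<in> homs ?S P (tr (ext P))" if P: "sprof P" for P
    using eta_hom[OF P] P sprof_tr[OF linear_st_ext[OF P]] by (simp add: SProf_hom)
  have "\<eta> \<in> homs (fun_cat ?S ?S) (id_functor ?S) (comp_functor ?S Tr Ext)"
  proof (rule nt_homI[OF functor_id_functor[OF category_SProf] functor_comp_functor[OF functor_Ext functor_Tr]])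
    show "ncomp \<eta> P \<in> homs ?S (omap (id_functor ?S) P) (omap (comp_functor ?S Tr Ext) P)" if PS: "P \<in> Ob ?S" for P
      using PS etaS[of P] linear_st_ext[of P] id_functor_simps(1)[OF PS] comp_functor_simps(1)[OF PS, of Tr Ext]
      by (simp add: \<eta>c Ext_simps(1) Tr_simps(1))
    show "Cmp ?S (ncomp \<eta> Q) (amap (id_functor ?S) \<theta>) = Cmp ?S (amap (comp_functor ?S Tr Ext) \<theta>) (ncomp \<eta> P)"
      if \<theta>: "\<theta> \<in> homs ?S P Q" for \<theta> P Q
    proof -
      have \<theta>': "\<theta> \<in> homs PC P Q" and P: "sprof P" and Q: "sprof Q" using \<theta> by (simp_all add: SProf_hom)
      have "amap Tr (st_ext_map A \<A> B \<theta>) = tr_lin_map A B (st_ext_map A \<A> B \<theta>)"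
        using Tr_simps(2)[OF functor_hom[OF functor_Ext \<theta>]] Ext_simps(2)[OF \<theta>] by simp
      then show ?thesis
        using eta_nat[OF \<theta>' P Q] id_functor_simps(2)[OF homsD(1)[OF \<theta>]] comp_functor_simps(2)[OF homsD(1)[OF \<theta>], of Tr Ext]
        by (simp add: \<eta>c P Q Ext_simps(2)[OF \<theta>])
    qed
  qed (simp_all add: \<eta>_def)
  moreover have "\<epsilon> \<in> homs (fun_cat ?L ?L) (comp_functor ?L Ext Tr) (id_functor ?L)"
  proof (rule nt_homI[OF functor_comp_functor[OF functor_Tr functor_Ext] functor_id_functor[OF category_Lin]])
    show "ncomp \<epsilon> L \<in> homs ?L (omap (comp_functor ?L Ext Tr) L) (omap (id_functor ?L) L)" if LS: "L \<in> Ob ?L" for L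
      using LS epsnt_Lin(1)[of L] sprof_tr[of L] id_functor_simps(1)[OF LS] comp_functor_simps(1)[OF LS, of Ext Tr]
      by (simp add: \<epsilon>c Ext_simps(1) Tr_simps(1))
    show "Cmp ?L (ncomp \<epsilon> M) (amap (comp_functor ?L Ext Tr) \<tau>) = Cmp ?L (amap (id_functor ?L) \<tau>) (ncomp \<epsilon> L)"
      if \<tau>: "\<tau> \<in> homs ?L L M" for \<tau> L M
    proof -
      have \<tau>': "\<tau> \<in> homs (fun_cat SA SB) L M" and L: "lin L" and M: "lin M" using \<tau> by (simp_all add: Lin_hom)
      have "amap Ext (tr_lin_map A B \<tau>) = st_ext_map A \<A> B (tr_lin_map A B \<tau>)"
        using Ext_simps(2)[OF functor_hom[OF functor_Tr \<tau>]] Tr_simps(2)[OF \<tau>] by simp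
      then show ?thesis
        using epsnt_nat[OF \<tau>' L M] id_functor_simps(2)[OF homsD(1)[OF \<tau>]] comp_functor_simps(2)[OF homsD(1)[OF \<tau>], of Ext Tr]
        by (simp add: \<epsilon>c L M Tr_simps(2)[OF \<tau>])
    qed
  qed (simp_all add: \<epsilon>_def)
  moreover have "Cmp ?L (ncomp \<epsilon> (omap Ext P)) (amap Ext (ncomp \<eta> P)) = Idt ?L (omap Ext P)" if "P \<in> Ob ?S" for P
  proof -
    have P: "sprof P" using that by simp
    show ?thesis
      using ext_triangle[OF P] Ext_simps(2)[OF etaS[OF P]] by (simp add: Ext_simps(1)[OF P] \<eta>c[OF P] \<epsilon>c[OF linear_st_ext[OF P]])
  qed
  moreover have "Cmp ?S (amap Tr (ncomp \<epsilon> L)) (ncomp \<eta> (omap Tr L)) = Idt ?S (omap Tr L)" if "L \<in> Ob ?L" for L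
  proof -
    have L: "lin L" using that by simp
    show ?thesis
      using tr_triangle[OF L] Tr_simps(2)[OF epsnt_Lin(1)[OF L]] by (simp add: Tr_simps(1)[OF L] \<epsilon>c[OF L] \<eta>c[OF sprof_tr[OF L]])
  qed
  moreover have "is_iso ?S (ncomp \<eta> P)" if "P \<in> Ob ?S" for P
    using that eta_iso by (simp add: \<eta>c)
  moreover have "is_iso ?L (ncomp \<epsilon> L)" if "L \<in> Ob ?L" for L
    using that epsnt_Lin(2) by (simp add: \<epsilon>c)
  ultimately show ?thesis
    unfolding adjoint_equivalence_def adjunction_def using functor_Ext functor_Tr by blast
qed

end

theorem theorem9p14:
  fixes A B :: "('u, 'u) cat"
    and \<A> \<B> :: "'u kit"
  assumes "set_universe TYPE('u)"
    and "small_groupoid A" and "boolean_kit A \<A>"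
    and "small_groupoid B" and "boolean_kit B \<B>"
  shows "\<exists>\<eta> \<epsilon>. adjoint_equivalence (SProf A \<A> B \<B>) (Lin A \<A> B \<B>)
           (st_ext_functor A \<A> B \<B>) (tr_lin_functor A \<A> B \<B>) \<eta> \<epsilon>"
proof -
  interpret two_kits A \<A> B \<B>
    using assms by unfold_locales
  show ?thesis
    by (rule adjoint_equivalence_Ext_Tr)
qed

end
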